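(* Let $M$ be a smooth connected manifold, $\bar x\in M$, $\Delta$ a smooth distribution on $M$, and $g$ a smooth Riemannian metric on $\Delta$ for which $M$ is complete (for the sub-Riemannian distance). If the distribution $\Delta$ is nonholonomic on $M$, then the value function $V_{g,\Delta}:M\to\mathbb{R}$ is continuous on $M$ and is a viscosity solution of the Hamilton-Jacobi equation $$-\frac12 V_{g,\Delta}(x)+H_{g,\Delta}\left(x,\frac12\,dV_{g,\Delta}(x)\right)=0,\qquad \forall x\in M\setminus\{\bar x\}.$$
   Context: $\Delta$ is a smooth subbundle of $TM$; it is nonholonomic if near every point it is spanned by linearly independent smooth vector fields whose iterated Lie brackets (including the fields themselves) span the tangent space at every point of that neighborhood. A smooth Riemannian metric $g$ on $\Delta$ is a smoothly varying inner product $g_x$ on $\Delta(x)$. A horizontal path is an absolutely continuous $\gamma:[0,1]\to M$ with $\dot\gamma(t)\in\Delta(\gamma(t))$ a.e.; $\Omega_\Delta(\bar x,x)$ is the set of horizontal paths with $\gamma(0)=\bar x$, $\gamma(1)=x$. The sub-Riemannian distance $d_{SR}(x_0,x_1)$ is the infimum of $\int_0^1\sqrt{g_\gamma(\dot\gamma,\dot\gamma)}\,dt$ over horizontal paths joining $x_0$ to $x_1$. The value function is $V_{g,\Delta}(x):=\inf\{J_g(\gamma) : \gamma\in\Omega_\Delta(\bar x,x)\}$, where $J_g(\gamma):=\int_0^1 g_{\gamma(t)}(\dot\gamma(t),\dot\gamma(t))\,dt$; it equals $d_{SR}(\bar x,x)^2$. The Hamiltonian $H_{g,\Delta}:T^*M\to\mathbb{R}$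 is $H_{g,\Delta}(x,p):=\max_{v\in\Delta(x)}\left(p(v)-\tfrac12 g_x(v,v)\right)$. Viscosity solution: for continuous $F:T^*M\times\mathbb{R}\to\mathbb{R}$ and $U\subset M$ open, a continuous $u:U\to\mathbb{R}$ is a viscosity subsolution (resp. supersolution) of $F(x,du(x),u(x))=0$ on $U$ if for every $C^1$ function $\phi:U\to\mathbb{R}$ with $\phi\ge u$ (resp. $\psi:U\to\mathbb{R}$ with $\psi\le u$) and every $x_0\in U$ with $\phi(x_0)=u(x_0)$ (resp. $\psi(x_0)=u(x_0)$), one has $F(x_0,d\phi(x_0),u(x_0))\le0$ (resp. $F(x_0,d\psi(x_0),u(x_0))\ge0$). It is a viscosity solution if it is both. *)

theory Defs
  imports "HOL-Analysis.Analysis" "HOL-Library.Function_Algebras"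
begin

text \<open>
  Functions into a real vector space form a real vector space under the pointwise operations.
  Tangent vectors are represented below as such functions, so that subspaces, spans and linear
  independence in a tangent space are those of the library.
\<close>

instantiation "fun" :: (type, real_vector) real_vector
begin

definition scaleR_fun :: "real \<Rightarrow> ('a \<Rightarrow> 'b) \<Rightarrow> 'a \<Rightarrow> 'b"
  where "scaleR_fun r f = (\<lambda>x. r *\<^sub>R f x)"

instance
  by standard (simp_all add: scaleR_fun_def fun_eq_iff scaleR_add_right scaleR_add_left)

end

section \<open>Smooth manifolds\<close>

primrec Ck_on :: "nat \<Rightarrow> 'a::euclidean_space set \<Rightarrow> ('a \<Rightarrow> 'b::real_normed_vector) \<Rightarrow> bool" where
  "Ck_on 0 S f \<longleftrightarrow> continuous_on S f"
| "Ck_on (Suc k) S f \<longleftrightarrow>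
     (\<forall>x\<in>S. f differentiable (at x)) \<and> (\<forall>v. Ck_on k S (\<lambda>x. frechet_derivative f (at x) v))"

definition smooth_on :: "'a::euclidean_space set \<Rightarrow> ('a \<Rightarrow> 'b::real_normed_vector) \<Rightarrow> bool"
  where "smooth_on S f \<longleftrightarrow> (\<forall>k. Ck_on k S f)"

text \<open>
  A chart is a pair of its domain and its coordinate map; the values of the coordinate map outside
  the domain are irrelevant.  The manifold is the whole type \<open>'a\<close>, modelled on \<open>'e\<close>, and
  its smooth structure is the one generated by the (not necessarily maximal) atlas.
\<close>

type_synonym ('a, 'e) chart = "'a set \<times> ('a \<Rightarrow> 'e)"

definition chart_inv :: "('a, 'e) chart \<Rightarrow> 'e \<Rightarrow> 'a"
  where "chart_inv c = inv_into (fst c) (snd c)"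

definition smooth_atlas ::
  "('a::{t2_space,second_countable_topology}, 'e::euclidean_space) chart set \<Rightarrow> bool"
  where "smooth_atlas A \<longleftrightarrow>
    (\<forall>c\<in>A. open (fst c) \<and> open (snd c ` fst c) \<and>
       homeomorphism (fst c) (snd c ` fst c) (snd c) (chart_inv c)) \<and>
    (\<Union>c\<in>A. fst c) = UNIV \<and>
    (\<forall>c\<in>A. \<forall>c'\<in>A. smooth_on (snd c ` (fst c \<inter> fst c')) (snd c' \<circ> chart_inv c))"

definition C1_fun :: "('a, 'e::euclidean_space) chart set \<Rightarrow> 'a set \<Rightarrow> ('a \<Rightarrow> real) \<Rightarrow> bool"
  where "C1_fun A U f \<longleftrightarrow> (\<forall>c\<in>A. Ck_on 1 (snd c ` (U \<inter> fst c)) (f \<circ> chart_inv c))"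

definition smooth_fun :: "('a, 'e::euclidean_space) chart set \<Rightarrow> 'a set \<Rightarrow> ('a \<Rightarrow> real) \<Rightarrow> bool"
  where "smooth_fun A U f \<longleftrightarrow> (\<forall>c\<in>A. smooth_on (snd c ` (U \<inter> fst c)) (f \<circ> chart_inv c))"

section \<open>Tangent vectors and vector fields\<close>

text \<open>
  A tangent vector at a point \<open>x\<close> assigns to each chart around \<open>x\<close> a coordinate vector, these
  vectors being related by the differentials of the coordinate changes; its values
  at all other arguments are fixed to be 0, so that distinct functions in
  \<open>tangent_space A x\<close> are distinct tangent vectors.
\<close>

type_synonym ('a, 'e) tangent = "('a, 'e) chart \<Rightarrow> 'e"

definition tangent_space :: "('a, 'e::euclidean_space) chart set \<Rightarrow> 'a \<Rightarrow> ('a, 'e) tangent set"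
  where "tangent_space A x =
    {v. (\<forall>c. c \<notin> A \<or> x \<notin> fst c \<longrightarrow> v c = 0) \<and>
        (\<forall>c\<in>A. \<forall>c'\<in>A. x \<in> fst c \<and> x \<in> fst c' \<longrightarrow>
           v c' = frechet_derivative (snd c' \<circ> chart_inv c) (at (snd c x)) (v c))}"

text \<open>The differential does not depend on the chart selected here if \<open>v\<close> is tangent at \<open>x\<close>.\<close>

definition differential ::
  "('a, 'e::euclidean_space) chart set \<Rightarrow> ('a \<Rightarrow> real) \<Rightarrow> 'a \<Rightarrow> ('a, 'e) tangent \<Rightarrow> real"
  where "differential A f x v =
    (let c = (SOME c. c \<in> A \<and> x \<in> fst c)
     in frechet_derivative (f \<circ> chart_inv c) (at (snd c x)) (v c))"

definition smooth_vector_field ::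
  "('a, 'e::euclidean_space) chart set \<Rightarrow> 'a set \<Rightarrow> ('a \<Rightarrow> ('a, 'e) tangent) \<Rightarrow> bool"
  where "smooth_vector_field A U X \<longleftrightarrow>
    (\<forall>x\<in>U. X x \<in> tangent_space A x) \<and>
    (\<forall>c\<in>A. smooth_on (snd c ` (U \<inter> fst c)) (\<lambda>u. X (chart_inv c u) c))"

text \<open>In the coordinates of each chart, \<open>[X, Y] = DY(X) - DX(Y)\<close>.\<close>

definition lie_bracket ::
  "('a, 'e::euclidean_space) chart set \<Rightarrow> ('a \<Rightarrow> ('a, 'e) tangent) \<Rightarrow> ('a \<Rightarrow> ('a, 'e) tangent) \<Rightarrow>
    'a \<Rightarrow> ('a, 'e) tangent"
  where "lie_bracket A X Y x =
    (\<lambda>c. if c \<in> A \<and> x \<in> fst c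
         then frechet_derivative (\<lambda>u. Y (chart_inv c u) c) (at (snd c x)) (X x c) -
              frechet_derivative (\<lambda>u. X (chart_inv c u) c) (at (snd c x)) (Y x c)
         else 0)"

inductive_set iterated_brackets ::
  "('a, 'e::euclidean_space) chart set \<Rightarrow> ('a \<Rightarrow> ('a, 'e) tangent) set \<Rightarrow>
    ('a \<Rightarrow> ('a, 'e) tangent) set"
  for A \<F> where
  base: "X \<in> \<F> \<Longrightarrow> X \<in> iterated_brackets A \<F>"
| bracket: "X \<in> iterated_brackets A \<F> \<Longrightarrow> Y \<in> iterated_brackets A \<F> \<Longrightarrow>
    lie_bracket A X Y \<in> iterated_brackets A \<F>"

section \<open>Sub-Riemannian structures\<close>

type_synonym ('a, 'e) distribution = "'a \<Rightarrow> ('a, 'e) tangent set"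
type_synonym ('a, 'e) metric_field = "'a \<Rightarrow> ('a, 'e) tangent \<Rightarrow> ('a, 'e) tangent \<Rightarrow> real"

definition local_frame ::
  "('a::topological_space, 'e::euclidean_space) chart set \<Rightarrow> ('a, 'e) distribution \<Rightarrow> 'a set \<Rightarrow>
    nat \<Rightarrow> (nat \<Rightarrow> 'a \<Rightarrow> ('a, 'e) tangent) \<Rightarrow> bool"
  where "local_frame A \<Delta> U m X \<longleftrightarrow>
    open U \<and> (\<forall>i<m. smooth_vector_field A U (X i)) \<and>
    (\<forall>x\<in>U. inj_on (\<lambda>i. X i x) {..<m} \<and> independent ((\<lambda>i. X i x) ` {..<m}) \<and>
           span ((\<lambda>i. X i x) ` {..<m}) = \<Delta> x)"

definition smooth_distribution ::
  "('a::topological_space, 'e::euclidean_space) chart set \<Rightarrow> ('a, 'e) distribution \<Rightarrow> bool"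
  where "smooth_distribution A \<Delta> \<longleftrightarrow> (\<exists>m. \<forall>x. \<exists>U X. x \<in> U \<and> local_frame A \<Delta> U m X)"

definition nonholonomic ::
  "('a::topological_space, 'e::euclidean_space) chart set \<Rightarrow> ('a, 'e) distribution \<Rightarrow> bool"
  where "nonholonomic A \<Delta> \<longleftrightarrow>
    (\<forall>x. \<exists>U m X. x \<in> U \<and> local_frame A \<Delta> U m X \<and>
      (\<forall>y\<in>U. span ((\<lambda>Z. Z y) ` iterated_brackets A (X ` {..<m})) = tangent_space A y))"

definition inner_product_on :: "'v::real_vector set \<Rightarrow> ('v \<Rightarrow> 'v \<Rightarrow> real) \<Rightarrow> bool"
  where "inner_product_on S b \<longleftrightarrow>
    (\<forall>u\<in>S. \<forall>v\<in>S. b u v = b v u) \<and>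
    (\<forall>u\<in>S. \<forall>v\<in>S. \<forall>w\<in>S. b (u + v) w = b u w + b v w) \<and>
    (\<forall>r. \<forall>u\<in>S. \<forall>v\<in>S. b (r *\<^sub>R u) v = r * b u v) \<and>
    (\<forall>v\<in>S. v \<noteq> 0 \<longrightarrow> 0 < b v v)"

definition smooth_metric_on ::
  "('a::topological_space, 'e::euclidean_space) chart set \<Rightarrow> ('a, 'e) distribution \<Rightarrow>
    ('a, 'e) metric_field \<Rightarrow> bool"
  where "smooth_metric_on A \<Delta> g \<longleftrightarrow>
    (\<forall>x. inner_product_on (\<Delta> x) (g x)) \<and>
    (\<forall>U X Y. open U \<and> smooth_vector_field A U X \<and> smooth_vector_field A U Y \<and>
       (\<forall>x\<in>U. X x \<in> \<Delta> x \<and> Y x \<in> \<Delta> x) \<longrightarrow> smooth_fun A U (\<lambda>x. g x (X x) (Y x)))"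

section \<open>Horizontal paths\<close>

definition absolutely_continuous_on_interval ::
  "real \<Rightarrow> real \<Rightarrow> (real \<Rightarrow> 'b::metric_space) \<Rightarrow> bool"
  where "absolutely_continuous_on_interval a b f \<longleftrightarrow>
    (\<forall>\<epsilon>>0. \<exists>\<delta>>0. \<forall>D :: (real \<times> real) set.
       finite D \<and> (\<forall>(s, t)\<in>D. a \<le> s \<and> s \<le> t \<and> t \<le> b) \<and>
       pairwise (\<lambda>(s, t) (s', t'). {s<..<t} \<inter> {s'<..<t'} = {}) D \<and>
       (\<Sum>(s, t)\<in>D. t - s) < \<delta> \<longrightarrow>
       (\<Sum>(s, t)\<in>D. dist (f s) (f t)) < \<epsilon>)"

definition absolutely_continuous_path ::
  "('a::topological_space, 'e::euclidean_space) chart set \<Rightarrow> (real \<Rightarrow> 'a) \<Rightarrow> bool"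
  where "absolutely_continuous_path A \<gamma> \<longleftrightarrow>
    continuous_on {0..1} \<gamma> \<and>
    (\<forall>c\<in>A. \<forall>a b. 0 \<le> a \<and> a \<le> b \<and> b \<le> 1 \<and> \<gamma> ` {a..b} \<subseteq> fst c \<longrightarrow>
       absolutely_continuous_on_interval a b (snd c \<circ> \<gamma>))"

text \<open>Meaningful where \<open>\<gamma>\<close> is differentiable, hence almost everywhere on an absolutely
  continuous path.\<close>

definition velocity ::
  "('a, 'e::euclidean_space) chart set \<Rightarrow> (real \<Rightarrow> 'a) \<Rightarrow> real \<Rightarrow> ('a, 'e) tangent"
  where "velocity A \<gamma> t =
    (\<lambda>c. if c \<in> A \<and> \<gamma> t \<in> fst c then vector_derivative (snd c \<circ> \<gamma>) (at t within {0..1}) else 0)"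

definition path_differentiable_at ::
  "('a, 'e::euclidean_space) chart set \<Rightarrow> (real \<Rightarrow> 'a) \<Rightarrow> real \<Rightarrow> bool"
  where "path_differentiable_at A \<gamma> t \<longleftrightarrow>
    (\<forall>c\<in>A. \<gamma> t \<in> fst c \<longrightarrow> (snd c \<circ> \<gamma>) differentiable (at t within {0..1}))"

definition horizontal_path ::
  "('a::topological_space, 'e::euclidean_space) chart set \<Rightarrow> ('a, 'e) distribution \<Rightarrow>
    (real \<Rightarrow> 'a) \<Rightarrow> bool"
  where "horizontal_path A \<Delta> \<gamma> \<longleftrightarrow>
    absolutely_continuous_path A \<gamma> \<and>
    (AE t in lebesgue_on {0..1}. path_differentiable_at A \<gamma> t \<and> velocity A \<gamma> t \<in> \<Delta> (\<gamma> t))"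

definition horizontal_paths ::
  "('a::topological_space, 'e::euclidean_space) chart set \<Rightarrow> ('a, 'e) distribution \<Rightarrow> 'a \<Rightarrow> 'a \<Rightarrow>
    (real \<Rightarrow> 'a) set"
  where "horizontal_paths A \<Delta> x y = {\<gamma>. horizontal_path A \<Delta> \<gamma> \<and> \<gamma> 0 = x \<and> \<gamma> 1 = y}"

text \<open>
  Length, energy and the two infima take values in \<open>[0, \<infinity>]\<close>: a horizontal path may have infinite
  energy, and an infimum over no paths is \<open>\<infinity>\<close>.
\<close>

definition path_length ::
  "('a, 'e::euclidean_space) chart set \<Rightarrow> ('a, 'e) metric_field \<Rightarrow> (real \<Rightarrow> 'a) \<Rightarrow> ennreal"
  where "path_length A g \<gamma> =
    (\<integral>\<^sup>+t. ennreal (sqrt (g (\<gamma> t) (velocity A \<gamma> t) (velocity A \<gamma> t))) \<partial>lebesgue_on {0..1})"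

definition path_energy ::
  "('a, 'e::euclidean_space) chart set \<Rightarrow> ('a, 'e) metric_field \<Rightarrow> (real \<Rightarrow> 'a) \<Rightarrow> ennreal"
  where "path_energy A g \<gamma> =
    (\<integral>\<^sup>+t. ennreal (g (\<gamma> t) (velocity A \<gamma> t) (velocity A \<gamma> t)) \<partial>lebesgue_on {0..1})"

definition sr_dist ::
  "('a::topological_space, 'e::euclidean_space) chart set \<Rightarrow> ('a, 'e) distribution \<Rightarrow>
    ('a, 'e) metric_field \<Rightarrow> 'a \<Rightarrow> 'a \<Rightarrow> ennreal"
  where "sr_dist A \<Delta> g x y = (INF \<gamma>\<in>horizontal_paths A \<Delta> x y. path_length A g \<gamma>)"

text \<open>If all distances are finite, as for a nonholonomic distribution on a connected manifold,
  this is completeness of the metric space \<open>(M, d\<^sub>S\<^sub>R)\<close>.\<close>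

definition sr_complete ::
  "('a::topological_space, 'e::euclidean_space) chart set \<Rightarrow> ('a, 'e) distribution \<Rightarrow>
    ('a, 'e) metric_field \<Rightarrow> bool"
  where "sr_complete A \<Delta> g \<longleftrightarrow>
    Metric_space.mcomplete UNIV (\<lambda>x y. enn2real (sr_dist A \<Delta> g x y))"

definition value_function ::
  "('a::topological_space, 'e::euclidean_space) chart set \<Rightarrow> ('a, 'e) distribution \<Rightarrow>
    ('a, 'e) metric_field \<Rightarrow> 'a \<Rightarrow> 'a \<Rightarrow> ennreal"
  where "value_function A \<Delta> g xbar x = (INF \<gamma>\<in>horizontal_paths A \<Delta> xbar x. path_energy A g \<gamma>)"

section \<open>Hamiltonian and viscosity solutions\<close>

text \<open>A covector at \<open>x\<close> is a function on tangent vectors of which only the restriction to the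
  tangent space at \<open>x\<close> matters.  \<open>GREATEST\<close> denotes the maximum, which is attained whenever
  \<open>p\<close> is linear on \<open>\<Delta> x\<close>.\<close>

definition hamiltonian ::
  "('a, 'e) distribution \<Rightarrow> ('a, 'e) metric_field \<Rightarrow> 'a \<Rightarrow> (('a, 'e) tangent \<Rightarrow> real) \<Rightarrow> real"
  where "hamiltonian \<Delta> g x p = (GREATEST h. \<exists>v\<in>\<Delta> x. h = p v - 1/2 * g x v v)"

definition viscosity_subsolution ::
  "('a::topological_space, 'e::euclidean_space) chart set \<Rightarrow>
    ('a \<Rightarrow> (('a, 'e) tangent \<Rightarrow> real) \<Rightarrow> real \<Rightarrow> real) \<Rightarrow> 'a set \<Rightarrow> ('a \<Rightarrow> real) \<Rightarrow> bool"
  where "viscosity_subsolution A F U u \<longleftrightarrow>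
    continuous_on U u \<and>
    (\<forall>\<phi>. C1_fun A U \<phi> \<and> (\<forall>x\<in>U. u x \<le> \<phi> x) \<longrightarrow>
       (\<forall>x\<^sub>0\<in>U. \<phi> x\<^sub>0 = u x\<^sub>0 \<longrightarrow> F x\<^sub>0 (differential A \<phi> x\<^sub>0) (u x\<^sub>0) \<le> 0))"

definition viscosity_supersolution ::
  "('a::topological_space, 'e::euclidean_space) chart set \<Rightarrow>
    ('a \<Rightarrow> (('a, 'e) tangent \<Rightarrow> real) \<Rightarrow> real \<Rightarrow> real) \<Rightarrow> 'a set \<Rightarrow> ('a \<Rightarrow> real) \<Rightarrow> bool"
  where "viscosity_supersolution A F U u \<longleftrightarrow>
    continuous_on U u \<and>
    (\<forall>\<psi>. C1_fun A U \<psi> \<and> (\<forall>x\<in>U. \<psi> x \<le> u x) \<longrightarrow>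
       (\<forall>x\<^sub>0\<in>U. \<psi> x\<^sub>0 = u x\<^sub>0 \<longrightarrow> F x\<^sub>0 (differential A \<psi> x\<^sub>0) (u x\<^sub>0) \<ge> 0))"

definition viscosity_solution ::
  "('a::topological_space, 'e::euclidean_space) chart set \<Rightarrow>
    ('a \<Rightarrow> (('a, 'e) tangent \<Rightarrow> real) \<Rightarrow> real \<Rightarrow> real) \<Rightarrow> 'a set \<Rightarrow> ('a \<Rightarrow> real) \<Rightarrow> bool"
  where "viscosity_solution A F U u \<longleftrightarrow>
    viscosity_subsolution A F U u \<and> viscosity_supersolution A F U u"

end

theory Submission
  imports Defs
begin

text \<open>
  Nonholonomy gives local reachability with small energy: if the iterated brackets of a frame span the
  tangent space, words in the flows of the frame move a point, for small times \<open>s\<close>, by \<open>s\<^sup>k\<close> times a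
  bracket of order \<open>k\<close> up to a higher order error (a formal computation with products of exponentials), and
  greedily removing the remaining displacement reaches every point of a neighbourhood in a short time.
  With connectedness, the value function is therefore finite, and its square root, which satisfies the
  triangle inequality, is continuous.

  Subsolution: if \<open>\<phi>\<close> touches \<open>V\<close> from above at \<open>x\<close>, compare \<open>\<phi>\<close> and \<open>V\<close> along a curve that
  arrives at \<open>x\<close> with velocity \<open>v \<in> \<Delta> x\<close>; this yields \<open>d\<phi>(v) \<le> 2 d \<surd>g(v, v) \<le> V + g(v, v)\<close>, where
  \<open>d = \<surd>V(x)\<close>.  Supersolution: if \<open>\<psi>\<close> touches \<open>V\<close> from below and \<open>2 H < V\<close> at \<open>x\<close>, then
  \<open>d\<psi>(v) \<le> h + g(v, v)\<close> with \<open>h < d\<^sup>2\<close>, and by scaling \<open>d\<psi>(v) \<le> h / \<sigma> + \<sigma> g(v, v)\<close> near \<open>x\<close>, up to a small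
  error.  Integrated over the last piece, of length \<open>\<rho>\<close>, of a nearly minimising path, this bounds the
  increase of \<open>\<psi>\<close> by \<open>\<kappa> \<rho>\<close> with \<open>\<kappa> < 2 d\<close>, whereas \<open>V\<close> increases by almost \<open>d\<^sup>2 - (d - \<rho>)\<^sup>2\<close>.
\<close>

section \<open>Real analysis: absolute continuity, the fundamental theorem, calculus of smooth
  maps\<close>

section \<open>Absolutely continuous functions on an interval\<close>

text \<open>Horizontal paths are only absolutely continuous and carry no preferred parametrisation.
  The product of duration and energy therefore stands in for the squared length: affine
  reparametrisation preserves it, it bounds \<open>V\<close> between the end points, and by
  Cauchy-Schwarz the roots of this product for two consecutive pieces sum to at most the root for
  the whole path. This is what cuts off a last piece of length \<rho> in the supersolution part;
  there \<open>h / d + d < 2 d\<close> holds exactly because \<open>h < d\<^sup>2\<close>. The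
  formal computation takes place in power series whose coefficients are linear operators on
  functions. Pull-back along a flow is the exponential of a derivation, derivations turn Lie
  brackets into commutators, and the group commutator of two series has the ring commutator as its
  leading coefficient. Taylor expansion along a word of flows converts this identity into an
  estimate. Each word corrects a displacement only approximately, so infinitely many are
  concatenated, with durations that decrease geometrically.\<close>

lemma absolutely_continuousD_indexed:
  fixes f :: "real \<Rightarrow> 'b::metric_space"
  assumes "absolutely_continuous_on_interval a b f" "0 < \<epsilon>"
  shows "\<exists>\<delta>>0. \<forall>(I :: 'i set) s t. finite I \<longrightarrow>
      (\<forall>i\<in>I. a \<le> s i \<and> s i \<le> t i \<and> t i \<le> b) \<longrightarrow>
      (\<forall>i\<in>I. \<forall>j\<in>I. i \<noteq> j \<longrightarrow> {s i<..<t i} \<inter> {s j<..<t j} = {}) \<longrightarrow>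
      (\<Sum>i\<in>I. t i - s i) < \<delta> \<longrightarrow> (\<Sum>i\<in>I. dist (f (s i)) (f (t i))) < \<epsilon>"
proof -
  obtain \<delta> where \<delta>: "0 < \<delta>" and small: "\<And>D :: (real \<times> real) set.
       finite D \<Longrightarrow> (\<forall>(s, t)\<in>D. a \<le> s \<and> s \<le> t \<and> t \<le> b) \<Longrightarrow>
       pairwise (\<lambda>(s, t) (s', t'). {s<..<t} \<inter> {s'<..<t'} = {}) D \<Longrightarrow>
       (\<Sum>(s, t)\<in>D. t - s) < \<delta> \<Longrightarrow> (\<Sum>(s, t)\<in>D. dist (f s) (f t)) < \<epsilon>"
    using assms unfolding absolutely_continuous_on_interval_def by meson
  show ?thesis
  proof (intro exI[of _ \<delta>] conjI allI impI \<delta>)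
    fix I :: "'i set" and s t :: "'i \<Rightarrow> real"
    assume fin: "finite I" and ord: "\<forall>i\<in>I. a \<le> s i \<and> s i \<le> t i \<and> t i \<le> b"
      and disj: "\<forall>i\<in>I. \<forall>j\<in>I. i \<noteq> j \<longrightarrow> {s i<..<t i} \<inter> {s j<..<t j} = {}"
      and len: "(\<Sum>i\<in>I. t i - s i) < \<delta>"
    \<comment> \<open>A set of pairs records repeated intervals only once. Nondegenerate intervals
      with distinct indices are disjoint, hence distinct, so on \<open>J\<close> the sum over
      indices is a sum over pairs; the discarded terms are 0.\<close>
    define J where "J = {i\<in>I. s i < t i}"
    have eqI: "s i = t i" if "i \<in> I - J" for i
      using that ord by (force simp: J_def)
    have J: "J \<subseteq> I" by (auto simp: J_def)
    have inj: "inj_on (\<lambda>i. (s i, t i)) J"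
    proof (rule inj_onI, rule ccontr)
      fix i j assume ij: "i \<in> J" "j \<in> J" "(s i, t i) = (s j, t j)" "i \<noteq> j"
      then have "{s i<..<t i} = {}" using disj[rule_format, of i j] by (auto simp: J_def)
      then show False using ij by (auto simp: J_def)
    qed
    let ?D = "(\<lambda>i. (s i, t i)) ` J"
    have "(\<Sum>i\<in>I. t i - s i) = (\<Sum>i\<in>J. t i - s i)"
      using fin eqI J by (intro sum.mono_neutral_right) simp_all
    moreover have "(\<Sum>i\<in>I. dist (f (s i)) (f (t i))) = (\<Sum>i\<in>J. dist (f (s i)) (f (t i)))"
      using fin eqI J by (intro sum.mono_neutral_right) simp_all
    moreover have "(\<Sum>(s, t)\<in>?D. dist (f s) (f t)) < \<epsilon>"
    proof (rule small)
      show "finite ?D" using fin by (simp add: J_def)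
      show "\<forall>(s, t)\<in>?D. a \<le> s \<and> s \<le> t \<and> t \<le> b" using ord by (auto simp: J_def)
      show "pairwise (\<lambda>(s, t) (s', t'). {s<..<t} \<inter> {s'<..<t'} = {}) ?D"
        using disj unfolding pairwise_def J_def by fast
      show "(\<Sum>(s, t)\<in>?D. t - s) < \<delta>"
        using len calculation(1) by (simp add: sum.reindex[OF inj])
    qed
    ultimately show "(\<Sum>i\<in>I. dist (f (s i)) (f (t i))) < \<epsilon>"
      by (simp add: sum.reindex[OF inj])
  qed
qed

lemma absolutely_continuousI_indexed:
  fixes f :: "real \<Rightarrow> 'b::metric_space"
  assumes "\<And>\<epsilon>. 0 < \<epsilon> \<Longrightarrow> \<exists>\<delta>>0. \<forall>(I :: (real \<times> real) set) s t. finite I \<longrightarrow>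
       (\<forall>i\<in>I. a \<le> s i \<and> s i \<le> t i \<and> t i \<le> b) \<longrightarrow>
       (\<forall>i\<in>I. \<forall>j\<in>I. i \<noteq> j \<longrightarrow> {s i<..<t i} \<inter> {s j<..<t j} = {}) \<longrightarrow>
       (\<Sum>i\<in>I. t i - s i) < \<delta> \<longrightarrow> (\<Sum>i\<in>I. dist (f (s i)) (f (t i))) < \<epsilon>"
  shows "absolutely_continuous_on_interval a b f"
  unfolding absolutely_continuous_on_interval_def
proof (intro allI impI)
  fix \<epsilon> :: real assume "0 < \<epsilon>"
  from assms[OF this] obtain \<delta> where "\<delta> > 0" and \<delta>: "\<forall>(I :: (real \<times> real) set) s t. finite I \<longrightarrow>
       (\<forall>i\<in>I. a \<le> s i \<and> s i \<le> t i \<and> t i \<le> b) \<longrightarrow>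
       (\<forall>i\<in>I. \<forall>j\<in>I. i \<noteq> j \<longrightarrow> {s i<..<t i} \<inter> {s j<..<t j} = {}) \<longrightarrow>
       (\<Sum>i\<in>I. t i - s i) < \<delta> \<longrightarrow> (\<Sum>i\<in>I. dist (f (s i)) (f (t i))) < \<epsilon>"
    by (elim exE conjE)
  show "\<exists>\<delta>>0. \<forall>D :: (real \<times> real) set.
       finite D \<and> (\<forall>(s, t)\<in>D. a \<le> s \<and> s \<le> t \<and> t \<le> b) \<and>
       pairwise (\<lambda>(s, t) (s', t'). {s<..<t} \<inter> {s'<..<t'} = {}) D \<and>
       (\<Sum>(s, t)\<in>D. t - s) < \<delta> \<longrightarrow>
       (\<Sum>(s, t)\<in>D. dist (f s) (f t)) < \<epsilon>"
  proof (intro exI conjI allI impI)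
    fix D :: "(real \<times> real) set"
    assume D: "finite D \<and> (\<forall>(s, t)\<in>D. a \<le> s \<and> s \<le> t \<and> t \<le> b) \<and>
       pairwise (\<lambda>(s, t) (s', t'). {s<..<t} \<inter> {s'<..<t'} = {}) D \<and> (\<Sum>(s, t)\<in>D. t - s) < \<delta>"
    show "(\<Sum>(s, t)\<in>D. dist (f s) (f t)) < \<epsilon>"
      using \<delta>[rule_format, of D fst snd] D unfolding pairwise_def by (auto simp: case_prod_unfold)
  qed (rule \<open>\<delta> > 0\<close>)
qed

lemma absolutely_continuous_on_interval_cong:
  assumes "absolutely_continuous_on_interval a b f" "\<And>t. t \<in> {a..b} \<Longrightarrow> f t = f' t"
  shows "absolutely_continuous_on_interval a b f'"
proof (rule absolutely_continuousI_indexed)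
  fix \<epsilon> :: real assume "0 < \<epsilon>"
  obtain \<delta> where "0 < \<delta>" and \<delta>: "\<forall>(I :: (real \<times> real) set) s t. finite I \<longrightarrow>
      (\<forall>i\<in>I. a \<le> s i \<and> s i \<le> t i \<and> t i \<le> b) \<longrightarrow>
      (\<forall>i\<in>I. \<forall>j\<in>I. i \<noteq> j \<longrightarrow> {s i<..<t i} \<inter> {s j<..<t j} = {}) \<longrightarrow>
      (\<Sum>i\<in>I. t i - s i) < \<delta> \<longrightarrow> (\<Sum>i\<in>I. dist (f (s i)) (f (t i))) < \<epsilon>"
    using absolutely_continuousD_indexed[OF assms(1) \<open>0 < \<epsilon>\<close>] by (elim exE conjE)
  show "\<exists>\<delta>>0. \<forall>(I :: (real \<times> real) set) s t. finite I \<longrightarrow>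
       (\<forall>i\<in>I. a \<le> s i \<and> s i \<le> t i \<and> t i \<le> b) \<longrightarrow>
       (\<forall>i\<in>I. \<forall>j\<in>I. i \<noteq> j \<longrightarrow> {s i<..<t i} \<inter> {s j<..<t j} = {}) \<longrightarrow>
       (\<Sum>i\<in>I. t i - s i) < \<delta> \<longrightarrow> (\<Sum>i\<in>I. dist (f' (s i)) (f' (t i))) < \<epsilon>"
  proof (intro exI[of _ \<delta>] conjI allI impI \<open>0 < \<delta>\<close>)
    fix I :: "(real \<times> real) set" and s t
    assume h: "finite I" "\<forall>i\<in>I. a \<le> s i \<and> s i \<le> t i \<and> t i \<le> b"
      "\<forall>i\<in>I. \<forall>j\<in>I. i \<noteq> j \<longrightarrow> {s i<..<t i} \<inter> {s j<..<t j} = {}" "(\<Sum>i\<in>I. t i - s i) < \<delta>"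
    have "(\<Sum>i\<in>I. dist (f' (s i)) (f' (t i))) = (\<Sum>i\<in>I. dist (f (s i)) (f (t i)))"
      using h(2) by (intro sum.cong refl) (smt (verit) assms(2) atLeastAtMost_iff)
    also have "\<dots> < \<epsilon>" using \<delta>[rule_format, of I s t] h by auto
    finally show "(\<Sum>i\<in>I. dist (f' (s i)) (f' (t i))) < \<epsilon>" .
  qed
qed

lemma absolutely_continuous_on_interval_affine:
  fixes p q :: real
  assumes "absolutely_continuous_on_interval (p + q * a) (p + q * b) f" "0 < q"
  shows "absolutely_continuous_on_interval a b (\<lambda>t. f (p + q * t))"
proof (rule absolutely_continuousI_indexed)
  fix \<epsilon> :: real assume "0 < \<epsilon>"
  obtain \<delta> where "0 < \<delta>" and \<delta>: "\<forall>(I :: (real \<times> real) set) s t. finite I \<longrightarrow>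
      (\<forall>i\<in>I. (p + q * a) \<le> s i \<and> s i \<le> t i \<and> t i \<le> (p + q * b)) \<longrightarrow>
      (\<forall>i\<in>I. \<forall>j\<in>I. i \<noteq> j \<longrightarrow> {s i<..<t i} \<inter> {s j<..<t j} = {}) \<longrightarrow>
      (\<Sum>i\<in>I. t i - s i) < \<delta> \<longrightarrow> (\<Sum>i\<in>I. dist (f (s i)) (f (t i))) < \<epsilon>"
    using absolutely_continuousD_indexed[OF assms(1) \<open>0 < \<epsilon>\<close>] by (elim exE conjE)
  show "\<exists>\<delta>>0. \<forall>(I :: (real \<times> real) set) s t. finite I \<longrightarrow>
       (\<forall>i\<in>I. a \<le> s i \<and> s i \<le> t i \<and> t i \<le> b) \<longrightarrow>
       (\<forall>i\<in>I. \<forall>j\<in>I. i \<noteq> j \<longrightarrow> {s i<..<t i} \<inter> {s j<..<t j} = {}) \<longrightarrow>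
       (\<Sum>i\<in>I. t i - s i) < \<delta> \<longrightarrow> (\<Sum>i\<in>I. dist (f (p + q * s i)) (f (p + q * t i))) < \<epsilon>"
  proof (intro exI[of _ "\<delta> / q"] conjI allI impI)
    show "0 < \<delta> / q" using \<open>0 < \<delta>\<close> assms(2) by simp
    fix I :: "(real \<times> real) set" and s t
    assume h: "finite I" "\<forall>i\<in>I. a \<le> s i \<and> s i \<le> t i \<and> t i \<le> b"
      "\<forall>i\<in>I. \<forall>j\<in>I. i \<noteq> j \<longrightarrow> {s i<..<t i} \<inter> {s j<..<t j} = {}" "(\<Sum>i\<in>I. t i - s i) < \<delta> / q"
    show "(\<Sum>i\<in>I. dist (f (p + q * s i)) (f (p + q * t i))) < \<epsilon>"
    proof (rule \<delta>[rule_format, OF h(1)])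
      fix i j assume ij: "i \<in> I" "j \<in> I" "i \<noteq> j"
      show "{p + q * s i<..<p + q * t i} \<inter> {p + q * s j<..<p + q * t j} = {}"
      proof (rule equals0I)
        fix x assume x: "x \<in> {p + q * s i<..<p + q * t i} \<inter> {p + q * s j<..<p + q * t j}"
        have "(x - p) / q \<in> {s i<..<t i} \<inter> {s j<..<t j}"
          using x assms(2) by (auto simp: field_simps)
        then show False using h(3) ij by blast
      qed
    next
      have "(\<Sum>i\<in>I. (p + q * t i) - (p + q * s i)) = q * (\<Sum>i\<in>I. t i - s i)"
        by (simp add: sum_distrib_left algebra_simps)
      then show "(\<Sum>i\<in>I. (p + q * t i) - (p + q * s i)) < \<delta>"
        using h(4) assms(2) by (simp add: field_simps)
    qed (use h(2) assms(2) in auto)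
  qed
qed

text \<open>An interval straddling \<open>m\<close> is cut there. The left parts and the right parts
  each form a disjoint family of no larger total length, and the triangle inequality at
  \<open>m\<close> pays for the cut.\<close>

lemma absolutely_continuous_on_interval_join:
  assumes "absolutely_continuous_on_interval a m f" "absolutely_continuous_on_interval m b f"
  shows "absolutely_continuous_on_interval a b f"
proof (rule absolutely_continuousI_indexed)
  fix \<epsilon> :: real assume "0 < \<epsilon>"
  then have e2: "0 < \<epsilon> / 2" by simp
  obtain \<delta>1 where "0 < \<delta>1" and \<delta>1: "\<forall>(I :: (real \<times> real) set) s t. finite I \<longrightarrow>
      (\<forall>i\<in>I. a \<le> s i \<and> s i \<le> t i \<and> t i \<le> m) \<longrightarrow>
      (\<forall>i\<in>I. \<forall>j\<in>I. i \<noteq> j \<longrightarrow> {s i<..<t i} \<inter> {s j<..<t j} = {}) \<longrightarrow>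
      (\<Sum>i\<in>I. t i - s i) < \<delta>1 \<longrightarrow> (\<Sum>i\<in>I. dist (f (s i)) (f (t i))) < \<epsilon> / 2"
    using absolutely_continuousD_indexed[OF assms(1) e2] by (elim exE conjE)
  obtain \<delta>2 where "0 < \<delta>2" and \<delta>2: "\<forall>(I :: (real \<times> real) set) s t. finite I \<longrightarrow>
      (\<forall>i\<in>I. m \<le> s i \<and> s i \<le> t i \<and> t i \<le> b) \<longrightarrow>
      (\<forall>i\<in>I. \<forall>j\<in>I. i \<noteq> j \<longrightarrow> {s i<..<t i} \<inter> {s j<..<t j} = {}) \<longrightarrow>
      (\<Sum>i\<in>I. t i - s i) < \<delta>2 \<longrightarrow> (\<Sum>i\<in>I. dist (f (s i)) (f (t i))) < \<epsilon> / 2"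
    using absolutely_continuousD_indexed[OF assms(2) e2] by (elim exE conjE)
  show "\<exists>\<delta>>0. \<forall>(I :: (real \<times> real) set) s t. finite I \<longrightarrow>
       (\<forall>i\<in>I. a \<le> s i \<and> s i \<le> t i \<and> t i \<le> b) \<longrightarrow>
       (\<forall>i\<in>I. \<forall>j\<in>I. i \<noteq> j \<longrightarrow> {s i<..<t i} \<inter> {s j<..<t j} = {}) \<longrightarrow>
       (\<Sum>i\<in>I. t i - s i) < \<delta> \<longrightarrow> (\<Sum>i\<in>I. dist (f (s i)) (f (t i))) < \<epsilon>"
  proof (intro exI[of _ "min \<delta>1 \<delta>2"] conjI allI impI)
    show "0 < min \<delta>1 \<delta>2" using \<open>0 < \<delta>1\<close> \<open>0 < \<delta>2\<close> by simp
    fix I :: "(real \<times> real) set" and s t :: "real \<times> real \<Rightarrow> real"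
    assume h: "finite I" "\<forall>i\<in>I. a \<le> s i \<and> s i \<le> t i \<and> t i \<le> b"
      "\<forall>i\<in>I. \<forall>j\<in>I. i \<noteq> j \<longrightarrow> {s i<..<t i} \<inter> {s j<..<t j} = {}" "(\<Sum>i\<in>I. t i - s i) < min \<delta>1 \<delta>2"
    define L where "L = {i\<in>I. s i \<le> m}"
    define R where "R = {i\<in>I. m \<le> t i}"
    have sub: "L \<subseteq> I" "R \<subseteq> I" by (auto simp: L_def R_def)
    have fin: "finite L" "finite R" using h(1) by (auto simp: L_def R_def)
    have disj: "{s' i<..<t' i} \<inter> {s' j<..<t' j} = {}"
      if "i \<in> I" "j \<in> I" "i \<noteq> j" "\<And>k. s k \<le> s' k" "\<And>k. t' k \<le> t k" for i j s' t'
    proof -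
      have "{s' i<..<t' i} \<inter> {s' j<..<t' j} \<subseteq> {s i<..<t i} \<inter> {s j<..<t j}"
        using that(4)[of i] that(4)[of j] that(5)[of i] that(5)[of j] by auto
      then show ?thesis using h(3) that by blast
    qed
    have 1: "(\<Sum>i\<in>L. dist (f (s i)) (f (min m (t i)))) < \<epsilon> / 2"
    proof (rule \<delta>1[rule_format, OF fin(1)])
      have "(\<Sum>i\<in>L. min m (t i) - s i) \<le> (\<Sum>i\<in>L. t i - s i)"
        by (rule sum_mono) auto
      also have "\<dots> \<le> (\<Sum>i\<in>I. t i - s i)"
        by (rule sum_mono2) (use h sub in auto)
      finally show "(\<Sum>i\<in>L. min m (t i) - s i) < \<delta>1" using h(4) by simp
    next
      fix i j assume "i \<in> L" "j \<in> L" "i \<noteq> j"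
      then show "{s i<..<min m (t i)} \<inter> {s j<..<min m (t j)} = {}"
        using sub by (intro disj) auto
    qed (use h(2) in \<open>auto simp: L_def\<close>)
    have 2: "(\<Sum>i\<in>R. dist (f (max m (s i))) (f (t i))) < \<epsilon> / 2"
    proof (rule \<delta>2[rule_format, OF fin(2)])
      have "(\<Sum>i\<in>R. t i - max m (s i)) \<le> (\<Sum>i\<in>R. t i - s i)"
        by (rule sum_mono) auto
      also have "\<dots> \<le> (\<Sum>i\<in>I. t i - s i)"
        by (rule sum_mono2) (use h sub in auto)
      finally show "(\<Sum>i\<in>R. t i - max m (s i)) < \<delta>2" using h(4) by simp
    next
      fix i j assume "i \<in> R" "j \<in> R" "i \<noteq> j"
      then show "{max m (s i)<..<t i} \<inter> {max m (s j)<..<t j} = {}"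
        using sub by (intro disj) auto
    qed (use h(2) in \<open>auto simp: R_def\<close>)
    have "(\<Sum>i\<in>I. dist (f (s i)) (f (t i))) \<le>
       (\<Sum>i\<in>I. (if i \<in> L then dist (f (s i)) (f (min m (t i))) else 0) +
              (if i \<in> R then dist (f (max m (s i))) (f (t i)) else 0))"
      by (rule sum_mono) (use h(2) dist_triangle in \<open>auto simp: L_def R_def min_def max_def\<close>)
    also have "\<dots> = (\<Sum>i\<in>L. dist (f (s i)) (f (min m (t i)))) + (\<Sum>i\<in>R. dist (f (max m (s i))) (f (t i)))"
      using h(1) sub by (simp add: sum.distrib sum.inter_restrict[symmetric] Int_absorb1)
    finally show "(\<Sum>i\<in>I. dist (f (s i)) (f (t i))) < \<epsilon>" using 1 2 by simp
  qed
qed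

lemma lipschitz_imp_absolutely_continuous:
  assumes "M-lipschitz_on {a..b} f"
  shows "absolutely_continuous_on_interval a b f"
proof (rule absolutely_continuousI_indexed)
  fix \<epsilon> :: real assume "0 < \<epsilon>"
  have M: "0 \<le> M" by (rule lipschitz_on_nonneg[OF assms])
  show "\<exists>\<delta>>0. \<forall>(I :: (real \<times> real) set) s t. finite I \<longrightarrow>
       (\<forall>i\<in>I. a \<le> s i \<and> s i \<le> t i \<and> t i \<le> b) \<longrightarrow>
       (\<forall>i\<in>I. \<forall>j\<in>I. i \<noteq> j \<longrightarrow> {s i<..<t i} \<inter> {s j<..<t j} = {}) \<longrightarrow>
       (\<Sum>i\<in>I. t i - s i) < \<delta> \<longrightarrow> (\<Sum>i\<in>I. dist (f (s i)) (f (t i))) < \<epsilon>"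
  proof (intro exI[of _ "\<epsilon> / (M + 1)"] conjI allI impI)
    show "0 < \<epsilon> / (M + 1)" using M \<open>0 < \<epsilon>\<close> by simp
    fix I :: "(real \<times> real) set" and s t :: "real \<times> real \<Rightarrow> real"
    assume h: "finite I" "\<forall>i\<in>I. a \<le> s i \<and> s i \<le> t i \<and> t i \<le> b" "(\<Sum>i\<in>I. t i - s i) < \<epsilon> / (M + 1)"
    have "(\<Sum>i\<in>I. dist (f (s i)) (f (t i))) \<le> (\<Sum>i\<in>I. (M + 1) * (t i - s i))"
    proof (rule sum_mono)
      fix i assume "i \<in> I"
      then have "dist (f (s i)) (f (t i)) \<le> M * dist (s i) (t i)"
        using h(2) by (intro lipschitz_onD[OF assms]) auto
      also have "\<dots> \<le> (M + 1) * (t i - s i)"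
        using h(2) \<open>i \<in> I\<close> by (simp add: dist_real_def distrib_right)
      finally show "dist (f (s i)) (f (t i)) \<le> (M + 1) * (t i - s i)" .
    qed
    also have "\<dots> = (M + 1) * (\<Sum>i\<in>I. t i - s i)" by (simp add: sum_distrib_left)
    also have "\<dots> < \<epsilon>" using h(3) M by (simp add: field_simps)
    finally show "(\<Sum>i\<in>I. dist (f (s i)) (f (t i))) < \<epsilon>" .
  qed
qed

text \<open>A gauge argument. Cells tagged outside \<open>N\<close> are controlled by
  differentiability at the tag. Cells tagged in \<open>N\<close> are forced by the gauge into an
  open set of measure below \<delta>, so absolute continuity bounds their total increment, while the
  integrand is set to 0 at their tags.\<close>

theorem absolutely_continuous_has_integral_derivative:
  fixes f :: "real \<Rightarrow> 'b::banach"
  assumes ac: "absolutely_continuous_on_interval a b f" and ab: "a \<le> b"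
    and neg: "negligible N"
    and der: "\<And>t. t \<in> {a..b} - N \<Longrightarrow> (f has_vector_derivative f' t) (at t within {a..b})"
  shows "(f' has_integral (f b - f a)) {a..b}"
proof -
  define h where "h t = (if t \<in> N then 0 else f' t)" for t
  have "(h has_integral (f b - f a)) {a..b}"
    unfolding has_integral_real
  proof (intro allI impI)
    fix e :: real assume "0 < e"
    \<comment> \<open>The cells tagged outside \<open>N\<close> contribute at most
      \<open>e1 * (b - a)\<close>, which must stay below \<open>e / 2\<close>; the summand 2 keeps
      the denominator positive when \<open>a = b\<close>.\<close>
    define e1 where "e1 = e / (2 * (b - a) + 2)"
    have e1: "0 < e1" "e1 * (b - a) < e / 2"
      using \<open>0 < e\<close> ab by (auto simp: e1_def field_simps)
    have "\<exists>d>0. \<forall>y\<in>{a..b}. norm (y - x) < d \<longrightarrow> norm (f y - f x - (y - x) *\<^sub>R f' x) \<le> e1 * norm (y - x)"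
      if "x \<in> {a..b} - N" for x
      using der[OF that] e1(1) unfolding has_vector_derivative_def has_derivative_within_alt by blast
    then have "\<forall>x\<in>{a..b} - N. \<exists>d>0. \<forall>y\<in>{a..b}. norm (y - x) < d \<longrightarrow>
        norm (f y - f x - (y - x) *\<^sub>R f' x) \<le> e1 * norm (y - x)"
      by blast
    from bchoice[OF this] obtain d where d: "\<And>x. x \<in> {a..b} - N \<Longrightarrow> 0 < d x"
      "\<And>x y. \<lbrakk>x \<in> {a..b} - N; y \<in> {a..b}; norm (y - x) < d x\<rbrakk> \<Longrightarrow>
         norm (f y - f x - (y - x) *\<^sub>R f' x) \<le> e1 * norm (y - x)"
      by blast
    obtain \<delta> where "0 < \<delta>" and \<delta>: "\<forall>(I :: (real \<times> real set) set) s t. finite I \<longrightarrow>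
      (\<forall>i\<in>I. a \<le> s i \<and> s i \<le> t i \<and> t i \<le> b) \<longrightarrow>
      (\<forall>i\<in>I. \<forall>j\<in>I. i \<noteq> j \<longrightarrow> {s i<..<t i} \<inter> {s j<..<t j} = {}) \<longrightarrow>
      (\<Sum>i\<in>I. t i - s i) < \<delta> \<longrightarrow> (\<Sum>i\<in>I. dist (f (s i)) (f (t i))) < e / 2"
    using absolutely_continuousD_indexed[OF ac half_gt_zero[OF \<open>0 < e\<close>]] by (elim exE conjE)
    have Nnull: "N \<in> null_sets lebesgue" using neg negligible_iff_null_sets by blast
    obtain T where T: "open T" "N \<subseteq> T" "(T - N) \<in> lmeasurable" "emeasure lebesgue (T - N) < ennreal \<delta>"
      using sets_lebesgue_outer_open[of N \<delta>] Nnull \<open>0 < \<delta>\<close> by auto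
    have "emeasure lebesgue T = emeasure lebesgue (T - N)"
      using Nnull T(1) by (intro emeasure_Diff_null_set[symmetric]) auto
    then have Tl: "emeasure lebesgue T < ennreal \<delta>" using T(4) by simp
    then have Tm: "T \<in> lmeasurable"
      using T(1) less_trans[OF Tl ennreal_less_top] by (intro fmeasurableI) auto
    have Td: "measure lebesgue T < \<delta>"
      using Tl \<open>0 < \<delta>\<close> by (simp add: emeasure_eq_measure2[OF Tm] ennreal_less_iff)
    define g where "g x = (if x \<in> N then T else ball x (if x \<in> {a..b} then d x else 1))" for x
    have gauge: "gauge g"
      unfolding gauge_def g_def using T d(1) by auto
    have riemann: "norm ((\<Sum>(x, k)\<in>p. measure lborel k *\<^sub>R h x) - (f b - f a)) < e"
      if p: "p tagged_division_of {a..b}" and fine: "g fine p" for p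
    proof -
      have fin: "finite p" using p by (rule tagged_division_of_finite)
      have K: "\<exists>u v. K = {u..v} \<and> u \<le> x \<and> x \<le> v \<and> a \<le> u \<and> v \<le> b" if xK: "(x, K) \<in> p" for x K
      proof -
        obtain u v where "K = cbox u v" using tagged_division_ofD(4)[OF p xK] by blast
        moreover have "x \<in> K" "K \<subseteq> {a..b}" using tagged_division_ofD(2,3)[OF p xK] by auto
        ultimately have "K = {u..v}" "u \<le> x" "x \<le> v" "{u..v} \<subseteq> {a..b}" by auto
        then show ?thesis by auto
      qed
      have K': "a \<le> Inf (snd z)" "Inf (snd z) \<le> Sup (snd z)" "Sup (snd z) \<le> b"
        "snd z = {Inf (snd z)..Sup (snd z)}" if zp: "z \<in> p" for z
      proof -
        obtain u v where "snd z = {u..v}" "u \<le> fst z" "fst z \<le> v" "a \<le> u" "v \<le> b"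
          using K[of "fst z" "snd z"] zp unfolding prod.collapse by blast
        then show "a \<le> Inf (snd z)" "Inf (snd z) \<le> Sup (snd z)" "Sup (snd z) \<le> b"
          "snd z = {Inf (snd z)..Sup (snd z)}" by auto
      qed
      define q where "q = {z\<in>p. fst z \<in> N}"
      have q: "q \<subseteq> p" "finite q" using fin by (auto simp: q_def)
      have disj: "{Inf (snd i)<..<Sup (snd i)} \<inter> {Inf (snd j)<..<Sup (snd j)} = {}"
        if ij: "i \<in> p" "j \<in> p" "i \<noteq> j" for i j
      proof -
        have "interior (snd i) \<inter> interior (snd j) = {}"
          using tagged_division_ofD(5)[OF p, of "fst i" "snd i" "fst j" "snd j"] ij by auto
        moreover have "interior (snd i) = {Inf (snd i)<..<Sup (snd i)}" if "i \<in> p" for i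
          using arg_cong[OF K'(4)[OF that], of interior] by simp
        ultimately show ?thesis using ij by simp
      qed
      have len: "(\<Sum>z\<in>q. Sup (snd z) - Inf (snd z)) < \<delta>"
      proof -
        have "(\<Sum>z\<in>q. Sup (snd z) - Inf (snd z)) = (\<Sum>z\<in>q. measure lebesgue {Inf (snd z)<..<Sup (snd z)})"
        proof (rule sum.cong[OF refl])
          fix z assume "z \<in> q"
          then have "Inf (snd z) \<le> Sup (snd z)" using K'(2) q by blast
          then show "Sup (snd z) - Inf (snd z) = measure lebesgue {Inf (snd z)<..<Sup (snd z)}" by simp
        qed
        also have "\<dots> = measure lebesgue (\<Union>z\<in>q. {Inf (snd z)<..<Sup (snd z)})"
        proof (rule measure_finite_Union[symmetric, OF q(2)])
          show "disjoint_family_on (\<lambda>z. {Inf (snd z)<..<Sup (snd z)}) q"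
            unfolding disjoint_family_on_def using q(1) by (intro ballI impI disj) auto
          show "emeasure lebesgue {Inf (snd z)<..<Sup (snd z)} \<noteq> \<infinity>" for z :: "real \<times> real set"
            by (rule le_cases[of "Inf (snd z)" "Sup (snd z)"]) simp_all
        qed auto
        also have "\<dots> \<le> measure lebesgue T"
        proof (rule measure_mono_fmeasurable[OF _ _ Tm])
          show "(\<Union>z\<in>q. {Inf (snd z)<..<Sup (snd z)}) \<subseteq> T"
          proof (rule UN_least)
            fix z assume "z \<in> q"
            then have z: "z \<in> p" "fst z \<in> N" by (auto simp: q_def)
            then have "snd z \<subseteq> T"
              using fineD[OF fine, of "fst z" "snd z"] by (simp add: g_def)
            then have "{Inf (snd z)..Sup (snd z)} \<subseteq> T"
              using K'(4)[OF z(1)] by simp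
            then show "{Inf (snd z)<..<Sup (snd z)} \<subseteq> T"
              using greaterThanLessThan_subseteq_atLeastAtMost_iff order_trans by blast
          qed
        qed (use q(2) in auto)
        finally show ?thesis using Td by simp
      qed
      have small: "(\<Sum>z\<in>q. dist (f (Inf (snd z))) (f (Sup (snd z)))) < e / 2"
      proof (rule \<delta>[rule_format, OF q(2) _ _ len])
        fix z assume "z \<in> q"
        then show "a \<le> Inf (snd z) \<and> Inf (snd z) \<le> Sup (snd z) \<and> Sup (snd z) \<le> b"
          using K'[of z] q by blast
      next
        fix i j assume "i \<in> q" "j \<in> q" "i \<noteq> j"
        then show "{Inf (snd i)<..<Sup (snd i)} \<inter> {Inf (snd j)<..<Sup (snd j)} = {}"
          using q(1) by (intro disj) auto
      qed
      have "(\<Sum>(x, k)\<in>p. measure lborel k *\<^sub>R h x) - (f b - f a) =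
          (\<Sum>z\<in>p. measure lborel (snd z) *\<^sub>R h (fst z) - (f (Sup (snd z)) - f (Inf (snd z))))"
        using additive_tagged_division_1[OF ab p, of f]
        by (simp add: sum_subtractf case_prod_unfold)
      also have "norm \<dots> \<le> (\<Sum>z\<in>p. (if z \<in> q then dist (f (Inf (snd z))) (f (Sup (snd z))) else 0) +
          e1 * (Sup (snd z) - Inf (snd z)))"
      proof (rule sum_norm_le)
        fix z assume "z \<in> p"
        obtain x k where z: "z = (x, k)" by fastforce
        with \<open>z \<in> p\<close> obtain u v where k: "k = {u..v}" "u \<le> x" "x \<le> v" "a \<le> u" "v \<le> b"
          using K by blast
        have pos: "0 \<le> e1 * (v - u)" using e1 k by auto
        show "norm (measure lborel (snd z) *\<^sub>R h (fst z) - (f (Sup (snd z)) - f (Inf (snd z)))) \<le>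
          (if z \<in> q then dist (f (Inf (snd z))) (f (Sup (snd z))) else 0) +
          e1 * (Sup (snd z) - Inf (snd z))"
        proof (cases "x \<in> N")
          case True
          then show ?thesis
            using \<open>z \<in> p\<close> z k pos by (simp add: q_def h_def dist_norm norm_minus_commute)
        next
          case False
          have xab: "x \<in> {a..b} - N" using k False by auto
          have sub: "{u..v} \<subseteq> ball x (d x)"
            using fineD[OF fine, of x "{u..v}"] \<open>z \<in> p\<close> z k xab by (simp add: g_def)
          have "u \<in> ball x (d x)" "v \<in> ball x (d x)"
            using sub k by (meson atLeastAtMost_iff order_refl order_trans subsetD)+
          then have 1: "norm (f u - f x - (u - x) *\<^sub>R f' x) \<le> e1 * (x - u)"
            and 2: "norm (f v - f x - (v - x) *\<^sub>R f' x) \<le> e1 * (v - x)"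
            using d(2)[OF xab, of u] d(2)[OF xab, of v] k by (auto simp: dist_real_def)
          have "norm ((v - u) *\<^sub>R f' x - (f v - f u)) =
             norm ((f u - f x - (u - x) *\<^sub>R f' x) - (f v - f x - (v - x) *\<^sub>R f' x))"
            by (simp add: algebra_simps)
          also have "\<dots> \<le> e1 * (x - u) + e1 * (v - x)"
            by (rule order_trans[OF norm_triangle_ineq4 add_mono[OF 1 2]])
          finally show ?thesis using False z k \<open>z \<in> p\<close> by (simp add: q_def h_def algebra_simps)
        qed
      qed
      also have "\<dots> = (\<Sum>z\<in>q. dist (f (Inf (snd z))) (f (Sup (snd z)))) + e1 * (\<Sum>z\<in>p. Sup (snd z) - Inf (snd z))"
        using fin q(1) by (simp add: sum.distrib sum.inter_restrict[symmetric] Int_absorb1 sum_distrib_left)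
      also have "(\<Sum>z\<in>p. Sup (snd z) - Inf (snd z)) = b - a"
        using additive_tagged_division_1[OF ab p, of "\<lambda>x. x"] by (simp add: case_prod_unfold)
      finally show ?thesis using small e1(2) by simp
    qed
    show "\<exists>\<gamma>. gauge \<gamma> \<and> (\<forall>\<D>. \<D> tagged_division_of {a..b} \<and> \<gamma> fine \<D> \<longrightarrow>
        norm ((\<Sum>(x, k)\<in>\<D>. measure lborel k *\<^sub>R h x) - (f b - f a)) < e)"
      by (intro exI[of _ g] conjI allI impI gauge riemann) (elim conjE, assumption)+
  qed
  then show ?thesis
    by (rule has_integral_spike[OF neg, rotated]) (simp add: h_def)
qed

section \<open>Calculus of smooth functions\<close>

lemma frechet_derivative_eqI:
  "(f has_derivative f') (at x) \<Longrightarrow> frechet_derivative f (at x) = f'"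
  by (metis frechet_derivative_at)

lemma frechet_derivative_cong_open:
  assumes "open S" "x \<in> S" "\<And>y. y \<in> S \<Longrightarrow> f y = g y"
  shows "frechet_derivative f (at x) = frechet_derivative g (at x)"
proof -
  have "(f has_derivative D) (at x) \<longleftrightarrow> (g has_derivative D) (at x)" for D
    using has_derivative_transform_within_open[OF _ assms(1,2), of f D UNIV g]
      has_derivative_transform_within_open[OF _ assms(1,2), of g D UNIV f] assms(3) by auto
  then show ?thesis by (simp add: frechet_derivative_def)
qed

lemma differentiable_cong_open:
  assumes "open S" "x \<in> S" "\<And>y. y \<in> S \<Longrightarrow> f y = g y" "f differentiable (at x)"
  shows "g differentiable (at x)"
  using has_derivative_transform_within_open[OF _ assms(1,2), of f _ UNIV g] assms(3,4)
  unfolding differentiable_def by blast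

lemma Ck_on_cong:
  assumes "open S" "\<And>y. y \<in> S \<Longrightarrow> f y = g y" "Ck_on k S f"
  shows "Ck_on k S g"
  using assms(2,3)
proof (induction k arbitrary: f g)
  case 0
  then show ?case by (auto intro: continuous_on_eq)
next
  case (Suc k)
  have "g differentiable (at x)" if "x \<in> S" for x
    using differentiable_cong_open[OF assms(1) that Suc.prems(1)] Suc.prems(2) that by auto
  moreover have "Ck_on k S (\<lambda>x. frechet_derivative g (at x) v)" for v
  proof (rule Suc.IH)
    show "Ck_on k S (\<lambda>x. frechet_derivative f (at x) v)" using Suc.prems(2) by simp
    show "frechet_derivative f (at x) v = frechet_derivative g (at x) v" if "x \<in> S" for x
      using frechet_derivative_cong_open[OF assms(1) that, of f g] Suc.prems(1) by simp
  qed
  ultimately show ?case by simp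
qed

lemma Ck_on_subset: "Ck_on k S f \<Longrightarrow> T \<subseteq> S \<Longrightarrow> Ck_on k T f"
  by (induction k arbitrary: f) (auto intro: continuous_on_subset)

lemma Ck_on_SucD: "Ck_on (Suc k) S f \<Longrightarrow> Ck_on k S f"
proof (induction k arbitrary: f)
  case 0
  then show ?case
    by (auto intro!: differentiable_imp_continuous_on simp: differentiable_on_def differentiable_at_withinI)
next
  case (Suc k)
  then have "Ck_on k S (\<lambda>x. frechet_derivative f (at x) v)" for v by (intro Suc.IH) simp
  then show ?case using Suc.prems by simp
qed

lemma Ck_on_const [simp]: "Ck_on k S (\<lambda>x. c)"
  by (induction k arbitrary: c) (auto simp: frechet_derivative_const)

lemma Ck_on_linear:
  assumes "bounded_linear L" "open S" "Ck_on k S f"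
  shows "Ck_on k S (\<lambda>x. L (f x))"
  using assms(3)
proof (induction k arbitrary: f)
  case 0
  then show ?case using bounded_linear.continuous_on[OF assms(1)] by auto
next
  case (Suc k)
  have der: "((\<lambda>x. L (f x)) has_derivative (\<lambda>v. L (frechet_derivative f (at x) v))) (at x)" if "x \<in> S" for x
    using Suc.prems that by (intro bounded_linear.has_derivative[OF assms(1)]) (simp add: frechet_derivative_works[symmetric])
  have "Ck_on k S (\<lambda>x. frechet_derivative (\<lambda>x. L (f x)) (at x) v)" for v
  proof (rule Ck_on_cong[OF assms(2)])
    show "Ck_on k S (\<lambda>x. L (frechet_derivative f (at x) v))"
      using Suc.prems by (intro Suc.IH) simp_all
  qed (simp add: frechet_derivative_eqI[OF der])
  then show ?case using der by (auto simp: differentiable_def)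
qed

lemma Ck_on_id [simp]: "Ck_on k S (\<lambda>x. x)"
  by (cases k) (auto simp: frechet_derivative_ident)

lemma Ck_on_add:
  assumes "open S" "Ck_on k S f" "Ck_on k S g"
  shows "Ck_on k S (\<lambda>x. f x + g x)"
  using assms(2,3)
proof (induction k arbitrary: f g)
  case 0
  then show ?case by (auto intro: continuous_on_add)
next
  case (Suc k)
  have der: "((\<lambda>x. f x + g x) has_derivative (\<lambda>v. frechet_derivative f (at x) v + frechet_derivative g (at x) v)) (at x)"
    if "x \<in> S" for x
    using Suc.prems that by (intro has_derivative_add) (simp_all add: frechet_derivative_works[symmetric])
  have "Ck_on k S (\<lambda>x. frechet_derivative (\<lambda>x. f x + g x) (at x) v)" for v
  proof (rule Ck_on_cong[OF assms(1)])
    show "Ck_on k S (\<lambda>x. frechet_derivative f (at x) v + frechet_derivative g (at x) v)"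
      using Suc.prems by (intro Suc.IH) simp_all
  qed (simp add: frechet_derivative_eqI[OF der])
  then show ?case using der by (auto simp: differentiable_def)
qed

lemma Ck_on_scaleR:
  fixes c :: "'a::euclidean_space \<Rightarrow> real"
  assumes "open S" "Ck_on k S c" "Ck_on k S f"
  shows "Ck_on k S (\<lambda>x. c x *\<^sub>R f x)"
  using assms(2,3)
proof (induction k arbitrary: c f)
  case 0
  then show ?case by (auto intro: continuous_on_scaleR)
next
  case (Suc k)
  have der: "((\<lambda>x. c x *\<^sub>R f x) has_derivative (\<lambda>v. c x *\<^sub>R frechet_derivative f (at x) v +
      frechet_derivative c (at x) v *\<^sub>R f x)) (at x)" if "x \<in> S" for x
    using Suc.prems that by (intro has_derivative_scaleR) (simp_all add: frechet_derivative_works[symmetric])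
  have "Ck_on k S (\<lambda>x. frechet_derivative (\<lambda>x. c x *\<^sub>R f x) (at x) v)" for v
  proof (rule Ck_on_cong[OF assms(1)])
    show "Ck_on k S (\<lambda>x. c x *\<^sub>R frechet_derivative f (at x) v + frechet_derivative c (at x) v *\<^sub>R f x)"
      using Suc.prems Ck_on_SucD[OF Suc.prems(1)] Ck_on_SucD[OF Suc.prems(2)]
      by (intro Ck_on_add[OF assms(1)] Suc.IH) simp_all
  qed (simp add: frechet_derivative_eqI[OF der])
  then show ?case using der by (auto simp: differentiable_def)
qed

lemma Ck_on_sum:
  assumes "open S" "\<And>i. i \<in> I \<Longrightarrow> Ck_on k S (f i)"
  shows "Ck_on k S (\<lambda>x. \<Sum>i\<in>I. f i x)"
  using assms(2) by (induction I rule: infinite_finite_induct) (simp_all add: Ck_on_add[OF assms(1)])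

lemma smooth_on_differentiable: "smooth_on S f \<Longrightarrow> x \<in> S \<Longrightarrow> f differentiable (at x)"
  unfolding smooth_on_def using Ck_on.simps(2) by blast

lemma smooth_on_has_derivative:
  "smooth_on S f \<Longrightarrow> x \<in> S \<Longrightarrow> (f has_derivative frechet_derivative f (at x)) (at x)"
  using smooth_on_differentiable frechet_derivative_works by blast

lemma smooth_on_continuous_on: "smooth_on S f \<Longrightarrow> continuous_on S f"
  unfolding smooth_on_def using Ck_on.simps(1) by blast

lemma smooth_on_subset: "smooth_on S f \<Longrightarrow> T \<subseteq> S \<Longrightarrow> smooth_on T f"
  unfolding smooth_on_def using Ck_on_subset by blast

lemma smooth_on_cong: "open S \<Longrightarrow> (\<And>y. y \<in> S \<Longrightarrow> f y = g y) \<Longrightarrow> smooth_on S f \<Longrightarrow> smooth_on S g"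
  unfolding smooth_on_def using Ck_on_cong by blast

lemma smooth_on_const [simp]: "smooth_on S (\<lambda>x. c)"
  by (simp add: smooth_on_def)

lemma smooth_on_id [simp]: "smooth_on S (\<lambda>x. x)"
  by (simp add: smooth_on_def)

lemma smooth_on_linear: "bounded_linear L \<Longrightarrow> open S \<Longrightarrow> smooth_on S f \<Longrightarrow> smooth_on S (\<lambda>x. L (f x))"
  by (simp add: smooth_on_def Ck_on_linear)

lemma smooth_on_add: "open S \<Longrightarrow> smooth_on S f \<Longrightarrow> smooth_on S g \<Longrightarrow> smooth_on S (\<lambda>x. f x + g x)"
  by (simp add: smooth_on_def Ck_on_add)

lemma smooth_on_scaleR:
  fixes c :: "'a::euclidean_space \<Rightarrow> real"
  shows "open S \<Longrightarrow> smooth_on S c \<Longrightarrow> smooth_on S f \<Longrightarrow> smooth_on S (\<lambda>x. c x *\<^sub>R f x)"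
  by (simp add: smooth_on_def Ck_on_scaleR)

lemma smooth_on_sum:
  "open S \<Longrightarrow> (\<And>i. i \<in> I \<Longrightarrow> smooth_on S (f i)) \<Longrightarrow> smooth_on S (\<lambda>x. \<Sum>i\<in>I. f i x)"
  by (simp add: smooth_on_def Ck_on_sum)

lemma smooth_on_minus: "open S \<Longrightarrow> smooth_on S f \<Longrightarrow> smooth_on S (\<lambda>x. - f x)"
  using smooth_on_linear[OF bounded_linear_minus[OF bounded_linear_ident]] by blast

lemma smooth_on_diff: "open S \<Longrightarrow> smooth_on S f \<Longrightarrow> smooth_on S g \<Longrightarrow> smooth_on S (\<lambda>x. f x - g x)"
  using smooth_on_add[of S f "\<lambda>x. - g x"] smooth_on_minus[of S g] by simp

lemma smooth_on_frechet_derivative: "smooth_on S f \<Longrightarrow> smooth_on S (\<lambda>x. frechet_derivative f (at x) v)"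
  unfolding smooth_on_def using Ck_on.simps(2) by blast

text \<open>\<open>smooth_on\<close> speaks only of derivatives in constant directions, so
  \<open>Y\<close> is expanded in the basis, with smooth coefficients.\<close>

lemma smooth_on_directional_derivative:
  fixes Y :: "'a::euclidean_space \<Rightarrow> 'a"
  assumes S: "open S" and f: "smooth_on S f" and Y: "smooth_on S Y"
  shows "smooth_on S (\<lambda>x. frechet_derivative f (at x) (Y x))"
proof (rule smooth_on_cong[OF S])
  show "smooth_on S (\<lambda>x. \<Sum>b\<in>Basis. (Y x \<bullet> b) *\<^sub>R frechet_derivative f (at x) b)"
    using assms by (intro smooth_on_sum smooth_on_scaleR smooth_on_frechet_derivative
        smooth_on_linear[OF bounded_linear_inner_left]) auto
  fix x assume "x \<in> S"
  then have "linear (frechet_derivative f (at x))"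
    using smooth_on_differentiable[OF f] linear_frechet_derivative by blast
  then show "(\<Sum>b\<in>Basis. (Y x \<bullet> b) *\<^sub>R frechet_derivative f (at x) b) = frechet_derivative f (at x) (Y x)"
    by (subst (2) euclidean_representation[of "Y x", symmetric]) (simp add: linear_sum linear_cmul)
qed

subsection \<open>Symmetry of second derivatives\<close>

text \<open>The mean value theorem in direction \<open>u\<close>, applied to the difference in
  direction \<open>v\<close>, and then once more in direction \<open>v\<close>, turns the quotient
  into a value of the mixed derivative at a point near \<open>x\<close>; continuity of that
  derivative gives the limit.\<close>

lemma second_difference_quotient:
  fixes f :: "'a::euclidean_space \<Rightarrow> real"
  assumes S: "open S" "x \<in> S" and f: "smooth_on S f"
  shows "((\<lambda>h. (f (x + h *\<^sub>R u + h *\<^sub>R v) - f (x + h *\<^sub>R u) - f (x + h *\<^sub>R v) + f x) / h\<^sup>2) \<longlongrightarrow>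
    frechet_derivative (\<lambda>y. frechet_derivative f (at y) u) (at x) v) (at_right 0)"
proof (rule tendstoI)
  fix e :: real assume "0 < e"
  define F where "F y = frechet_derivative f (at y) u" for y
  define G where "G y = frechet_derivative F (at y) v" for y
  have F: "smooth_on S F" unfolding F_def by (rule smooth_on_frechet_derivative[OF f])
  then have "continuous_on S G" unfolding G_def by (intro smooth_on_continuous_on smooth_on_frechet_derivative)
  then have "isCont G x" using S by (simp add: continuous_on_eq_continuous_at)
  then obtain d where d: "0 < d" "\<And>y. dist y x < d \<Longrightarrow> dist (G y) (G x) < e"
    using \<open>0 < e\<close> unfolding continuous_at_eps_delta by meson
  obtain r where r: "0 < r" "ball x r \<subseteq> S" using S open_contains_ball by blast
  \<comment> \<open>For \<open>h < h0\<close> the parallelogram with sides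
    \<open>h *\<^sub>R u\<close> and \<open>h *\<^sub>R v\<close> at \<open>x\<close> lies in
    \<open>S\<close> and within the continuity radius \<open>d\<close>; the summand 1 covers
    \<open>u = v = 0\<close>.\<close>
  define h0 where "h0 = min d r / (norm u + norm v + 1)"
  have h0: "0 < h0" using d r by (simp add: h0_def add_nonneg_pos)
  have inb: "norm (s *\<^sub>R u + t *\<^sub>R v) < min d r" if "0 \<le> s" "s \<le> h" "0 \<le> t" "t \<le> h" "h < h0" for s t h
  proof -
    have "norm (s *\<^sub>R u + t *\<^sub>R v) \<le> s * norm u + t * norm v"
      using that norm_triangle_ineq[of "s *\<^sub>R u" "t *\<^sub>R v"] by simp
    also have "\<dots> \<le> h * norm u + h * norm v"
      using that by (intro add_mono mult_right_mono) auto
    also have "\<dots> \<le> h * (norm u + norm v + 1)" using that by (simp add: algebra_simps)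
    also have "\<dots> < h0 * (norm u + norm v + 1)" using that by (intro mult_strict_right_mono) (auto intro: add_nonneg_pos)
    also have "\<dots> = min d r" by (simp add: h0_def add_nonneg_eq_0_iff)
    finally show ?thesis .
  qed
  have mem: "x + s *\<^sub>R u + t *\<^sub>R v \<in> S" "dist (x + s *\<^sub>R u + t *\<^sub>R v) x < d"
    if "0 \<le> s" "s \<le> h" "0 \<le> t" "t \<le> h" "h < h0" for s t h
    using inb[OF that] r(2) by (auto simp: subset_iff dist_norm norm_minus_commute add.assoc dist_commute)
  have "dist ((f (x + h *\<^sub>R u + h *\<^sub>R v) - f (x + h *\<^sub>R u) - f (x + h *\<^sub>R v) + f x) / h\<^sup>2) (G x) < e"
    if h: "0 < h" "h < h0" for h
  proof -
    define g where "g s = f (x + s *\<^sub>R u + h *\<^sub>R v) - f (x + s *\<^sub>R u + 0 *\<^sub>R v)" for s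
    have dg: "(g has_real_derivative (F (x + s *\<^sub>R u + h *\<^sub>R v) - F (x + s *\<^sub>R u + 0 *\<^sub>R v))) (at s)"
      if "0 \<le> s" "s \<le> h" for s
    proof -
      have "((\<lambda>s. f (x + s *\<^sub>R u + t *\<^sub>R v)) has_derivative (\<lambda>k. k * F (x + s *\<^sub>R u + t *\<^sub>R v))) (at s)"
        if t: "0 \<le> t" "t \<le> h" for t
      proof -
        have "x + s *\<^sub>R u + t *\<^sub>R v \<in> S" using mem(1)[of s h t] h t \<open>0 \<le> s\<close> \<open>s \<le> h\<close> by auto
        note fd = smooth_on_has_derivative[OF f this]
        have "((\<lambda>s. x + s *\<^sub>R u + t *\<^sub>R v) has_derivative (\<lambda>k. k *\<^sub>R u)) (at s)"
          by (auto intro!: derivative_eq_intros)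
        from has_derivative_compose[OF this fd] show ?thesis
          using linear_cmul[OF has_derivative_linear[OF fd]] by (simp add: F_def)
      qed
      note * = this
      have "(g has_derivative (\<lambda>k. k * F (x + s *\<^sub>R u + h *\<^sub>R v) - k * F (x + s *\<^sub>R u + 0 *\<^sub>R v))) (at s)"
        unfolding g_def by (rule has_derivative_diff[OF *[of h] *[of 0]]) (use h in auto)
      then show ?thesis
        unfolding has_field_derivative_def by (rule has_derivative_eq_rhs) (simp add: fun_eq_iff algebra_simps)
    qed
    obtain \<theta> where \<theta>: "0 < \<theta>" "\<theta> < h" "g h - g 0 = (h - 0) * (F (x + \<theta> *\<^sub>R u + h *\<^sub>R v) - F (x + \<theta> *\<^sub>R u + 0 *\<^sub>R v))"
      using MVT2[OF h(1) dg] by auto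
    have dF: "((\<lambda>t. F (x + \<theta> *\<^sub>R u + t *\<^sub>R v)) has_real_derivative G (x + \<theta> *\<^sub>R u + t *\<^sub>R v)) (at t)"
      if t: "0 \<le> t" "t \<le> h" for t
    proof -
      have "x + \<theta> *\<^sub>R u + t *\<^sub>R v \<in> S" using mem(1)[of \<theta> h t] h t \<theta> by auto
      note fd = smooth_on_has_derivative[OF F this]
      have "((\<lambda>t. x + \<theta> *\<^sub>R u + t *\<^sub>R v) has_derivative (\<lambda>k. k *\<^sub>R v)) (at t)"
        by (auto intro!: derivative_eq_intros)
      from has_derivative_compose[OF this fd] show ?thesis
        unfolding has_field_derivative_def
        by (rule has_derivative_eq_rhs)
          (simp add: G_def fun_eq_iff linear_cmul[OF has_derivative_linear[OF fd]])
    qed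
    obtain \<eta> where \<eta>: "0 < \<eta>" "\<eta> < h"
      "F (x + \<theta> *\<^sub>R u + h *\<^sub>R v) - F (x + \<theta> *\<^sub>R u + 0 *\<^sub>R v) = (h - 0) * G (x + \<theta> *\<^sub>R u + \<eta> *\<^sub>R v)"
      using MVT2[OF h(1) dF] by auto
    have "f (x + h *\<^sub>R u + h *\<^sub>R v) - f (x + h *\<^sub>R u) - f (x + h *\<^sub>R v) + f x = g h - g 0"
      by (simp add: g_def)
    also have "\<dots> = h\<^sup>2 * G (x + \<theta> *\<^sub>R u + \<eta> *\<^sub>R v)"
      using \<theta>(3) \<eta>(3) by (simp add: power2_eq_square)
    finally have "(f (x + h *\<^sub>R u + h *\<^sub>R v) - f (x + h *\<^sub>R u) - f (x + h *\<^sub>R v) + f x) / h\<^sup>2 =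
        G (x + \<theta> *\<^sub>R u + \<eta> *\<^sub>R v)" using h by simp
    then show ?thesis using d(2)[OF mem(2)[of \<theta> h \<eta>]] \<theta> \<eta> h by simp
  qed
  then show "\<forall>\<^sub>F h in at_right 0. dist ((f (x + h *\<^sub>R u + h *\<^sub>R v) - f (x + h *\<^sub>R u) - f (x + h *\<^sub>R v) + f x) / h\<^sup>2)
     (frechet_derivative (\<lambda>y. frechet_derivative f (at y) u) (at x) v) < e"
    unfolding eventually_at_right_field using h0 by (auto simp: G_def F_def[abs_def])
qed

text \<open>The second difference is symmetric in \<open>u\<close> and \<open>v\<close>, and its
  limit is unique.\<close>

lemma second_derivative_symmetric_real:
  fixes f :: "'a::euclidean_space \<Rightarrow> real"
  assumes S: "open S" "x \<in> S" and f: "smooth_on S f"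
  shows "frechet_derivative (\<lambda>y. frechet_derivative f (at y) u) (at x) v =
    frechet_derivative (\<lambda>y. frechet_derivative f (at y) v) (at x) u"
proof -
  let ?q = "\<lambda>u v h. (f (x + h *\<^sub>R u + h *\<^sub>R v) - f (x + h *\<^sub>R u) - f (x + h *\<^sub>R v) + f x) / h\<^sup>2"
  have "?q v u = ?q u v" by (simp add: algebra_simps fun_eq_iff)
  then have "(?q u v \<longlongrightarrow> frechet_derivative (\<lambda>y. frechet_derivative f (at y) v) (at x) u) (at_right 0)"
    using second_difference_quotient[OF assms, of v u] by simp
  with second_difference_quotient[OF assms, of u v] show ?thesis
    by (rule tendsto_unique[OF trivial_limit_at_right_real])
qed

lemma frechet_derivative_inner:
  assumes "f differentiable (at x)"
  shows "frechet_derivative (\<lambda>y. f y \<bullet> b) (at x) v = frechet_derivative f (at x) v \<bullet> b"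
proof -
  have "((\<lambda>y. f y \<bullet> b) has_derivative (\<lambda>v. frechet_derivative f (at x) v \<bullet> b)) (at x)"
    using assms by (intro has_derivative_inner_left) (simp add: frechet_derivative_works[symmetric])
  then show ?thesis by (simp add: frechet_derivative_eqI)
qed

text \<open>The mean value theorem needs real values, so the claim is reduced to the
  components.\<close>

lemma second_derivative_symmetric:
  fixes f :: "'a::euclidean_space \<Rightarrow> 'b::euclidean_space"
  assumes S: "open S" "x \<in> S" and f: "smooth_on S f"
  shows "frechet_derivative (\<lambda>y. frechet_derivative f (at y) u) (at x) v =
    frechet_derivative (\<lambda>y. frechet_derivative f (at y) v) (at x) u"
proof (rule euclidean_eqI)
  fix b :: 'b assume "b \<in> Basis"
  have *: "frechet_derivative (\<lambda>y. frechet_derivative f (at y) u) (at x) v \<bullet> b =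
    frechet_derivative (\<lambda>y. frechet_derivative (\<lambda>z. f z \<bullet> b) (at y) u) (at x) v" for u v
  proof -
    have "frechet_derivative (\<lambda>y. frechet_derivative (\<lambda>z. f z \<bullet> b) (at y) u) (at x) =
        frechet_derivative (\<lambda>y. frechet_derivative f (at y) u \<bullet> b) (at x)"
      by (rule frechet_derivative_cong_open[OF S]) (simp add: frechet_derivative_inner smooth_on_differentiable[OF f])
    then show ?thesis
      by (simp add: frechet_derivative_inner smooth_on_differentiable[OF smooth_on_frechet_derivative[OF f] S(2)])
  qed
  show "frechet_derivative (\<lambda>y. frechet_derivative f (at y) u) (at x) v \<bullet> b =
    frechet_derivative (\<lambda>y. frechet_derivative f (at y) v) (at x) u \<bullet> b"
    unfolding * using S f by (intro second_derivative_symmetric_real smooth_on_linear[OF bounded_linear_inner_left]) auto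
qed

section \<open>Formal algebra of words of flows: group commutators realise Lie brackets\<close>

section \<open>Formal exponential series and commutators\<close>

text \<open>The formal exponential exp(s y), the variable of the power series standing for the time
  s.\<close>

definition exp_series :: "'r::real_algebra_1 \<Rightarrow> 'r fps"
  where "exp_series y = Abs_fps (\<lambda>n. (1 / fact n) *\<^sub>R y ^ n)"

lemma exp_series_nth: "fps_nth (exp_series y) n = (1 / fact n) *\<^sub>R y ^ n"
  by (simp add: exp_series_def)

text \<open>The coefficient of order \<open>n\<close> is a multiple of \<open>y ^ n\<close> by an
  alternating sum of binomial coefficients, which vanishes for positive \<open>n\<close>. This uses
  that \<open>y\<close> commutes with itself only, so no commutativity of the ring enters.\<close>

lemma exp_series_minus: "exp_series y * exp_series (- y) = (1 :: 'r::real_algebra_1 fps)"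
proof (rule fps_ext)
  fix n
  have "fps_nth (exp_series y * exp_series (- y)) n =
      (\<Sum>i=0..n. ((1 / fact n) * ((-1) ^ (n - i) * of_nat (n choose i))) *\<^sub>R y ^ n)"
    unfolding fps_mult_nth
  proof (rule sum.cong[OF refl])
    fix i assume "i \<in> {0..n}"
    then have i: "i \<le> n" by simp
    have "(- y) ^ (n - i) = ((-1) ^ (n - i)) *\<^sub>R y ^ (n - i)"
      by (subst power_minus) (simp add: scaleR_conv_of_real)
    then show "fps_nth (exp_series y) i * fps_nth (exp_series (- y)) (n - i) =
       ((1 / fact n) * ((-1) ^ (n - i) * of_nat (n choose i))) *\<^sub>R y ^ n"
      using i by (simp add: exp_series_nth power_add[symmetric] binomial_fact)
  qed
  also have "\<dots> = ((1 / fact n) * (\<Sum>i=0..n. (-1) ^ (n - i) * of_nat (n choose i))) *\<^sub>R y ^ n"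
    by (simp add: scaleR_sum_left sum_distrib_left)
  also have "(\<Sum>i=0..n. (-1) ^ (n - i) * of_nat (n choose i)) = (\<Sum>i\<le>n. (-1) ^ i * of_nat (n choose i) :: real)"
    by (rule sum.reindex_bij_witness[where i = "\<lambda>i. n - i" and j = "\<lambda>i. n - i"])
      (auto simp: binomial_symmetric[symmetric])
  finally show "fps_nth (exp_series y * exp_series (- y)) n = fps_nth 1 n"
    using choose_alternating_sum[of n, where 'a = real] by (cases "n = 0") auto
qed

text \<open>The letter that is followed first stands leftmost: pull-back along flows reverses
  composition, so the value of \<open>f\<close> at the end of the word is formally the whole product
  applied to \<open>f\<close>, evaluated at the starting point.\<close>

fun word_series :: "'r::real_algebra_1 list \<Rightarrow> 'r fps" where
  "word_series [] = 1"
| "word_series (y # w) = exp_series y * word_series w"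

lemma word_series_append: "word_series (v @ w) = word_series v * word_series w"
  by (induction v) (simp_all add: mult.assoc)

lemma word_series_inverse:
  "word_series w * word_series (rev (map uminus w)) = 1"
  "word_series (rev (map uminus w)) * word_series w = 1"
proof (induction w)
  case (Cons y w)
  {
    case 1
    have "word_series (y # w) * word_series (rev (map uminus (y # w))) =
        exp_series y * (word_series w * word_series (rev (map uminus w))) * exp_series (- y)"
      by (simp add: word_series_append mult.assoc)
    then show ?case using Cons.IH by (simp add: exp_series_minus)
  next
    case 2
    have "word_series (rev (map uminus (y # w))) * word_series (y # w) =
        word_series (rev (map uminus w)) * (exp_series (- y) * exp_series (- (- y))) * word_series w"
      by (simp add: word_series_append mult.assoc)
    then show ?case using Cons.IH by (simp only: exp_series_minus mult_1_right)
  }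
qed simp_all

text \<open>The series \<open>1 + s\<^sup>k z + O(s\<^sup>k\<^sup>+\<^sup>1)\<close>.\<close>

definition leading_term :: "nat \<Rightarrow> 'r::ring_1 \<Rightarrow> 'r fps \<Rightarrow> bool"
  where "leading_term k z P \<longleftrightarrow>
    0 < k \<and> fps_nth P 0 = 1 \<and> (\<forall>j. 0 < j \<and> j < k \<longrightarrow> fps_nth P j = 0) \<and> fps_nth P k = z"

lemma fps_mult_low_order:
  fixes f g :: "'r::ring_1 fps"
  assumes "\<And>j. j < a \<Longrightarrow> fps_nth f j = 0" "\<And>j. j < b \<Longrightarrow> fps_nth g j = 0"
  shows "n < a + b \<Longrightarrow> fps_nth (f * g) n = 0"
    and "fps_nth (f * g) (a + b) = fps_nth f a * fps_nth g b"
proof -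
  show "fps_nth (f * g) n = 0" if "n < a + b"
    unfolding fps_mult_nth
  proof (intro sum.neutral ballI)
    fix i assume "i \<in> {0..n}"
    then have "i < a \<or> n - i < b" using that by auto
    then show "fps_nth f i * fps_nth g (n - i) = 0" using assms by auto
  qed
  have "fps_nth (f * g) (a + b) = (\<Sum>i=0..a+b. if i = a then fps_nth f a * fps_nth g b else 0)"
    unfolding fps_mult_nth
  proof (rule sum.cong[OF refl])
    fix i assume "i \<in> {0..a+b}"
    then have "i < a \<or> i = a \<or> a + b - i < b" by auto
    then show "fps_nth f i * fps_nth g (a + b - i) = (if i = a then fps_nth f a * fps_nth g b else 0)"
      using assms by auto
  qed
  then show "fps_nth (f * g) (a + b) = fps_nth f a * fps_nth g b" by simp
qed

lemma leading_term_exp_series: "leading_term 1 y (exp_series y)"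
  by (auto simp: leading_term_def exp_series_nth)

lemma fps_nth_0_right_inverse:
  fixes P P' :: "'r::ring_1 fps"
  assumes "P * P' = 1" "fps_nth P 0 = 1"
  shows "fps_nth P' 0 = 1"
  using arg_cong[OF assms(1), of "\<lambda>f. fps_nth f 0"] assms(2) by (simp add: fps_mult_nth)

text \<open>From \<open>P' = 1 - (P - 1) * P'\<close>: the correction starts at order
  \<open>k\<close>, and there \<open>P'\<close> enters only through its constant coefficient
  1.\<close>

lemma leading_term_inverse:
  assumes P: "leading_term k z P" and inv: "P * P' = 1"
  shows "leading_term k (- z) P'"
proof -
  have k: "0 < k" and P0: "fps_nth P 0 = 1" using P by (auto simp: leading_term_def)
  note P'0 = fps_nth_0_right_inverse[OF inv P0]
  have low: "j < k \<Longrightarrow> fps_nth (P - 1) j = 0" for j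
    using P by (cases "j = 0") (auto simp: leading_term_def)
  have eq: "P' = 1 - (P - 1) * P'" using inv by (simp add: left_diff_distrib)
  define c where "c = (P - 1) * P'"
  have "fps_nth c j = 0" if "j < k" for j
    unfolding c_def by (rule fps_mult_low_order(1)[of k _ 0]) (use low that in auto)
  moreover have "fps_nth c (k + 0) = fps_nth (P - 1) k * fps_nth P' 0"
    unfolding c_def by (rule fps_mult_low_order(2)[of k _ 0]) (use low in auto)
  moreover have "P' = 1 - c" using eq by (simp add: c_def)
  ultimately show ?thesis
    using k P P'0 by (simp add: leading_term_def)
qed

text \<open>Since \<open>Q * P * P' * Q' = 1\<close>, the group commutator is
  \<open>1 + (P * Q - Q * P) * (P' * Q')\<close>. Subtracting 1 from both factors does not change
  \<open>P * Q - Q * P\<close>, so its order is at least \<open>k + l\<close> and its leading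
  coefficient is the commutator of the leading ones.\<close>

lemma leading_term_commutator:
  assumes P: "leading_term k z P" "P * P' = 1" and Q: "leading_term l w Q" "Q * Q' = 1"
  shows "leading_term (k + l) (z * w - w * z) (P * Q * P' * Q')"
proof -
  have k: "0 < k" "0 < l" "fps_nth P 0 = 1" "fps_nth Q 0 = 1"
    "fps_nth P k = z" "fps_nth Q l = w"
    using P Q by (auto simp: leading_term_def)
  note P'0 = fps_nth_0_right_inverse[OF P(2) k(3)] fps_nth_0_right_inverse[OF Q(2) k(4)]
  define p where "p = P - 1"
  define q where "q = Q - 1"
  have low: "j < k \<Longrightarrow> fps_nth p j = 0" "j < l \<Longrightarrow> fps_nth q j = 0" for j
    using P Q by (cases "j = 0"; auto simp: leading_term_def p_def q_def)+
  have R: "fps_nth (p * q - q * p) j = 0" if "j < k + l" for j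
    using fps_mult_low_order(1)[of k p l q j] fps_mult_low_order(1)[of l q k p j] low that by simp
  have "fps_nth (p * q) (k + l) = z * w" "fps_nth (q * p) (l + k) = w * z"
    using fps_mult_low_order(2)[of k p l q] fps_mult_low_order(2)[of l q k p] low k
    by (auto simp: p_def q_def)
  then have Rkl: "fps_nth (p * q - q * p) (k + l) = z * w - w * z" by (simp add: add.commute)
  have "Q * P * P' * Q' = Q * (P * P') * Q'" by (simp only: mult.assoc)
  then have "Q * P * P' * Q' = 1" using P(2) Q(2) by simp
  then have "P * Q * P' * Q' = 1 + (P * Q - Q * P) * (P' * Q')"
    by (simp add: left_diff_distrib mult.assoc)
  also have "P * Q - Q * P = p * q - q * p"
    by (simp add: p_def q_def algebra_simps)
  finally have eq: "P * Q * P' * Q' = 1 + (p * q - q * p) * (P' * Q')" .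
  define c where "c = (p * q - q * p) * (P' * Q')"
  have "fps_nth c j = 0" if "j < k + l" for j
    unfolding c_def by (rule fps_mult_low_order(1)[of "k + l" _ 0]) (use R that in auto)
  moreover have "fps_nth c (k + l + 0) = z * w - w * z"
    unfolding c_def by (subst fps_mult_low_order(2)[of "k + l" _ 0]) (use R Rkl P'0 in auto)
  ultimately show ?thesis using k(1,2) by (simp add: leading_term_def eq c_def[symmetric])
qed

section \<open>Linear operators on vector-valued functions\<close>

text \<open>The law \<open>a * (b + c) = a * b + a * c\<close> holds for composition only if
  \<open>a\<close> is linear, so a ring of coefficients needs a type of linear operators. They act
  on functions with values in \<open>'e\<close> so that a coordinate map can be inserted.\<close>

typedef (overloaded) ('e::euclidean_space) fop = "{T :: ('e \<Rightarrow> 'e) \<Rightarrow> ('e \<Rightarrow> 'e). linear T}"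
  morphisms fop_apply Fop
  by (rule exI[of _ "\<lambda>x. x"]) (simp add: linear_id[unfolded id_def])

setup_lifting type_definition_fop

instantiation fop :: (euclidean_space) real_algebra_1
begin

lift_definition zero_fop :: "'a fop" is "\<lambda>_. 0" by (rule linear_zero)
lift_definition one_fop :: "'a fop" is "\<lambda>f. f" by (rule linear_id[unfolded id_def])
lift_definition plus_fop :: "'a fop \<Rightarrow> 'a fop \<Rightarrow> 'a fop" is "\<lambda>S T f. S f + T f"
  by (rule linear_compose_add)
lift_definition minus_fop :: "'a fop \<Rightarrow> 'a fop \<Rightarrow> 'a fop" is "\<lambda>S T f. S f - T f"
  by (rule linear_compose_sub)
lift_definition uminus_fop :: "'a fop \<Rightarrow> 'a fop" is "\<lambda>S f. - S f"
  by (rule linear_compose_neg)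
lift_definition times_fop :: "'a fop \<Rightarrow> 'a fop \<Rightarrow> 'a fop" is "\<lambda>S T f. S (T f)"
  by (auto intro!: linearI simp: linear_add linear_scale)
lift_definition scaleR_fop :: "real \<Rightarrow> 'a fop \<Rightarrow> 'a fop" is "\<lambda>c S f. c *\<^sub>R S f"
  by (rule linear_compose_scale_right)

instance
proof
  fix a b c :: "'a fop" and r s :: real
  show "a * b * c = a * (b * c)" by transfer simp
  show "(a + b) * c = a * c + b * c" by transfer simp
  show "a * (b + c) = a * b + a * c" by transfer (simp add: linear_add fun_eq_iff)
  show "1 * a = a" by transfer simp
  show "a * 1 = a" by transfer simp
  show "a + b + c = a + (b + c)" by transfer (simp add: add.assoc)
  show "a + b = b + a" by transfer (simp add: add.commute)
  show "0 + a = a" by transfer simp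
  show "- a + a = 0" by transfer (simp add: fun_eq_iff)
  show "a - b = a + - b" by transfer (simp add: fun_eq_iff)
  show "(0 :: 'a fop) \<noteq> 1"
  proof transfer
    obtain b :: 'a where "b \<in> Basis" using nonempty_Basis by blast
    then have "(\<lambda>x::'a. b) \<noteq> 0" by (auto simp: fun_eq_iff)
    then show "(\<lambda>_. 0) \<noteq> (\<lambda>f :: 'a \<Rightarrow> 'a. f)"
      using fun_cong[of "\<lambda>_. 0" "\<lambda>f :: 'a \<Rightarrow> 'a. f" "\<lambda>x. b"] by auto
  qed
  show "r *\<^sub>R (a + b) = r *\<^sub>R a + r *\<^sub>R b" by transfer (simp add: scaleR_add_right)
  show "(r + s) *\<^sub>R a = r *\<^sub>R a + s *\<^sub>R a" by transfer (simp add: scaleR_add_left)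
  show "r *\<^sub>R s *\<^sub>R a = (r * s) *\<^sub>R a" by transfer simp
  show "1 *\<^sub>R a = a" by transfer simp
  show "r *\<^sub>R a * b = r *\<^sub>R (a * b)" by transfer simp
  show "a * r *\<^sub>R b = r *\<^sub>R (a * b)" by transfer (simp add: linear_scale fun_eq_iff)
qed

end

section \<open>Derivations on smooth functions\<close>

definition field_bracket :: "('e \<Rightarrow> 'e) \<Rightarrow> ('e \<Rightarrow> 'e) \<Rightarrow> 'e::euclidean_space \<Rightarrow> 'e"
  where "field_bracket X Y = (\<lambda>x. frechet_derivative Y (at x) (X x) - frechet_derivative X (at x) (Y x))"

lemma smooth_on_field_bracket:
  "open S \<Longrightarrow> smooth_on S X \<Longrightarrow> smooth_on S Y \<Longrightarrow> smooth_on S (field_bracket X Y)"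
  unfolding field_bracket_def by (intro smooth_on_diff smooth_on_directional_derivative)

text \<open>The product rule, after \<open>Y\<close> is expanded in the basis. Symmetry of the
  second derivative lets the term in which \<open>f\<close> is differentiated twice be collected as
  a derivative in direction \<open>Y x\<close>.\<close>

lemma frechet_derivative_directional:
  fixes f :: "'e::euclidean_space \<Rightarrow> 'e"
  assumes S: "open S" "x \<in> S" and f: "smooth_on S f" and Y: "smooth_on S Y"
  shows "frechet_derivative (\<lambda>y. frechet_derivative f (at y) (Y y)) (at x) v =
    frechet_derivative (\<lambda>y. frechet_derivative f (at y) v) (at x) (Y x) +
    frechet_derivative f (at x) (frechet_derivative Y (at x) v)"
proof -
  have lin: "linear (frechet_derivative f (at y))" if "y \<in> S" for y
    using smooth_on_differentiable[OF f that] linear_frechet_derivative by blast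
  have lin2: "linear (frechet_derivative (\<lambda>y. frechet_derivative f (at y) v) (at x))"
    using smooth_on_differentiable[OF smooth_on_frechet_derivative[OF f] S(2)] linear_frechet_derivative by blast
  have rep: "(\<Sum>b\<in>Basis. (z \<bullet> b) *\<^sub>R L b) = L z" if "linear L" for L :: "'e \<Rightarrow> 'e" and z
    by (subst (2) euclidean_representation[of z, symmetric]) (simp add: linear_sum[OF that] linear_cmul[OF that])
  have "frechet_derivative (\<lambda>y. frechet_derivative f (at y) (Y y)) (at x) =
      frechet_derivative (\<lambda>y. \<Sum>b\<in>Basis. (Y y \<bullet> b) *\<^sub>R frechet_derivative f (at y) b) (at x)"
    by (rule frechet_derivative_cong_open[OF S]) (simp add: rep[OF lin])
  also have "\<dots> = (\<lambda>v. \<Sum>b\<in>Basis. (Y x \<bullet> b) *\<^sub>R frechet_derivative (\<lambda>y. frechet_derivative f (at y) b) (at x) v +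
      (frechet_derivative Y (at x) v \<bullet> b) *\<^sub>R frechet_derivative f (at x) b)"
    by (intro frechet_derivative_eqI has_derivative_sum has_derivative_scaleR has_derivative_inner_left
        smooth_on_has_derivative[OF Y S(2)] smooth_on_has_derivative[OF smooth_on_frechet_derivative[OF f] S(2)])
  finally have "frechet_derivative (\<lambda>y. frechet_derivative f (at y) (Y y)) (at x) v =
      (\<Sum>b\<in>Basis. (Y x \<bullet> b) *\<^sub>R frechet_derivative (\<lambda>y. frechet_derivative f (at y) b) (at x) v) +
      (\<Sum>b\<in>Basis. (frechet_derivative Y (at x) v \<bullet> b) *\<^sub>R frechet_derivative f (at x) b)"
    by (simp add: sum.distrib)
  also have "(\<Sum>b\<in>Basis. (Y x \<bullet> b) *\<^sub>R frechet_derivative (\<lambda>y. frechet_derivative f (at y) b) (at x) v) =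
      (\<Sum>b\<in>Basis. (Y x \<bullet> b) *\<^sub>R frechet_derivative (\<lambda>y. frechet_derivative f (at y) v) (at x) b)"
    by (rule sum.cong[OF refl]) (simp add: second_derivative_symmetric[OF S f, of _ v])
  finally show ?thesis by (simp add: rep[OF lin2] rep[OF lin[OF S(2)]])
qed

text \<open>Functions are normalised to vanish off the open set, so that they form a linear space on which
  derivations act linearly (\<open>frechet_derivative\<close> is arbitrary at points of non-differentiability).\<close>

definition smooth_fns :: "'e::euclidean_space set \<Rightarrow> ('e \<Rightarrow> 'e) set"
  where "smooth_fns S = {f. smooth_on S f \<and> (\<forall>x. x \<notin> S \<longrightarrow> f x = 0)}"

definition lie_derivative :: "'e::euclidean_space set \<Rightarrow> ('e \<Rightarrow> 'e) \<Rightarrow> ('e \<Rightarrow> 'e) \<Rightarrow> 'e \<Rightarrow> 'e"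
  where "lie_derivative S Y f = (\<lambda>x. if x \<in> S then frechet_derivative f (at x) (Y x) else 0)"

text \<open>An element of \<open>fop\<close> acts on all functions, whereas differentiation is
  linear only on smooth ones. A linear projection onto \<open>smooth_fns S\<close> extends the
  operator; on that subspace it is the identity.\<close>

definition smooth_proj :: "'e::euclidean_space set \<Rightarrow> ('e \<Rightarrow> 'e) \<Rightarrow> ('e \<Rightarrow> 'e)"
  where "smooth_proj S = (SOME \<pi>. linear \<pi> \<and> range \<pi> \<subseteq> smooth_fns S \<and> (\<forall>f\<in>smooth_fns S. \<pi> f = f))"

definition derivation :: "'e::euclidean_space set \<Rightarrow> ('e \<Rightarrow> 'e) \<Rightarrow> 'e fop"
  where "derivation S Y = Fop (\<lambda>f. lie_derivative S Y (smooth_proj S f))"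

context
  fixes S :: "'e::euclidean_space set"
  assumes S: "open S"
begin

lemma subspace_smooth_fns: "subspace (smooth_fns S)"
  unfolding subspace_def smooth_fns_def
  using smooth_on_add[OF S] smooth_on_scaleR[OF S smooth_on_const]
  by (auto simp: plus_fun_def scaleR_fun_def zero_fun_def)

lemma smooth_proj:
  "linear (smooth_proj S)" "smooth_proj S f \<in> smooth_fns S" "f \<in> smooth_fns S \<Longrightarrow> smooth_proj S f = f"
proof -
  have "\<exists>\<pi>. linear \<pi> \<and> range \<pi> \<subseteq> smooth_fns S \<and> (\<forall>f\<in>smooth_fns S. \<pi> f = f)"
    using real_vector.linear_exists_left_inverse_on[OF real_vector.linear_id subspace_smooth_fns]
    by (auto simp: inj_on_def linear_def)
  from someI_ex[OF this]
  show "linear (smooth_proj S)" "smooth_proj S f \<in> smooth_fns S" "f \<in> smooth_fns S \<Longrightarrow> smooth_proj S f = f"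
    unfolding smooth_proj_def[symmetric] by auto
qed

lemma smooth_fnsD:
  assumes "f \<in> smooth_fns S" "x \<in> S"
  shows "(f has_derivative frechet_derivative f (at x)) (at x)" "linear (frechet_derivative f (at x))"
  using assms smooth_on_has_derivative[of S f x] has_derivative_linear by (auto simp: smooth_fns_def)

lemma lie_derivative_smooth_fns:
  assumes "f \<in> smooth_fns S" "smooth_on S Y"
  shows "lie_derivative S Y f \<in> smooth_fns S"
  using smooth_on_cong[OF S _ smooth_on_directional_derivative[OF S _ assms(2), of f]] assms(1)
  by (auto simp: smooth_fns_def lie_derivative_def)

lemma fop_apply_derivation: "fop_apply (derivation S Y) f = lie_derivative S Y (smooth_proj S f)"
proof -
  have "linear (\<lambda>f. lie_derivative S Y (smooth_proj S f))"
  proof (rule linearI)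
    fix f g :: "'e \<Rightarrow> 'e" and c :: real
    let ?\<pi> = "smooth_proj S"
    have sm: "(?\<pi> f has_derivative frechet_derivative (?\<pi> f) (at x)) (at x)" if "x \<in> S" for x f
      by (rule smooth_fnsD(1)[OF smooth_proj(2) that])
    have "frechet_derivative (?\<pi> (f + g)) (at x) =
        (\<lambda>v. frechet_derivative (?\<pi> f) (at x) v + frechet_derivative (?\<pi> g) (at x) v)" if "x \<in> S" for x
      unfolding linear_add[OF smooth_proj(1)] unfolding plus_fun_def
      by (intro frechet_derivative_eqI has_derivative_add sm that)
    then show "lie_derivative S Y (?\<pi> (f + g)) = lie_derivative S Y (?\<pi> f) + lie_derivative S Y (?\<pi> g)"
      by (simp add: lie_derivative_def fun_eq_iff)
    have "frechet_derivative (?\<pi> (c *\<^sub>R f)) (at x) = (\<lambda>v. c *\<^sub>R frechet_derivative (?\<pi> f) (at x) v)" if "x \<in> S" for x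
      unfolding linear_cmul[OF smooth_proj(1)] unfolding scaleR_fun_def
      by (intro frechet_derivative_eqI has_derivative_scaleR_right sm that)
    then show "lie_derivative S Y (?\<pi> (c *\<^sub>R f)) = c *\<^sub>R lie_derivative S Y (?\<pi> f)"
      by (simp add: lie_derivative_def scaleR_fun_def fun_eq_iff)
  qed
  then show ?thesis by (simp add: derivation_def Fop_inverse)
qed

lemma derivation_minus: "derivation S (- Y) = - derivation S Y"
proof -
  have "fop_apply (derivation S (- Y)) f = fop_apply (- derivation S Y) f" for f
  proof -
    have "lie_derivative S (- Y) (smooth_proj S f) = - lie_derivative S Y (smooth_proj S f)"
      using linear_neg[OF smooth_fnsD(2)[OF smooth_proj(2)]] by (auto simp: lie_derivative_def fun_eq_iff)
    then show ?thesis by (simp add: fop_apply_derivation uminus_fop.rep_eq)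
  qed
  then show ?thesis by (simp add: fop_apply_inject[symmetric] fun_eq_iff)
qed

text \<open>In the commutator of the two derivations the terms with second derivatives of the
  function cancel by symmetry; what remains is the derivative in the direction of the
  bracket.\<close>

lemma derivation_field_bracket:
  assumes X: "smooth_on S X" and Y: "smooth_on S Y"
  shows "derivation S (field_bracket X Y) = derivation S X * derivation S Y - derivation S Y * derivation S X"
proof -
  have "fop_apply (derivation S (field_bracket X Y)) f =
    fop_apply (derivation S X * derivation S Y - derivation S Y * derivation S X) f" for f
  proof -
    define h where "h = smooth_proj S f"
    have h: "h \<in> smooth_fns S" unfolding h_def by (rule smooth_proj(2))
    then have hs: "smooth_on S h" by (simp add: smooth_fns_def)
    have sp: "smooth_proj S (lie_derivative S Z h) = lie_derivative S Z h" if "smooth_on S Z" for Z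
      by (intro smooth_proj(3) lie_derivative_smooth_fns h that)
    have 1: "lie_derivative S Z (lie_derivative S W h) x =
        frechet_derivative (\<lambda>y. frechet_derivative h (at y) (Z x)) (at x) (W x) +
        frechet_derivative h (at x) (frechet_derivative W (at x) (Z x))"
      if "x \<in> S" and W: "smooth_on S W" for Z W x
    proof -
      have "frechet_derivative (lie_derivative S W h) (at x) =
          frechet_derivative (\<lambda>y. frechet_derivative h (at y) (W y)) (at x)"
        by (rule frechet_derivative_cong_open[OF S that(1)]) (simp add: lie_derivative_def)
      then show ?thesis
        using frechet_derivative_directional[OF S that(1) hs W] that(1) by (simp add: lie_derivative_def)
    qed
    have "lie_derivative S (field_bracket X Y) h =
        lie_derivative S X (lie_derivative S Y h) - lie_derivative S Y (lie_derivative S X h)"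
    proof
      fix x
      show "lie_derivative S (field_bracket X Y) h x =
        (lie_derivative S X (lie_derivative S Y h) - lie_derivative S Y (lie_derivative S X h)) x"
      proof (cases "x \<in> S")
        case True
        have "frechet_derivative (\<lambda>y. frechet_derivative h (at y) (X x)) (at x) (Y x) =
            frechet_derivative (\<lambda>y. frechet_derivative h (at y) (Y x)) (at x) (X x)"
          by (rule second_derivative_symmetric[OF S True hs])
        moreover have "lie_derivative S (field_bracket X Y) h x =
            frechet_derivative h (at x) (frechet_derivative Y (at x) (X x)) -
            frechet_derivative h (at x) (frechet_derivative X (at x) (Y x))"
          using True by (simp add: lie_derivative_def field_bracket_def linear_diff[OF smooth_fnsD(2)[OF h True]])
        ultimately show ?thesis
          using 1[OF True X] 1[OF True Y] by simp
      qed (simp add: lie_derivative_def)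
    qed
    then show ?thesis
      by (simp add: fop_apply_derivation minus_fop.rep_eq times_fop.rep_eq h_def[symmetric] sp X Y)
  qed
  then show ?thesis by (simp add: fop_apply_inject[symmetric] fun_eq_iff)
qed

end

lemma fop_apply_sum: "fop_apply (\<Sum>i\<in>I. T i) f = (\<Sum>i\<in>I. fop_apply (T i) f)"
  by (induction I rule: infinite_finite_induct) (simp_all add: zero_fop.rep_eq plus_fop.rep_eq)

inductive_set field_brackets :: "('e::euclidean_space \<Rightarrow> 'e) set \<Rightarrow> ('e \<Rightarrow> 'e) set" for F where
  base: "X \<in> F \<Longrightarrow> X \<in> field_brackets F"
| bracket: "X \<in> field_brackets F \<Longrightarrow> Y \<in> field_brackets F \<Longrightarrow> field_bracket X Y \<in> field_brackets F"

lemma field_brackets_smooth: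
  assumes "open S" "\<And>X. X \<in> F \<Longrightarrow> smooth_on S X" "Z \<in> field_brackets F"
  shows "smooth_on S Z"
  using assms(3) by induction (auto intro: assms(2) smooth_on_field_bracket[OF assms(1)])

text \<open>A bracket is realised by the word \<open>u v u' v'\<close>, where \<open>u'\<close> and
  \<open>v'\<close> are the inverse words: reversed lists of negated fields. The order
  \<open>k\<close> counts the generators in the bracket with multiplicity.\<close>

lemma field_brackets_word:
  assumes S: "open S" and F: "\<And>X. X \<in> F \<Longrightarrow> smooth_on S X" "\<And>X. X \<in> F \<Longrightarrow> - X \<in> F"
    and Z: "Z \<in> field_brackets F"
  shows "\<exists>k w. set w \<subseteq> F \<and> leading_term k (derivation S Z) (word_series (map (derivation S) w))"
  using Z
proof induction
  case (base X)
  then show ?case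
    using leading_term_exp_series[of "derivation S X"] by (intro exI[of _ 1] exI[of _ "[X]"]) simp
next
  case (bracket X Y)
  then obtain k u l v where u: "set u \<subseteq> F" "leading_term k (derivation S X) (word_series (map (derivation S) u))"
    and v: "set v \<subseteq> F" "leading_term l (derivation S Y) (word_series (map (derivation S) v))" by blast
  have inv: "map (derivation S) (rev (map uminus w)) = rev (map uminus (map (derivation S) w))" for w
    by (simp add: rev_map derivation_minus[OF S])
  have smooth: "smooth_on S X" "smooth_on S Y"
    by (rule field_brackets_smooth[OF S F(1)], assumption, fact)+
  have "leading_term (k + l) (derivation S (field_bracket X Y))
     (word_series (map (derivation S) (u @ v @ rev (map uminus u) @ rev (map uminus v))))"
    unfolding derivation_field_bracket[OF S smooth]
    using leading_term_commutator[OF u(2) word_series_inverse(1) v(2) word_series_inverse(1)]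
    by (simp add: word_series_append inv flip: mult.assoc)
  moreover have "set (u @ v @ rev (map uminus u) @ rev (map uminus v)) \<subseteq> F"
    using u(1) v(1) F(2) by auto
  ultimately show ?case by blast
qed

section \<open>Flows of smooth fields and their Taylor expansion along words\<close>

section \<open>Integral curves\<close>

text \<open>Picard iteration as a contraction on curves in the closed ball:
  \<open>M * T \<le> R\<close> keeps the iterates in the ball and \<open>L * T \<le> 1/2\<close>
  gives the factor 1/2.\<close>

lemma integral_curve_exists:
  fixes Y :: "'e::euclidean_space \<Rightarrow> 'e"
  assumes lip: "L-lipschitz_on (cball x R) Y" and M: "\<And>z. z \<in> cball x R \<Longrightarrow> norm (Y z) \<le> M"
    and R: "0 \<le> R" and T: "0 \<le> T" "M * T \<le> R" "L * T \<le> 1/2"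
  shows "\<exists>\<gamma>. \<gamma> 0 = x \<and> (\<forall>t\<in>{0..T}. \<gamma> t \<in> cball x R \<and> (\<gamma> has_vector_derivative Y (\<gamma> t)) (at t within {0..T}))"
proof -
  \<comment> \<open>Clamping the time to \<open>{0..T}\<close> makes each iterate a bounded
    continuous function on the whole line, as \<open>bcontfun\<close> requires.\<close>
  define cl where "cl t = max 0 (min T t)" for t :: real
  have cl: "cl t \<in> {0..T}" "t \<in> {0..T} \<Longrightarrow> cl t = t" for t using T by (auto simp: cl_def)
  have L: "0 \<le> L" using lip by (rule lipschitz_on_nonneg)
  have contY: "continuous_on (cball x R) Y" using lip by (rule lipschitz_on_continuous_on)
  define C where "C = PiC UNIV (\<lambda>_::real. cball x R)"
  have C: "\<phi> \<in> C \<longleftrightarrow> (\<forall>t. apply_bcontfun \<phi> t \<in> cball x R)" for \<phi> by (auto simp: C_def mem_PiC_iff)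
  define K where "K \<phi> t = x + integral {0..cl t} (\<lambda>\<tau>. Y (apply_bcontfun \<phi> \<tau>))" for \<phi> t
  have cont: "continuous_on A (\<lambda>\<tau>. Y (apply_bcontfun \<phi> \<tau>))" if "\<phi> \<in> C" for \<phi> A
    by (rule continuous_on_compose2[OF contY continuous_on_apply_bcontfun]) (use that C in auto)
  have int: "(\<lambda>\<tau>. Y (apply_bcontfun \<phi> \<tau>)) integrable_on {a..b}" if "\<phi> \<in> C" for \<phi> a b
    using cont[OF that] by (rule integrable_continuous_real)
  have Kball: "K \<phi> t \<in> cball x R" if "\<phi> \<in> C" for \<phi> t
  proof -
    have "norm (integral {0..cl t} (\<lambda>\<tau>. Y (apply_bcontfun \<phi> \<tau>))) \<le> M * (cl t - 0)"
      by (rule integral_bound) (use cl(1)[of t] cont[OF that] C that M in auto)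
    also have "\<dots> \<le> M * T"
      using cl(1)[of t] R order_trans[OF norm_ge_zero M[of x]] by (intro mult_left_mono) auto
    finally show ?thesis using T(2) by (simp add: K_def dist_norm)
  qed
  have Kcont: "continuous_on UNIV (K \<phi>)" if "\<phi> \<in> C" for \<phi>
  proof -
    have "continuous_on {0..T} (\<lambda>u. integral {0..u} (\<lambda>\<tau>. Y (apply_bcontfun \<phi> \<tau>)))"
      by (rule indefinite_integral_continuous_1[OF int[OF that]])
    moreover have "continuous_on UNIV cl" unfolding cl_def by (intro continuous_intros)
    ultimately have "continuous_on UNIV (\<lambda>t. integral {0..cl t} (\<lambda>\<tau>. Y (apply_bcontfun \<phi> \<tau>)))"
      by (rule continuous_on_compose2) (use cl(1) in auto)
    then show ?thesis unfolding K_def[abs_def] by (intro continuous_on_add continuous_on_const)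
  qed
  have Kb: "K \<phi> \<in> bcontfun" if "\<phi> \<in> C" for \<phi>
    using Kcont[OF that] bounded_subset[OF bounded_cball[of x R] image_subsetI, OF Kball[OF that]]
    by (simp add: bcontfun_def)
  have ap: "apply_bcontfun (Bcontfun (K \<phi>)) = K \<phi>" if "\<phi> \<in> C" for \<phi>
    by (rule Bcontfun_inverse[OF Kb[OF that]])
  have "\<exists>!\<phi>\<in>C. Bcontfun (K \<phi>) = \<phi>"
  proof (rule Banach_fix[where S = C and f = "\<lambda>\<phi>. Bcontfun (K \<phi>)" and c = "1/2"])
    show "complete C" unfolding C_def by (intro complete_eq_closed[THEN iffD2] closed_PiC) auto
    have "const_bcontfun x \<in> C" unfolding C using R by (simp add: const_bcontfun.rep_eq)
    then show "C \<noteq> {}" by blast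
    show "(\<lambda>\<phi>. Bcontfun (K \<phi>)) ` C \<subseteq> C"
      using Kball ap by (auto simp: C)
  next
    fix \<phi> \<psi> assume *: "\<phi> \<in> C" "\<psi> \<in> C"
    show "dist (Bcontfun (K \<phi>)) (Bcontfun (K \<psi>)) \<le> 1/2 * dist \<phi> \<psi>"
    proof (rule dist_bound)
      fix t
      have "dist (K \<phi> t) (K \<psi> t) =
          norm (integral {0..cl t} (\<lambda>\<tau>. Y (apply_bcontfun \<phi> \<tau>) - Y (apply_bcontfun \<psi> \<tau>)))"
        using * by (simp add: K_def dist_norm integral_diff[OF int int])
      also have "\<dots> \<le> (L * dist \<phi> \<psi>) * (cl t - 0)"
      proof (rule integral_bound)
        show "continuous_on {0..cl t} (\<lambda>\<tau>. Y (apply_bcontfun \<phi> \<tau>) - Y (apply_bcontfun \<psi> \<tau>))"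
          using * by (intro continuous_on_diff cont) auto
        fix \<tau> assume "\<tau> \<in> {0..cl t}"
        have "dist (Y (apply_bcontfun \<phi> \<tau>)) (Y (apply_bcontfun \<psi> \<tau>)) \<le> L * dist (apply_bcontfun \<phi> \<tau>) (apply_bcontfun \<psi> \<tau>)"
          using * by (intro lipschitz_onD[OF lip]) (auto simp: C)
        also have "\<dots> \<le> L * dist \<phi> \<psi>"
          by (intro mult_left_mono dist_bounded L)
        finally show "norm (Y (apply_bcontfun \<phi> \<tau>) - Y (apply_bcontfun \<psi> \<tau>)) \<le> L * dist \<phi> \<psi>"
          by (simp add: dist_norm)
      qed (use cl(1)[of t] in auto)
      also have "\<dots> \<le> (L * dist \<phi> \<psi>) * T"
        using cl(1)[of t] L by (intro mult_left_mono) auto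
      also have "\<dots> = (L * T) * dist \<phi> \<psi>" by simp
      also have "\<dots> \<le> 1/2 * dist \<phi> \<psi>"
        by (rule mult_right_mono[OF T(3)]) simp
      finally show "dist (apply_bcontfun (Bcontfun (K \<phi>)) t) (apply_bcontfun (Bcontfun (K \<psi>)) t) \<le> 1/2 * dist \<phi> \<psi>"
        using * by (simp add: ap)
    qed
  qed auto
  then obtain \<phi> where \<phi>: "\<phi> \<in> C" "Bcontfun (K \<phi>) = \<phi>" by (elim ex1E conjE)
  have eq: "apply_bcontfun \<phi> t = K \<phi> t" for t using ap[OF \<phi>(1)] \<phi>(2) by simp
  have "(apply_bcontfun \<phi> has_vector_derivative Y (apply_bcontfun \<phi> t)) (at t within {0..T})" if t: "t \<in> {0..T}" for t
  proof (rule has_vector_derivative_transform[OF t])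
    show "((\<lambda>t. x + integral {0..t} (\<lambda>\<tau>. Y (apply_bcontfun \<phi> \<tau>))) has_vector_derivative Y (apply_bcontfun \<phi> t)) (at t within {0..T})"
      using has_vector_derivative_add[OF has_vector_derivative_const
          integral_has_vector_derivative[OF cont[OF \<phi>(1)] t]] by simp
    show "apply_bcontfun \<phi> s = x + integral {0..s} (\<lambda>\<tau>. Y (apply_bcontfun \<phi> \<tau>))" if "s \<in> {0..T}" for s
      using eq[of s] cl(2)[OF that] by (simp add: K_def)
  qed
  moreover have "apply_bcontfun \<phi> 0 = x" using eq[of 0] cl(2)[of 0] T by (simp add: K_def)
  ultimately show ?thesis using \<phi>(1) by (intro exI[of _ "apply_bcontfun \<phi>"]) (auto simp: C)
qed

text \<open>On the compact ball the derivatives in the basis directions are bounded; the sum of the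
  bounds controls the operator norm, and the ball is convex, so the mean value inequality
  applies.\<close>

lemma C1_lipschitz_cball:
  fixes Y :: "'e::euclidean_space \<Rightarrow> 'b::real_normed_vector"
  assumes "Ck_on 1 S Y" "cball x R \<subseteq> S"
  shows "\<exists>L. L-lipschitz_on (cball x R) Y"
proof -
  have diff: "Y differentiable (at z)" if "z \<in> S" for z using assms(1) that by simp
  have "\<exists>B. \<forall>z\<in>cball x R. norm (frechet_derivative Y (at z) b) \<le> B" for b
  proof -
    have "continuous_on S (\<lambda>z. frechet_derivative Y (at z) b)" using assms(1) by simp
    then have "continuous_on (cball x R) (\<lambda>z. frechet_derivative Y (at z) b)"
      using assms(2) by (rule continuous_on_subset)
    then have "bounded ((\<lambda>z. frechet_derivative Y (at z) b) ` cball x R)"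
      by (intro compact_imp_bounded compact_continuous_image) auto
    then show ?thesis by (auto simp: bounded_iff)
  qed
  then obtain B where B: "\<And>b z. z \<in> cball x R \<Longrightarrow> norm (frechet_derivative Y (at z) b) \<le> B b" by metis
  have on: "onorm (frechet_derivative Y (at z)) \<le> (\<Sum>b\<in>Basis. \<bar>B b\<bar>)" if z: "z \<in> cball x R" for z
  proof (rule onorm_bound)
    fix v :: 'e
    have lin: "linear (frechet_derivative Y (at z))"
      using diff assms(2) z linear_frechet_derivative by blast
    have "frechet_derivative Y (at z) v = (\<Sum>b\<in>Basis. (v \<bullet> b) *\<^sub>R frechet_derivative Y (at z) b)"
      by (subst (1) euclidean_representation[of v, symmetric]) (simp add: linear_sum[OF lin] linear_cmul[OF lin])
    also have "norm \<dots> \<le> (\<Sum>b\<in>Basis. \<bar>B b\<bar> * norm v)"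
    proof (rule sum_norm_le)
      fix b :: 'e assume "b \<in> Basis"
      then have "\<bar>v \<bullet> b\<bar> * norm (frechet_derivative Y (at z) b) \<le> norm v * \<bar>B b\<bar>"
        using B[OF z, of b] by (intro mult_mono Basis_le_norm) auto
      then show "norm ((v \<bullet> b) *\<^sub>R frechet_derivative Y (at z) b) \<le> \<bar>B b\<bar> * norm v" by (simp add: mult.commute)
    qed
    finally show "norm (frechet_derivative Y (at z) v) \<le> (\<Sum>b\<in>Basis. \<bar>B b\<bar>) * norm v"
      by (simp add: sum_distrib_right)
  qed (simp add: sum_nonneg)
  have "(\<Sum>b\<in>Basis. \<bar>B b\<bar>)-lipschitz_on (cball x R) Y"
  proof (rule lipschitz_onI)
    fix y z assume yz: "y \<in> cball x R" "z \<in> cball x R"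
    have "norm (Y y - Y z) \<le> (\<Sum>b\<in>Basis. \<bar>B b\<bar>) * norm (y - z)"
    proof (rule differentiable_bound[OF convex_cball _ on yz])
      fix w assume "w \<in> cball x R"
      then have "w \<in> S" using assms(2) by blast
      from diff[OF this] show "(Y has_derivative frechet_derivative Y (at w)) (at w within cball x R)"
        unfolding frechet_derivative_works by (rule has_derivative_at_withinI)
    qed
    then show "dist (Y y) (Y z) \<le> (\<Sum>b\<in>Basis. \<bar>B b\<bar>) * dist y z" by (simp add: dist_norm)
  qed (simp add: sum_nonneg)
  then show ?thesis by blast
qed

lemma smooth_on_lipschitz_cball:
  fixes Y :: "'e::euclidean_space \<Rightarrow> 'b::real_normed_vector"
  assumes "smooth_on S Y" "cball x R \<subseteq> S"
  shows "\<exists>L. L-lipschitz_on (cball x R) Y"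
  by (rule C1_lipschitz_cball[OF spec[OF assms(1)[unfolded smooth_on_def]] assms(2)])

section \<open>Following words of fields\<close>

text \<open>A relation rather than a function: it describes partial flows confined to
  \<open>B\<close> without fixing a domain of definition.\<close>

definition flow_step :: "'e::euclidean_space set \<Rightarrow> ('e \<Rightarrow> 'e) \<Rightarrow> real \<Rightarrow> 'e \<Rightarrow> 'e \<Rightarrow> bool"
  where "flow_step B Y s x y \<longleftrightarrow> (\<exists>\<gamma>. \<gamma> 0 = x \<and> \<gamma> s = y \<and>
    (\<forall>t\<in>{0..s}. \<gamma> t \<in> B \<and> (\<gamma> has_vector_derivative Y (\<gamma> t)) (at t within {0..s})))"

text \<open>All letters run for the same time \<open>s\<close>, matching a power series in one
  variable.\<close>

fun flow_word :: "'e::euclidean_space set \<Rightarrow> ('e \<Rightarrow> 'e) list \<Rightarrow> real \<Rightarrow> 'e \<Rightarrow> 'e \<Rightarrow> bool" where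
  "flow_word B [] s x z \<longleftrightarrow> x = z \<and> x \<in> B"
| "flow_word B (Y # w) s x z \<longleftrightarrow> (\<exists>y. flow_step B Y s x y \<and> flow_word B w s y z)"

lemma flow_word_mem: "0 \<le> s \<Longrightarrow> flow_word B w s x z \<Longrightarrow> x \<in> B"
  by (cases w) (auto simp: flow_step_def)

lemma smooth_fns_bounded:
  assumes "f \<in> smooth_fns S" "compact B" "B \<subseteq> S"
  shows "\<exists>C\<ge>0. \<forall>z\<in>B. norm (f z) \<le> C"
proof -
  have "continuous_on B f"
    using assms smooth_on_continuous_on[of S f] continuous_on_subset by (auto simp: smooth_fns_def)
  then have "bounded (f ` B)" using assms(2) by (intro compact_imp_bounded compact_continuous_image)
  then obtain C where "\<forall>z\<in>B. norm (f z) \<le> C" by (auto simp: bounded_iff)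
  then show ?thesis by (intro exI[of _ "max C 0"]) (auto intro: max.coboundedI1)
qed

text \<open>Induction on the order. The error of order \<open>N + 1\<close> for \<open>f\<close>
  vanishes at time 0, and its derivative along the curve is the error of order \<open>N\<close> for
  the Lie derivative of \<open>f\<close>; integration adds a factor \<open>s\<close>, and the
  constant is inherited.\<close>

lemma flow_taylor:
  fixes f :: "'e::euclidean_space \<Rightarrow> 'e"
  assumes S: "open S" and Y: "smooth_on S Y" and B: "compact B" "B \<subseteq> S" and f: "f \<in> smooth_fns S"
  shows "\<exists>C\<ge>0. \<forall>s x y. 0 \<le> s \<longrightarrow> flow_step B Y s x y \<longrightarrow>
    norm (f y - (\<Sum>j<N. (s ^ j / fact j) *\<^sub>R (lie_derivative S Y ^^ j) f x)) \<le> C * s ^ N"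
  using f
proof (induction N arbitrary: f)
  case 0
  from smooth_fns_bounded[OF 0 B] obtain C where C: "0 \<le> C" "\<And>z. z \<in> B \<Longrightarrow> norm (f z) \<le> C" by blast
  show ?case
  proof (intro exI[of _ C] conjI allI impI)
    fix s :: real and x y :: 'e assume "0 \<le> s" "flow_step B Y s x y"
    then have "y \<in> B" by (auto simp: flow_step_def)
    then show "norm (f y - (\<Sum>j<0. (s ^ j / fact j) *\<^sub>R (lie_derivative S Y ^^ j) f x)) \<le> C * s ^ 0"
      using C(2) by simp
  qed (rule C(1))
next
  case (Suc N)
  define h where "h = lie_derivative S Y f"
  have "h \<in> smooth_fns S" unfolding h_def by (rule lie_derivative_smooth_fns[OF S Suc.prems Y])
  from Suc.IH[OF this] obtain C where C: "0 \<le> C" "\<And>s x y. 0 \<le> s \<Longrightarrow> flow_step B Y s x y \<Longrightarrow>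
    norm (h y - (\<Sum>j<N. (s ^ j / fact j) *\<^sub>R (lie_derivative S Y ^^ j) h x)) \<le> C * s ^ N" by blast
  show ?case
  proof (intro exI[of _ C] conjI allI impI)
    fix s :: real and x y :: 'e assume s: "0 \<le> s" and "flow_step B Y s x y"
    then obtain \<gamma> where \<gamma>: "\<gamma> 0 = x" "\<gamma> s = y" "\<And>t. t \<in> {0..s} \<Longrightarrow> \<gamma> t \<in> B"
      "\<And>t. t \<in> {0..s} \<Longrightarrow> (\<gamma> has_vector_derivative Y (\<gamma> t)) (at t within {0..s})"
      unfolding flow_step_def by blast
    define E where "E t = f (\<gamma> t) - (\<Sum>j<Suc N. (t ^ j / fact j) *\<^sub>R (lie_derivative S Y ^^ j) f x)" for t
    define D where "D t = h (\<gamma> t) - (\<Sum>j<N. (t ^ j / fact j) *\<^sub>R (lie_derivative S Y ^^ j) h x)" for t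
    have E': "(E has_vector_derivative D t) (at t within {0..s})" if t: "t \<in> {0..s}" for t
    proof -
      have gS: "\<gamma> t \<in> S" using \<gamma>(3)[OF t] B(2) by blast
      note fd = smooth_fnsD(1)[OF S Suc.prems gS]
      have "((\<lambda>t. f (\<gamma> t)) has_vector_derivative frechet_derivative f (at (\<gamma> t)) (Y (\<gamma> t))) (at t within {0..s})"
        using vector_derivative_diff_chain_within[OF \<gamma>(4)[OF t] has_derivative_at_withinI[OF fd]]
        by (simp add: o_def)
      then have 1: "((\<lambda>t. f (\<gamma> t)) has_vector_derivative h (\<gamma> t)) (at t within {0..s})"
        using gS by (simp add: h_def lie_derivative_def)
      have "((\<lambda>t. (t ^ Suc j / fact (Suc j)) *\<^sub>R v) has_vector_derivative (t ^ j / fact j) *\<^sub>R v) (at t within {0..s})"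
        for j and v :: 'e
      proof -
        have "((\<lambda>t. t ^ Suc j / fact (Suc j)) has_real_derivative (real (Suc j) * t ^ j) / fact (Suc j)) (at t within {0..s})"
          using DERIV_cdivide[OF DERIV_pow[of "Suc j" t "{0..s}"], of "fact (Suc j)"] by simp
        moreover have "(real (Suc j) * t ^ j) / fact (Suc j) = t ^ j / fact j"
          by (simp add: fact_Suc del: of_nat_Suc)
        ultimately have "((\<lambda>t. t ^ Suc j / fact (Suc j)) has_real_derivative t ^ j / fact j) (at t within {0..s})"
          by simp
        from has_vector_derivative_scaleR[OF this has_vector_derivative_const] show ?thesis by simp
      qed
      then have "((\<lambda>t. f x + (\<Sum>j<N. (t ^ Suc j / fact (Suc j)) *\<^sub>R (lie_derivative S Y ^^ j) h x)) has_vector_derivative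
          0 + (\<Sum>j<N. (t ^ j / fact j) *\<^sub>R (lie_derivative S Y ^^ j) h x)) (at t within {0..s})"
        by (intro has_vector_derivative_add has_vector_derivative_const has_vector_derivative_sum)
      moreover have "(\<Sum>j<Suc N. (t ^ j / fact j) *\<^sub>R (lie_derivative S Y ^^ j) f x) =
          f x + (\<Sum>j<N. (t ^ Suc j / fact (Suc j)) *\<^sub>R (lie_derivative S Y ^^ j) h x)" for t
        unfolding sum.lessThan_Suc_shift by (simp add: h_def funpow_Suc_right del: funpow.simps fact_Suc power_Suc)
      ultimately show ?thesis
        unfolding E_def D_def using has_vector_derivative_diff[OF 1] by simp
    qed
    have "norm (E s - E 0) \<le> (C * s ^ N) * norm (s - 0)"
    proof (rule differentiable_bound[where S = "{0..s}" and f' = "\<lambda>t v. v *\<^sub>R D t"])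
      show "(E has_derivative (\<lambda>v. v *\<^sub>R D t)) (at t within {0..s})" if "t \<in> {0..s}" for t
        using E'[OF that] by (simp add: has_vector_derivative_def)
      show "onorm (\<lambda>v. v *\<^sub>R D t) \<le> C * s ^ N" if t: "t \<in> {0..s}" for t
      proof -
        \<comment> \<open>The induction hypothesis is needed at every earlier time, for the curve
          stopped at \<open>t\<close>.\<close>
        have "flow_step B Y t x (\<gamma> t)"
          unfolding flow_step_def
        proof (intro exI[of _ \<gamma>] conjI ballI)
          fix \<tau> assume "\<tau> \<in> {0..t}"
          then have "\<tau> \<in> {0..s}" using t by auto
          then show "\<gamma> \<tau> \<in> B" "(\<gamma> has_vector_derivative Y (\<gamma> \<tau>)) (at \<tau> within {0..t})"
            using \<gamma>(3,4) has_vector_derivative_within_subset[OF \<gamma>(4), of \<tau> "{0..t}"] t by auto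
        qed (use \<gamma> in auto)
        then have "norm (D t) \<le> C * t ^ N" using C(2)[of t x "\<gamma> t"] t by (simp add: D_def)
        also have "\<dots> \<le> C * s ^ N" using t C(1) by (intro mult_left_mono power_mono) auto
        finally have "norm (D t) \<le> C * s ^ N" .
        moreover have "onorm (\<lambda>v::real. v *\<^sub>R D t) \<le> norm (D t)"
          by (rule onorm_bound) (simp_all add: mult.commute)
        ultimately show ?thesis by simp
      qed
    qed (use s in auto)
    moreover have "E 0 = 0" unfolding E_def sum.lessThan_Suc_shift using \<gamma>(1) by simp
    ultimately show "norm (f y - (\<Sum>j<Suc N. (s ^ j / fact j) *\<^sub>R (lie_derivative S Y ^^ j) f x)) \<le> C * s ^ Suc N"
      using s \<gamma>(2) by (simp add: E_def mult.commute mult.left_commute)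
  qed (rule C(1))
qed

lemma fop_apply_derivation_power:
  assumes "open S" "smooth_on S Y" "f \<in> smooth_fns S"
  shows "fop_apply (derivation S Y ^ j) f = (lie_derivative S Y ^^ j) f \<and> (lie_derivative S Y ^^ j) f \<in> smooth_fns S"
proof (induction j)
  case 0
  then show ?case using assms(3) by (simp add: one_fop.rep_eq)
next
  case (Suc j)
  then show ?case
    using lie_derivative_smooth_fns[OF assms(1) _ assms(2)]
    by (simp add: times_fop.rep_eq fop_apply_derivation[OF assms(1)] smooth_proj(3)[OF assms(1)])
qed

lemma subspace_smooth_fns_sum:
  "open S \<Longrightarrow> (\<And>i. i \<in> I \<Longrightarrow> T i \<in> smooth_fns S) \<Longrightarrow> (\<Sum>i\<in>I. T i) \<in> smooth_fns S"
  by (rule subspace_sum[OF subspace_smooth_fns])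

lemma word_series_smooth_fns:
  assumes S: "open S" and w: "\<And>Y. Y \<in> set w \<Longrightarrow> smooth_on S Y" and f: "f \<in> smooth_fns S"
  shows "fop_apply (fps_nth (word_series (map (derivation S) w)) n) f \<in> smooth_fns S"
  using w
proof (induction w arbitrary: n)
  case Nil
  have "(\<lambda>_. 0) \<in> smooth_fns S"
    using subspace_0[OF subspace_smooth_fns[OF S]] by (simp add: zero_fun_def)
  then show ?case using f by (simp add: one_fop.rep_eq zero_fop.rep_eq)
next
  case (Cons Y w)
  have "fop_apply (fps_nth (exp_series (derivation S Y)) i)
      (fop_apply (fps_nth (word_series (map (derivation S) w)) k) f) \<in> smooth_fns S" for i k
    using Cons.IH[of k] Cons.prems
    by (auto simp: exp_series_nth scaleR_fop.rep_eq fop_apply_derivation_power[OF S]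
        intro!: subspace_scale[OF subspace_smooth_fns[OF S]])
  then show ?case
    by (auto simp: fps_mult_nth fop_apply_sum times_fop.rep_eq intro!: subspace_smooth_fns_sum[OF S])
qed

lemma sum_fun_apply: "(\<Sum>i\<in>I. T i) x = (\<Sum>i\<in>I. T i x :: 'b::comm_monoid_add)"
  by (induction I rule: infinite_finite_induct) simp_all

text \<open>Induction on the word. The value at the end is expanded, by the series of the tail,
  around the point reached after the first letter; each coefficient of this expansion is a smooth
  function and is expanded along the first letter. The resulting double sum is the Cauchy product of
  the two series.\<close>

lemma flow_word_taylor:
  fixes f :: "'e::euclidean_space \<Rightarrow> 'e"
  assumes S: "open S" and w: "\<And>Y. Y \<in> set w \<Longrightarrow> smooth_on S Y" and B: "compact B" "B \<subseteq> S"
    and f: "f \<in> smooth_fns S"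
  shows "\<exists>C\<ge>0. \<forall>s x z. 0 \<le> s \<longrightarrow> flow_word B w s x z \<longrightarrow>
    norm (f z - (\<Sum>n<N. s ^ n *\<^sub>R fop_apply (fps_nth (word_series (map (derivation S) w)) n) f x)) \<le> C * s ^ N"
  using w
proof (induction w)
  case Nil
  obtain C where C: "0 \<le> C" "\<And>z. z \<in> B \<Longrightarrow> norm (f z) \<le> C" using smooth_fns_bounded[OF f B] by blast
  show ?case
  proof (intro exI[of _ C] conjI allI impI)
    fix s :: real and x z assume s: "0 \<le> s" and "flow_word B [] s x z"
    then have xz: "x = z" "z \<in> B" by auto
    have "(\<Sum>n<N. s ^ n *\<^sub>R fop_apply (fps_nth (word_series (map (derivation S) [])) n) f x) =
        (\<Sum>n<N. if n = 0 then f x else 0)"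
      by (rule sum.cong) (auto simp: one_fop.rep_eq zero_fop.rep_eq)
    also have "\<dots> = (if N = 0 then 0 else f x)" by simp
    finally show "norm (f z - (\<Sum>n<N. s ^ n *\<^sub>R fop_apply (fps_nth (word_series (map (derivation S) [])) n) f x)) \<le> C * s ^ N"
      using C xz s by (auto simp: mult_nonneg_nonneg)
  qed (rule C(1))
next
  case (Cons Y w)
  have Y: "smooth_on S Y" using Cons.prems by simp
  define g where "g n = fop_apply (fps_nth (word_series (map (derivation S) w)) n) f" for n
  have g: "g n \<in> smooth_fns S" for n
    unfolding g_def by (rule word_series_smooth_fns[OF S _ f]) (use Cons.prems in auto)
  obtain C where C: "0 \<le> C" "\<And>s x z. 0 \<le> s \<Longrightarrow> flow_word B w s x z \<Longrightarrow>
      norm (f z - (\<Sum>n<N. s ^ n *\<^sub>R g n x)) \<le> C * s ^ N"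
    using Cons unfolding g_def by auto
  define T where "T i j = (lie_derivative S Y ^^ j) (g i)" for i j
  \<comment> \<open>The coefficient \<open>g i\<close> carries the factor \<open>s ^ i\<close>, so
    expanding it to order \<open>N - i\<close> gives a total error of order
    \<open>N\<close>.\<close>
  have "\<forall>i. \<exists>K\<ge>0. \<forall>s x y. 0 \<le> s \<longrightarrow> flow_step B Y s x y \<longrightarrow>
      norm (g i y - (\<Sum>j<N - i. (s ^ j / fact j) *\<^sub>R T i j x)) \<le> K * s ^ (N - i)"
    unfolding T_def using flow_taylor[OF S Y B g] by blast
  from choice[OF this] obtain K where K: "\<And>i. 0 \<le> K i"
    "\<And>i s x y. 0 \<le> s \<Longrightarrow> flow_step B Y s x y \<Longrightarrow>
      norm (g i y - (\<Sum>j<N - i. (s ^ j / fact j) *\<^sub>R T i j x)) \<le> K i * s ^ (N - i)" by blast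
  have coeff: "fop_apply (fps_nth (word_series (map (derivation S) (Y # w))) n) f x =
      (\<Sum>j\<le>n. (1 / fact j) *\<^sub>R T (n - j) j x)" for n x
  proof -
    have "fop_apply (fps_nth (word_series (map (derivation S) (Y # w))) n) f =
       (\<Sum>j=0..n. (1 / fact j) *\<^sub>R T (n - j) j)"
      unfolding T_def
      by (simp add: fps_mult_nth fop_apply_sum times_fop.rep_eq exp_series_nth scaleR_fop.rep_eq
          g_def[symmetric] fop_apply_derivation_power[OF S Y g])
    moreover have "(\<Sum>j=0..n. (1 / fact j) *\<^sub>R T (n - j) j) x = (\<Sum>j=0..n. (1 / fact j) *\<^sub>R T (n - j) j x)"
      by (simp add: sum_fun_apply scaleR_fun_def)
    ultimately show ?thesis by (simp add: atLeast0AtMost)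
  qed
  show ?case
  proof (intro exI[of _ "C + (\<Sum>i<N. K i)"] conjI allI impI)
    fix s :: real and x z assume s: "0 \<le> s" and "flow_word B (Y # w) s x z"
    then obtain y where y: "flow_step B Y s x y" "flow_word B w s y z" by auto
    have "(\<Sum>n<N. s ^ n *\<^sub>R fop_apply (fps_nth (word_series (map (derivation S) (Y # w))) n) f x) =
       (\<Sum>n<N. \<Sum>j\<le>n. (s ^ (n - j + j) / fact j) *\<^sub>R T (n - j) j x)"
      unfolding coeff by (simp add: scaleR_sum_right)
    also have "\<dots> = (\<Sum>(j, i)\<in>{(j, i). j + i < N}. (s ^ (i + j) / fact j) *\<^sub>R T i j x)"
      by (rule sum.triangle_reindex[symmetric])
    also have "\<dots> = (\<Sum>i<N. \<Sum>j<N - i. (s ^ (i + j) / fact j) *\<^sub>R T i j x)"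
      by (subst sum.Sigma) (auto intro!: sum.reindex_bij_witness[of _ "\<lambda>(i, j). (j, i)" "\<lambda>(i, j). (j, i)"])
    also have "\<dots> = (\<Sum>i<N. s ^ i *\<^sub>R (\<Sum>j<N - i. (s ^ j / fact j) *\<^sub>R T i j x))"
      by (simp add: scaleR_sum_right power_add)
    finally have eq: "(\<Sum>n<N. s ^ n *\<^sub>R fop_apply (fps_nth (word_series (map (derivation S) (Y # w))) n) f x) =
      (\<Sum>i<N. s ^ i *\<^sub>R (\<Sum>j<N - i. (s ^ j / fact j) *\<^sub>R T i j x))" .
    have "norm ((\<Sum>i<N. s ^ i *\<^sub>R g i y) - (\<Sum>i<N. s ^ i *\<^sub>R (\<Sum>j<N - i. (s ^ j / fact j) *\<^sub>R T i j x))) \<le>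
      (\<Sum>i<N. K i * s ^ N)"
      unfolding sum_subtractf[symmetric]
    proof (rule sum_norm_le)
      fix i assume i: "i \<in> {..<N}"
      have "norm (s ^ i *\<^sub>R g i y - s ^ i *\<^sub>R (\<Sum>j<N - i. (s ^ j / fact j) *\<^sub>R T i j x)) =
         s ^ i * norm (g i y - (\<Sum>j<N - i. (s ^ j / fact j) *\<^sub>R T i j x))"
        using s by (simp flip: scaleR_diff_right)
      also have "\<dots> \<le> s ^ i * (K i * s ^ (N - i))"
        using K(2)[OF s y(1)] s by (intro mult_left_mono) auto
      also have "\<dots> = K i * s ^ N" using i by (simp add: power_add[symmetric])
      finally show "norm (s ^ i *\<^sub>R g i y - s ^ i *\<^sub>R (\<Sum>j<N - i. (s ^ j / fact j) *\<^sub>R T i j x)) \<le> K i * s ^ N" .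
    qed
    moreover have "norm (f z - (\<Sum>n<N. s ^ n *\<^sub>R g n y)) \<le> C * s ^ N" by (rule C(2)[OF s y(2)])
    ultimately have "norm (f z - (\<Sum>i<N. s ^ i *\<^sub>R (\<Sum>j<N - i. (s ^ j / fact j) *\<^sub>R T i j x))) \<le>
        C * s ^ N + (\<Sum>i<N. K i * s ^ N)"
      by (rule norm_diff_triangle_le[rotated])
    then show "norm (f z - (\<Sum>n<N. s ^ n *\<^sub>R fop_apply (fps_nth (word_series (map (derivation S) (Y # w))) n) f x)) \<le>
        (C + (\<Sum>i<N. K i)) * s ^ N"
      unfolding eq by (simp add: sum_distrib_right distrib_right)
  qed (use C(1) K(1) in \<open>simp add: sum_nonneg\<close>)
qed

section \<open>Local reachability in coordinates\<close>

section \<open>Trajectories of a family of fields\<close>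

text \<open>The countable exceptional set leaves room for the junction times of infinitely many
  pieces; elsewhere the field may change from one time to another.\<close>

definition trajectory :: "real \<Rightarrow> 'e::euclidean_space set \<Rightarrow> ('e \<Rightarrow> 'e) set \<Rightarrow> real \<Rightarrow> (real \<Rightarrow> 'e) \<Rightarrow> bool"
  where "trajectory M B F T \<gamma> \<longleftrightarrow> M-lipschitz_on {0..T} \<gamma> \<and> \<gamma> ` {0..T} \<subseteq> B \<and>
    (\<exists>N. countable N \<and> (\<forall>t\<in>{0<..<T} - N. \<exists>Y\<in>F. (\<gamma> has_vector_derivative Y (\<gamma> t)) (at t)))"

definition traj_reach :: "real \<Rightarrow> 'e::euclidean_space set \<Rightarrow> ('e \<Rightarrow> 'e) set \<Rightarrow> real \<Rightarrow> 'e \<Rightarrow> 'e \<Rightarrow> bool"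
  where "traj_reach M B F T x y \<longleftrightarrow> 0 \<le> T \<and> (\<exists>\<gamma>. trajectory M B F T \<gamma> \<and> \<gamma> 0 = x \<and> \<gamma> T = y)"

lemma trajectory_join:
  assumes 1: "trajectory M B F S \<gamma>" and 2: "trajectory M B F T \<eta>" and ST: "0 \<le> S" "0 \<le> T"
    and eq: "\<gamma> S = \<eta> 0"
  shows "trajectory M B F (S + T) (\<lambda>t. if t \<le> S then \<gamma> t else \<eta> (t - S))"
proof -
  let ?j = "\<lambda>t. if t \<le> S then \<gamma> t else \<eta> (t - S)"
  have l1: "M-lipschitz_on {0..S} \<gamma>" and l2: "M-lipschitz_on {0..T} \<eta>"
    using 1 2 by (auto simp: trajectory_def)
  have l3: "M-lipschitz_on {S..S+T} (\<lambda>t. \<eta> (t - S))"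
  proof (rule lipschitz_onI)
    fix s t assume "s \<in> {S..S+T}" "t \<in> {S..S+T}"
    then have "dist (\<eta> (s - S)) (\<eta> (t - S)) \<le> M * dist (s - S) (t - S)"
      by (intro lipschitz_onD[OF l2]) auto
    then show "dist (\<eta> (s - S)) (\<eta> (t - S)) \<le> M * dist s t" by (simp add: dist_norm)
  qed (rule lipschitz_on_nonneg[OF l2])
  have lip: "M-lipschitz_on {0..S+T} ?j"
    by (rule lipschitz_on_concat[OF l1 l3]) (simp add: eq)
  have sub: "?j ` {0..S+T} \<subseteq> B"
    using 1 2 by (auto simp: trajectory_def)
  obtain N1 where N1: "countable N1"
    "\<forall>t\<in>{0<..<S} - N1. \<exists>Y\<in>F. (\<gamma> has_vector_derivative Y (\<gamma> t)) (at t)"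
    using 1 unfolding trajectory_def by (elim conjE exE)
  obtain N2 where N2: "countable N2"
    "\<forall>t\<in>{0<..<T} - N2. \<exists>Y\<in>F. (\<eta> has_vector_derivative Y (\<eta> t)) (at t)"
    using 2 unfolding trajectory_def by (elim conjE exE)
  have der: "\<exists>Y\<in>F. (?j has_vector_derivative Y (?j t)) (at t)"
    if t: "t \<in> {0<..<S+T} - (N1 \<union> insert S ((\<lambda>t. t + S) ` N2))" for t
  proof (cases "t < S")
    case True
    then obtain Y where Y: "Y \<in> F" "(\<gamma> has_vector_derivative Y (\<gamma> t)) (at t)"
      using N1(2)[rule_format, of t] t by auto
    have "(?j has_vector_derivative Y (\<gamma> t)) (at t)"
      by (rule has_vector_derivative_transform_within_open[OF Y(2), of "{..<S}"]) (use True in auto)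
    then show ?thesis using Y(1) True by auto
  next
    case False
    then have tS: "S < t" "t - S \<in> {0<..<T} - N2" using t by (auto simp: image_iff)
    from N2(2)[rule_format, OF tS(2)] obtain Y where Y: "Y \<in> F" "(\<eta> has_vector_derivative Y (\<eta> (t - S))) (at (t - S))"
      by blast
    have "((\<lambda>t. t - S) has_vector_derivative 1) (at t)"
      by (auto intro!: derivative_eq_intros)
    from vector_diff_chain_at[OF this Y(2)]
    have "((\<lambda>t. \<eta> (t - S)) has_vector_derivative Y (\<eta> (t - S))) (at t)" by (simp add: o_def)
    then have "(?j has_vector_derivative Y (\<eta> (t - S))) (at t)"
      by (rule has_vector_derivative_transform_within_open[of _ _ _ "{S<..}"]) (use tS in auto)
    then show ?thesis using Y(1) tS by auto
  qed
  have cnt: "countable (N1 \<union> insert S ((\<lambda>t. t + S) ` N2))" using N1 N2 by auto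
  show ?thesis unfolding trajectory_def
    by (intro conjI exI[of _ "N1 \<union> insert S ((\<lambda>t. t + S) ` N2)"] lip sub cnt ballI der)
qed

lemma traj_reach_trans:
  assumes "traj_reach M B F S x y" "traj_reach M B F T y z"
  shows "traj_reach M B F (S + T) x z"
proof -
  obtain \<gamma> \<eta> where *: "0 \<le> S" "0 \<le> T" "trajectory M B F S \<gamma>" "\<gamma> 0 = x" "\<gamma> S = y"
    "trajectory M B F T \<eta>" "\<eta> 0 = y" "\<eta> T = z"
    using assms unfolding traj_reach_def by blast
  have "trajectory M B F (S + T) (\<lambda>t. if t \<le> S then \<gamma> t else \<eta> (t - S))"
    by (rule trajectory_join) (use * in auto)
  then show ?thesis
    unfolding traj_reach_def using * by (intro conjI exI[of _ "\<lambda>t. if t \<le> S then \<gamma> t else \<eta> (t - S)"]) auto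
qed

lemma traj_reach_flow_step:
  assumes "flow_step B Y s x y" "0 \<le> s" "Y \<in> F" "\<And>z. z \<in> B \<Longrightarrow> norm (Y z) \<le> M" "0 \<le> M"
  shows "traj_reach M B F s x y"
proof -
  obtain \<gamma> where \<gamma>: "\<gamma> 0 = x" "\<gamma> s = y" "\<And>t. t \<in> {0..s} \<Longrightarrow> \<gamma> t \<in> B"
    "\<And>t. t \<in> {0..s} \<Longrightarrow> (\<gamma> has_vector_derivative Y (\<gamma> t)) (at t within {0..s})"
    using assms(1) unfolding flow_step_def by blast
  have "M-lipschitz_on {0..s} \<gamma>"
  proof (rule lipschitz_onI[OF _ assms(5)])
    fix t u assume tu: "t \<in> {0..s}" "u \<in> {0..s}"
    have "norm (\<gamma> t - \<gamma> u) \<le> M * norm (t - u)"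
    proof (rule differentiable_bound[OF _ _ _ tu, where f' = "\<lambda>t v. v *\<^sub>R Y (\<gamma> t)"])
      show "(\<gamma> has_derivative (\<lambda>v. v *\<^sub>R Y (\<gamma> t))) (at t within {0..s})" if "t \<in> {0..s}" for t
        using \<gamma>(4)[OF that] by (simp add: has_vector_derivative_def)
      show "onorm (\<lambda>v. v *\<^sub>R Y (\<gamma> t)) \<le> M" if "t \<in> {0..s}" for t
      proof -
        have "onorm (\<lambda>v::real. v *\<^sub>R Y (\<gamma> t)) \<le> norm (Y (\<gamma> t))"
          by (rule onorm_bound) (simp_all add: mult.commute)
        then show ?thesis using assms(4)[OF \<gamma>(3)[OF that]] by simp
      qed
    qed simp
    then show "dist (\<gamma> t) (\<gamma> u) \<le> M * dist t u" by (simp add: dist_norm)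
  qed
  moreover have "\<exists>Y\<in>F. (\<gamma> has_vector_derivative Y (\<gamma> t)) (at t)" if "t \<in> {0<..<s} - {}" for t
    using \<gamma>(4)[of t] that at_within_Icc_at[of 0 t s] assms(3) by auto
  ultimately have "trajectory M B F s \<gamma>" unfolding trajectory_def using \<gamma>(3) by blast
  then show ?thesis unfolding traj_reach_def using \<gamma> assms(2) by blast
qed

lemma traj_reach_refl:
  assumes "x \<in> B" "0 \<le> M"
  shows "traj_reach M B F 0 x x"
proof -
  have "trajectory M B F 0 (\<lambda>_. x)"
    unfolding trajectory_def using assms by (auto intro!: exI[of _ "{}"] lipschitz_onI)
  then show ?thesis unfolding traj_reach_def by auto
qed

lemma traj_reach_flow_word:
  fixes s :: real
  assumes "flow_word B w s x z" "0 \<le> s" "set w \<subseteq> F" "\<And>Y z. Y \<in> F \<Longrightarrow> z \<in> B \<Longrightarrow> norm (Y z) \<le> M" "0 \<le> M"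
  shows "traj_reach M B F (real (length w) * s) x z"
  using assms(1,3)
proof (induction w arbitrary: x)
  case Nil
  then show ?case using assms(5) by (auto intro: traj_reach_refl)
next
  case (Cons Y w)
  then obtain y where y: "flow_step B Y s x y" "flow_word B w s y z" by auto
  have "traj_reach M B F s x y"
    by (rule traj_reach_flow_step[OF y(1)]) (use assms Cons.prems in auto)
  moreover have "traj_reach M B F (real (length w) * s) y z" by (rule Cons.IH) (use y Cons.prems in auto)
  ultimately have "traj_reach M B F (s + real (length w) * s) x z" by (rule traj_reach_trans)
  then show ?case by (simp add: algebra_simps)
qed

text \<open>Infinitely many pieces of finite total duration can be concatenated, because all pieces have the
  same Lipschitz constant.\<close>

lemma traj_reach_infinite:
  fixes y :: "nat \<Rightarrow> 'e::euclidean_space"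
  assumes reach: "\<And>n. traj_reach M B F (\<tau> n) (y n) (y (Suc n))" and sum: "summable \<tau>"
    and lim: "y \<longlonglongrightarrow> z" and B: "closed B" and M: "0 \<le> M"
  shows "traj_reach M B F (suminf \<tau>) (y 0) z"
proof -
  define S where "S n = (\<Sum>i<n. \<tau> i)" for n
  define T where "T = suminf \<tau>"
  have \<tau>: "0 \<le> \<tau> n" for n using reach by (simp add: traj_reach_def)
  have S0: "S 0 = 0" "0 \<le> S n" "S n \<le> S (Suc n)" "S (Suc n) = S n + \<tau> n" for n
    using \<tau> by (auto simp: S_def sum_nonneg)
  have Sm: "S m \<le> S n" if "m \<le> n" for m n using S0(3) that by (rule lift_Suc_mono_le)
  have ST: "S \<longlonglongrightarrow> T" unfolding S_def T_def using sum by (rule summable_LIMSEQ)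
  have SleT: "S n \<le> T" for n
    unfolding S_def T_def by (rule sum_le_suminf[OF sum]) (use \<tau> in auto)
  \<comment> \<open>Dependent choice builds trajectories each of which extends the preceding one, so
    that a limit curve can be read off.\<close>
  have "\<exists>g. \<forall>n. (trajectory M B F (S n) (g n) \<and> g n 0 = y 0 \<and> g n (S n) = y n) \<and>
      (\<forall>t\<in>{..S n}. g (Suc n) t = g n t)"
  proof (rule dependent_nat_choice)
    have "y 0 \<in> B" using reach[of 0] \<tau> by (force simp: traj_reach_def trajectory_def)
    then show "\<exists>g. trajectory M B F (S 0) g \<and> g 0 = y 0 \<and> g (S 0) = y 0"
      using traj_reach_refl[of "y 0" B M F] M unfolding traj_reach_def S0(1) by blast
    fix g n assume g: "trajectory M B F (S n) g \<and> g 0 = y 0 \<and> g (S n) = y n"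
    obtain \<eta> where \<eta>: "trajectory M B F (\<tau> n) \<eta>" "\<eta> 0 = y n" "\<eta> (\<tau> n) = y (Suc n)"
      using reach[of n] unfolding traj_reach_def by blast
    show "\<exists>h. (trajectory M B F (S (Suc n)) h \<and> h 0 = y 0 \<and> h (S (Suc n)) = y (Suc n)) \<and> (\<forall>t\<in>{..S n}. h t = g t)"
    proof (intro exI[of _ "\<lambda>t. if t \<le> S n then g t else \<eta> (t - S n)"] conjI)
      show "trajectory M B F (S (Suc n)) (\<lambda>t. if t \<le> S n then g t else \<eta> (t - S n))"
        unfolding S0(4) by (rule trajectory_join) (use g \<eta> S0 \<tau> in auto)
    qed (use g \<eta> S0 \<tau> in \<open>auto simp: antisym_conv\<close>)
  qed
  then obtain g where g: "\<And>n. trajectory M B F (S n) (g n)" "\<And>n. g n 0 = y 0" "\<And>n. g n (S n) = y n"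
    and ext: "\<And>n t. t \<le> S n \<Longrightarrow> g (Suc n) t = g n t" by auto
  have gmn: "g n t = g m t" if "m \<le> n" "t \<le> S m" for m n t
    using that(1)
  proof (induction rule: dec_induct)
    case (step n)
    then show ?case using ext[of t n] Sm[OF step(1)] that(2) by auto
  qed simp
  \<comment> \<open>\<open>LEAST\<close> selects one of the trajectories that run beyond
    \<open>t\<close>; by compatibility any other one has the same value there. The limit
    \<open>z\<close> fills in the final time.\<close>
  define \<gamma> where "\<gamma> t = (if t < T then g (LEAST n. t < S n) t else z)" for t
  have ex: "\<exists>n. t < S n" if "t < T" for t
    using order_tendstoD(1)[OF ST that] by (auto simp: eventually_sequentially)
  have \<gamma>: "\<gamma> t = g n t" if t: "t < T" "t \<le> S n" for t n
  proof -
    define k where "k = (LEAST n. t < S n)"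
    have k: "t < S k" unfolding k_def using ex[OF t(1)] by (rule LeastI_ex)
    have "g k t = g n t"
      using gmn[of k n t] gmn[of n k t] k t(2) by (cases "k \<le> n") auto
    then show ?thesis using t(1) by (simp add: \<gamma>_def k_def)
  qed
  have lip: "M-lipschitz_on {0..S n} (g n)" for n using g(1) by (simp add: trajectory_def)
  \<comment> \<open>Passing to the limit in the estimate between the times \<open>t\<close> and
    \<open>S n\<close> yields the Lipschitz bound at the final time \<open>T\<close>, which the
    finite concatenations need not reach.\<close>
  have near: "dist (\<gamma> t) z \<le> M * (T - t)" if t: "0 \<le> t" "t < T" for t
  proof (rule LIMSEQ_le)
    show "(\<lambda>n. dist (\<gamma> t) (y n)) \<longlonglongrightarrow> dist (\<gamma> t) z" by (intro tendsto_intros lim)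
    show "(\<lambda>n. M * (S n - t)) \<longlonglongrightarrow> M * (T - t)" by (intro tendsto_intros ST)
    obtain m where m: "t < S m" using ex[OF t(2)] by blast
    have "dist (\<gamma> t) (y n) \<le> M * (S n - t)" if "m \<le> n" for n
    proof -
      have tn: "t \<le> S n" using m Sm[OF that] by simp
      then have "dist (g n t) (g n (S n)) \<le> M * dist t (S n)"
        using t S0 by (intro lipschitz_onD[OF lip]) auto
      then show ?thesis using \<gamma>[OF t(2) tn] g(3) tn by (simp add: dist_real_def)
    qed
    then show "\<exists>N. \<forall>n\<ge>N. dist (\<gamma> t) (y n) \<le> M * (S n - t)" by blast
  qed
  have "M-lipschitz_on {0..T} \<gamma>"
  proof (rule lipschitz_on_leI[OF _ M])
    fix s t assume st: "s \<in> {0..T}" "t \<in> {0..T}" "s \<le> t"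
    show "dist (\<gamma> s) (\<gamma> t) \<le> M * dist s t"
    proof (cases "t < T")
      case True
      obtain n where n: "t < S n" using ex[OF True] by blast
      have "dist (g n s) (g n t) \<le> M * dist s t"
        using st n by (intro lipschitz_onD[OF lip]) auto
      then show ?thesis using \<gamma>[of s n] \<gamma>[of t n] True n st by simp
    next
      case False
      then have "\<gamma> t = z" "t = T" using st by (auto simp: \<gamma>_def)
      moreover have "\<gamma> T = z" by (simp add: \<gamma>_def)
      ultimately show ?thesis using near[of s] st by (cases "s < T") (auto simp: dist_real_def)
    qed
  qed
  moreover have "\<gamma> ` {0..T} \<subseteq> B"
  proof (rule image_subsetI)
    fix t assume t: "t \<in> {0..T}"
    have gB: "g n s \<in> B" if "s \<in> {0..S n}" for n s using g(1)[of n] that by (auto simp: trajectory_def)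
    have yB: "y n \<in> B" for n using gB[of "S n" n] g(3) S0 by simp
    show "\<gamma> t \<in> B"
    proof (cases "t < T")
      case True
      then obtain n where "t < S n" using ex by blast
      then show ?thesis using \<gamma>[OF True, of n] gB[of t n] t by simp
    next
      case False
      then show ?thesis using closed_sequentially[OF B _ lim] yB by (simp add: \<gamma>_def)
    qed
  qed
  moreover have "\<exists>N. countable N \<and> (\<forall>t\<in>{0<..<T} - N. \<exists>Y\<in>F. (\<gamma> has_vector_derivative Y (\<gamma> t)) (at t))"
  proof -
    have "\<forall>n. \<exists>N. countable N \<and> (\<forall>t\<in>{0<..<S n} - N. \<exists>Y\<in>F. (g n has_vector_derivative Y (g n t)) (at t))"
      by (intro allI conjunct2[OF conjunct2[OF g(1)[unfolded trajectory_def]]])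
    from choice[OF this] obtain N where N: "\<forall>n. countable (N n) \<and>
      (\<forall>t\<in>{0<..<S n} - N n. \<exists>Y\<in>F. (g n has_vector_derivative Y (g n t)) (at t))" by (elim exE)
    have "\<exists>Y\<in>F. (\<gamma> has_vector_derivative Y (\<gamma> t)) (at t)" if t: "t \<in> {0<..<T} - (\<Union>n. N n)" for t
    proof -
      obtain n where n: "t < S n" using ex[of t] t by auto
      then obtain Y where Y: "Y \<in> F" "(g n has_vector_derivative Y (g n t)) (at t)"
        using bspec[OF conjunct2[OF spec[OF N, of n]], of t] t by auto
      have eq: "g n s = \<gamma> s" if "s \<in> {..<S n}" for s
        using \<gamma>[of s n] that SleT[of n] by auto
      have "(\<gamma> has_vector_derivative Y (g n t)) (at t)"
        by (rule has_vector_derivative_transform_within_open[OF Y(2), of "{..<S n}"]) (use n eq in auto)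
      then show ?thesis using Y(1) eq[of t] n by auto
    qed
    then show ?thesis using N by (intro exI[of _ "\<Union>n. N n"]) auto
  qed
  ultimately have "trajectory M B F T \<gamma>" by (simp add: trajectory_def)
  \<comment> \<open>If \<open>T = 0\<close>, all pieces have duration 0, so \<open>y\<close> is
    constant and \<open>z\<close> is its value.\<close>
  moreover have "\<gamma> 0 = y 0"
  proof (cases "0 < T")
    case True
    then show ?thesis using \<gamma>[of 0 0] g(2)[of 0] S0 by simp
  next
    case False
    then have "S n = 0" for n using S0(2)[of n] SleT[of n] by simp
    then have "y n = y 0" for n using g(2,3)[of n] by simp
    then have "y = (\<lambda>_. y 0)" by (simp add: fun_eq_iff)
    then have "(\<lambda>_. y 0) \<longlonglongrightarrow> z" using lim by simp
    then have "z = y 0" using LIMSEQ_unique tendsto_const by blast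
    then show ?thesis using False by (simp add: \<gamma>_def)
  qed
  moreover have "\<gamma> T = z" "0 \<le> T" using SleT[of 0] S0 by (auto simp: \<gamma>_def)
  ultimately show ?thesis unfolding traj_reach_def T_def by blast
qed

section \<open>Small displacements along brackets\<close>

text \<open>Each letter may use half of the remaining distance to the boundary of the ball; the
  induction therefore runs over all radii \<rho> below \<open>r\<close>.\<close>

lemma flow_word_exists:
  fixes x0 :: "'e::euclidean_space"
  assumes w: "\<And>Y. Y \<in> set w \<Longrightarrow> smooth_on S Y" and r: "cball x0 r \<subseteq> S" and \<rho>: "\<rho> < r"
  shows "\<exists>s0>0. \<forall>s\<in>{0..s0}. \<forall>x\<in>cball x0 \<rho>. \<exists>z. flow_word (cball x0 r) w s x z"
  using w \<rho>
proof (induction w arbitrary: \<rho>)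
  case Nil
  then show ?case by (auto intro!: exI[of _ 1])
next
  case (Cons Y w)
  have Y: "smooth_on S Y" using Cons.prems by simp
  define R where "R = (r - \<rho>) / 2"
  have R: "0 < R" "\<rho> + R < r" using Cons.prems(2) by (auto simp: R_def field_simps)
  obtain L where L: "L-lipschitz_on (cball x0 r) Y" using smooth_on_lipschitz_cball[OF Y r] by blast
  have "bounded (Y ` cball x0 r)"
    using lipschitz_on_continuous_on[OF L] by (intro compact_imp_bounded compact_continuous_image) auto
  then obtain M where M: "\<And>z. z \<in> cball x0 r \<Longrightarrow> norm (Y z) \<le> M"
    by (auto simp: bounded_iff simp del: mem_cball)
  obtain s1 where s1: "0 < s1" "\<And>s x. s \<in> {0..s1} \<Longrightarrow> x \<in> cball x0 (\<rho> + R) \<Longrightarrow> \<exists>z. flow_word (cball x0 r) w s x z"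
    using Cons.IH[OF _ R(2)] Cons.prems(1) by auto
  define s0 where "s0 = min s1 (min (R / (\<bar>M\<bar> + 1)) (1 / (2 * (\<bar>L\<bar> + 1))))"
  have s0: "0 < s0" "s0 \<le> s1" using s1 R by (auto simp: s0_def)
  have "\<exists>z. flow_word (cball x0 r) (Y # w) s x z" if s: "s \<in> {0..s0}" and x: "x \<in> cball x0 \<rho>" for s x
  proof -
    have sub: "cball x R \<subseteq> cball x0 (\<rho> + R)"
    proof
      fix y assume "y \<in> cball x R"
      then show "y \<in> cball x0 (\<rho> + R)" using x dist_triangle[of x0 y x] by simp
    qed
    then have sub': "cball x R \<subseteq> cball x0 r" using R(2) by (auto simp: subset_iff)
    have "M * s \<le> (\<bar>M\<bar> + 1) * s" using s by (intro mult_right_mono) auto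
    also have "\<dots> \<le> (\<bar>M\<bar> + 1) * (R / (\<bar>M\<bar> + 1))" using s by (intro mult_left_mono) (auto simp: s0_def)
    also have "\<dots> = R" by simp
    finally have Ms: "M * s \<le> R" .
    have "L * s \<le> (\<bar>L\<bar> + 1) * s" using s by (intro mult_right_mono) auto
    also have "\<dots> \<le> (\<bar>L\<bar> + 1) * (1 / (2 * (\<bar>L\<bar> + 1)))" using s by (intro mult_left_mono) (auto simp: s0_def)
    also have "\<dots> = 1/2" by (simp add: field_simps)
    finally have Ls: "L * s \<le> 1/2" .
    have "\<exists>\<gamma>. \<gamma> 0 = x \<and> (\<forall>t\<in>{0..s}. \<gamma> t \<in> cball x R \<and> (\<gamma> has_vector_derivative Y (\<gamma> t)) (at t within {0..s}))"
      by (rule integral_curve_exists[OF lipschitz_on_subset[OF L sub'] M])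
        (use sub' s Ms Ls R in \<open>auto simp: subset_iff\<close>)
    then obtain \<gamma> where \<gamma>: "\<gamma> 0 = x" "\<forall>t\<in>{0..s}. \<gamma> t \<in> cball x R \<and> (\<gamma> has_vector_derivative Y (\<gamma> t)) (at t within {0..s})"
      by blast
    have "flow_step (cball x0 r) Y s x (\<gamma> s)"
      unfolding flow_step_def using \<gamma> sub' by (intro exI[of _ \<gamma>]) blast
    moreover have "\<gamma> s \<in> cball x0 (\<rho> + R)" using \<gamma>(2) sub s by (meson atLeastAtMost_iff order_refl subsetD)
    ultimately show ?thesis using s1(2)[of s "\<gamma> s"] s s0 by auto
  qed
  then show ?case using s0(1) by blast
qed

text \<open>The Taylor expansion along the word is applied to the identity map of \<open>S\<close>,
  extended by 0: its value is the position and its derivative along \<open>Z\<close> is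
  \<open>Z\<close> itself.\<close>

lemma leading_term_displacement:
  fixes Z :: "'e::euclidean_space \<Rightarrow> 'e"
  assumes S: "open S" and w: "\<And>Y. Y \<in> set w \<Longrightarrow> smooth_on S Y" and B: "compact B" "B \<subseteq> S"
    and lead: "leading_term k (derivation S Z) (word_series (map (derivation S) w))"
  shows "\<exists>C\<ge>0. \<forall>s x z. 0 \<le> s \<longrightarrow> flow_word B w s x z \<longrightarrow> norm (z - x - s ^ k *\<^sub>R Z x) \<le> C * s ^ Suc k"
proof -
  define f where "f x = (if x \<in> S then x else 0)" for x :: 'e
  have f: "f \<in> smooth_fns S"
    using smooth_on_cong[OF S _ smooth_on_id, of f] by (auto simp: smooth_fns_def f_def)
  have fZ: "lie_derivative S Z f x = Z x" if "x \<in> S" for x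
    using frechet_derivative_cong_open[OF S that, of f "\<lambda>x. x"] that
    by (simp add: lie_derivative_def f_def frechet_derivative_ident)
  let ?c = "\<lambda>n. fop_apply (fps_nth (word_series (map (derivation S) w)) n) f"
  obtain C where C: "0 \<le> C" "\<And>s x z. 0 \<le> s \<Longrightarrow> flow_word B w s x z \<Longrightarrow>
    norm (f z - (\<Sum>n<Suc k. s ^ n *\<^sub>R ?c n x)) \<le> C * s ^ Suc k"
    using flow_word_taylor[OF S w B f, where N = "Suc k"] by blast
  have k: "0 < k" using lead by (simp add: leading_term_def)
  have "norm (z - x - s ^ k *\<^sub>R Z x) \<le> C * s ^ Suc k" if s: "0 \<le> s" "flow_word B w s x z" for s x z
  proof -
    have "z \<in> B" using s(2) by (induction w arbitrary: x) (auto simp: flow_step_def)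
    then have zS: "z \<in> S" using B by blast
    have xS: "x \<in> S" using flow_word_mem[OF s] B by blast
    have "(\<Sum>n<Suc k. s ^ n *\<^sub>R ?c n x) = (\<Sum>n<Suc k. (if n = 0 then x else 0) + (if n = k then s ^ k *\<^sub>R Z x else 0))"
    proof (rule sum.cong[OF refl])
      fix n assume "n \<in> {..<Suc k}"
      then consider "n = 0" | "0 < n" "n < k" | "n = k" by force
      then show "s ^ n *\<^sub>R ?c n x = (if n = 0 then x else 0) + (if n = k then s ^ k *\<^sub>R Z x else 0)"
        using lead k xS
        by cases (auto simp: leading_term_def one_fop.rep_eq zero_fop.rep_eq f_def[of x]
            fop_apply_derivation[OF S] smooth_proj(3)[OF S f] fZ)
    qed
    also have "\<dots> = x + s ^ k *\<^sub>R Z x" unfolding sum.distrib by simp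
    finally show ?thesis using C(2)[OF s] zS by (simp add: f_def[of z] diff_diff_eq)
  qed
  then show ?thesis using C(1) by blast
qed

lemma span_brackets_finite:
  fixes Z0 :: "('e::euclidean_space \<Rightarrow> 'e) set"
  assumes "span ((\<lambda>Z. Z x0) ` Z0) = (UNIV :: 'e set)"
  shows "\<exists>Bk. finite Bk \<and> Bk \<subseteq> Z0 \<and> span ((\<lambda>Z. Z x0) ` Bk) = UNIV"
proof -
  obtain B where B: "B \<subseteq> (\<lambda>Z. Z x0) ` Z0" "independent B" "(\<lambda>Z. Z x0) ` Z0 \<subseteq> span B"
    using maximal_independent_subset by blast
  have "finite B" using B(2) independent_imp_finite by blast
  then obtain Bk where "Bk \<subseteq> Z0" "finite Bk" "B = (\<lambda>Z. Z x0) ` Bk"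
    using finite_subset_image[OF _ B(1)] by blast
  moreover have "span B = UNIV" using span_minimal[OF B(3) subspace_span] assms by auto
  ultimately show ?thesis by blast
qed

text \<open>At \<open>x0\<close> the sum of the absolute inner products with spanning vectors is a
  norm of \<open>v\<close>, so it is bounded below on the unit sphere by compactness, and one
  summand has at least the average size. Continuity keeps half of this bound near
  \<open>x0\<close>.\<close>

lemma spanning_fields_detect:
  fixes Bk :: "('e::euclidean_space \<Rightarrow> 'e) set"
  assumes fin: "finite Bk" and span: "span ((\<lambda>Z. Z x0) ` Bk) = UNIV" and S: "open S" "x0 \<in> S"
    and cont: "\<And>Z. Z \<in> Bk \<Longrightarrow> continuous_on S Z"
  shows "\<exists>c>0. \<exists>d>0. \<forall>y\<in>cball x0 d. \<forall>v. \<exists>Z\<in>Bk. c * norm v \<le> \<bar>Z y \<bullet> v\<bar>"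
proof -
  define \<phi> where "\<phi> v = (\<Sum>Z\<in>Bk. \<bar>Z x0 \<bullet> v\<bar>)" for v
  have pos: "0 < \<phi> v" if "v \<noteq> 0" for v
  proof (rule ccontr)
    assume "\<not> 0 < \<phi> v"
    moreover have "0 \<le> \<phi> v" unfolding \<phi>_def by (rule sum_nonneg) simp
    ultimately have "\<phi> v = 0" by simp
    then have "\<forall>Z\<in>Bk. Z x0 \<bullet> v = 0"
      using sum_nonneg_eq_0_iff[OF fin, of "\<lambda>Z. \<bar>Z x0 \<bullet> v\<bar>"] by (simp add: \<phi>_def)
    then have "(\<lambda>Z. Z x0) ` Bk \<subseteq> {u. u \<bullet> v = 0}" by auto
    then have "span ((\<lambda>Z. Z x0) ` Bk) \<subseteq> {u. u \<bullet> v = 0}"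
      by (rule span_minimal) (auto simp: subspace_def inner_left_distrib)
    then have "v \<in> {u. u \<bullet> v = 0}" using span by blast
    then show False using that by simp
  qed
  obtain b :: 'e where "b \<in> Basis" using nonempty_Basis by blast
  then have ne: "sphere (0::'e) 1 \<noteq> {}" by (auto intro!: exI[of _ b])
  have "continuous_on (sphere 0 1) \<phi>" unfolding \<phi>_def by (intro continuous_intros)
  from continuous_attains_inf[OF compact_sphere ne this] obtain u where u: "norm u = 1" "\<And>v. norm v = 1 \<Longrightarrow> \<phi> u \<le> \<phi> v"
    by auto
  define m where "m = \<phi> u"
  have m: "0 < m" unfolding m_def by (rule pos) (use u in auto)
  have Bne: "Bk \<noteq> {}" using m by (auto simp: m_def \<phi>_def)
  define n where "n = real (card Bk)"
  have n: "0 < n" using fin Bne by (simp add: n_def card_gt_0_iff)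
  have \<phi>m: "m * norm v \<le> \<phi> v" for v
  proof (cases "v = 0")
    case False
    have "m \<le> \<phi> (v /\<^sub>R norm v)" unfolding m_def by (rule u(2)) (use False in simp)
    also have "\<dots> = \<phi> v / norm v"
      by (simp add: \<phi>_def abs_mult sum_divide_distrib divide_inverse mult.commute sum_distrib_left)
    finally show ?thesis using False by (simp add: pos_le_divide_eq)
  qed (simp add: \<phi>_def)
  \<comment> \<open>If at a nearby point every inner product were below
    \<open>m / (2 * n) * norm v\<close>, a variation of the \<open>n\<close> fields by at most
    \<open>m / (2 * n)\<close> would still leave the sum at \<open>x0\<close> below
    \<open>m * norm v\<close>.\<close>
  have "\<forall>Z\<in>Bk. \<exists>d>0. \<forall>y. dist y x0 < d \<longrightarrow> dist (Z y) (Z x0) < m / (2 * n)"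
  proof
    fix Z assume "Z \<in> Bk"
    then have "isCont Z x0" using cont S by (simp add: continuous_on_eq_continuous_at)
    then show "\<exists>d>0. \<forall>y. dist y x0 < d \<longrightarrow> dist (Z y) (Z x0) < m / (2 * n)"
      using m n by (simp add: continuous_at_eps_delta)
  qed
  from bchoice[OF this] obtain d where d: "\<forall>Z\<in>Bk. 0 < d Z \<and> (\<forall>y. dist y x0 < d Z \<longrightarrow> dist (Z y) (Z x0) < m / (2 * n))" by blast
  define e where "e = Min (d ` Bk) / 2"
  have e0: "0 < Min (d ` Bk)" using fin Bne d by (simp add: Min_gr_iff)
  then have e: "0 < e" by (simp add: e_def)
  have ed: "e < d Z" if "Z \<in> Bk" for Z
  proof -
    have "Min (d ` Bk) \<le> d Z" using fin that by simp
    then show ?thesis using e0 by (simp add: e_def)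
  qed
  have "\<exists>Z\<in>Bk. (m / (2 * n)) * norm v \<le> \<bar>Z y \<bullet> v\<bar>" if y: "y \<in> cball x0 e" for y v
  proof (rule ccontr)
    assume "\<not> ?thesis"
    then have less: "\<And>Z. Z \<in> Bk \<Longrightarrow> \<bar>Z y \<bullet> v\<bar> < (m / (2 * n)) * norm v" by (simp add: not_le)
    then have v: "v \<noteq> 0" using Bne by fastforce
    have "\<phi> v < (\<Sum>Z\<in>Bk. m / n * norm v)"
      unfolding \<phi>_def
    proof (rule sum_strict_mono[OF fin Bne])
      fix Z assume Z: "Z \<in> Bk"
      have "dist (Z y) (Z x0) < m / (2 * n)" using d Z y ed[OF Z] by (simp add: dist_commute[of y])
      then have "\<bar>(Z x0 - Z y) \<bullet> v\<bar> \<le> (m / (2 * n)) * norm v"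
        by (intro order_trans[OF Cauchy_Schwarz_ineq2] mult_right_mono) (auto simp: dist_norm norm_minus_commute)
      moreover have "\<bar>Z x0 \<bullet> v\<bar> \<le> \<bar>Z y \<bullet> v\<bar> + \<bar>(Z x0 - Z y) \<bullet> v\<bar>" by (simp add: inner_diff_left)
      ultimately have "\<bar>Z x0 \<bullet> v\<bar> < (m / (2 * n)) * norm v + (m / (2 * n)) * norm v" using less[OF Z] by linarith
      then show "\<bar>Z x0 \<bullet> v\<bar> < m / n * norm v" by (simp add: field_simps)
    qed
    also have "\<dots> = m * norm v" using n by (simp add: n_def)
    finally show False using \<phi>m[of v] by simp
  qed
  then show ?thesis using m n e by (intro exI[of _ "m / (2 * n)"] conjI exI[of _ e]) auto
qed

text \<open>When the squared distance is expanded, \<open>m\<^sup>2 \<le> c * L\<close> makes the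
  quadratic term of the ideal step \<open>a *\<^sub>R u\<close> at most half of the linear gain for
  a distance of \<open>L * a\<close>. This leaves \<open>(L - c / 2) * a\<close>, and the error of
  the actual move costs half of that improvement.\<close>

lemma greedy_step:
  fixes z y u y' :: "'e::euclidean_space"
  assumes c: "0 < c" and L: "2 * c \<le> L" "m\<^sup>2 \<le> c * L" and a: "0 \<le> a"
    and y: "norm (z - y) \<le> L * a" and u: "norm u \<le> m" "c * norm (z - y) \<le> u \<bullet> (z - y)"
    and y': "norm (y' - y - a *\<^sub>R u) \<le> c / 4 * a"
  shows "norm (z - y') \<le> (L - c / 4) * a"
proof -
  define R where "R = norm (z - y)"
  have R: "0 \<le> R" "R \<le> L * a" using y by (auto simp: R_def)
  have La: "0 \<le> L * a" using R by linarith
  \<comment> \<open>The distance \<open>R\<close> may be much smaller than \<open>L * a\<close>,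
    where the step overshoots; then the left side is at most 0 and the right side is
    nonnegative.\<close>
  have 1: "R * (R - 2 * c * a) \<le> (L * a) * (L * a - 2 * c * a)"
  proof (cases "R \<le> 2 * c * a")
    case True
    then have "R * (R - 2 * c * a) \<le> 0" using R by (intro mult_nonneg_nonpos) auto
    moreover have "2 * c * a \<le> L * a" using L(1) a by (rule mult_right_mono)
    then have "0 \<le> (L * a) * (L * a - 2 * c * a)" by (intro mult_nonneg_nonneg[OF La]) simp
    ultimately show ?thesis by linarith
  next
    case False
    then show ?thesis using R La by (intro mult_mono) auto
  qed
  have "(norm u)\<^sup>2 \<le> c * L" using power_mono[OF u(1) norm_ge_zero, of 2] L(2) by linarith
  then have 2: "a\<^sup>2 * (norm u)\<^sup>2 \<le> a\<^sup>2 * (c * L)" by (rule mult_left_mono) simp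
  define w where "w = z - y"
  have 3: "(norm (w - a *\<^sub>R u))\<^sup>2 = R\<^sup>2 - 2 * (a * (u \<bullet> w)) + a\<^sup>2 * (norm u)\<^sup>2"
    unfolding R_def w_def[symmetric] power2_norm_eq_inner
    by (simp add: inner_diff_left inner_diff_right inner_commute[of w u] power2_eq_square right_diff_distrib)
  have 4: "a * (c * R) \<le> a * (u \<bullet> w)"
    using mult_left_mono[OF u(2) a] by (simp add: R_def w_def)
  have 5: "R * (R - 2 * c * a) = R\<^sup>2 - 2 * (a * (c * R))" by (simp add: power2_eq_square algebra_simps)
  have 6: "(L * a) * (L * a - 2 * c * a) + a\<^sup>2 * (c * L) = ((L - c / 2) * a)\<^sup>2 - (c / 2 * a)\<^sup>2"
    by (simp add: power2_eq_square algebra_simps)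
  have 7: "0 \<le> (c / 2 * a)\<^sup>2" by simp
  have "(norm (w - a *\<^sub>R u))\<^sup>2 \<le> ((L - c / 2) * a)\<^sup>2"
    using 1 2 3 4 5 6 7 by linarith
  moreover have "0 \<le> (L - c / 2) * a" using L(1) c a by simp
  ultimately have "norm (z - y - a *\<^sub>R u) \<le> (L - c / 2) * a"
    unfolding w_def by (rule power2_le_imp_le)
  moreover have "norm (z - y') \<le> norm (z - y - a *\<^sub>R u) + norm (y' - y - a *\<^sub>R u)"
    using norm_triangle_ineq4[of "z - y - a *\<^sub>R u" "y' - y - a *\<^sub>R u"] by simp
  ultimately show ?thesis using y' by (simp add: algebra_simps)
qed

text \<open>For brackets of different orders \<open>k\<close>, running the words for time \<open>s\<^sup>K\<^sup>/\<^sup>k\<close> makes all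
  displacements of the common order \<open>s\<^sup>K\<close>.\<close>

lemma bracket_moves:
  fixes x0 :: "'e::euclidean_space"
  assumes S: "open S" and F0: "\<forall>Y\<in>F. smooth_on S Y" "\<forall>Y\<in>F. - Y \<in> F"
    and r: "0 < r" "cball x0 r \<subseteq> S"
    and M: "0 \<le> M" "\<forall>Y\<in>F. \<forall>z\<in>cball x0 r. norm (Y z) \<le> M"
    and span: "span ((\<lambda>Z. Z x0) ` field_brackets F) = UNIV"
  shows "\<exists>K>0. \<exists>c>0. \<exists>C\<ge>0. \<exists>n\<ge>0. \<exists>m. \<exists>s1. 0 < s1 \<and> s1 \<le> 1 \<and> (\<exists>\<rho>>0. \<forall>y\<in>cball x0 \<rho>. \<forall>v. \<forall>s\<in>{0..s1}.
    \<exists>u y' T. T \<le> n * s \<and> traj_reach M (cball x0 r) F T y y' \<and> norm (y' - y - s ^ K *\<^sub>R u) \<le> C * s ^ Suc K \<and>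
      c * norm v \<le> u \<bullet> v \<and> norm u \<le> m)"
proof -
  note F = F0[rule_format]
  let ?B = "cball x0 r"
  obtain Bk where Bk: "finite Bk" "Bk \<subseteq> field_brackets F" "span ((\<lambda>Z. Z x0) ` Bk) = UNIV"
    using span_brackets_finite[OF span] by blast
  have smooth: "smooth_on S Z" if "Z \<in> Bk" for Z
    by (rule field_brackets_smooth[OF S F(1)]) (use that Bk in auto)
  have "x0 \<in> S" using r by auto
  from spanning_fields_detect[OF Bk(1,3) S this smooth_on_continuous_on[OF smooth]]
  obtain c d where c: "0 < c" and d: "0 < d" "\<And>y v. y \<in> cball x0 d \<Longrightarrow> \<exists>Z\<in>Bk. c * norm v \<le> \<bar>Z y \<bullet> v\<bar>" by blast
  \<comment> \<open>Negated fields are added so that the sign of the inner product with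
    \<open>v\<close> can be chosen; a negated bracket is the leading coefficient of the inverse
    word.\<close>
  define D where "D = Bk \<union> uminus ` Bk"
  have D: "finite D" using Bk by (simp add: D_def)
  have Dsm: "smooth_on S Z" if "Z \<in> D" for Z
    using that smooth smooth_on_minus[OF S] by (auto simp: D_def fun_Compl_def)
  have "\<forall>Z\<in>D. \<exists>h. case h of (k, w, C) \<Rightarrow> 0 < k \<and> set w \<subseteq> F \<and> 0 \<le> C \<and>
    (\<forall>s x z. 0 \<le> s \<longrightarrow> flow_word ?B w s x z \<longrightarrow> norm (z - x - s ^ k *\<^sub>R Z x) \<le> C * s ^ Suc k)"
  proof
    fix Z assume "Z \<in> D"
    have "\<exists>k w. set w \<subseteq> F \<and> leading_term k (derivation S Z) (word_series (map (derivation S) w))"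
    proof (cases "Z \<in> Bk")
      case True
      then show ?thesis using field_brackets_word[OF S F] Bk(2) by blast
    next
      case False
      then obtain W where W: "W \<in> Bk" "Z = - W" using \<open>Z \<in> D\<close> by (auto simp: D_def)
      obtain k w where w: "set w \<subseteq> F" "leading_term k (derivation S W) (word_series (map (derivation S) w))"
        using field_brackets_word[OF S F] Bk(2) W(1) by blast
      have "map (derivation S) (rev (map uminus w)) = rev (map uminus (map (derivation S) w))"
        by (simp add: rev_map derivation_minus[OF S])
      then have "leading_term k (derivation S Z) (word_series (map (derivation S) (rev (map uminus w))))"
        using leading_term_inverse[OF w(2) word_series_inverse(1)] derivation_minus[OF S, of W] W(2) by simp
      moreover have "set (rev (map uminus w)) \<subseteq> F" using w(1) F(2) by auto
      ultimately show ?thesis by blast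
    qed
    then obtain k w where w: "set w \<subseteq> F" "leading_term k (derivation S Z) (word_series (map (derivation S) w))" by blast
    have "smooth_on S Y" if "Y \<in> set w" for Y using F(1) w(1) that by blast
    from leading_term_displacement[OF S this compact_cball r(2) w(2)] obtain C where
      "0 \<le> C" "\<forall>s x z. 0 \<le> s \<longrightarrow> flow_word ?B w s x z \<longrightarrow> norm (z - x - s ^ k *\<^sub>R Z x) \<le> C * s ^ Suc k" by blast
    then show "\<exists>h. case h of (k, w, C) \<Rightarrow> 0 < k \<and> set w \<subseteq> F \<and> 0 \<le> C \<and>
      (\<forall>s x z. 0 \<le> s \<longrightarrow> flow_word ?B w s x z \<longrightarrow> norm (z - x - s ^ k *\<^sub>R Z x) \<le> C * s ^ Suc k)"
      using w by (intro exI[of _ "(k, w, C)"]) (simp add: leading_term_def)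
  qed
  from bchoice[OF this] obtain h where h: "\<forall>Z\<in>D. case h Z of (k, w, C) \<Rightarrow> 0 < k \<and> set w \<subseteq> F \<and> 0 \<le> C \<and>
    (\<forall>s x z. 0 \<le> s \<longrightarrow> flow_word ?B w s x z \<longrightarrow> norm (z - x - s ^ k *\<^sub>R Z x) \<le> C * s ^ Suc k)" by (elim exE)
  define k where "k Z = fst (h Z)" for Z
  define w where "w Z = fst (snd (h Z))" for Z
  define C where "C Z = snd (snd (h Z))" for Z
  have kwC: "0 < k Z" "set (w Z) \<subseteq> F" "0 \<le> C Z" if "Z \<in> D" for Z
    using h[rule_format, OF that] by (auto simp: k_def w_def C_def case_prod_unfold)
  have disp: "norm (z - x - s ^ k Z *\<^sub>R Z x) \<le> C Z * s ^ Suc (k Z)"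
    if "Z \<in> D" "0 \<le> s" "flow_word ?B (w Z) s x z" for Z s x z
    using h[rule_format, OF that(1)] that(2,3) by (simp add: k_def w_def C_def case_prod_unfold)
  define K where "K = (\<Prod>Z\<in>D. k Z)"
  have K: "0 < K" unfolding K_def by (rule prod_pos) (use kwC in auto)
  define p where "p Z = K div k Z" for Z
  have pk: "p Z * k Z = K" "0 < p Z" if "Z \<in> D" for Z
  proof -
    have "k Z dvd K" unfolding K_def by (rule dvd_prodI[OF D that])
    then show "p Z * k Z = K" by (simp add: p_def)
    then show "0 < p Z" using K by (cases "p Z") auto
  qed
  have "\<forall>Z\<in>D. \<exists>s0>0. \<forall>s\<in>{0..s0}. \<forall>x\<in>cball x0 (r/2). \<exists>z. flow_word ?B (w Z) s x z"
  proof
    fix Z assume Z: "Z \<in> D"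
    have "smooth_on S Y" if "Y \<in> set (w Z)" for Y using F(1) kwC(2)[OF Z] that by blast
    then show "\<exists>s0>0. \<forall>s\<in>{0..s0}. \<forall>x\<in>cball x0 (r/2). \<exists>z. flow_word ?B (w Z) s x z"
      by (rule flow_word_exists[OF _ r(2)]) (use r in auto)
  qed
  from bchoice[OF this] obtain s0 where s0: "\<forall>Z\<in>D. 0 < s0 Z \<and>
    (\<forall>s\<in>{0..s0 Z}. \<forall>x\<in>cball x0 (r/2). \<exists>z. flow_word ?B (w Z) s x z)" by (elim exE)
  \<comment> \<open>The bound 1 ensures \<open>s ^ p Z \<le> s\<close>, so the duration of the word
    and the extra factor in its error are both controlled by \<open>s\<close>.\<close>
  define s1 where "s1 = Min (insert 1 (s0 ` D))"
  have s1: "0 < s1" "s1 \<le> 1" "\<And>Z. Z \<in> D \<Longrightarrow> s1 \<le> s0 Z"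
    using D s0 by (auto simp: s1_def Min_gr_iff)
  have "\<forall>Z\<in>D. \<exists>b\<ge>0. \<forall>y\<in>?B. norm (Z y) \<le> b"
  proof
    fix Z assume "Z \<in> D"
    then have "bounded (Z ` ?B)"
      using continuous_on_subset[OF smooth_on_continuous_on[OF Dsm] r(2)]
      by (intro compact_imp_bounded compact_continuous_image) auto
    then obtain b where "\<forall>y\<in>?B. norm (Z y) \<le> b" by (auto simp: bounded_iff simp del: mem_cball)
    then show "\<exists>b\<ge>0. \<forall>y\<in>?B. norm (Z y) \<le> b"
      by (intro exI[of _ "max b 0"]) (auto intro: max.coboundedI1 simp del: mem_cball)
  qed
  from bchoice[OF this] obtain b where b: "\<forall>Z\<in>D. 0 \<le> b Z \<and> (\<forall>y\<in>?B. norm (Z y) \<le> b Z)" by (elim exE)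
  define \<rho> where "\<rho> = min d (r / 2)"
  define n where "n = (\<Sum>Z\<in>D. real (length (w Z)))"
  have mv: "\<exists>u y' T. T \<le> n * s \<and> traj_reach M ?B F T y y' \<and> norm (y' - y - s ^ K *\<^sub>R u) \<le> (\<Sum>Z\<in>D. C Z) * s ^ Suc K \<and>
      c * norm v \<le> u \<bullet> v \<and> norm u \<le> (\<Sum>Z\<in>D. b Z)"
    if y: "y \<in> cball x0 \<rho>" and s: "s \<in> {0..s1}" for y v s
  proof -
    have yd: "y \<in> cball x0 d" "y \<in> cball x0 (r/2)" "y \<in> ?B" using y r(1) by (auto simp: \<rho>_def)
    obtain W where W: "W \<in> Bk" "c * norm v \<le> \<bar>W y \<bullet> v\<bar>" using d(2)[OF yd(1)] by blast
    obtain Z where Z: "Z \<in> D" "c * norm v \<le> Z y \<bullet> v"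
    proof (cases "0 \<le> W y \<bullet> v")
      case True
      then show ?thesis using that[of W] W by (auto simp: D_def)
    next
      case False
      then show ?thesis using that[of "- W"] W by (auto simp: D_def)
    qed
    have s1': "0 \<le> s" "s \<le> 1" using s s1 by auto
    have sp: "s ^ p Z \<le> s" using power_decreasing[of 1 "p Z" s] pk(2)[OF Z(1)] s1' by simp
    then have "s ^ p Z \<in> {0..s0 Z}" using s s1(3)[OF Z(1)] by auto
    then obtain y' where y': "flow_word ?B (w Z) (s ^ p Z) y y'" using s0 Z(1) yd(2) by blast
    have sp0: "0 \<le> s ^ p Z" using s1' by simp
    have "traj_reach M ?B F (real (length (w Z)) * s ^ p Z) y y'"
      by (rule traj_reach_flow_word[OF y' sp0 kwC(2)[OF Z(1)] _ M(1)]) (use M(2) in blast)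
    moreover have "real (length (w Z)) * s ^ p Z \<le> n * s"
      unfolding n_def using sp s1' D Z(1) by (intro mult_mono member_le_sum) (auto intro: sum_nonneg)
    moreover have "norm (y' - y - s ^ K *\<^sub>R Z y) \<le> (\<Sum>Z\<in>D. C Z) * s ^ Suc K"
    proof -
      have "norm (y' - y - s ^ K *\<^sub>R Z y) \<le> C Z * (s ^ p Z) ^ Suc (k Z)"
        using disp[OF Z(1) sp0 y'] pk(1)[OF Z(1)] by (simp add: power_mult[symmetric])
      also have "(s ^ p Z) ^ Suc (k Z) = s ^ K * s ^ p Z"
        using pk(1)[OF Z(1)] by (simp add: power_mult[symmetric])
      also have "C Z * (s ^ K * s ^ p Z) \<le> (\<Sum>Z\<in>D. C Z) * (s ^ K * s)"
        using sp s1' D Z(1) kwC(3) by (intro mult_mono member_le_sum sum_nonneg) auto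
      finally show ?thesis by (simp add: mult.commute)
    qed
    moreover have "norm (Z y) \<le> (\<Sum>Z\<in>D. b Z)"
    proof (rule order_trans)
      show "norm (Z y) \<le> b Z" using bspec[OF b Z(1)] yd(3) by blast
      show "b Z \<le> (\<Sum>Z\<in>D. b Z)" by (rule member_le_sum[OF Z(1) _ D]) (use b in simp)
    qed
    ultimately show ?thesis using Z(2) by blast
  qed
  have nn: "0 \<le> n" "0 \<le> (\<Sum>Z\<in>D. C Z)" "0 < \<rho>"
    using kwC(3) d r by (auto simp: n_def \<rho>_def intro: sum_nonneg)
  show ?thesis
    by (rule exI[of _ K], rule conjI[OF K], rule exI[of _ c], rule conjI[OF c], rule exI, rule conjI[OF nn(2)],
        rule exI, rule conjI[OF nn(1)], rule exI, rule exI[of _ s1], rule conjI[OF s1(1)], rule conjI[OF s1(2)],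
        rule exI, rule conjI[OF nn(3)], intro ballI allI, rule mv)
qed

text \<open>A displacement of size \<open>s ^ K\<close> costs a time proportional to
  \<open>s\<close>. Every greedy step multiplies the bound on the remaining displacement by a fixed
  factor \<theta> below 1, so the durations form a geometric series and the concatenation ends
  exactly at \<open>z\<close>.\<close>

theorem local_reachability:
  fixes x0 :: "'e::euclidean_space"
  assumes S: "open S" and F0: "\<forall>Y\<in>F. smooth_on S Y" "\<forall>Y\<in>F. - Y \<in> F"
    and r: "0 < r" "cball x0 r \<subseteq> S"
    and M: "0 \<le> M" "\<forall>Y\<in>F. \<forall>z\<in>cball x0 r. norm (Y z) \<le> M"
    and span: "span ((\<lambda>Z. Z x0) ` field_brackets F) = UNIV"
    and \<epsilon>: "0 < \<epsilon>"
  shows "\<exists>\<delta>>0. \<forall>y\<in>ball x0 \<delta>. \<forall>z\<in>ball x0 \<delta>. \<exists>T<\<epsilon>. traj_reach M (cball x0 r) F T y z"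
proof -
  let ?B = "cball x0 r"
  obtain K c C n m s1 \<rho> where K: "0 < K" and c: "0 < (c::real)" and C: "0 \<le> C" and n: "0 \<le> n"
    and s1: "0 < s1" "s1 \<le> 1" and \<rho>: "0 < \<rho>"
    and move: "\<forall>y\<in>cball x0 \<rho>. \<forall>v. \<forall>s\<in>{0..s1}.
      \<exists>u y' T. T \<le> n * s \<and> traj_reach M ?B F T y y' \<and> norm (y' - y - s ^ K *\<^sub>R u) \<le> C * s ^ Suc K \<and>
        c * norm v \<le> u \<bullet> v \<and> norm u \<le> m"
    using bracket_moves[OF S F0 r M span] by (elim exE conjE)
  \<comment> \<open>The least value that meets both conditions of
    \<open>greedy_step\<close>.\<close>
  define L where "L = max (2 * c) (m\<^sup>2 / c)"
  have "m\<^sup>2 / c \<le> L" by (simp add: L_def)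
  then have "m\<^sup>2 \<le> c * L" using c by (simp add: pos_divide_le_eq mult.commute)
  moreover have "2 * c \<le> L" by (simp add: L_def)
  ultimately have L: "2 * c \<le> L" "m\<^sup>2 \<le> c * L" "0 < L" using c by auto
  define \<theta> where "\<theta> = 1 - c / (4 * L)"
  have \<theta>: "0 < \<theta>" "\<theta> < 1" "L * \<theta> = L - c / 4" using L c by (auto simp: \<theta>_def field_simps)
  \<comment> \<open>Displacements scale as the \<open>K\<close>-th power of the time parameter:
    shrinking them by \<theta> means shrinking the times by \<open>q\<close>.\<close>
  define q where "q = root K \<theta>"
  have q: "0 < q" "q < 1" "q ^ K = \<theta>"
    using \<theta> K by (auto simp: q_def real_root_pow_pos2)
  \<comment> \<open>The bounds in turn: the moves are available up to \<open>s1\<close>; the error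
    \<open>C * s\<close> stays below \<open>c / 4\<close>, as \<open>greedy_step\<close> asks; the
    iterates stay within distance \<rho> of \<open>x0\<close>; and the total time, at most
    \<open>n * s / (1 - q)\<close>, stays below \<epsilon>.\<close>
  define s where "s = min s1 (min (c / (4 * (C + 1))) (min (\<rho> / (2 * L)) (\<epsilon> * (1 - q) / (2 * (n + 1)))))"
  have s: "0 < s" "s \<le> s1" "s \<le> c / (4 * (C + 1))" "s \<le> \<rho> / (2 * L)" "s \<le> \<epsilon> * (1 - q) / (2 * (n + 1))"
    using s1 c C \<rho> L \<epsilon> q n by (auto simp: s_def)
  have Cs: "C * s \<le> c / 4"
  proof -
    have "s * (4 * (C + 1)) \<le> c" using s(3) C by (subst (asm) pos_le_divide_eq) auto
    then show ?thesis using s(1) by (simp add: algebra_simps)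
  qed
  have Ls: "L * s ^ K \<le> \<rho> / 2"
  proof -
    have "s ^ K \<le> s" using power_decreasing[of 1 K s] K s s1 by simp
    then have "L * s ^ K \<le> L * (\<rho> / (2 * L))" using s L by (intro mult_left_mono) auto
    then show ?thesis using L by simp
  qed
  have sq: "s * q ^ i \<in> {0..s1}" "s * q ^ i \<le> s" for i
  proof -
    have "q ^ i \<le> 1" using q by (intro power_le_one) auto
    then show "s * q ^ i \<le> s" using s by (simp add: mult_left_le)
    then show "s * q ^ i \<in> {0..s1}" using s(1) q(1) order_trans[OF _ s(2)] by auto
  qed
  have main: "\<exists>T<\<epsilon>. traj_reach M ?B F T y z" if zy: "norm (z - y) \<le> L * s ^ K" and z: "z \<in> cball x0 (\<rho> / 2)" for y z
  proof -
    have "\<exists>f. \<forall>i. norm (z - f i) \<le> L * (s * q ^ i) ^ K \<and> (i = 0 \<longrightarrow> f i = y) \<and>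
        (\<exists>T. T \<le> n * (s * q ^ i) \<and> traj_reach M ?B F T (f i) (f (Suc i)))"
    proof -
      have "\<exists>f. \<forall>i. (norm (z - f i) \<le> L * (s * q ^ i) ^ K \<and> (i = 0 \<longrightarrow> f i = y)) \<and>
          (\<exists>T. T \<le> n * (s * q ^ i) \<and> traj_reach M ?B F T (f i) (f (Suc i)))"
      proof (rule dependent_nat_choice)
        show "\<exists>x. norm (z - x) \<le> L * (s * q ^ 0) ^ K \<and> ((0::nat) = 0 \<longrightarrow> x = y)" using zy by auto
        fix x i assume x: "norm (z - x) \<le> L * (s * q ^ i) ^ K \<and> (i = 0 \<longrightarrow> x = y)"
        define t where "t = s * q ^ i"
        have t: "t \<in> {0..s1}" "t \<le> s" using sq[of i] by (auto simp: t_def)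
        have "L * t ^ K \<le> L * s ^ K" using t L by (intro mult_left_mono power_mono) auto
        then have "norm (z - x) \<le> \<rho> / 2" using x Ls by (simp add: t_def)
        then have "x \<in> cball x0 \<rho>"
          using z dist_triangle[of x0 x z] by (simp add: dist_norm)
        then obtain u x' T where x': "T \<le> n * t" "traj_reach M ?B F T x x'"
          "norm (x' - x - t ^ K *\<^sub>R u) \<le> C * t ^ Suc K" "c * norm (z - x) \<le> u \<bullet> (z - x)" "norm u \<le> m"
          using move t(1) by blast
        have "C * t ^ Suc K = (C * t) * t ^ K" by simp
        also have "\<dots> \<le> c / 4 * t ^ K"
          using order_trans[OF mult_left_mono[OF t(2) C] Cs] t by (intro mult_right_mono) auto
        finally have "norm (x' - x - t ^ K *\<^sub>R u) \<le> c / 4 * t ^ K" using x'(3) by simp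
        from greedy_step[OF c L(1,2) _ _ x'(5,4) this]
        have "norm (z - x') \<le> (L - c / 4) * t ^ K" using x t by (simp add: t_def)
        also have "\<dots> = L * (s * q ^ Suc i) ^ K"
          using q(3) \<theta>(3) by (simp add: t_def power_mult_distrib power_mult[symmetric] mult.commute)
        finally show "\<exists>x'. (norm (z - x') \<le> L * (s * q ^ Suc i) ^ K \<and> (Suc i = 0 \<longrightarrow> x' = y)) \<and>
          (\<exists>T. T \<le> n * (s * q ^ i) \<and> traj_reach M ?B F T x x')"
          using x'(1,2) by (auto simp: t_def)
      qed
      then show ?thesis by blast
    qed
    then obtain f where f: "\<forall>i. norm (z - f i) \<le> L * (s * q ^ i) ^ K \<and> (i = 0 \<longrightarrow> f i = y) \<and>
        (\<exists>T. T \<le> n * (s * q ^ i) \<and> traj_reach M ?B F T (f i) (f (Suc i)))" by (elim exE)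
    have "\<forall>i. \<exists>T. T \<le> n * (s * q ^ i) \<and> traj_reach M ?B F T (f i) (f (Suc i))" using f by simp
    from choice[OF this] obtain \<tau> where \<tau>: "\<And>i. \<tau> i \<le> n * (s * q ^ i)" "\<And>i. traj_reach M ?B F (\<tau> i) (f i) (f (Suc i))"
      by auto
    have \<tau>0: "0 \<le> \<tau> i" for i using \<tau>(2)[of i] by (simp add: traj_reach_def)
    have geo: "(\<lambda>i. n * (s * q ^ i)) sums (n * (s * (1 / (1 - q))))"
      using q by (intro sums_mult geometric_sums) auto
    have sum: "summable \<tau>"
      by (rule summable_comparison_test[OF _ sums_summable[OF geo]]) (use \<tau> \<tau>0 in auto)
    have "suminf \<tau> \<le> n * s / (1 - q)"
      using suminf_le[OF \<tau>(1) sum sums_summable[OF geo]] sums_unique[OF geo] by simp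
    moreover have "s * (2 * (n + 1)) \<le> \<epsilon> * (1 - q)" using s(5) n by (subst (asm) pos_le_divide_eq) auto
    moreover have "0 \<le> n * s" using n s by simp
    moreover from calculation(2,3) have "n * s < \<epsilon> * (1 - q)" using s(1) by (simp add: algebra_simps)
    then have "n * s / (1 - q) < \<epsilon>" using q by (simp add: pos_divide_less_eq)
    ultimately have "suminf \<tau> < \<epsilon>" by linarith
    moreover have "f \<longlonglongrightarrow> z"
    proof -
      have "(\<lambda>i. L * (s * q ^ i) ^ K) \<longlonglongrightarrow> L * (s * 0) ^ K"
        using q by (intro tendsto_intros LIMSEQ_power_zero) auto
      then have "(\<lambda>i. L * (s * q ^ i) ^ K) \<longlonglongrightarrow> 0" using K by (simp add: zero_power)
      then have "(\<lambda>i. norm (f i - z)) \<longlonglongrightarrow> 0"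
        by (rule tendsto_sandwich[OF _ _ tendsto_const, rotated 2]) (use f in \<open>auto simp: norm_minus_commute\<close>)
      then show ?thesis by (simp add: tendsto_norm_zero_iff LIM_zero_iff)
    qed
    moreover have "f 0 = y" using f by simp
    ultimately show ?thesis
      using traj_reach_infinite[of M ?B F \<tau> f z] \<tau>(2) sum M(1) by auto
  qed
  define \<delta> where "\<delta> = min (\<rho> / 2) (L * s ^ K / 2)"
  have "0 < \<delta>" using \<rho> L s by (simp add: \<delta>_def)
  moreover have "\<exists>T<\<epsilon>. traj_reach M ?B F T y z" if "y \<in> ball x0 \<delta>" "z \<in> ball x0 \<delta>" for y z
  proof (rule main)
    have "dist z y < 2 * \<delta>" using that dist_triangle[of z y x0] by (simp add: dist_commute)
    then show "norm (z - y) \<le> L * s ^ K" by (simp add: \<delta>_def dist_norm)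
    show "z \<in> cball x0 (\<rho> / 2)" using that by (simp add: \<delta>_def)
  qed
  ultimately show ?thesis by blast
qed

section \<open>From coordinates to the manifold: charts, tangent vectors, adapted frames\<close>

section \<open>Composition of absolutely continuous curves with continuously differentiable maps\<close>

text \<open>A chord between points of \<open>S\<close> may leave \<open>S\<close>, so the estimate
  is confined to short chords. Finitely many balls cover \<open>K\<close>, and doubling their radii
  puts both ends of a short chord into one ball, where a local constant applies.\<close>

lemma C1_uniform_local_lipschitz:
  fixes f :: "'e::euclidean_space \<Rightarrow> 'b::real_normed_vector"
  assumes f: "Ck_on 1 S f" and S: "open S" and K: "compact K" "K \<subseteq> S"
  shows "\<exists>\<rho>>0. \<exists>L\<ge>0. \<forall>y\<in>K. \<forall>z. dist y z < \<rho> \<longrightarrow> dist (f y) (f z) \<le> L * dist y z"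
proof -
  have "\<forall>y\<in>K. \<exists>r>0. cball y (2 * r) \<subseteq> S"
  proof
    fix y assume "y \<in> K"
    then obtain e where "0 < e" "cball y e \<subseteq> S" using S K(2) open_contains_cball by blast
    then show "\<exists>r>0. cball y (2 * r) \<subseteq> S" by (intro exI[of _ "e/2"]) auto
  qed
  from bchoice[OF this] obtain r where r: "\<forall>y\<in>K. 0 < r y \<and> cball y (2 * r y) \<subseteq> S" by (elim exE)
  have "\<forall>y\<in>K. \<exists>L. L-lipschitz_on (cball y (2 * r y)) f"
    using r by (intro ballI C1_lipschitz_cball[OF f]) blast
  from bchoice[OF this] obtain L where L: "\<forall>y\<in>K. (L y)-lipschitz_on (cball y (2 * r y)) f" by (elim exE)
  have "K \<subseteq> (\<Union>y\<in>K. ball y (r y))" using r by force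
  then obtain D where D: "D \<subseteq> K" "finite D" "K \<subseteq> (\<Union>y\<in>D. ball y (r y))"
    using compactE_image[OF K(1), of K "\<lambda>y. ball y (r y)"] by auto
  define \<rho> where "\<rho> = Min (insert 1 (r ` D))"
  have \<rho>: "0 < \<rho>" "\<And>y. y \<in> D \<Longrightarrow> \<rho> \<le> r y"
    using D r by (auto simp: \<rho>_def Min_gr_iff)
  have L0: "0 \<le> L y" if "y \<in> D" for y using L D(1) that lipschitz_on_nonneg by blast
  have "dist (f y) (f z) \<le> (\<Sum>x\<in>D. L x) * dist y z" if y: "y \<in> K" and yz: "dist y z < \<rho>" for y z
  proof -
    obtain x where x: "x \<in> D" "dist x y < r x" using D(3) y by auto
    have "dist x z \<le> dist x y + dist y z" by (rule dist_triangle)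
    moreover have "dist x y \<le> 2 * r x" using x(2) zero_le_dist[of x y] by linarith
    ultimately have "y \<in> cball x (2 * r x)" "z \<in> cball x (2 * r x)"
      using x yz \<rho>(2)[OF x(1)] by auto
    then have "dist (f y) (f z) \<le> L x * dist y z"
      using lipschitz_onD[OF bspec[OF L], of x y z] x(1) D(1) by blast
    also have "\<dots> \<le> (\<Sum>x\<in>D. L x) * dist y z"
      using member_le_sum[OF x(1) _ D(2), of L] L0 by (intro mult_right_mono) auto
    finally show ?thesis .
  qed
  moreover have "0 \<le> (\<Sum>x\<in>D. L x)" using L0 by (intro sum_nonneg)
  ultimately show ?thesis using \<rho>(1) by blast
qed

lemma absolutely_continuous_imp_uniform:
  assumes "absolutely_continuous_on_interval a b x" "0 < \<epsilon>"
  shows "\<exists>\<delta>>0. \<forall>s t. a \<le> s \<longrightarrow> s \<le> t \<longrightarrow> t \<le> b \<longrightarrow> t - s < \<delta> \<longrightarrow> dist (x s) (x t) < \<epsilon>"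
proof -
  obtain \<delta> where \<delta>: "0 < \<delta>" "\<forall>D :: (real \<times> real) set.
       finite D \<and> (\<forall>(s, t)\<in>D. a \<le> s \<and> s \<le> t \<and> t \<le> b) \<and>
       pairwise (\<lambda>(s, t) (s', t'). {s<..<t} \<inter> {s'<..<t'} = {}) D \<and>
       (\<Sum>(s, t)\<in>D. t - s) < \<delta> \<longrightarrow> (\<Sum>(s, t)\<in>D. dist (x s) (x t)) < \<epsilon>"
    using assms unfolding absolutely_continuous_on_interval_def by meson
  show ?thesis
  proof (intro exI[of _ \<delta>] conjI allI impI \<delta>(1))
    fix s t assume "a \<le> s" "s \<le> t" "t \<le> b" "t - s < \<delta>"
    then show "dist (x s) (x t) < \<epsilon>" using spec[OF \<delta>(2), of "{(s, t)}"] by simp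
  qed
qed

text \<open>In a family of total length below \<open>d\<close> each interval is short enough for its
  end points to be mapped to points at distance below \<rho>, where the Lipschitz estimate is
  valid.\<close>

lemma absolutely_continuous_compose_C1:
  fixes f :: "'e::euclidean_space \<Rightarrow> 'b::real_normed_vector" and x :: "real \<Rightarrow> 'e"
  assumes f: "Ck_on 1 S f" and S: "open S" and x: "absolutely_continuous_on_interval a b x"
    and cont: "continuous_on {a..b} x" and sub: "x ` {a..b} \<subseteq> S"
  shows "absolutely_continuous_on_interval a b (\<lambda>t. f (x t))"
proof (rule absolutely_continuousI_indexed)
  fix \<epsilon> :: real assume "0 < \<epsilon>"
  have "compact (x ` {a..b})" using cont by (intro compact_continuous_image) auto
  from C1_uniform_local_lipschitz[OF f S this sub] obtain \<rho> L where \<rho>: "0 < \<rho>" and L: "0 \<le> L"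
    and lip: "\<forall>y\<in>x ` {a..b}. \<forall>z. dist y z < \<rho> \<longrightarrow> dist (f y) (f z) \<le> L * dist y z" by blast
  obtain d where d: "0 < d" "\<forall>s t. a \<le> s \<longrightarrow> s \<le> t \<longrightarrow> t \<le> b \<longrightarrow> t - s < d \<longrightarrow> dist (x s) (x t) < \<rho>"
    using absolutely_continuous_imp_uniform[OF x \<rho>] by blast
  have "0 < \<epsilon> / (L + 1)" using \<open>0 < \<epsilon>\<close> L by simp
  from absolutely_continuousD_indexed[OF x this, where 'i = "real \<times> real"]
  obtain \<delta> where "0 < \<delta>" and \<delta>: "\<forall>(I :: (real \<times> real) set) s t. finite I \<longrightarrow>
      (\<forall>i\<in>I. a \<le> s i \<and> s i \<le> t i \<and> t i \<le> b) \<longrightarrow>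
      (\<forall>i\<in>I. \<forall>j\<in>I. i \<noteq> j \<longrightarrow> {s i<..<t i} \<inter> {s j<..<t j} = {}) \<longrightarrow>
      (\<Sum>i\<in>I. t i - s i) < \<delta> \<longrightarrow> (\<Sum>i\<in>I. dist (x (s i)) (x (t i))) < \<epsilon> / (L + 1)"
    by (elim exE conjE)
  show "\<exists>\<delta>>0. \<forall>(I :: (real \<times> real) set) s t. finite I \<longrightarrow>
       (\<forall>i\<in>I. a \<le> s i \<and> s i \<le> t i \<and> t i \<le> b) \<longrightarrow>
       (\<forall>i\<in>I. \<forall>j\<in>I. i \<noteq> j \<longrightarrow> {s i<..<t i} \<inter> {s j<..<t j} = {}) \<longrightarrow>
       (\<Sum>i\<in>I. t i - s i) < \<delta> \<longrightarrow> (\<Sum>i\<in>I. dist (f (x (s i))) (f (x (t i)))) < \<epsilon>"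
  proof (intro exI[of _ "min \<delta> d"] conjI allI impI)
    show "0 < min \<delta> d" using \<open>0 < \<delta>\<close> d by simp
    fix I :: "(real \<times> real) set" and s t :: "real \<times> real \<Rightarrow> real"
    assume h: "finite I" "\<forall>i\<in>I. a \<le> s i \<and> s i \<le> t i \<and> t i \<le> b"
      "\<forall>i\<in>I. \<forall>j\<in>I. i \<noteq> j \<longrightarrow> {s i<..<t i} \<inter> {s j<..<t j} = {}" "(\<Sum>i\<in>I. t i - s i) < min \<delta> d"
    have "(\<Sum>i\<in>I. dist (f (x (s i))) (f (x (t i)))) \<le> (\<Sum>i\<in>I. (L + 1) * dist (x (s i)) (x (t i)))"
    proof (rule sum_mono)
      fix i assume i: "i \<in> I"
      have "t i - s i \<le> (\<Sum>i\<in>I. t i - s i)" by (rule member_le_sum[OF i]) (use h in auto)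
      then have "dist (x (s i)) (x (t i)) < \<rho>" using d(2) h(2,4) i by simp
      moreover have "x (s i) \<in> x ` {a..b}" using h(2) i by auto
      ultimately have "dist (f (x (s i))) (f (x (t i))) \<le> L * dist (x (s i)) (x (t i))" using lip by blast
      also have "\<dots> \<le> (L + 1) * dist (x (s i)) (x (t i))" by (simp add: mult_right_mono)
      finally show "dist (f (x (s i))) (f (x (t i))) \<le> (L + 1) * dist (x (s i)) (x (t i))" .
    qed
    also have "\<dots> = (L + 1) * (\<Sum>i\<in>I. dist (x (s i)) (x (t i)))" by (simp add: sum_distrib_left)
    also have "\<dots> < (L + 1) * (\<epsilon> / (L + 1))"
      using \<delta>[rule_format, of I s t] h L by (intro mult_strict_left_mono) auto
    also have "\<dots> = \<epsilon>" using L by simp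
    finally show "(\<Sum>i\<in>I. dist (f (x (s i))) (f (x (t i)))) < \<epsilon>" .
  qed
qed

section \<open>Charts and tangent vectors\<close>

locale manifold_atlas =
  fixes A :: "('a::{t2_space,second_countable_topology}, 'e::euclidean_space) chart set"
  assumes atlas: "smooth_atlas A"
begin

lemma chart_open: "c \<in> A \<Longrightarrow> open (fst c)" "c \<in> A \<Longrightarrow> open (snd c ` fst c)"
  and chart_homeo: "c \<in> A \<Longrightarrow> homeomorphism (fst c) (snd c ` fst c) (snd c) (chart_inv c)"
  using atlas by (auto simp: smooth_atlas_def)

lemma chart_exists: "\<exists>c\<in>A. x \<in> fst c"
  using atlas by (auto simp: smooth_atlas_def)

lemma chart_inv_left [simp]: "c \<in> A \<Longrightarrow> x \<in> fst c \<Longrightarrow> chart_inv c (snd c x) = x"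
  using chart_homeo homeomorphism_apply1 by blast

lemma chart_inv_right [simp]: "c \<in> A \<Longrightarrow> u \<in> snd c ` fst c \<Longrightarrow> snd c (chart_inv c u) = u"
  using chart_homeo homeomorphism_apply2 by blast

lemma chart_continuous: "c \<in> A \<Longrightarrow> continuous_on (fst c) (snd c)"
  and chart_inv_continuous: "c \<in> A \<Longrightarrow> continuous_on (snd c ` fst c) (chart_inv c)"
  using chart_homeo unfolding homeomorphism_def by blast+

lemma chart_image_mem:
  assumes "c \<in> A" "W \<subseteq> fst c"
  shows "u \<in> snd c ` W \<longleftrightarrow> u \<in> snd c ` fst c \<and> chart_inv c u \<in> W"
  using assms by (auto simp: image_iff)

lemma chart_image_open:
  assumes c: "c \<in> A" and W: "open W"
  shows "open (snd c ` (W \<inter> fst c))"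
proof -
  have "snd c ` (W \<inter> fst c) = snd c ` fst c \<inter> chart_inv c -` W"
    using chart_image_mem[OF c, of "W \<inter> fst c"] c by auto
  then show ?thesis
    using continuous_open_preimage[OF chart_inv_continuous[OF c] chart_open(2)[OF c] W] by simp
qed

lemma transition_smooth:
  "c \<in> A \<Longrightarrow> c' \<in> A \<Longrightarrow> smooth_on (snd c ` (fst c \<inter> fst c')) (snd c' \<circ> chart_inv c)"
  using atlas by (auto simp: smooth_atlas_def)

lemma transition_has_derivative:
  assumes "c \<in> A" "c' \<in> A" "x \<in> fst c" "x \<in> fst c'"
  shows "((snd c' \<circ> chart_inv c) has_derivative frechet_derivative (snd c' \<circ> chart_inv c) (at (snd c x))) (at (snd c x))"
  using smooth_on_has_derivative[OF transition_smooth[OF assms(1,2)], of "snd c x"] assms by auto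

lemma tangent_zero: "v \<in> tangent_space A x \<Longrightarrow> c \<notin> A \<or> x \<notin> fst c \<Longrightarrow> v c = 0"
  unfolding tangent_space_def by blast

lemma tangent_transform:
  "v \<in> tangent_space A x \<Longrightarrow> c \<in> A \<Longrightarrow> c' \<in> A \<Longrightarrow> x \<in> fst c \<Longrightarrow> x \<in> fst c' \<Longrightarrow>
    v c' = frechet_derivative (snd c' \<circ> chart_inv c) (at (snd c x)) (v c)"
  unfolding tangent_space_def by blast

lemma tangentI:
  assumes "\<And>c. c \<notin> A \<or> x \<notin> fst c \<Longrightarrow> v c = 0"
    and "\<And>c c'. \<lbrakk>c \<in> A; c' \<in> A; x \<in> fst c; x \<in> fst c'\<rbrakk> \<Longrightarrow>
      v c' = frechet_derivative (snd c' \<circ> chart_inv c) (at (snd c x)) (v c)"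
  shows "v \<in> tangent_space A x"
  unfolding tangent_space_def mem_Collect_eq
  by (intro conjI allI ballI impI) (rule assms(1), assumption, elim conjE, rule assms(2))

lemma tangent_eqI:
  assumes "v \<in> tangent_space A x" "w \<in> tangent_space A x" "c \<in> A" "x \<in> fst c" "v c = w c"
  shows "v = w"
proof
  fix c'
  show "v c' = w c'"
    using tangent_transform[OF assms(1,3) _ assms(4), of c'] tangent_transform[OF assms(2,3) _ assms(4), of c']
      tangent_zero[OF assms(1), of c'] tangent_zero[OF assms(2), of c'] assms(5)
    by (cases "c' \<in> A \<and> x \<in> fst c'") auto
qed

lemma subspace_tangent: "subspace (tangent_space A x)"
proof -
  have lin: "linear (frechet_derivative (snd c' \<circ> chart_inv c) (at (snd c x)))"
    if "c \<in> A" "c' \<in> A" "x \<in> fst c" "x \<in> fst c'" for c c'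
    using has_derivative_linear[OF transition_has_derivative[OF that]] .
  show ?thesis
  proof (rule subspaceI)
    show "0 \<in> tangent_space A x" by (rule tangentI) (simp_all add: linear_0[OF lin])
  next
    fix v w assume vw: "v \<in> tangent_space A x" "w \<in> tangent_space A x"
    show "v + w \<in> tangent_space A x"
    proof (rule tangentI)
      show "(v + w) c = 0" if "c \<notin> A \<or> x \<notin> fst c" for c
        using tangent_zero[OF vw(1) that] tangent_zero[OF vw(2) that] by simp
      show "(v + w) c' = frechet_derivative (snd c' \<circ> chart_inv c) (at (snd c x)) ((v + w) c)"
        if "c \<in> A" "c' \<in> A" "x \<in> fst c" "x \<in> fst c'" for c c'
        using tangent_transform[OF vw(1) that] tangent_transform[OF vw(2) that] linear_add[OF lin[OF that]] by simp
    qed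
  next
    fix r v assume v: "v \<in> tangent_space A x"
    show "r *\<^sub>R v \<in> tangent_space A x"
    proof (rule tangentI)
      show "(r *\<^sub>R v) c = 0" if "c \<notin> A \<or> x \<notin> fst c" for c
        using tangent_zero[OF v that] by (simp add: scaleR_fun_def)
      show "(r *\<^sub>R v) c' = frechet_derivative (snd c' \<circ> chart_inv c) (at (snd c x)) ((r *\<^sub>R v) c)"
        if "c \<in> A" "c' \<in> A" "x \<in> fst c" "x \<in> fst c'" for c c'
        using tangent_transform[OF v that] linear_cmul[OF lin[OF that]] by (simp add: scaleR_fun_def)
    qed
  qed
qed

text \<open>The vector \<open>w\<close> is transported from \<open>c\<close> to all other charts; by
  the chain rule on triple overlaps the transported vectors are compatible with each other.\<close>

lemma tangent_exists:
  assumes c: "c \<in> A" "x \<in> fst c"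
  shows "\<exists>v\<in>tangent_space A x. v c = w"
proof -
  define v where "v c' = (if c' \<in> A \<and> x \<in> fst c' then frechet_derivative (snd c' \<circ> chart_inv c) (at (snd c x)) w else 0)" for c'
  have comp: "frechet_derivative (snd c'' \<circ> chart_inv c) (at (snd c x)) w =
      frechet_derivative (snd c'' \<circ> chart_inv c') (at (snd c' x)) (frechet_derivative (snd c' \<circ> chart_inv c) (at (snd c x)) w)"
    if c': "c' \<in> A" "x \<in> fst c'" "c'' \<in> A" "x \<in> fst c''" for c' c''
  proof -
    let ?S = "snd c ` (fst c \<inter> fst c' \<inter> fst c'')"
    have S: "open ?S" "snd c x \<in> ?S"
      using chart_image_open[OF c(1), of "fst c' \<inter> fst c''"] chart_open c c'
      by (auto simp: Int_ac open_Int)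
    have "((snd c'' \<circ> chart_inv c') \<circ> (snd c' \<circ> chart_inv c) has_derivative
        frechet_derivative (snd c'' \<circ> chart_inv c') (at (snd c' x)) \<circ> frechet_derivative (snd c' \<circ> chart_inv c) (at (snd c x))) (at (snd c x))"
      using diff_chain_at[OF transition_has_derivative[OF c(1) c'(1) c(2) c'(2)], of "snd c'' \<circ> chart_inv c'"]
        transition_has_derivative[OF c'(1,3,2,4)] c by simp
    from frechet_derivative_eqI[OF this]
    have "frechet_derivative ((snd c'' \<circ> chart_inv c') \<circ> (snd c' \<circ> chart_inv c)) (at (snd c x)) w =
        frechet_derivative (snd c'' \<circ> chart_inv c') (at (snd c' x)) (frechet_derivative (snd c' \<circ> chart_inv c) (at (snd c x)) w)"
      by simp
    moreover have "frechet_derivative ((snd c'' \<circ> chart_inv c') \<circ> (snd c' \<circ> chart_inv c)) (at (snd c x)) =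
        frechet_derivative (snd c'' \<circ> chart_inv c) (at (snd c x))"
      by (rule frechet_derivative_cong_open[OF S]) (use c c' in auto)
    ultimately show ?thesis by simp
  qed
  have "v \<in> tangent_space A x"
  proof (rule tangentI)
    show "v c' = 0" if "c' \<notin> A \<or> x \<notin> fst c'" for c' using that by (auto simp: v_def)
    show "v c'' = frechet_derivative (snd c'' \<circ> chart_inv c') (at (snd c' x)) (v c')"
      if "c' \<in> A" "c'' \<in> A" "x \<in> fst c'" "x \<in> fst c''" for c' c''
      using comp[OF that(1,3,2,4)] that by (simp add: v_def)
  qed
  moreover have "v c = w"
  proof -
    have "frechet_derivative (snd c \<circ> chart_inv c) (at (snd c x)) = frechet_derivative (\<lambda>u. u) (at (snd c x))"
      by (rule frechet_derivative_cong_open[OF chart_open(2)[OF c(1)]]) (use c in auto)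
    then show ?thesis using c by (simp add: v_def frechet_derivative_ident)
  qed
  ultimately show ?thesis by blast
qed

lemma linear_eval: "linear (\<lambda>v :: ('a, 'e) tangent. v c)"
  by (rule linearI) (simp_all add: scaleR_fun_def)

text \<open>The derivatives are two-sided and refer to no fixed interval, in contrast to
  \<open>velocity\<close>; this suits restricting, joining and rescaling paths.\<close>

definition has_velocity :: "(real \<Rightarrow> 'a) \<Rightarrow> ('a, 'e) tangent \<Rightarrow> real \<Rightarrow> bool"
  where "has_velocity \<gamma> v t \<longleftrightarrow> v \<in> tangent_space A (\<gamma> t) \<and>
    (\<forall>c\<in>A. \<gamma> t \<in> fst c \<longrightarrow> (snd c \<circ> \<gamma> has_vector_derivative v c) (at t))"

text \<open>One chart is enough, since the derivative passes to the others through the transition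
  maps. The path must stay in \<open>fst c\<close> near \<open>t\<close>, because only there
  \<open>chart_inv c\<close> undoes \<open>snd c\<close>.\<close>

lemma has_velocityI:
  assumes c: "c \<in> A" "\<gamma> t \<in> fst c" and v: "v \<in> tangent_space A (\<gamma> t)"
    and der: "(snd c \<circ> \<gamma> has_vector_derivative v c) (at t)"
    and ev: "\<forall>\<^sub>F s in nhds t. \<gamma> s \<in> fst c"
  shows "has_velocity \<gamma> v t"
  unfolding has_velocity_def
proof (intro conjI v ballI impI)
  fix c' assume c': "c' \<in> A" "\<gamma> t \<in> fst c'"
  have "((snd c' \<circ> chart_inv c) \<circ> (snd c \<circ> \<gamma>) has_vector_derivative
      frechet_derivative (snd c' \<circ> chart_inv c) (at (snd c (\<gamma> t))) (v c)) (at t)"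
    using vector_derivative_diff_chain_within[OF der[unfolded has_vector_derivative_def[symmetric]], of "snd c' \<circ> chart_inv c"]
      has_derivative_at_withinI[OF transition_has_derivative[OF c(1) c'(1) c(2) c'(2)]] by simp
  then have "((snd c' \<circ> chart_inv c) \<circ> (snd c \<circ> \<gamma>) has_vector_derivative v c') (at t)"
    using tangent_transform[OF v c(1) c'(1) c(2) c'(2)] by simp
  note D = this
  obtain W where W: "open W" "t \<in> W" "\<forall>s\<in>W. \<gamma> s \<in> fst c"
    using ev unfolding eventually_nhds by blast
  show "(snd c' \<circ> \<gamma> has_vector_derivative v c') (at t)"
    by (rule has_vector_derivative_transform_within_open[OF D W(1,2)]) (use W(3) c in simp)
qed

lemma has_velocity_unique: "has_velocity \<gamma> v t \<Longrightarrow> has_velocity \<gamma> w t \<Longrightarrow> v = w"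
  using chart_exists[of "\<gamma> t"] unfolding has_velocity_def
  by (blast intro: tangent_eqI vector_derivative_unique_at)

lemma has_velocity_cong:
  assumes "\<forall>\<^sub>F s in nhds t. \<gamma> s = \<eta> s" "has_velocity \<gamma> v t"
  shows "has_velocity \<eta> v t"
proof -
  have eq: "\<gamma> t = \<eta> t" using assms(1) by (rule eventually_nhds_x_imp_x)
  have "(snd c \<circ> \<eta> has_vector_derivative d) (at t)" if "(snd c \<circ> \<gamma> has_vector_derivative d) (at t)" for c :: "('a, 'e) chart" and d
  proof -
    obtain W where W: "open W" "t \<in> W" "\<forall>s\<in>W. \<gamma> s = \<eta> s" using assms(1) unfolding eventually_nhds by blast
    show ?thesis by (rule has_vector_derivative_transform_within_open[OF that W(1,2)]) (use W(3) in simp)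
  qed
  then show ?thesis using assms(2) eq by (simp add: has_velocity_def)
qed

lemma has_velocity_affine:
  assumes "has_velocity \<gamma> v (p + q * t)"
  shows "has_velocity (\<lambda>t. \<gamma> (p + q * t)) (q *\<^sub>R v) t"
proof -
  have aff: "((\<lambda>t. p + q * t) has_vector_derivative q) (at t)"
    by (auto intro!: derivative_eq_intros simp: has_vector_derivative_def)
  have "(snd c \<circ> (\<lambda>t. \<gamma> (p + q * t)) has_vector_derivative q *\<^sub>R v c) (at t)"
    if "(snd c \<circ> \<gamma> has_vector_derivative v c) (at (p + q * t))" for c
    using vector_diff_chain_at[OF aff that] by (simp add: o_def)
  moreover have "q *\<^sub>R v \<in> tangent_space A (\<gamma> (p + q * t))"
    using assms by (intro subspace_scale[OF subspace_tangent]) (simp add: has_velocity_def)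
  ultimately show ?thesis using assms by (auto simp: has_velocity_def scaleR_fun_def)
qed

end

section \<open>The sub-Riemannian structure in an adapted frame\<close>

lemma inner_product_onD:
  assumes "inner_product_on S b"
  shows inner_product_on_sym: "u \<in> S \<Longrightarrow> v \<in> S \<Longrightarrow> b u v = b v u"
    and inner_product_on_add: "u \<in> S \<Longrightarrow> v \<in> S \<Longrightarrow> w \<in> S \<Longrightarrow> b (u + v) w = b u w + b v w"
    and inner_product_on_scale: "u \<in> S \<Longrightarrow> v \<in> S \<Longrightarrow> b (r *\<^sub>R u) v = r * b u v"
    and inner_product_on_pos: "v \<in> S \<Longrightarrow> v \<noteq> 0 \<Longrightarrow> 0 < b v v"
  using assms unfolding inner_product_on_def by auto

lemma inner_product_on_0_left:
  assumes "inner_product_on S b" "subspace S" "w \<in> S"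
  shows "b 0 w = 0"
  using inner_product_on_scale[OF assms(1) subspace_0[OF assms(2)] assms(3), of 0] by simp

lemma inner_product_on_sum_left:
  assumes b: "inner_product_on S b" "subspace S" and w: "w \<in> S" and f: "\<And>i. i \<in> I \<Longrightarrow> f i \<in> S"
  shows "b (\<Sum>i\<in>I. a i *\<^sub>R f i) w = (\<Sum>i\<in>I. a i * b (f i) w)"
  using f
proof (induction I rule: infinite_finite_induct)
  case (insert i I)
  have S: "a i *\<^sub>R f i \<in> S" "(\<Sum>i\<in>I. a i *\<^sub>R f i) \<in> S"
    using insert.prems by (auto intro!: subspace_sum[OF b(2)] subspace_scale[OF b(2)])
  have "b (\<Sum>i\<in>insert i I. a i *\<^sub>R f i) w = b (a i *\<^sub>R f i) w + b (\<Sum>i\<in>I. a i *\<^sub>R f i) w"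
    using inner_product_on_add[OF b(1) S w] insert.hyps by simp
  moreover have "b (a i *\<^sub>R f i) w = a i * b (f i) w"
    using inner_product_on_scale[OF b(1) _ w] insert.prems by simp
  moreover have "b (\<Sum>i\<in>I. a i *\<^sub>R f i) w = (\<Sum>i\<in>I. a i * b (f i) w)"
    using insert.IH insert.prems by simp
  ultimately show ?case using insert.hyps by simp
qed (simp_all add: inner_product_on_0_left[OF b w])

lemma inner_product_on_sum:
  assumes b: "inner_product_on S b" "subspace S" and f: "\<And>i. i \<in> I \<Longrightarrow> f i \<in> S"
  shows "b (\<Sum>i\<in>I. a i *\<^sub>R f i) (\<Sum>i\<in>I. a i *\<^sub>R f i) = (\<Sum>i\<in>I. \<Sum>j\<in>I. a i * a j * b (f i) (f j))"
proof -
  let ?v = "\<Sum>i\<in>I. a i *\<^sub>R f i"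
  have v: "?v \<in> S" using f by (auto intro!: subspace_sum[OF b(2)] subspace_scale[OF b(2)])
  have "b ?v ?v = (\<Sum>i\<in>I. a i * b (f i) ?v)" by (rule inner_product_on_sum_left[OF b v f])
  also have "\<dots> = (\<Sum>i\<in>I. \<Sum>j\<in>I. a i * a j * b (f i) (f j))"
  proof (rule sum.cong[OF refl])
    fix i assume i: "i \<in> I"
    have "b (f i) ?v = b ?v (f i)" by (rule inner_product_on_sym[OF b(1) f[OF i] v])
    also have "\<dots> = (\<Sum>j\<in>I. a j * b (f j) (f i))" by (rule inner_product_on_sum_left[OF b f[OF i] f])
    also have "\<dots> = (\<Sum>j\<in>I. a j * b (f i) (f j))"
      by (rule sum.cong[OF refl]) (simp add: inner_product_on_sym[OF b(1) f f[OF i]])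
    finally show "a i * b (f i) ?v = (\<Sum>j\<in>I. a i * a j * b (f i) (f j))"
      by (simp add: sum_distrib_left mult.assoc)
  qed
  finally show ?thesis .
qed

locale sub_riemannian = manifold_atlas A
  for A :: "('a::{t2_space,second_countable_topology}, 'e::euclidean_space) chart set" +
  fixes \<Delta> :: "('a, 'e) distribution" and g :: "('a, 'e) metric_field"
  assumes metric: "smooth_metric_on A \<Delta> g" and nonhol: "nonholonomic A \<Delta>"
begin

lemma frame_exists:
  "\<exists>U m X. x \<in> U \<and> local_frame A \<Delta> U m X \<and>
    (\<forall>y\<in>U. span ((\<lambda>Z. Z y) ` iterated_brackets A (X ` {..<m})) = tangent_space A y)"
  using nonhol by (simp add: nonholonomic_def)

lemma subspace_Delta: "subspace (\<Delta> x)"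
  and Delta_tangent: "v \<in> \<Delta> x \<Longrightarrow> v \<in> tangent_space A x"
proof -
  obtain U m X where "x \<in> U" and f: "local_frame A \<Delta> U m X" using frame_exists by blast
  then have \<Delta>: "span ((\<lambda>i. X i x) ` {..<m}) = \<Delta> x" and X: "\<And>i. i < m \<Longrightarrow> X i x \<in> tangent_space A x"
    by (auto simp: local_frame_def smooth_vector_field_def)
  show "subspace (\<Delta> x)" unfolding \<Delta>[symmetric] by (rule subspace_span)
  have "\<Delta> x \<subseteq> tangent_space A x" unfolding \<Delta>[symmetric]
    by (rule span_minimal[OF _ subspace_tangent]) (use X in auto)
  then show "v \<in> \<Delta> x \<Longrightarrow> v \<in> tangent_space A x" by blast
qed

lemma inner_product_g: "inner_product_on (\<Delta> x) (g x)"
  using metric by (simp add: smooth_metric_on_def)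

lemma g_pos: "v \<in> \<Delta> x \<Longrightarrow> v \<noteq> 0 \<Longrightarrow> 0 < g x v v"
  by (rule inner_product_on_pos[OF inner_product_g])

lemma g_nonneg: "v \<in> \<Delta> x \<Longrightarrow> 0 \<le> g x v v"
  using g_pos[of v x] inner_product_on_0_left[OF inner_product_g subspace_Delta, of 0 x]
    subspace_0[OF subspace_Delta] by (cases "v = 0") (auto simp: less_imp_le)

lemma g_scale: "v \<in> \<Delta> x \<Longrightarrow> g x (r *\<^sub>R v) (r *\<^sub>R v) = r\<^sup>2 * g x v v"
  using inner_product_on_sum[OF inner_product_g subspace_Delta, of "{()}" "\<lambda>_. v" x "\<lambda>_. r"]
  by (simp add: power2_eq_square)

end

locale framed_chart = sub_riemannian A \<Delta> g
  for A :: "('a::{t2_space,second_countable_topology}, 'e::euclidean_space) chart set" and \<Delta> g +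
  fixes c :: "('a, 'e) chart" and U :: "'a set" and m :: nat and X :: "nat \<Rightarrow> 'a \<Rightarrow> ('a, 'e) tangent" and x0 :: 'a
  assumes c: "c \<in> A" "x0 \<in> fst c" and x0: "x0 \<in> U" and frame: "local_frame A \<Delta> U m X"
    and brackets_span: "\<And>y. y \<in> U \<Longrightarrow>
      span ((\<lambda>Z. Z y) ` iterated_brackets A (X ` {..<m})) = tangent_space A y"
begin

definition Om :: "'e set" where "Om = snd c ` (U \<inter> fst c)"
definition Xc :: "nat \<Rightarrow> 'e \<Rightarrow> 'e" where "Xc i u = X i (chart_inv c u) c"
text \<open>The Gram matrix of the frame, read in the chart \<open>c\<close>.\<close>

definition G :: "nat \<Rightarrow> nat \<Rightarrow> 'e \<Rightarrow> real"
  where "G i j u = g (chart_inv c u) (X i (chart_inv c u)) (X j (chart_inv c u))"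

abbreviation "u0 \<equiv> snd c x0"

lemma open_U: "open U" using frame by (simp add: local_frame_def)

lemma open_Om: "open Om"
  unfolding Om_def by (rule chart_image_open[OF c(1) open_U])

lemma u0_mem: "u0 \<in> Om" using c x0 by (auto simp: Om_def)

lemma Om_sub: "Om \<subseteq> snd c ` fst c" by (auto simp: Om_def)

lemma Om_inv: "u \<in> Om \<Longrightarrow> chart_inv c u \<in> U \<inter> fst c" "u \<in> Om \<Longrightarrow> snd c (chart_inv c u) = u"
  using c by (auto simp: Om_def)

lemma Om_mem: "x \<in> fst c \<Longrightarrow> snd c x \<in> Om \<Longrightarrow> x \<in> U"
  using Om_inv(1)[of "snd c x"] c by simp

lemma frame_field: "i < m \<Longrightarrow> smooth_vector_field A U (X i)"
  using frame by (simp add: local_frame_def)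

lemma X_smooth: "i < m \<Longrightarrow> smooth_on Om (Xc i)"
  using frame_field[of i] c(1) unfolding smooth_vector_field_def Om_def Xc_def[abs_def] by blast

lemma X_Delta: "i < m \<Longrightarrow> x \<in> U \<Longrightarrow> X i x \<in> \<Delta> x"
  using frame span_superset[of "(\<lambda>i. X i x) ` {..<m}"] by (auto simp: local_frame_def)

lemma sum_X_Delta: "x \<in> U \<Longrightarrow> (\<Sum>i<m. a i *\<^sub>R X i x) \<in> \<Delta> x"
  using X_Delta by (intro subspace_sum[OF subspace_Delta] subspace_scale[OF subspace_Delta]) auto

lemma Delta_rep:
  assumes "x \<in> U" "v \<in> \<Delta> x"
  shows "\<exists>a. v = (\<Sum>i<m. a i *\<^sub>R X i x)"
proof -
  have inj: "inj_on (\<lambda>i. X i x) {..<m}" and \<Delta>: "span ((\<lambda>i. X i x) ` {..<m}) = \<Delta> x"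
    using frame assms(1) by (auto simp: local_frame_def)
  have "finite ((\<lambda>i. X i x) ` {..<m})" by simp
  from span_finite[OF this] assms(2) obtain a where "v = (\<Sum>w\<in>(\<lambda>i. X i x) ` {..<m}. a w *\<^sub>R w)"
    unfolding \<Delta> by blast
  then have "v = (\<Sum>i<m. a (X i x) *\<^sub>R X i x)" by (simp add: sum.reindex[OF inj])
  then show ?thesis by (rule exI[of _ "\<lambda>i. a (X i x)"])
qed

lemma sum_X_coord: "x \<in> fst c \<Longrightarrow> (\<Sum>i<m. a i *\<^sub>R X i x) c = (\<Sum>i<m. a i *\<^sub>R Xc i (snd c x))"
  using c(1) by (simp add: linear_sum[OF linear_eval] scaleR_fun_def Xc_def)

lemma g_sum_X: "x \<in> U \<Longrightarrow> x \<in> fst c \<Longrightarrow> g x (\<Sum>i<m. a i *\<^sub>R X i x) (\<Sum>i<m. a i *\<^sub>R X i x) =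
    (\<Sum>i<m. \<Sum>j<m. a i * a j * G i j (snd c x))"
  using inner_product_on_sum[OF inner_product_g subspace_Delta, of "{..<m}" "\<lambda>i. X i x" x a] X_Delta c(1)
  by (simp add: G_def)

lemma G_continuous:
  assumes "i < m" "j < m"
  shows "continuous_on Om (G i j)"
proof -
  have "\<forall>x\<in>U. X i x \<in> \<Delta> x \<and> X j x \<in> \<Delta> x" using X_Delta assms by blast
  then have "smooth_fun A U (\<lambda>x. g x (X i x) (X j x))"
    using metric open_U frame_field assms unfolding smooth_metric_on_def by blast
  then have "smooth_on Om ((\<lambda>x. g x (X i x) (X j x)) \<circ> chart_inv c)"
    using c(1) by (simp add: smooth_fun_def Om_def)
  then show ?thesis using smooth_on_continuous_on by (simp add: o_def G_def[abs_def])
qed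

text \<open>A tangent vector is determined by its component in one chart, so passing to coordinates
  is injective on the span of the frame.\<close>

lemma coord_independent: "inj_on (\<lambda>i. Xc i u0) {..<m}" "independent ((\<lambda>i. Xc i u0) ` {..<m})"
proof -
  have inj: "inj_on (\<lambda>i. X i x0) {..<m}" and ind: "independent ((\<lambda>i. X i x0) ` {..<m})"
    using frame x0 by (auto simp: local_frame_def)
  have eq: "Xc i u0 = X i x0 c" for i using c by (simp add: Xc_def)
  have span: "span ((\<lambda>i. X i x0) ` {..<m}) = \<Delta> x0" using frame x0 by (auto simp: local_frame_def)
  have evinj: "inj_on (\<lambda>v. v c) (\<Delta> x0)"
    by (rule inj_onI) (use tangent_eqI[OF Delta_tangent Delta_tangent c] in blast)
  show "inj_on (\<lambda>i. Xc i u0) {..<m}"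
    unfolding eq using comp_inj_on[OF inj, of "\<lambda>v. v c"] inj_on_subset[OF evinj] X_Delta x0
    by (auto simp: o_def image_subset_iff)
  have "independent ((\<lambda>v. v c) ` ((\<lambda>i. X i x0) ` {..<m}))"
    by (rule linear_independent_injective_image[OF linear_eval ind]) (simp add: span evinj)
  then show "independent ((\<lambda>i. Xc i u0) ` {..<m})" by (simp add: image_image eq)
qed

text \<open>The frame trivialises \<open>\<Delta>\<close> near \<open>x0\<close>: the maps \<open>\<Phi> u\<close> are small perturbations of the identity of
  the model space carrying the coordinate image of \<open>\<Delta> x0\<close> to that of \<open>\<Delta> x\<close>, and \<open>Q u\<close> is the
  metric pulled back along \<open>\<Phi> u\<close>.\<close>

lemma trivialisation:
  shows "\<exists>(\<Phi> :: 'e \<Rightarrow> 'e \<Rightarrow> 'e) (Q :: 'e \<Rightarrow> 'e \<Rightarrow> real) (\<omega> :: 'e \<Rightarrow> real) (\<mu> :: real).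
    (\<forall>u. linear (\<Phi> u)) \<and> (\<forall>w. continuous_on Om (\<lambda>u. \<Phi> u w)) \<and>
    continuous_on (Om \<times> UNIV) (\<lambda>(u, w). Q u w) \<and> continuous_on Om \<omega> \<and> \<omega> u0 = 0 \<and>
    (\<forall>u w. norm (\<Phi> u w - w) \<le> \<omega> u * norm w) \<and> (\<forall>u w. \<bar>Q u w - Q u0 w\<bar> \<le> \<omega> u * (norm w)\<^sup>2) \<and>
    0 < \<mu> \<and> (\<forall>v\<in>\<Delta> x0. \<mu> * (norm (v c))\<^sup>2 \<le> Q u0 (v c)) \<and>
    (\<forall>x\<in>fst c. snd c x \<in> Om \<longrightarrow> (\<forall>v\<in>\<Delta> x.
      \<exists>v0\<in>\<Delta> x0. v c = \<Phi> (snd c x) (v0 c) \<and> g x v v = Q (snd c x) (v0 c) \<and> g x0 v0 v0 = Q u0 (v0 c)))"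
proof -
  define e where "e i = Xc i u0" for i
  have inj: "e j = e i \<longleftrightarrow> j = i" if "i < m" "j < m" for i j
    using coord_independent(1) that unfolding e_def inj_on_def by blast
  \<comment> \<open>The dual functionals of the frame at \<open>x0\<close>, extended from its span
    to the whole model space so that \<Phi> and \<open>Q\<close> are defined on all of it.\<close>
  have "\<forall>i. \<exists>l. linear l \<and> (\<forall>w\<in>e ` {..<m}. l w = (if w = e i then 1 else (0::real)))"
  proof
    fix i
    show "\<exists>l. linear l \<and> (\<forall>w\<in>e ` {..<m}. l w = (if w = e i then 1 else (0::real)))"
      unfolding e_def[abs_def] by (rule linear_independent_extend[OF coord_independent(2)])
  qed
  from choice[OF this] obtain l where l: "\<forall>i. linear (l i) \<and> (\<forall>w\<in>e ` {..<m}. l i w = (if w = e i then 1 else (0::real)))"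
    by (elim exE)
  have lin: "linear (l i)" for i using l by blast
  have le: "l i (e j) = (if j = i then 1 else 0)" if "i < m" "j < m" for i j
    using bspec[OF conjunct2[OF spec[OF l, of i]], of "e j"] inj[OF that] that(2) by simp
  have lcoef: "l i (\<Sum>j<m. a j *\<^sub>R e j) = a i" if "i < m" for i a
  proof -
    have "l i (\<Sum>j<m. a j *\<^sub>R e j) = (\<Sum>j<m. if j = i then a i else 0)"
      unfolding linear_sum[OF lin] by (rule sum.cong[OF refl]) (simp add: linear_cmul[OF lin] le[OF that])
    then show ?thesis using that by simp
  qed
  have "\<forall>i. \<exists>K\<ge>0. \<forall>w. \<bar>l i w\<bar> \<le> norm w * K"
    using bounded_linear.nonneg_bounded[OF linear_conv_bounded_linear[THEN iffD1, OF lin]] by simp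
  from choice[OF this] obtain K where K: "\<forall>i. 0 \<le> K i \<and> (\<forall>w. \<bar>l i w\<bar> \<le> norm w * K i)" by (elim exE)
  define C where "C = (\<Sum>i<m. K i)"
  have C0: "0 \<le> C" unfolding C_def using K by (intro sum_nonneg) simp
  have lC: "\<bar>l i w\<bar> \<le> C * norm w" if "i < m" for i w
  proof -
    have "K i \<le> C" unfolding C_def by (rule member_le_sum) (use that K in auto)
    then have "norm w * K i \<le> norm w * C" by (intro mult_left_mono) auto
    moreover have "\<bar>l i w\<bar> \<le> norm w * K i" using K by blast
    ultimately show ?thesis by (simp add: mult.commute)
  qed
  \<comment> \<open>The component along \<open>e i\<close> is carried to \<open>Xc i u\<close>, and
    what the functionals do not see is left alone.\<close>
  define \<Phi> where "\<Phi> u w = w + (\<Sum>i<m. l i w *\<^sub>R (Xc i u - e i))" for u w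
  define Q where "Q u w = (\<Sum>i<m. \<Sum>j<m. l i w * l j w * G i j u)" for u w
  define \<omega> where "\<omega> u = C * (\<Sum>i<m. norm (Xc i u - e i)) + C\<^sup>2 * (\<Sum>i<m. \<Sum>j<m. \<bar>G i j u - G i j u0\<bar>)" for u
  have contX: "continuous_on Om (Xc i)" if "i < m" for i
    using X_smooth[OF that] by (rule smooth_on_continuous_on)
  have lcont: "continuous_on B (l i)" for B i by (rule linear_continuous_on[OF linear_conv_bounded_linear[THEN iffD1, OF lin]])
  have main: "\<exists>v0\<in>\<Delta> x0. v c = \<Phi> (snd c x) (v0 c) \<and> g x v v = Q (snd c x) (v0 c) \<and> g x0 v0 v0 = Q u0 (v0 c)"
    if x: "x \<in> fst c" "snd c x \<in> Om" and v: "v \<in> \<Delta> x" for x v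
  proof -
    have xU: "x \<in> U" using Om_mem x by blast
    obtain a where a: "v = (\<Sum>i<m. a i *\<^sub>R X i x)" using Delta_rep[OF xU v] by blast
    define v0 where "v0 = (\<Sum>i<m. a i *\<^sub>R X i x0)"
    have v0c: "v0 c = (\<Sum>i<m. a i *\<^sub>R e i)" unfolding v0_def e_def by (rule sum_X_coord[OF c(2)])
    have lv: "l i (v0 c) = a i" if "i < m" for i unfolding v0c by (rule lcoef[OF that])
    have "\<Phi> (snd c x) (v0 c) = v0 c + (\<Sum>i<m. a i *\<^sub>R (Xc i (snd c x) - e i))"
      by (simp add: \<Phi>_def lv)
    also have "\<dots> = (\<Sum>i<m. a i *\<^sub>R Xc i (snd c x))"
      unfolding v0c sum.distrib[symmetric] by (simp add: scaleR_diff_right)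
    finally have "v c = \<Phi> (snd c x) (v0 c)" unfolding a sum_X_coord[OF x(1)] by simp
    moreover have "g x v v = Q (snd c x) (v0 c)"
      unfolding a g_sum_X[OF xU x(1)] by (simp add: Q_def lv)
    moreover have "g x0 v0 v0 = Q u0 (v0 c)"
      using g_sum_X[OF x0 c(2), of a] by (simp add: Q_def lv v0_def[symmetric])
    moreover have "v0 \<in> \<Delta> x0" unfolding v0_def by (rule sum_X_Delta[OF x0])
    ultimately show ?thesis by blast
  qed
  have nn: "0 \<le> (\<Sum>i<m. \<Sum>j<m. \<bar>G i j u - G i j u0\<bar>)" for u by (intro sum_nonneg) auto
  have nn': "0 \<le> (\<Sum>i<m. norm (Xc i u - e i))" for u by (intro sum_nonneg) auto
  have pert: "norm (\<Phi> u w - w) \<le> \<omega> u * norm w" for u w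
  proof -
    have "norm (\<Phi> u w - w) \<le> (\<Sum>i<m. C * norm w * norm (Xc i u - e i))"
      unfolding \<Phi>_def add_diff_cancel_left'
      by (rule sum_norm_le) (simp add: lC mult_right_mono)
    also have "\<dots> = C * (\<Sum>i<m. norm (Xc i u - e i)) * norm w"
      unfolding sum_distrib_left[symmetric] by (simp only: mult_ac)
    also have "\<dots> \<le> \<omega> u * norm w"
      unfolding \<omega>_def using mult_nonneg_nonneg[OF zero_le_power2 nn, of C u] by (intro mult_right_mono) auto
    finally show ?thesis .
  qed
  have Qpert: "\<bar>Q u w - Q u0 w\<bar> \<le> \<omega> u * (norm w)\<^sup>2" for u w
  proof -
    have eq: "Q u w - Q u0 w = (\<Sum>i<m. \<Sum>j<m. l i w * l j w * (G i j u - G i j u0))"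
      by (simp add: Q_def sum_subtractf right_diff_distrib)
    have "norm (\<Sum>i<m. \<Sum>j<m. l i w * l j w * (G i j u - G i j u0)) \<le>
        (\<Sum>i<m. \<Sum>j<m. (C * norm w) * (C * norm w) * \<bar>G i j u - G i j u0\<bar>)"
    proof (rule sum_norm_le)
      fix i assume i: "i \<in> {..<m}"
      show "norm (\<Sum>j<m. l i w * l j w * (G i j u - G i j u0)) \<le>
          (\<Sum>j<m. (C * norm w) * (C * norm w) * \<bar>G i j u - G i j u0\<bar>)"
      proof (rule sum_norm_le)
        fix j assume "j \<in> {..<m}"
        then have "\<bar>l i w\<bar> * \<bar>l j w\<bar> \<le> (C * norm w) * (C * norm w)"
          using lC C0 i by (intro mult_mono) auto
        then show "norm (l i w * l j w * (G i j u - G i j u0)) \<le> (C * norm w) * (C * norm w) * \<bar>G i j u - G i j u0\<bar>"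
          unfolding real_norm_def abs_mult by (rule mult_right_mono) simp
      qed
    qed
    also have "\<dots> = C\<^sup>2 * (\<Sum>i<m. \<Sum>j<m. \<bar>G i j u - G i j u0\<bar>) * (norm w)\<^sup>2"
      unfolding sum_distrib_left[symmetric] by (simp only: power2_eq_square mult_ac)
    also have "\<dots> \<le> \<omega> u * (norm w)\<^sup>2"
      unfolding \<omega>_def using mult_nonneg_nonneg[OF C0 nn'] by (intro mult_right_mono) auto
    finally show ?thesis unfolding eq by simp
  qed
  have u0: "\<omega> u0 = 0" by (simp add: \<omega>_def e_def)
  have \<Phi>u0: "\<Phi> u0 w = w" for w using pert[of u0 w] u0 by simp
  define W where "W = (\<lambda>v. v c) ` \<Delta> x0"
  have QW: "0 < Q u0 w" if wW: "w \<in> W" "w \<noteq> 0" for w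
  proof -
    obtain v where v: "v \<in> \<Delta> x0" "w = v c" using wW(1) by (auto simp: W_def)
    obtain v0 where v0: "v0 \<in> \<Delta> x0" "v c = \<Phi> u0 (v0 c)" "g x0 v0 v0 = Q u0 (v0 c)"
      using main[OF c(2) u0_mem v(1)] by blast
    have "v0 c = w" using v0(2) v(2) \<Phi>u0 by simp
    moreover from this have "v0 \<noteq> 0" using wW(2) by auto
    ultimately show ?thesis using g_pos[OF v0(1)] v0(3) by simp
  qed
  have "subspace W" unfolding W_def by (rule linear_subspace_image[OF linear_eval subspace_Delta])
  then have Wscale: "w \<in> W \<Longrightarrow> r *\<^sub>R w \<in> W" for w r by (rule subspace_scale)
  have "closed W" by (rule closed_subspace[OF \<open>subspace W\<close>])
  have comp: "compact (sphere 0 1 \<inter> W)" using \<open>closed W\<close> by (intro compact_Int_closed) auto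
  have Qcont0: "continuous_on B (Q u0)" for B
    unfolding Q_def[abs_def] by (intro continuous_intros lcont)
  have Qscale: "Q u (r *\<^sub>R w) = r\<^sup>2 * Q u w" for u r w
    by (simp add: Q_def linear_cmul[OF lin] sum_distrib_left power2_eq_square mult_ac)
  \<comment> \<open>The minimum of \<open>Q u0\<close> on the compact unit sphere of
    \<open>W\<close>; if \<open>\<Delta> x0\<close> is trivial, this sphere is empty and any
    positive constant serves.\<close>
  have "\<exists>\<mu>>0. \<forall>w\<in>sphere 0 1 \<inter> W. \<mu> \<le> Q u0 w"
  proof (cases "sphere 0 1 \<inter> W = {}")
    case False
    from continuous_attains_inf[OF comp False Qcont0] obtain w where
      w: "w \<in> sphere 0 1 \<inter> W" "\<forall>y\<in>sphere 0 1 \<inter> W. Q u0 w \<le> Q u0 y" by blast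
    moreover from w(1) have "0 < Q u0 w" by (intro QW) auto
    ultimately show ?thesis by blast
  qed (auto intro: exI[of _ 1])
  then obtain \<mu> where \<mu>: "0 < \<mu>" "\<And>w. w \<in> W \<Longrightarrow> norm w = 1 \<Longrightarrow> \<mu> \<le> Q u0 w" by auto
  have low: "\<mu> * (norm (v c))\<^sup>2 \<le> Q u0 (v c)" if v: "v \<in> \<Delta> x0" for v
  proof (cases "v c = 0")
    case True
    then show ?thesis using Qscale[of u0 0 "v c"] by simp
  next
    case False
    have vW: "v c \<in> W" using v by (simp add: W_def)
    have "\<mu> \<le> Q u0 ((1 / norm (v c)) *\<^sub>R v c)" using False by (intro \<mu>(2) Wscale vW) simp
    also have "\<dots> = Q u0 (v c) / (norm (v c))\<^sup>2" unfolding Qscale by (simp add: power_divide)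
    finally show ?thesis using False by (simp add: pos_le_divide_eq)
  qed
  show ?thesis
  proof (intro exI[of _ \<Phi>] exI[of _ Q] exI[of _ \<omega>] exI[of _ \<mu>] conjI allI ballI impI)
    show "linear (\<Phi> u)" for u
      unfolding \<Phi>_def
      by (intro linear_compose_add linear_compose_sum linear_ident ballI)
        (auto intro!: linearI simp: linear_add[OF lin] linear_cmul[OF lin] scaleR_add_left)
    show "continuous_on Om (\<lambda>u. \<Phi> u w)" for w
      unfolding \<Phi>_def by (intro continuous_intros contX) auto
    have 1: "continuous_on (Om \<times> UNIV) (\<lambda>z. l i (snd z))" for i
      by (rule continuous_on_compose2[OF lcont[of UNIV] continuous_on_snd[OF continuous_on_id]]) auto
    have 2: "continuous_on (Om \<times> (UNIV :: 'e set)) (\<lambda>z. G i j (fst z))" if "i < m" "j < m" for i j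
      by (rule continuous_on_compose2[OF G_continuous[OF that] continuous_on_fst[OF continuous_on_id]]) auto
    show "continuous_on (Om \<times> UNIV) (\<lambda>(u, w). Q u w)"
      unfolding Q_def case_prod_unfold by (intro continuous_intros 1 2) auto
    show "continuous_on Om \<omega>"
      unfolding \<omega>_def[abs_def] by (intro continuous_intros contX G_continuous) auto
  qed (fact u0 pert Qpert \<mu>(1) low main)+
qed

text \<open>Three needs are met: \<open>F\<close> makes the energy density measurable, \<mu>
  converts energy into coordinate displacement, and the last clause carries inequalities on
  \<open>\<Delta> x0\<close> to nearby points. Near \<open>u0\<close> the map
  \<open>\<Phi> u\<close> differs from the identity by at most half the norm of its argument, hence
  it is invertible.\<close>

lemma local_model:
  "\<exists>R>0. \<exists>\<mu>>0. \<exists>F :: 'e \<times> 'e \<Rightarrow> real. cball u0 R \<subseteq> Om \<and> continuous_on (cball u0 R \<times> UNIV) F \<and>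
    (\<forall>x\<in>fst c. snd c x \<in> cball u0 R \<longrightarrow> (\<forall>v\<in>\<Delta> x. g x v v = F (snd c x, v c) \<and> \<mu> * (norm (v c))\<^sup>2 \<le> g x v v)) \<and>
    (\<forall>\<eta>>0. \<exists>\<delta>>0. \<forall>x\<in>fst c. snd c x \<in> cball u0 \<delta> \<longrightarrow>
      (\<forall>v\<in>\<Delta> x. \<exists>v0\<in>\<Delta> x0. norm (v c - v0 c) \<le> \<eta> * norm (v c) \<and> g x0 v0 v0 \<le> g x v v + \<eta> * (norm (v c))\<^sup>2))"
proof -
  from trivialisation obtain \<Phi> Q \<omega> \<mu> where "\<forall>u. linear (\<Phi> u)" "\<forall>w. continuous_on Om (\<lambda>u. \<Phi> u w)"
    and Q: "continuous_on (Om \<times> UNIV) (\<lambda>(u, w). Q u w)" and \<omega>: "continuous_on Om \<omega>" "\<omega> u0 = 0"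
    and "\<forall>u w. norm (\<Phi> u w - w) \<le> \<omega> u * norm w" "\<forall>u w. \<bar>Q u w - Q u0 w\<bar> \<le> \<omega> u * (norm w)\<^sup>2"
    and \<mu>0: "0 < \<mu>" "\<forall>v\<in>\<Delta> x0. \<mu> * (norm (v c))\<^sup>2 \<le> Q u0 (v c)"
    and main: "\<forall>x\<in>fst c. snd c x \<in> Om \<longrightarrow> (\<forall>v\<in>\<Delta> x.
      \<exists>v0\<in>\<Delta> x0. v c = \<Phi> (snd c x) (v0 c) \<and> g x v v = Q (snd c x) (v0 c) \<and> g x0 v0 v0 = Q u0 (v0 c))"
    by (elim exE conjE)
  note \<Phi> = this(1,2)[rule_format] and pert = this(6,7)[rule_format] and \<mu> = \<mu>0[rule_format] and main = main[rule_format]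
  have small: "\<exists>\<delta>>0. cball u0 \<delta> \<subseteq> Om \<and> (\<forall>u\<in>cball u0 \<delta>. \<omega> u \<le> \<eta>)" if \<eta>: "0 < \<eta>" for \<eta>
  proof -
    obtain r where r: "0 < r" "cball u0 r \<subseteq> Om" using open_Om u0_mem open_contains_cball by blast
    have "isCont \<omega> u0" using \<omega>(1) open_Om u0_mem by (simp add: continuous_on_eq_continuous_at)
    then obtain d where d: "0 < d" "\<forall>u. dist u u0 < d \<longrightarrow> dist (\<omega> u) (\<omega> u0) < \<eta>"
      using \<eta> unfolding continuous_at_eps_delta by meson
    have "\<omega> u \<le> \<eta>" if "u \<in> cball u0 (min r (d / 2))" for u
    proof -
      have "dist u u0 < d" using that d(1) by (auto simp: dist_commute)
      then have "dist (\<omega> u) (\<omega> u0) < \<eta>" using d(2) by blast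
      then show ?thesis using \<omega>(2) by (simp add: dist_real_def)
    qed
    moreover have "cball u0 (min r (d / 2)) \<subseteq> Om" using r(2) by auto
    ultimately show ?thesis using r(1) d(1) by (intro exI[of _ "min r (d / 2)"]) auto
  qed
  have "0 < min (1/2) (\<mu> / 2)" using \<mu> by simp
  from small[OF this] obtain R where R: "0 < R" "cball u0 R \<subseteq> Om" "\<forall>u\<in>cball u0 R. \<omega> u \<le> min (1/2) (\<mu> / 2)" by blast
  have half: "norm w \<le> 2 * norm (\<Phi> u w)" "norm (\<Phi> u w) \<le> 3/2 * norm w" if "\<omega> u \<le> 1/2" for u w
  proof -
    have "norm (\<Phi> u w - w) \<le> 1/2 * norm w"
      using pert(1)[of u w] mult_right_mono[OF that norm_ge_zero[of w]] by linarith
    then show "norm w \<le> 2 * norm (\<Phi> u w)" "norm (\<Phi> u w) \<le> 3/2 * norm w"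
      using norm_triangle_ineq2[of w "\<Phi> u w"] norm_triangle_ineq2[of "\<Phi> u w" w]
      by (auto simp: norm_minus_commute)
  qed
  have half': "norm w \<le> 2 * norm (\<Phi> u w)" "norm (\<Phi> u w) \<le> 3/2 * norm w" if "u \<in> cball u0 R" for u w
    using half[of u w] R(3) that by auto
  define \<Psi> where "\<Psi> u = inv (\<Phi> u)" for u
  have bij: "\<Phi> u (\<Psi> u w) = w" "\<Psi> u (\<Phi> u w) = w" if "u \<in> cball u0 R" for u w
  proof -
    have inj: "inj (\<Phi> u)"
      unfolding linear_injective_0[OF \<Phi>(1)]
    proof (intro allI impI)
      fix w assume "\<Phi> u w = 0"
      then show "w = 0" using half'(1)[OF that, of w] by simp
    qed
    moreover have "surj (\<Phi> u)" by (rule linear_inj_imp_surj[OF \<Phi>(1) inj])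
    ultimately show "\<Phi> u (\<Psi> u w) = w" "\<Psi> u (\<Phi> u w) = w" by (simp_all add: \<Psi>_def surj_f_inv_f)
  qed
  \<comment> \<open>The lower bound on \<open>\<Phi> u\<close> bounds all inverses uniformly, so
    joint continuity of \<Psi> reduces to continuity of \<open>\<Phi> u w\<close> in
    \<open>u\<close> for a single vector \<open>w\<close>.\<close>
  have \<Psi>cont: "continuous_on (cball u0 R \<times> UNIV) (\<lambda>z. \<Psi> (fst z) (snd z))"
    unfolding continuous_on_def
  proof
    fix z :: "'e \<times> 'e" assume z: "z \<in> cball u0 R \<times> UNIV"
    let ?F = "at z within cball u0 R \<times> UNIV"
    define w where "w = \<Psi> (fst z) (snd z)"
    have zR: "fst z \<in> cball u0 R" using z by auto
    have "continuous_on (cball u0 R \<times> (UNIV :: 'e set)) (\<lambda>y. \<Phi> (fst y) w)"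
      by (rule continuous_on_compose2[OF \<Phi>(2) continuous_on_fst[OF continuous_on_id]]) (use R(2) in auto)
    then have "((\<lambda>y. \<Phi> (fst y) w) \<longlongrightarrow> \<Phi> (fst z) w) ?F" using z unfolding continuous_on_def by blast
    then have "((\<lambda>y. 2 * norm (snd y - \<Phi> (fst y) w)) \<longlongrightarrow> 2 * norm (snd z - \<Phi> (fst z) w)) ?F"
      by (intro tendsto_intros)
    then have lim: "((\<lambda>y. 2 * norm (snd y - \<Phi> (fst y) w)) \<longlongrightarrow> 0) ?F" using bij(1)[OF zR] by (simp add: w_def)
    have "((\<lambda>y. \<Psi> (fst y) (snd y) - w) \<longlongrightarrow> 0) ?F"
    proof (rule Lim_null_comparison[OF _ lim])
      show "\<forall>\<^sub>F y in ?F. norm (\<Psi> (fst y) (snd y) - w) \<le> 2 * norm (snd y - \<Phi> (fst y) w)"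
        unfolding eventually_at_topological
      proof (intro exI[of _ UNIV] conjI ballI impI)
        fix y :: "'e \<times> 'e" assume "y \<in> cball u0 R \<times> UNIV"
        then have y: "fst y \<in> cball u0 R" by auto
        show "norm (\<Psi> (fst y) (snd y) - w) \<le> 2 * norm (snd y - \<Phi> (fst y) w)"
          using half'(1)[OF y, of "\<Psi> (fst y) (snd y) - w"] bij(1)[OF y] by (simp add: linear_diff[OF \<Phi>(1)])
      qed auto
    qed
    then show "((\<lambda>y. \<Psi> (fst y) (snd y)) \<longlongrightarrow> \<Psi> (fst z) (snd z)) ?F"
      unfolding w_def by (rule LIM_zero_cancel)
  qed
  define F where "F z = Q (fst z) (\<Psi> (fst z) (snd z))" for z
  have "continuous_on (cball u0 R \<times> UNIV) (\<lambda>z. (\<lambda>(u, w). Q u w) (fst z, \<Psi> (fst z) (snd z)))"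
    by (rule continuous_on_compose2[OF Q]) (use R(2) in \<open>auto intro!: continuous_on_Pair \<Psi>cont continuous_on_fst continuous_on_id\<close>)
  then have Fcont: "continuous_on (cball u0 R \<times> UNIV) F" by (simp add: F_def[abs_def])
  \<comment> \<open>Half of \<mu> is lost to the variation of \<open>Q\<close>, and
    \<open>norm (v c)\<close> is at most 3/2 of \<open>norm (v0 c)\<close>; the factor 2/9 is 1/2
    divided by 9/4.\<close>
  have model: "g x v v = F (snd c x, v c) \<and> (\<mu> * (2/9)) * (norm (v c))\<^sup>2 \<le> g x v v"
    if x: "x \<in> fst c" "snd c x \<in> cball u0 R" and v: "v \<in> \<Delta> x" for x v
  proof -
    have xO: "snd c x \<in> Om" using x R(2) by blast
    obtain v0 where v0: "v0 \<in> \<Delta> x0" "v c = \<Phi> (snd c x) (v0 c)" "g x v v = Q (snd c x) (v0 c)"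
      using main[OF x(1) xO v] by blast
    have "g x v v = F (snd c x, v c)" using v0 bij(2)[OF x(2)] by (simp add: F_def)
    moreover have "(\<mu> * (2/9)) * (norm (v c))\<^sup>2 \<le> g x v v"
    proof -
      have \<omega>h: "\<omega> (snd c x) \<le> \<mu> / 2" using R(3) x(2) by auto
      have "(norm (v c))\<^sup>2 \<le> (3/2 * norm (v0 c))\<^sup>2"
        using half'(2)[OF x(2), of "v0 c"] by (intro power_mono) (auto simp: v0(2))
      then have "(\<mu> * (2/9)) * (norm (v c))\<^sup>2 \<le> (\<mu> * (2/9)) * (3/2 * norm (v0 c))\<^sup>2"
        using \<mu>(1) by (intro mult_left_mono) auto
      also have "\<dots> = \<mu> * (norm (v0 c))\<^sup>2 - \<mu> / 2 * (norm (v0 c))\<^sup>2" by (simp add: power2_eq_square)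
      also have "\<dots> \<le> Q u0 (v0 c) - \<omega> (snd c x) * (norm (v0 c))\<^sup>2"
        using \<mu>(2)[OF v0(1)] mult_right_mono[OF \<omega>h, of "(norm (v0 c))\<^sup>2"] by simp
      also have "\<dots> \<le> g x v v" using pert(2)[of "snd c x" "v0 c"] v0(3) by linarith
      finally show ?thesis .
    qed
    ultimately show ?thesis ..
  qed
  have compare: "\<exists>\<delta>>0. \<forall>x\<in>fst c. snd c x \<in> cball u0 \<delta> \<longrightarrow>
      (\<forall>v\<in>\<Delta> x. \<exists>v0\<in>\<Delta> x0. norm (v c - v0 c) \<le> \<eta> * norm (v c) \<and> g x0 v0 v0 \<le> g x v v + \<eta> * (norm (v c))\<^sup>2)"
    if \<eta>: "0 < \<eta>" for \<eta>
  proof -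
    have "0 < min (1/2) (\<eta> / 4)" using \<eta> by simp
    from small[OF this] obtain \<delta> where \<delta>: "0 < \<delta>" "cball u0 \<delta> \<subseteq> Om" "\<forall>u\<in>cball u0 \<delta>. \<omega> u \<le> min (1/2) (\<eta> / 4)" by blast
    have "\<exists>v0\<in>\<Delta> x0. norm (v c - v0 c) \<le> \<eta> * norm (v c) \<and> g x0 v0 v0 \<le> g x v v + \<eta> * (norm (v c))\<^sup>2"
      if x: "x \<in> fst c" "snd c x \<in> cball u0 \<delta>" and v: "v \<in> \<Delta> x" for x v
    proof -
      have xO: "snd c x \<in> Om" using x \<delta>(2) by blast
      obtain v0 where v0: "v0 \<in> \<Delta> x0" "v c = \<Phi> (snd c x) (v0 c)" "g x v v = Q (snd c x) (v0 c)" "g x0 v0 v0 = Q u0 (v0 c)"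
        using main[OF x(1) xO v] by blast
      have \<omega>x: "\<omega> (snd c x) \<le> 1/2" "\<omega> (snd c x) \<le> \<eta> / 4" using \<delta>(3) x(2) by auto
      have n2: "norm (v0 c) \<le> 2 * norm (v c)" using half(1)[OF \<omega>x(1), of "v0 c"] v0(2) by simp
      have "norm (v c - v0 c) \<le> \<eta> / 4 * norm (v0 c)"
        using pert(1)[of "snd c x" "v0 c"] mult_right_mono[OF \<omega>x(2) norm_ge_zero[of "v0 c"]] v0(2) by simp
      also have "\<dots> \<le> \<eta> / 4 * (2 * norm (v c))" using n2 \<eta> by (intro mult_left_mono) auto
      also have "\<dots> \<le> \<eta> * norm (v c)" using \<eta> by simp
      finally have 1: "norm (v c - v0 c) \<le> \<eta> * norm (v c)" .
      have "g x0 v0 v0 \<le> g x v v + \<omega> (snd c x) * (norm (v0 c))\<^sup>2"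
        using pert(2)[of "snd c x" "v0 c"] v0 by linarith
      also have "\<omega> (snd c x) * (norm (v0 c))\<^sup>2 \<le> \<eta> / 4 * (2 * norm (v c))\<^sup>2"
        using \<omega>x(2) n2 \<eta> by (intro mult_mono power_mono) auto
      finally have "g x0 v0 v0 \<le> g x v v + \<eta> * (norm (v c))\<^sup>2" by (simp add: power_mult_distrib)
      with 1 v0(1) show ?thesis by blast
    qed
    then show ?thesis using \<delta>(1) by blast
  qed
  have \<mu>9: "0 < \<mu> * (2/9)" using \<mu>(1) by simp
  show ?thesis
    by (rule exI[of _ R], rule conjI[OF R(1)], rule exI[of _ "\<mu> * (2/9)"], rule conjI[OF \<mu>9], rule exI[of _ F],
        intro conjI R(2) Fcont ballI impI allI model compare)
qed

end

section \<open>Horizontal paths, their energy, and comparison with the value function\<close>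

section \<open>Horizontal paths on arbitrary intervals\<close>

context sub_riemannian
begin

definition hor :: "(real \<Rightarrow> 'a) \<Rightarrow> real \<Rightarrow> bool"
  where "hor \<gamma> t \<longleftrightarrow> (\<exists>v\<in>\<Delta> (\<gamma> t). has_velocity \<gamma> v t)"

definition vel :: "(real \<Rightarrow> 'a) \<Rightarrow> real \<Rightarrow> ('a, 'e) tangent"
  where "vel \<gamma> t = (THE v. has_velocity \<gamma> v t)"

text \<open>Non-horizontal times, which form a null set on a horizontal path, get the value 0; the
  density is then nonnegative everywhere.\<close>

definition speed_sq :: "(real \<Rightarrow> 'a) \<Rightarrow> real \<Rightarrow> real"
  where "speed_sq \<gamma> t = (if hor \<gamma> t then g (\<gamma> t) (vel \<gamma> t) (vel \<gamma> t) else 0)"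

definition energy :: "real \<Rightarrow> real \<Rightarrow> (real \<Rightarrow> 'a) \<Rightarrow> ennreal"
  where "energy a b \<gamma> = (\<integral>\<^sup>+t. ennreal (indicator {a..b} t * speed_sq \<gamma> t) \<partial>lebesgue)"

text \<open>Horizontality is required inside the open interval: \<open>hor\<close> uses two-sided
  derivatives, so at an end point it would depend on the path outside the interval.\<close>

definition hpath :: "real \<Rightarrow> real \<Rightarrow> (real \<Rightarrow> 'a) \<Rightarrow> bool"
  where "hpath a b \<gamma> \<longleftrightarrow> continuous_on {a..b} \<gamma> \<and>
    (\<forall>c\<in>A. \<forall>s t. a \<le> s \<and> s \<le> t \<and> t \<le> b \<and> \<gamma> ` {s..t} \<subseteq> fst c \<longrightarrow>
      absolutely_continuous_on_interval s t (snd c \<circ> \<gamma>)) \<and>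
    negligible {t\<in>{a<..<b}. \<not> hor \<gamma> t}"

lemma vel_eq: "has_velocity \<gamma> v t \<Longrightarrow> vel \<gamma> t = v"
  unfolding vel_def by (rule the_equality) (auto dest: has_velocity_unique)

lemma horD:
  assumes "hor \<gamma> t"
  shows "vel \<gamma> t \<in> \<Delta> (\<gamma> t)" "has_velocity \<gamma> (vel \<gamma> t) t"
  using assms vel_eq unfolding hor_def by auto

lemma speed_sq_nonneg: "0 \<le> speed_sq \<gamma> t"
  using horD(1) g_nonneg by (simp add: speed_sq_def)

lemma hor_cong:
  assumes ev: "\<forall>\<^sub>F s in nhds t. \<gamma> s = \<eta> s"
  shows "hor \<gamma> t \<longleftrightarrow> hor \<eta> t" "vel \<gamma> t = vel \<eta> t" "speed_sq \<gamma> t = speed_sq \<eta> t"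
proof -
  have eq: "\<gamma> t = \<eta> t" using ev by (rule eventually_nhds_x_imp_x)
  have ev': "\<forall>\<^sub>F s in nhds t. \<eta> s = \<gamma> s" using ev by eventually_elim simp
  have "has_velocity \<gamma> v t \<longleftrightarrow> has_velocity \<eta> v t" for v
    using has_velocity_cong[OF ev] has_velocity_cong[OF ev'] by blast
  then show "hor \<gamma> t \<longleftrightarrow> hor \<eta> t" "vel \<gamma> t = vel \<eta> t"
    using eq by (simp_all add: hor_def vel_def)
  then show "speed_sq \<gamma> t = speed_sq \<eta> t" using eq by (simp add: speed_sq_def)
qed

lemma hor_affine:
  assumes "q \<noteq> 0"
  shows "hor (\<lambda>t. \<gamma> (p + q * t)) t \<longleftrightarrow> hor \<gamma> (p + q * t)"
    and "speed_sq (\<lambda>t. \<gamma> (p + q * t)) t = q\<^sup>2 * speed_sq \<gamma> (p + q * t)"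
proof -
  let ?\<eta> = "\<lambda>t. \<gamma> (p + q * t)"
  have fwd: "has_velocity ?\<eta> (q *\<^sub>R v) t" if "has_velocity \<gamma> v (p + q * t)" for v
    by (rule has_velocity_affine[OF that])
  have bwd: "has_velocity \<gamma> ((1 / q) *\<^sub>R v) (p + q * t)" if "has_velocity ?\<eta> v t" for v
  proof -
    have e: "p + q * (- p / q + 1 / q * s) = s" for s using assms by (simp add: field_simps)
    have "has_velocity ?\<eta> v (- p / q + 1 / q * (p + q * t))" using that assms by (simp add: field_simps)
    from has_velocity_affine[OF this] show ?thesis unfolding e .
  qed
  show iff: "hor ?\<eta> t \<longleftrightarrow> hor \<gamma> (p + q * t)"
    unfolding hor_def using fwd bwd subspace_scale[OF subspace_Delta] by blast
  show "speed_sq ?\<eta> t = q\<^sup>2 * speed_sq \<gamma> (p + q * t)"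
  proof (cases "hor \<gamma> (p + q * t)")
    case True
    have "vel ?\<eta> t = q *\<^sub>R vel \<gamma> (p + q * t)" by (rule vel_eq[OF fwd[OF horD(2)[OF True]]])
    then show ?thesis using True iff g_scale[OF horD(1)[OF True]] by (simp add: speed_sq_def)
  qed (simp add: speed_sq_def iff)
qed

lemma hpathD:
  assumes "hpath a b \<gamma>"
  shows "continuous_on {a..b} \<gamma>" "negligible {t\<in>{a<..<b}. \<not> hor \<gamma> t}"
    "c \<in> A \<Longrightarrow> a \<le> s \<Longrightarrow> s \<le> t \<Longrightarrow> t \<le> b \<Longrightarrow> \<gamma> ` {s..t} \<subseteq> fst c \<Longrightarrow>
      absolutely_continuous_on_interval s t (snd c \<circ> \<gamma>)"
  using assms unfolding hpath_def by blast+

lemma hpath_subinterval: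
  assumes h: "hpath a b \<gamma>" and ab: "a \<le> a'" "b' \<le> b"
  shows "hpath a' b' \<gamma>"
  unfolding hpath_def
proof (intro conjI ballI allI impI)
  show "continuous_on {a'..b'} \<gamma>" by (rule continuous_on_subset[OF hpathD(1)[OF h]]) (use ab in auto)
  show "negligible {t \<in> {a'<..<b'}. \<not> hor \<gamma> t}"
    by (rule negligible_subset[OF hpathD(2)[OF h]]) (use ab in auto)
  fix c s t assume "c \<in> A" "a' \<le> s \<and> s \<le> t \<and> t \<le> b' \<and> \<gamma> ` {s..t} \<subseteq> fst c"
  then show "absolutely_continuous_on_interval s t (snd c \<circ> \<gamma>)"
    using ab by (intro hpathD(3)[OF h]) auto
qed

lemma hpath_affine:
  assumes h: "hpath (p + q * a) (p + q * b) \<gamma>" and q: "0 < q"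
  shows "hpath a b (\<lambda>t. \<gamma> (p + q * t))"
  unfolding hpath_def
proof (intro conjI ballI allI impI)
  show "continuous_on {a..b} (\<lambda>t. \<gamma> (p + q * t))"
    by (rule continuous_on_compose2[OF hpathD(1)[OF h]]) (use q in \<open>auto intro!: continuous_intros\<close>)
  let ?N = "{t \<in> {p + q * a<..<p + q * b}. \<not> hor \<gamma> t}"
  have "{t \<in> {a<..<b}. \<not> hor (\<lambda>t. \<gamma> (p + q * t)) t} \<subseteq> (\<lambda>s. (s - p) / q) ` ?N"
  proof
    fix t assume t: "t \<in> {t \<in> {a<..<b}. \<not> hor (\<lambda>t. \<gamma> (p + q * t)) t}"
    have "t = ((p + q * t) - p) / q" using q by simp
    moreover have "p + q * t \<in> ?N"
      using t q hor_affine(1)[of q \<gamma> p t] by auto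
    ultimately show "t \<in> (\<lambda>s. (s - p) / q) ` ?N" by blast
  qed
  moreover have "negligible ((\<lambda>s. (s - p) / q) ` ?N)"
    by (rule negligible_differentiable_image_negligible[OF _ hpathD(2)[OF h]])
      (use q in \<open>auto intro!: derivative_intros simp: differentiable_on_def\<close>)
  ultimately show "negligible {t \<in> {a<..<b}. \<not> hor (\<lambda>t. \<gamma> (p + q * t)) t}" by (rule negligible_subset[rotated])
  fix c s t assume c: "c \<in> A" and st: "a \<le> s \<and> s \<le> t \<and> t \<le> b \<and> (\<lambda>t. \<gamma> (p + q * t)) ` {s..t} \<subseteq> fst c"
  have "\<gamma> ` {p + q * s..p + q * t} \<subseteq> fst c"
  proof
    fix x assume "x \<in> \<gamma> ` {p + q * s..p + q * t}"
    then obtain r where r: "r \<in> {p + q * s..p + q * t}" "x = \<gamma> r" by blast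
    then have "(r - p) / q \<in> {s..t}" and e: "p + q * ((r - p) / q) = r" using q by (auto simp: field_simps)
    then have "\<gamma> (p + q * ((r - p) / q)) \<in> fst c" using st by blast
    then show "x \<in> fst c" using r(2) e by simp
  qed
  then have "absolutely_continuous_on_interval (p + q * s) (p + q * t) (snd c \<circ> \<gamma>)"
    using st q by (intro hpathD(3)[OF h c]) auto
  from absolutely_continuous_on_interval_affine[OF this q]
  show "absolutely_continuous_on_interval s t (snd c \<circ> (\<lambda>t. \<gamma> (p + q * t)))" by (simp add: o_def)
qed

lemma hpath_join:
  assumes h: "hpath a m \<gamma>" "hpath m b \<eta>" and m: "a \<le> m" "m \<le> b" and eq: "\<gamma> m = \<eta> m"
  shows "hpath a b (\<lambda>t. if t \<le> m then \<gamma> t else \<eta> t)"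
proof -
  let ?j = "\<lambda>t. if t \<le> m then \<gamma> t else \<eta> t"
  have j2: "?j t = \<eta> t" if "m \<le> t" for t using that eq by (cases "t = m") auto
  have c1: "continuous_on {a..m} ?j"
    by (rule continuous_on_eq[OF hpathD(1)[OF h(1)]]) auto
  have c2: "continuous_on {m..b} ?j"
    by (rule continuous_on_eq[OF hpathD(1)[OF h(2)] j2[symmetric]]) auto
  have "{a..b} = {a..m} \<union> {m..b}" using m by auto
  then have cont: "continuous_on {a..b} ?j"
    using continuous_on_closed_Un[OF _ _ c1 c2] by simp
  have ev1: "\<forall>\<^sub>F s in nhds t. \<gamma> s = ?j s" if "t < m" for t
    unfolding eventually_nhds by (rule exI[of _ "{..<m}"]) (use that in auto)
  have ev2: "\<forall>\<^sub>F s in nhds t. \<eta> s = ?j s" if "m < t" for t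
    unfolding eventually_nhds by (rule exI[of _ "{m<..}"]) (use that in auto)
  have "{t \<in> {a<..<b}. \<not> hor ?j t} \<subseteq> {t \<in> {a<..<m}. \<not> hor \<gamma> t} \<union> {t \<in> {m<..<b}. \<not> hor \<eta> t} \<union> {m}"
  proof
    fix t assume t: "t \<in> {t \<in> {a<..<b}. \<not> hor ?j t}"
    consider "t < m" | "t = m" | "m < t" by linarith
    then show "t \<in> {t \<in> {a<..<m}. \<not> hor \<gamma> t} \<union> {t \<in> {m<..<b}. \<not> hor \<eta> t} \<union> {m}"
      using t hor_cong(1)[OF ev1] hor_cong(1)[OF ev2] by cases auto
  qed
  moreover have "negligible ({t \<in> {a<..<m}. \<not> hor \<gamma> t} \<union> {t \<in> {m<..<b}. \<not> hor \<eta> t} \<union> {m})"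
    by (intro negligible_Un hpathD(2) h) auto
  ultimately have neg: "negligible {t \<in> {a<..<b}. \<not> hor ?j t}" by (rule negligible_subset[rotated])
  have ac: "absolutely_continuous_on_interval s t (snd c \<circ> ?j)"
    if c: "c \<in> A" and st: "a \<le> s \<and> s \<le> t \<and> t \<le> b \<and> ?j ` {s..t} \<subseteq> fst c" for c s t
  proof -
    have L: "absolutely_continuous_on_interval u v (snd c \<circ> ?j)" if "s \<le> u" "u \<le> v" "v \<le> t" "v \<le> m" for u v
    proof (rule absolutely_continuous_on_interval_cong)
      have "\<gamma> ` {u..v} = ?j ` {u..v}" by (rule image_cong) (use that in auto)
      then have "\<gamma> ` {u..v} \<subseteq> fst c" using that st by (auto simp: image_subset_iff)
      then show "absolutely_continuous_on_interval u v (snd c \<circ> \<gamma>)"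
        using st that by (intro hpathD(3)[OF h(1) c]) auto
    qed (use that in auto)
    have R: "absolutely_continuous_on_interval u v (snd c \<circ> ?j)" if "s \<le> u" "u \<le> v" "v \<le> t" "m \<le> u" for u v
    proof (rule absolutely_continuous_on_interval_cong)
      have e: "?j r = \<eta> r" if "r \<in> {u..v}" for r by (rule j2) (use that \<open>m \<le> u\<close> in auto)
      have "\<eta> ` {u..v} = ?j ` {u..v}" by (rule image_cong) (use e in auto)
      moreover have "?j ` {u..v} \<subseteq> ?j ` {s..t}" by (rule image_mono) (use that in auto)
      ultimately have "\<eta> ` {u..v} \<subseteq> fst c" using st by blast
      then show "absolutely_continuous_on_interval u v (snd c \<circ> \<eta>)"
        using st that by (intro hpathD(3)[OF h(2) c]) auto
      show "(snd c \<circ> \<eta>) r = (snd c \<circ> ?j) r" if "r \<in> {u..v}" for r using e[OF that] by simp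
    qed
    consider "t \<le> m" | "m \<le> s" | "s < m" "m < t" by linarith
    then show ?thesis
    proof cases
      case 1 then show ?thesis using L[of s t] st by simp
    next
      case 2 then show ?thesis using R[of s t] st by simp
    next
      case 3 then show ?thesis
        by (intro absolutely_continuous_on_interval_join[OF L[of s m] R[of m t]]) auto
    qed
  qed
  show ?thesis unfolding hpath_def by (intro conjI ballI allI impI cont neg) (rule ac)
qed

text \<open>Besides the displacement this provides integrability, and so measurability, of the
  velocity in coordinates.\<close>

lemma hpath_has_integral:
  assumes h: "hpath a b \<gamma>" and ab: "a \<le> b" and c: "c \<in> A" and sub: "\<gamma> ` {a..b} \<subseteq> fst c"
  shows "((\<lambda>t. vel \<gamma> t c) has_integral (snd c (\<gamma> b) - snd c (\<gamma> a))) {a..b}"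
proof -
  have ac: "absolutely_continuous_on_interval a b (snd c \<circ> \<gamma>)" by (rule hpathD(3)[OF h c]) (use ab sub in auto)
  have neg: "negligible ({t \<in> {a<..<b}. \<not> hor \<gamma> t} \<union> {a, b})"
    by (intro negligible_Un hpathD(2)[OF h]) auto
  have "(snd c \<circ> \<gamma> has_vector_derivative vel \<gamma> t c) (at t within {a..b})"
    if t: "t \<in> {a..b} - ({t \<in> {a<..<b}. \<not> hor \<gamma> t} \<union> {a, b})" for t
  proof -
    have "hor \<gamma> t" "\<gamma> t \<in> fst c" using t sub by auto
    then have "(snd c \<circ> \<gamma> has_vector_derivative vel \<gamma> t c) (at t)"
      using bspec[OF conjunct2[OF horD(2)[unfolded has_velocity_def]] c] by blast
    then show ?thesis by (rule has_vector_derivative_at_within)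
  qed
  then have "((\<lambda>t. vel \<gamma> t c) has_integral ((snd c \<circ> \<gamma>) b - (snd c \<circ> \<gamma>) a)) {a..b}"
    by (rule absolutely_continuous_has_integral_derivative[OF ac ab neg])
  then show ?thesis by simp
qed

text \<open>Measurability of the energy density is local, and in a framed chart the density is a continuous
  function of position and velocity.\<close>

lemma measurable_locally:
  fixes f :: "real \<Rightarrow> real"
  assumes ab: "a \<le> b"
    and loc: "\<And>x. x \<in> {a..b} \<Longrightarrow> \<exists>d>0. \<forall>s t. a \<le> s \<longrightarrow> s \<le> x \<longrightarrow> x \<le> t \<longrightarrow> t \<le> b \<longrightarrow> t - s < d \<longrightarrow>
      (\<lambda>r. indicator {s..t} r * f r) \<in> borel_measurable lebesgue"
  shows "(\<lambda>r. indicator {a..b} r * f r) \<in> borel_measurable lebesgue"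
proof -
  \<comment> \<open>The outer bounds are premises inside \<open>P\<close> because
    \<open>Bolzano\<close> quantifies over all small intervals around a point, including those that
    stick out of \<open>{a..b}\<close>.\<close>
  define P where "P s t \<longleftrightarrow> (a \<le> s \<longrightarrow> t \<le> b \<longrightarrow> (\<lambda>r. indicator {s..t} r * f r) \<in> borel_measurable lebesgue)" for s t
  have "P a b"
  proof (induction rule: Bolzano[OF ab])
    case (1 s t u)
    show ?case unfolding P_def
    proof (intro impI)
      assume su: "a \<le> s" "u \<le> b"
      have m: "(\<lambda>r. indicator {s..t} r * f r) \<in> borel_measurable lebesgue"
        "(\<lambda>r. indicator {t..u} r * f r) \<in> borel_measurable lebesgue"
        using 1 su by (auto simp: P_def)
      have "(\<lambda>r. if r \<le> t then indicator {s..t} r * f r else indicator {t..u} r * f r) \<in> borel_measurable lebesgue"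
        by (intro measurable_If m) auto
      also have "(\<lambda>r. if r \<le> t then indicator {s..t} r * f r else indicator {t..u} r * f r) =
          (\<lambda>r. indicator {s..u} r * f r)"
        using 1(3,4) by (auto simp: fun_eq_iff indicator_def)
      finally show "(\<lambda>r. indicator {s..u} r * f r) \<in> borel_measurable lebesgue" .
    qed
  next
    case (2 x)
    then obtain d where d: "d > 0" "\<forall>s t. a \<le> s \<longrightarrow> s \<le> x \<longrightarrow> x \<le> t \<longrightarrow> t \<le> b \<longrightarrow> t - s < d \<longrightarrow>
      (\<lambda>r. indicator {s..t} r * f r) \<in> borel_measurable lebesgue" using loc[of x] by auto
    then show ?case unfolding P_def by (intro exI[of _ d]) auto
  qed
  then show ?thesis by (simp add: P_def)
qed

lemma chart_neighbourhood_path: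
  fixes \<gamma> :: "real \<Rightarrow> 'a"
  assumes cont: "continuous_on {a..b} \<gamma>" and x: "x \<in> {a..b}" and c: "c \<in> A" "\<gamma> x \<in> fst c" and R: "0 < R"
  shows "\<exists>d>0. \<forall>t\<in>{a..b}. \<bar>t - x\<bar> < d \<longrightarrow> \<gamma> t \<in> fst c \<and> snd c (\<gamma> t) \<in> cball (snd c (\<gamma> x)) R"
proof -
  define W where "W = fst c \<inter> snd c -` ball (snd c (\<gamma> x)) R"
  have W: "open W" unfolding W_def
    by (rule continuous_open_preimage[OF chart_continuous[OF c(1)] chart_open(1)[OF c(1)]]) simp
  have "\<gamma> x \<in> W" using c R by (simp add: W_def)
  then obtain B where B: "open B" "x \<in> B" "\<forall>t\<in>{a..b}. t \<in> B \<longrightarrow> \<gamma> t \<in> W"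
    using cont x W unfolding continuous_on_topological by meson
  then obtain d where d: "0 < d" "ball x d \<subseteq> B" using open_contains_ball by blast
  have "\<gamma> t \<in> fst c \<and> snd c (\<gamma> t) \<in> cball (snd c (\<gamma> x)) R" if "t \<in> {a..b}" "\<bar>t - x\<bar> < d" for t
  proof -
    have "t \<in> B" using d(2) that(2) by (auto simp: subset_iff dist_real_def abs_minus_commute)
    then show ?thesis using B(3) that(1) by (auto simp: W_def)
  qed
  then show ?thesis using d(1) by blast
qed

lemma framed_chart_exists:
  assumes "c \<in> A" "x \<in> fst c"
  shows "\<exists>U m X. framed_chart A \<Delta> g c U m X x"
proof -
  obtain U m X where "x \<in> U" "local_frame A \<Delta> U m X"
    "\<forall>y\<in>U. span ((\<lambda>Z. Z y) ` iterated_brackets A (X ` {..<m})) = tangent_space A y"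
    using frame_exists by blast
  then have "framed_chart A \<Delta> g c U m X x"
    using assms by unfold_locales auto
  then show ?thesis by blast
qed

lemma speed_sq_measurable:
  assumes h: "hpath a b \<gamma>" and ab: "a \<le> b"
  shows "(\<lambda>t. indicator {a..b} t * speed_sq \<gamma> t) \<in> borel_measurable lebesgue"
proof (rule measurable_locally[OF ab])
  fix x assume x: "x \<in> {a..b}"
  obtain c where c: "c \<in> A" "\<gamma> x \<in> fst c" using chart_exists by blast
  obtain U m X where fc: "framed_chart A \<Delta> g c U m X (\<gamma> x)" using framed_chart_exists[OF c] by blast
  from framed_chart.local_model[OF fc] obtain R and F :: "'e \<times> 'e \<Rightarrow> real" where R: "0 < R"
    and F: "continuous_on (cball (snd c (\<gamma> x)) R \<times> UNIV) F"
    and gF: "\<forall>y\<in>fst c. snd c y \<in> cball (snd c (\<gamma> x)) R \<longrightarrow> (\<forall>v\<in>\<Delta> y. g y v v = F (snd c y, v c))" by blast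
  let ?K = "cball (snd c (\<gamma> x)) R"
  obtain d where d: "0 < d" "\<forall>t\<in>{a..b}. \<bar>t - x\<bar> < d \<longrightarrow> \<gamma> t \<in> fst c \<and> snd c (\<gamma> t) \<in> ?K"
    using chart_neighbourhood_path[OF hpathD(1)[OF h] x c R] by blast
  show "\<exists>d>0. \<forall>s t. a \<le> s \<longrightarrow> s \<le> x \<longrightarrow> x \<le> t \<longrightarrow> t \<le> b \<longrightarrow> t - s < d \<longrightarrow>
      (\<lambda>r. indicator {s..t} r * speed_sq \<gamma> r) \<in> borel_measurable lebesgue"
  proof (intro exI[of _ d] conjI d(1) allI impI)
    fix s t assume st: "a \<le> s" "s \<le> x" "x \<le> t" "t \<le> b" "t - s < d"
    have inK: "\<gamma> r \<in> fst c \<and> snd c (\<gamma> r) \<in> ?K" if "r \<in> {s..t}" for r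
    proof -
      have "r \<in> {a..b}" "\<bar>r - x\<bar> < d" using that st by auto
      then show ?thesis using d(2) by blast
    qed
    have h': "hpath s t \<gamma>" by (rule hpath_subinterval[OF h]) (use st in auto)
    have sub: "\<gamma> ` {s..t} \<subseteq> fst c" using inK by blast
    have "((\<lambda>r. vel \<gamma> r c) has_integral (snd c (\<gamma> t) - snd c (\<gamma> s))) {s..t}"
      by (rule hpath_has_integral[OF h' _ c(1) sub]) (use st in simp)
    then have m1: "(\<lambda>r. vel \<gamma> r c) \<in> borel_measurable (lebesgue_on {s..t})"
      by (intro integrable_imp_measurable) (rule has_integral_integrable)
    have "continuous_on {s..t} (\<lambda>r. snd c (\<gamma> r))"
      by (rule continuous_on_compose2[OF chart_continuous[OF c(1)] hpathD(1)[OF h'] sub])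
    then have m2: "(\<lambda>r. snd c (\<gamma> r)) \<in> borel_measurable (lebesgue_on {s..t})"
      by (rule continuous_imp_measurable_on_sets_lebesgue) simp
    have "(\<lambda>r. (snd c (\<gamma> r), vel \<gamma> r c)) \<in> measurable (lebesgue_on {s..t}) (restrict_space borel (?K \<times> UNIV))"
      by (rule measurable_restrict_space2[OF _ borel_measurable_Pair[OF m2 m1]]) (use inK in auto)
    from measurable_compose[OF this borel_measurable_continuous_on_restrict[OF F]]
    have m3: "(\<lambda>r. F (snd c (\<gamma> r), vel \<gamma> r c)) \<in> borel_measurable (lebesgue_on {s..t})" .
    then have m4: "(\<lambda>r. indicator {s..t} r * F (snd c (\<gamma> r), vel \<gamma> r c)) \<in> borel_measurable lebesgue"
      by (subst (asm) borel_measurable_restrict_space_iff) simp_all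
    \<comment> \<open>The continuous model and the energy density differ at most at non-horizontal
      times and at the two ends. This is a null set, and Lebesgue measure is complete.\<close>
    have "{r. indicator {s..t} r * F (snd c (\<gamma> r), vel \<gamma> r c) \<noteq> indicator {s..t} r * speed_sq \<gamma> r} \<subseteq>
        {r \<in> {s<..<t}. \<not> hor \<gamma> r} \<union> {s, t}"
    proof
      fix r assume r: "r \<in> {r. indicator {s..t} r * F (snd c (\<gamma> r), vel \<gamma> r c) \<noteq> indicator {s..t} r * speed_sq \<gamma> r}"
      then have rst: "r \<in> {s..t}" by (auto simp: indicator_def split: if_splits)
      have "\<not> hor \<gamma> r"
      proof
        assume hr: "hor \<gamma> r"
        have "g (\<gamma> r) (vel \<gamma> r) (vel \<gamma> r) = F (snd c (\<gamma> r), vel \<gamma> r c)"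
          using gF inK[OF rst] horD(1)[OF hr] by blast
        then show False using r hr by (simp add: speed_sq_def)
      qed
      then show "r \<in> {r \<in> {s<..<t}. \<not> hor \<gamma> r} \<union> {s, t}" using rst by auto
    qed
    moreover have "negligible ({r \<in> {s<..<t}. \<not> hor \<gamma> r} \<union> {s, t})"
      by (intro negligible_Un hpathD(2)[OF h']) auto
    ultimately have "AE r in lebesgue. indicator {s..t} r * F (snd c (\<gamma> r), vel \<gamma> r c) = indicator {s..t} r * speed_sq \<gamma> r"
      unfolding eventually_ae_filter_negligible by blast
    with m4 show "(\<lambda>r. indicator {s..t} r * speed_sq \<gamma> r) \<in> borel_measurable lebesgue" by (rule borel_measurable_AE)
  qed
qed

lemma energy_mono: "a \<le> a' \<Longrightarrow> b' \<le> b \<Longrightarrow> energy a' b' \<gamma> \<le> energy a b \<gamma>"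
  unfolding energy_def using speed_sq_nonneg[of \<gamma>]
  by (intro nn_integral_mono ennreal_leI) (auto simp: indicator_def)

lemma energy_split:
  assumes h: "hpath a b \<gamma>" and m: "a \<le> m" "m \<le> b"
  shows "energy a b \<gamma> = energy a m \<gamma> + energy m b \<gamma>"
proof -
  have ms: "(\<lambda>t. indicator {a..m} t * speed_sq \<gamma> t) \<in> borel_measurable lebesgue"
    "(\<lambda>t. indicator {m..b} t * speed_sq \<gamma> t) \<in> borel_measurable lebesgue"
    using hpath_subinterval[OF h, of a m] hpath_subinterval[OF h, of m b] m by (auto intro: speed_sq_measurable)
  have "energy a m \<gamma> + energy m b \<gamma> =
    (\<integral>\<^sup>+t. ennreal (indicator {a..m} t * speed_sq \<gamma> t) + ennreal (indicator {m..b} t * speed_sq \<gamma> t) \<partial>lebesgue)"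
    unfolding energy_def by (rule nn_integral_add[symmetric]) (use ms in simp_all)
  also have "\<dots> = energy a b \<gamma>"
    unfolding energy_def
  proof (rule nn_integral_cong_AE)
    have "ennreal (indicator {a..m} t * speed_sq \<gamma> t) + ennreal (indicator {m..b} t * speed_sq \<gamma> t) =
        ennreal (indicator {a..b} t * speed_sq \<gamma> t)" if "t \<noteq> m" for t
      using that m by (auto simp: indicator_def)
    then show "AE t in lebesgue. ennreal (indicator {a..m} t * speed_sq \<gamma> t) + ennreal (indicator {m..b} t * speed_sq \<gamma> t) =
        ennreal (indicator {a..b} t * speed_sq \<gamma> t)"
      unfolding eventually_ae_filter_negligible by (intro exI[of _ "{m}"]) auto
  qed
  finally show ?thesis ..
qed

lemma energy_cong:
  assumes "\<And>t. t \<in> {a<..<b} \<Longrightarrow> \<gamma> t = \<eta> t"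
  shows "energy a b \<gamma> = energy a b \<eta>"
  unfolding energy_def
proof (rule nn_integral_cong_AE)
  have "speed_sq \<gamma> t = speed_sq \<eta> t" if t: "t \<in> {a<..<b}" for t
  proof (rule hor_cong(3))
    show "\<forall>\<^sub>F s in nhds t. \<gamma> s = \<eta> s"
      unfolding eventually_nhds by (rule exI[of _ "{a<..<b}"]) (use t assms in auto)
  qed
  then have "ennreal (indicator {a..b} t * speed_sq \<gamma> t) = ennreal (indicator {a..b} t * speed_sq \<eta> t)"
    if "t \<notin> {a, b}" for t using that by (cases "t \<in> {a<..<b}") (auto simp: indicator_def)
  then show "AE t in lebesgue. ennreal (indicator {a..b} t * speed_sq \<gamma> t) = ennreal (indicator {a..b} t * speed_sq \<eta> t)"
    unfolding eventually_ae_filter_negligible by (intro exI[of _ "{a, b}"]) auto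
qed

text \<open>Velocities scale by \<open>q\<close>, so the density gains \<open>q\<^sup>2\<close>, and
  the change of variable takes one factor \<open>q\<close> back.\<close>

lemma energy_affine:
  assumes h: "hpath (p + q * a) (p + q * b) \<gamma>" and q: "0 < q" and ab: "a \<le> b"
  shows "energy a b (\<lambda>t. \<gamma> (p + q * t)) = ennreal q * energy (p + q * a) (p + q * b) \<gamma>"
proof -
  define f where "f t = ennreal (indicator {p + q * a..p + q * b} t * speed_sq \<gamma> t)" for t
  have f: "f \<in> borel_measurable lebesgue"
    unfolding f_def[abs_def] using speed_sq_measurable[OF h] q ab by simp
  have ind: "indicator {p + q * a..p + q * b} (p + q * t) = (indicator {a..b} t :: real)" for t
    using q by (auto simp: indicator_def)
  have "energy a b (\<lambda>t. \<gamma> (p + q * t)) = (\<integral>\<^sup>+t. ennreal (q\<^sup>2) * f (p + q * t) \<partial>lebesgue)"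
    unfolding energy_def f_def ind hor_affine(2)[OF less_imp_neq[OF q, symmetric]]
    by (intro nn_integral_cong) (simp add: ennreal_mult'[symmetric] mult.left_commute)
  also have "\<dots> = ennreal (q\<^sup>2) * (\<integral>\<^sup>+t. f (p + q * t) \<partial>lebesgue)"
  proof (rule nn_integral_cmult)
    have "(\<lambda>t. p + q * t) \<in> measurable lebesgue lebesgue"
      using lebesgue_affine_measurable[of "\<lambda>_. q" p] q by simp
    then show "(\<lambda>t. f (p + q * t)) \<in> borel_measurable lebesgue" using f by (rule measurable_compose)
  qed
  also have "\<dots> = ennreal q * (ennreal \<bar>q\<bar> * (\<integral>\<^sup>+t. f (p + q * t) \<partial>lebesgue))"
    using q by (simp add: power2_eq_square ennreal_mult mult.assoc)
  also have "ennreal \<bar>q\<bar> * (\<integral>\<^sup>+t. f (p + q * t) \<partial>lebesgue) = integral\<^sup>N lebesgue f"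
    by (rule nn_integral_real_affine_lebesgue[symmetric, OF f]) (use q in simp)
  finally show ?thesis by (simp add: energy_def f_def[abs_def])
qed

end

section \<open>The value function: comparison with energies, triangle inequality\<close>

section \<open>The value function as a squared distance\<close>

lemma negligible_countable:
  fixes N :: "'a::euclidean_space set"
  shows "countable N \<Longrightarrow> negligible N"
  by (simp add: negligible_iff_null_sets null_sets_completionI countable_imp_null_set_lborel)

context sub_riemannian
begin

text \<open>Away from the ends of \<open>{0..1}\<close> a derivative within the interval is
  two-sided, so both notions of velocity agree; the two end points form a null set.\<close>

lemma velocity_interior:
  assumes t: "t \<in> {0<..<1}"
  shows "path_differentiable_at A \<gamma> t \<and> velocity A \<gamma> t \<in> \<Delta> (\<gamma> t) \<longleftrightarrow> hor \<gamma> t"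
    and "hor \<gamma> t \<Longrightarrow> velocity A \<gamma> t = vel \<gamma> t"
proof -
  have at: "at t within {0..1} = at t" using t by (intro at_within_Icc_at) auto
  have vel: "velocity A \<gamma> t = v" if v: "has_velocity \<gamma> v t" for v
  proof
    fix c
    show "velocity A \<gamma> t c = v c"
    proof (cases "c \<in> A \<and> \<gamma> t \<in> fst c")
      case True
      then have "(snd c \<circ> \<gamma> has_vector_derivative v c) (at t)" using v unfolding has_velocity_def by blast
      then show ?thesis using True by (simp add: velocity_def at vector_derivative_at)
    next
      case False
      then show ?thesis using v tangent_zero[of v "\<gamma> t" c] unfolding has_velocity_def velocity_def by auto
    qed
  qed
  show "path_differentiable_at A \<gamma> t \<and> velocity A \<gamma> t \<in> \<Delta> (\<gamma> t) \<longleftrightarrow> hor \<gamma> t"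
  proof
    assume l: "path_differentiable_at A \<gamma> t \<and> velocity A \<gamma> t \<in> \<Delta> (\<gamma> t)"
    have "(snd c \<circ> \<gamma> has_vector_derivative velocity A \<gamma> t c) (at t)" if "c \<in> A" "\<gamma> t \<in> fst c" for c
    proof -
      have "(snd c \<circ> \<gamma>) differentiable (at t)"
        using l that unfolding path_differentiable_at_def at by blast
      then show ?thesis using that by (simp add: velocity_def at vector_derivative_works[symmetric])
    qed
    then have "has_velocity \<gamma> (velocity A \<gamma> t) t"
      using l Delta_tangent unfolding has_velocity_def by blast
    then show "hor \<gamma> t" using l unfolding hor_def by blast
  next
    assume "hor \<gamma> t"
    then obtain v where v: "v \<in> \<Delta> (\<gamma> t)" "has_velocity \<gamma> v t" unfolding hor_def by blast
    then have "path_differentiable_at A \<gamma> t"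
      unfolding path_differentiable_at_def has_velocity_def at
      using has_vector_derivative_def differentiable_def by blast
    then show "path_differentiable_at A \<gamma> t \<and> velocity A \<gamma> t \<in> \<Delta> (\<gamma> t)" using v vel by simp
  qed
  show "hor \<gamma> t \<Longrightarrow> velocity A \<gamma> t = vel \<gamma> t" using vel horD(2) by blast
qed

lemma horizontal_path_iff: "horizontal_path A \<Delta> \<gamma> \<longleftrightarrow> hpath 0 1 \<gamma>"
proof -
  let ?P = "\<lambda>t. path_differentiable_at A \<gamma> t \<and> velocity A \<gamma> t \<in> \<Delta> (\<gamma> t)"
  have "(AE t in lebesgue_on {0..1}. ?P t) \<longleftrightarrow> (AE t in lebesgue. t \<in> {0..1} \<longrightarrow> ?P t)"
    by (subst AE_restrict_space_iff) auto
  also have "\<dots> \<longleftrightarrow> negligible {t \<in> {0<..<1}. \<not> hor \<gamma> t}"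
  proof
    assume "AE t in lebesgue. t \<in> {0..1} \<longrightarrow> ?P t"
    then obtain N where N: "negligible N" "{t. \<not> (t \<in> {0..1} \<longrightarrow> ?P t)} \<subseteq> N"
      unfolding eventually_ae_filter_negligible by blast
    have "{t \<in> {0<..<1}. \<not> hor \<gamma> t} \<subseteq> N" using N(2) velocity_interior(1)[of _ \<gamma>] by fastforce
    then show "negligible {t \<in> {0<..<1}. \<not> hor \<gamma> t}" using N(1) negligible_subset by blast
  next
    assume n: "negligible {t \<in> {0<..<1}. \<not> hor \<gamma> t}"
    have "negligible ({t \<in> {0<..<1}. \<not> hor \<gamma> t} \<union> {0, 1})" using n by (intro negligible_Un) auto
    moreover have "{t. \<not> (t \<in> {0..1} \<longrightarrow> ?P t)} \<subseteq> {t \<in> {0<..<1}. \<not> hor \<gamma> t} \<union> {0, 1}"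
    proof
      fix t assume t: "t \<in> {t. \<not> (t \<in> {0..1} \<longrightarrow> ?P t)}"
      show "t \<in> {t \<in> {0<..<1}. \<not> hor \<gamma> t} \<union> {0, 1}"
      proof (cases "t \<in> {0<..<1}")
        case True
        then show ?thesis using t velocity_interior(1)[OF True, of \<gamma>] by blast
      qed (use t in auto)
    qed
    ultimately show "AE t in lebesgue. t \<in> {0..1} \<longrightarrow> ?P t"
      unfolding eventually_ae_filter_negligible by blast
  qed
  finally show ?thesis
    unfolding horizontal_path_def hpath_def absolutely_continuous_path_def by blast
qed

lemma path_energy_eq:
  assumes h: "hpath 0 1 \<gamma>"
  shows "path_energy A g \<gamma> = energy 0 1 \<gamma>"
proof -
  have "path_energy A g \<gamma> = (\<integral>\<^sup>+t. ennreal (g (\<gamma> t) (velocity A \<gamma> t) (velocity A \<gamma> t)) * indicator {0..1} t \<partial>lebesgue)"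
    unfolding path_energy_def by (subst nn_integral_restrict_space) auto
  also have "\<dots> = energy 0 1 \<gamma>"
    unfolding energy_def
  proof (rule nn_integral_cong_AE)
    have "negligible ({t \<in> {0<..<1}. \<not> hor \<gamma> t} \<union> {0, 1})"
      by (intro negligible_Un hpathD(2)[OF h]) auto
    moreover have "ennreal (g (\<gamma> t) (velocity A \<gamma> t) (velocity A \<gamma> t)) * indicator {0..1} t =
        ennreal (indicator {0..1} t * speed_sq \<gamma> t)" if "t \<notin> {t \<in> {0<..<1}. \<not> hor \<gamma> t} \<union> {0, 1}" for t
    proof (cases "t \<in> {0<..<1}")
      case True
      then have "hor \<gamma> t" using that by auto
      then show ?thesis using velocity_interior(2)[OF True] True by (simp add: speed_sq_def)
    next
      case False
      then have "t \<notin> {0..1}" using that by auto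
      then show ?thesis by simp
    qed
    ultimately show "AE t in lebesgue. ennreal (g (\<gamma> t) (velocity A \<gamma> t) (velocity A \<gamma> t)) * indicator {0..1} t =
        ennreal (indicator {0..1} t * speed_sq \<gamma> t)"
      unfolding eventually_ae_filter_negligible by blast
  qed
  finally show ?thesis .
qed

abbreviation "V \<equiv> value_function A \<Delta> g"

text \<open>Rescaling to unit duration multiplies the energy by the old duration.\<close>

lemma V_le_energy:
  assumes h: "hpath a b \<gamma>" and ab: "a < b"
  shows "V (\<gamma> a) (\<gamma> b) \<le> ennreal (b - a) * energy a b \<gamma>"
proof -
  let ?\<eta> = "\<lambda>t. \<gamma> (a + (b - a) * t)"
  have h': "hpath (a + (b - a) * 0) (a + (b - a) * 1) \<gamma>" using h by simp
  have \<eta>: "hpath 0 1 ?\<eta>" by (rule hpath_affine[OF h']) (use ab in simp)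
  have "?\<eta> \<in> horizontal_paths A \<Delta> (\<gamma> a) (\<gamma> b)"
    using \<eta> by (simp add: horizontal_paths_def horizontal_path_iff)
  then have "V (\<gamma> a) (\<gamma> b) \<le> path_energy A g ?\<eta>"
    unfolding value_function_def by (rule INF_lower)
  also have "\<dots> = energy 0 1 ?\<eta>" by (rule path_energy_eq[OF \<eta>])
  also have "\<dots> = ennreal (b - a) * energy a b \<gamma>"
    using energy_affine[OF h'] ab by simp
  finally show ?thesis .
qed

lemma V_le_speed_bound:
  assumes h: "hpath a b \<gamma>" and ab: "a < b" and N: "countable N"
    and sp: "\<And>t. t \<in> {a<..<b} - N \<Longrightarrow> speed_sq \<gamma> t \<le> C" and C: "0 \<le> C"
  shows "V (\<gamma> a) (\<gamma> b) \<le> ennreal ((b - a)\<^sup>2 * C)"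
proof -
  have "energy a b \<gamma> \<le> (\<integral>\<^sup>+t. ennreal C * indicator {a..b} t \<partial>lebesgue)"
    unfolding energy_def
  proof (rule nn_integral_mono_AE)
    have "negligible (N \<union> {a, b})" by (intro negligible_Un negligible_countable[OF N]) simp
    moreover have "ennreal (indicator {a..b} t * speed_sq \<gamma> t) \<le> ennreal C * indicator {a..b} t"
      if "t \<notin> N \<union> {a, b}" for t
      using sp[of t] that C by (cases "t \<in> {a..b}") (auto intro!: ennreal_leI)
    ultimately show "AE t in lebesgue. ennreal (indicator {a..b} t * speed_sq \<gamma> t) \<le> ennreal C * indicator {a..b} t"
      unfolding eventually_ae_filter_negligible by blast
  qed
  also have "\<dots> = ennreal C * ennreal (b - a)" using ab by (simp add: nn_integral_cmult_indicator)
  finally have E: "energy a b \<gamma> \<le> ennreal C * ennreal (b - a)" .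
  have "V (\<gamma> a) (\<gamma> b) \<le> ennreal (b - a) * energy a b \<gamma>" by (rule V_le_energy[OF h ab])
  also have "\<dots> \<le> ennreal (b - a) * (ennreal C * ennreal (b - a))" using E by (intro mult_mono) auto
  also have "\<dots> = ennreal ((b - a)\<^sup>2 * C)" using ab C by (simp add: ennreal_mult[symmetric] power2_eq_square mult_ac)
  finally show ?thesis .
qed

lemma V_less_path:
  assumes "V x y < E"
  shows "\<exists>\<gamma>. hpath 0 1 \<gamma> \<and> \<gamma> 0 = x \<and> \<gamma> 1 = y \<and> energy 0 1 \<gamma> < E"
proof -
  obtain \<gamma> where "\<gamma> \<in> horizontal_paths A \<Delta> x y" "path_energy A g \<gamma> < E"
    using assms unfolding value_function_def INF_less_iff by blast
  then show ?thesis using path_energy_eq horizontal_path_iff by (auto simp: horizontal_paths_def)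
qed

text \<open>Duration \<open>p\<close> normalises the mean square speed to at most 1; in this
  normalisation durations and energy bounds simply add up when paths are joined.\<close>

lemma V_less_path_duration:
  assumes V: "V x y < ennreal (p\<^sup>2)" and p: "0 < p"
  shows "\<exists>\<gamma>. hpath s (s + p) \<gamma> \<and> \<gamma> s = x \<and> \<gamma> (s + p) = y \<and> energy s (s + p) \<gamma> \<le> ennreal p"
proof -
  obtain \<gamma> where \<gamma>: "hpath 0 1 \<gamma>" "\<gamma> 0 = x" "\<gamma> 1 = y" "energy 0 1 \<gamma> < ennreal (p\<^sup>2)"
    using V_less_path[OF V] by blast
  let ?\<eta> = "\<lambda>t. \<gamma> (- s / p + (1 / p) * t)"
  have e: "- s / p + (1 / p) * s = 0" "- s / p + (1 / p) * (s + p) = 1" using p by (auto simp: field_simps)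
  have h: "hpath (- s / p + (1 / p) * s) (- s / p + (1 / p) * (s + p)) \<gamma>" unfolding e by (rule \<gamma>(1))
  have \<eta>: "hpath s (s + p) ?\<eta>" by (rule hpath_affine[OF h]) (use p in simp)
  have "energy s (s + p) ?\<eta> = ennreal (1 / p) * energy 0 1 \<gamma>"
    using energy_affine[OF h] p unfolding e by simp
  also have "\<dots> \<le> ennreal (1 / p) * ennreal (p\<^sup>2)" using \<gamma>(4) by (intro mult_left_mono) auto
  also have "\<dots> = ennreal p" using p by (simp add: ennreal_mult[symmetric] power2_eq_square)
  finally show ?thesis using \<eta> \<gamma>(2,3) e by (intro exI[of _ ?\<eta>]) simp
qed

text \<open>Giving the two pieces durations proportional to their lengths turns the energies \<open>p\<^sup>2\<close> and \<open>q\<^sup>2\<close>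
  into \<open>(p + q)\<^sup>2\<close>.\<close>

lemma V_triangle:
  assumes "V x y < ennreal (p\<^sup>2)" "V y z < ennreal (q\<^sup>2)" and pq: "0 < p" "0 < q"
  shows "V x z \<le> ennreal ((p + q)\<^sup>2)"
proof -
  obtain \<gamma> where \<gamma>: "hpath 0 p \<gamma>" "\<gamma> 0 = x" "\<gamma> p = y" "energy 0 p \<gamma> \<le> ennreal p"
    using V_less_path_duration[OF assms(1) pq(1), of 0] by auto
  obtain \<eta> where \<eta>: "hpath p (p + q) \<eta>" "\<eta> p = y" "\<eta> (p + q) = z" "energy p (p + q) \<eta> \<le> ennreal q"
    using V_less_path_duration[OF assms(2) pq(2), of p] by auto
  let ?j = "\<lambda>t. if t \<le> p then \<gamma> t else \<eta> t"
  have j: "hpath 0 (p + q) ?j" by (rule hpath_join[OF \<gamma>(1) \<eta>(1)]) (use pq \<gamma> \<eta> in auto)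
  have "energy 0 (p + q) ?j = energy 0 p ?j + energy p (p + q) ?j"
    by (rule energy_split[OF j]) (use pq in auto)
  also have "energy 0 p ?j = energy 0 p \<gamma>" by (rule energy_cong) auto
  also have "energy p (p + q) ?j = energy p (p + q) \<eta>" by (rule energy_cong) auto
  also have "energy 0 p \<gamma> + energy p (p + q) \<eta> \<le> ennreal (p + q)"
    using add_mono[OF \<gamma>(4) \<eta>(4)] pq by simp
  finally have E: "energy 0 (p + q) ?j \<le> ennreal (p + q)" .
  have "V (?j 0) (?j (p + q)) \<le> ennreal (p + q - 0) * energy 0 (p + q) ?j"
    by (rule V_le_energy[OF j]) (use pq in simp)
  also have "\<dots> \<le> ennreal (p + q) * ennreal (p + q)" using E by (intro mult_mono) auto
  also have "\<dots> = ennreal ((p + q)\<^sup>2)"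
    using pq by (simp add: ennreal_mult[symmetric] power2_eq_square del: ennreal_plus)
  finally show ?thesis using pq \<gamma>(2) \<eta>(3) by simp
qed

lemma V_refl: "V x x = 0"
proof -
  have v: "has_velocity (\<lambda>_. x) 0 t" for t
    unfolding has_velocity_def using subspace_0[OF subspace_tangent] by (auto simp: o_def)
  have hor: "hor (\<lambda>_. x) t" for t unfolding hor_def using v subspace_0[OF subspace_Delta] by blast
  have h: "hpath 0 1 (\<lambda>_. x)"
    unfolding hpath_def by (auto simp: hor o_def intro!: lipschitz_imp_absolutely_continuous lipschitz_on_constant)
  have "speed_sq (\<lambda>_. x) t = 0" for t
    using vel_eq[OF v[of t]] inner_product_on_0_left[OF inner_product_g subspace_Delta subspace_0[OF subspace_Delta]]
    by (simp add: speed_sq_def)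
  then have "energy 0 1 (\<lambda>_. x) = 0" by (simp add: energy_def)
  then show ?thesis using V_le_energy[OF h] by simp
qed

end

section \<open>Finiteness and continuity of the value function\<close>

section \<open>Curves in a framed chart\<close>

context framed_chart
begin

text \<open>In the other charts the curve is composed with a smooth transition map, which preserves
  absolute continuity on compact intervals; the velocity needs to be checked in the chart
  \<open>c\<close> alone.\<close>

lemma chart_curve:
  fixes x :: "real \<Rightarrow> 'e"
  assumes lip: "M-lipschitz_on {0..T} x" and sub: "x ` {0..T} \<subseteq> Om" and N: "countable N"
    and der: "\<And>t. t \<in> {0<..<T} - N \<Longrightarrow> \<exists>v\<in>\<Delta> (chart_inv c (x t)). (x has_vector_derivative v c) (at t)"
  shows "hpath 0 T (\<lambda>t. chart_inv c (x t))"
    and "\<And>t v. t \<in> {0<..<T} \<Longrightarrow> v \<in> \<Delta> (chart_inv c (x t)) \<Longrightarrow> (x has_vector_derivative v c) (at t) \<Longrightarrow>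
      has_velocity (\<lambda>t. chart_inv c (x t)) v t"
proof -
  let ?\<gamma> = "\<lambda>t. chart_inv c (x t)"
  have contx: "continuous_on {0..T} x" using lip by (rule lipschitz_on_continuous_on)
  have xO: "x t \<in> Om" if "t \<in> {0..T}" for t using sub that by blast
  have \<gamma>c: "?\<gamma> t \<in> fst c" "snd c (?\<gamma> t) = x t" if "t \<in> {0..T}" for t
    using Om_inv[OF xO[OF that]] by auto
  have sub': "x ` {0..T} \<subseteq> snd c ` fst c" using sub Om_sub by blast
  show vel: "has_velocity ?\<gamma> v t"
    if t: "t \<in> {0<..<T}" and v: "v \<in> \<Delta> (?\<gamma> t)" and d: "(x has_vector_derivative v c) (at t)" for t v
  proof (rule has_velocityI[OF c(1)])
    show "?\<gamma> t \<in> fst c" using \<gamma>c(1) t by auto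
    show "v \<in> tangent_space A (?\<gamma> t)" by (rule Delta_tangent[OF v])
    show "(snd c \<circ> ?\<gamma> has_vector_derivative v c) (at t)"
      by (rule has_vector_derivative_transform_within_open[OF d, of "{0<..<T}"]) (use t \<gamma>c(2) in auto)
    show "\<forall>\<^sub>F s in nhds t. ?\<gamma> s \<in> fst c"
      unfolding eventually_nhds by (rule exI[of _ "{0<..<T}"]) (use t \<gamma>c(1) in auto)
  qed
  show "hpath 0 T ?\<gamma>"
    unfolding hpath_def
  proof (intro conjI ballI allI impI)
    show "continuous_on {0..T} ?\<gamma>"
      by (rule continuous_on_compose2[OF chart_inv_continuous[OF c(1)] contx sub'])
    have "{t \<in> {0<..<T}. \<not> hor ?\<gamma> t} \<subseteq> N"
    proof
      fix t assume t: "t \<in> {t \<in> {0<..<T}. \<not> hor ?\<gamma> t}"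
      show "t \<in> N"
      proof (rule ccontr)
        assume "t \<notin> N"
        with t have tN: "t \<in> {0<..<T} - N" by simp
        from der[OF tN] obtain v where v: "v \<in> \<Delta> (?\<gamma> t)" "(x has_vector_derivative v c) (at t)"
          by (elim bexE)
        have "has_velocity ?\<gamma> v t" by (rule vel[OF _ v]) (use tN in simp)
        with v(1) have "hor ?\<gamma> t" unfolding hor_def by (intro bexI[of _ v])
        then show False using t by simp
      qed
    qed
    then show "negligible {t \<in> {0<..<T}. \<not> hor ?\<gamma> t}"
      by (rule negligible_subset[OF negligible_countable[OF N]])
    fix c' s t assume c': "c' \<in> A" and st: "0 \<le> s \<and> s \<le> t \<and> t \<le> T \<and> ?\<gamma> ` {s..t} \<subseteq> fst c'"
    let ?S = "snd c ` (fst c \<inter> fst c')"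
    have "Ck_on 1 ?S (snd c' \<circ> chart_inv c)"
      using transition_smooth[OF c(1) c'] unfolding smooth_on_def by (rule spec)
    moreover have "open ?S"
    proof -
      have "open (snd c ` (fst c' \<inter> fst c))" by (rule chart_image_open[OF c(1) chart_open(1)[OF c']])
      then show ?thesis by (simp only: Int_commute)
    qed
    moreover have "absolutely_continuous_on_interval s t x"
      by (rule lipschitz_imp_absolutely_continuous[OF lipschitz_on_subset[OF lip]]) (use st in auto)
    moreover have "continuous_on {s..t} x" by (rule continuous_on_subset[OF contx]) (use st in auto)
    moreover have "x ` {s..t} \<subseteq> ?S"
    proof (rule image_subsetI)
      fix r assume r: "r \<in> {s..t}"
      then have 1: "?\<gamma> r \<in> fst c'" using st by blast
      have 2: "?\<gamma> r \<in> fst c" "snd c (?\<gamma> r) = x r" using \<gamma>c[of r] r st by auto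
      show "x r \<in> ?S" by (rule image_eqI[of _ _ "?\<gamma> r"]) (use 1 2 in simp_all)
    qed
    ultimately have "absolutely_continuous_on_interval s t (\<lambda>r. (snd c' \<circ> chart_inv c) (x r))"
      by (rule absolutely_continuous_compose_C1)
    then show "absolutely_continuous_on_interval s t (snd c' \<circ> ?\<gamma>)" by (simp only: o_def)
  qed
qed

text \<open>Both signs occur because inverse words run fields backwards.\<close>

definition Fields :: "('e \<Rightarrow> 'e) set" where "Fields = Xc ` {..<m} \<union> uminus ` Xc ` {..<m}"

lemma Fields_smooth: "\<forall>Y\<in>Fields. smooth_on Om Y"
  using X_smooth smooth_on_minus[OF open_Om] by (auto simp: Fields_def fun_Compl_def)

lemma Fields_minus: "\<forall>Y\<in>Fields. - Y \<in> Fields"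
  by (auto simp: Fields_def)

lemma Fields_horizontal:
  assumes "Y \<in> Fields" "u \<in> Om"
  shows "\<exists>v\<in>\<Delta> (chart_inv c u). v c = Y u \<and> (\<exists>i<m. g (chart_inv c u) v v = G i i u)"
proof -
  have u: "chart_inv c u \<in> U" using Om_inv(1)[OF assms(2)] by simp
  obtain i where i: "i < m" "Y = Xc i \<or> Y = - Xc i" using assms(1) by (auto simp: Fields_def)
  have X: "X i (chart_inv c u) \<in> \<Delta> (chart_inv c u)" by (rule X_Delta[OF i(1) u])
  from i(2) show ?thesis
  proof
    assume "Y = Xc i"
    then show ?thesis using X i(1) by (intro bexI[OF _ X]) (auto simp: Xc_def G_def)
  next
    assume Y: "Y = - Xc i"
    have m: "- 1 *\<^sub>R X i (chart_inv c u) \<in> \<Delta> (chart_inv c u)" by (rule subspace_scale[OF subspace_Delta X])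
    show ?thesis
      using i(1) g_scale[OF X, of "-1"] Y by (intro bexI[OF _ m]) (auto simp: Xc_def G_def scaleR_fun_def)
  qed
qed

text \<open>The Frechet derivative at a point of the open set \<open>Om\<close> depends only on
  values in \<open>Om\<close>, so agreement there is inherited by brackets.\<close>

lemma bracket_coord:
  assumes "Z \<in> iterated_brackets A (X ` {..<m})"
  shows "\<exists>W\<in>field_brackets Fields. \<forall>u\<in>Om. Z (chart_inv c u) c = W u"
  using assms
proof induction
  case (base Z)
  then obtain i where "i < m" "Z = X i" by auto
  moreover from this have "Xc i \<in> field_brackets Fields" by (intro field_brackets.base) (auto simp: Fields_def)
  ultimately show ?case by (intro bexI[of _ "Xc i"]) (auto simp: Xc_def)
next
  case (bracket Y Z)
  then obtain V W where V: "V \<in> field_brackets Fields" "\<forall>u\<in>Om. Y (chart_inv c u) c = V u"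
    and W: "W \<in> field_brackets Fields" "\<forall>u\<in>Om. Z (chart_inv c u) c = W u" by blast
  have "lie_bracket A Y Z (chart_inv c u) c = field_bracket V W u" if u: "u \<in> Om" for u
  proof -
    have "frechet_derivative (\<lambda>u. Z (chart_inv c u) c) (at u) = frechet_derivative W (at u)"
      by (rule frechet_derivative_cong_open[OF open_Om u]) (use W(2) in simp)
    moreover have "frechet_derivative (\<lambda>u. Y (chart_inv c u) c) (at u) = frechet_derivative V (at u)"
      by (rule frechet_derivative_cong_open[OF open_Om u]) (use V(2) in simp)
    ultimately show ?thesis
      using Om_inv[OF u] c(1) V(2) W(2) u by (simp add: lie_bracket_def field_bracket_def)
  qed
  then show ?case using field_brackets.bracket[OF V(1) W(1)] by blast
qed

lemma span_brackets: "span ((\<lambda>Z. Z u0) ` field_brackets Fields) = UNIV"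
proof -
  have "w \<in> span ((\<lambda>Z. Z u0) ` field_brackets Fields)" for w
  proof -
    obtain v where v: "v \<in> tangent_space A x0" "v c = w" using tangent_exists[OF c] by blast
    let ?I = "iterated_brackets A (X ` {..<m})"
    have "v \<in> span ((\<lambda>Z. Z x0) ` ?I)" using brackets_span[OF x0] v(1) by simp
    then have "w \<in> (\<lambda>v. v c) ` span ((\<lambda>Z. Z x0) ` ?I)" using v(2) by blast
    also have "\<dots> = span ((\<lambda>v. v c) ` (\<lambda>Z. Z x0) ` ?I)" by (rule linear_span_image[OF linear_eval, symmetric])
    also have "\<dots> \<subseteq> span ((\<lambda>Z. Z u0) ` field_brackets Fields)"
    proof (rule span_mono, rule image_subsetI)
      fix v assume "v \<in> (\<lambda>Z. Z x0) ` ?I"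
      then obtain Z where Z: "Z \<in> ?I" "v = Z x0" by blast
      then obtain W where "W \<in> field_brackets Fields" "Z (chart_inv c u0) c = W u0"
        using bracket_coord[OF Z(1)] u0_mem by blast
      then show "v c \<in> (\<lambda>Z. Z u0) ` field_brackets Fields" using Z(2) c by force
    qed
    finally show ?thesis .
  qed
  then show ?thesis by blast
qed

text \<open>Along a trajectory of the frame fields and their negatives the squared speed is at most
  \<open>C\<close>. A duration \<open>T\<close> below \<tau> therefore gives \<open>V\<close> at
  most \<open>T\<^sup>2 * C\<close>, which is less than \<epsilon>.\<close>

lemma V_small_near:
  assumes \<epsilon>: "0 < \<epsilon>"
  shows "\<exists>W. open W \<and> x0 \<in> W \<and> (\<forall>y\<in>W. \<forall>z\<in>W. V y z < ennreal \<epsilon>)"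
proof -
  obtain r where r: "0 < r" "cball u0 r \<subseteq> Om" using open_Om u0_mem open_contains_cball by blast
  let ?B = "cball u0 r"
  have bdd: "\<exists>b\<ge>0. \<forall>u\<in>?B. norm (f u) \<le> b" if "continuous_on Om f" for f :: "'e \<Rightarrow> 'z::real_normed_vector"
  proof -
    have "bounded (f ` ?B)"
      using continuous_on_subset[OF that r(2)] by (intro compact_imp_bounded compact_continuous_image) auto
    then obtain b where "\<forall>u\<in>?B. norm (f u) \<le> b" by (auto simp: bounded_iff simp del: mem_cball)
    then show ?thesis by (intro exI[of _ "max b 0"]) (auto intro: max.coboundedI1 simp del: mem_cball)
  qed
  have "\<forall>i\<in>{..<m}. \<exists>b\<ge>0. \<forall>u\<in>?B. norm (G i i u) \<le> b"
    by (intro ballI bdd G_continuous) auto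
  from bchoice[OF this] obtain b where b: "\<forall>i\<in>{..<m}. 0 \<le> b i \<and> (\<forall>u\<in>?B. norm (G i i u) \<le> b i)" by (elim exE)
  have "\<forall>i\<in>{..<m}. \<exists>b\<ge>0. \<forall>u\<in>?B. norm (Xc i u) \<le> b"
    by (intro ballI bdd smooth_on_continuous_on X_smooth) auto
  from bchoice[OF this] obtain d where d: "\<forall>i\<in>{..<m}. 0 \<le> d i \<and> (\<forall>u\<in>?B. norm (Xc i u) \<le> d i)" by (elim exE)
  \<comment> \<open>The summand 1 keeps \<open>C\<close> positive even if all \<open>b i\<close>
    vanish, so that \<tau> can be defined by dividing by it.\<close>
  define C where "C = (\<Sum>i<m. b i) + 1"
  define M where "M = (\<Sum>i<m. d i)"
  have b0: "\<forall>i\<in>{..<m}. 0 \<le> b i" and d0: "\<forall>i\<in>{..<m}. 0 \<le> d i" using b d by simp_all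
  have C: "0 < C" unfolding C_def by (intro add_nonneg_pos sum_nonneg b0[rule_format]) simp_all
  have GC: "G i i u \<le> C" if "i < m" "u \<in> ?B" for i u
  proof -
    have "b i \<le> (\<Sum>i<m. b i)" by (rule member_le_sum) (use b0 that in auto)
    moreover have "norm (G i i u) \<le> b i"
      by (rule bspec[OF conjunct2[OF bspec[OF b]] that(2)]) (use that(1) in simp)
    then have "G i i u \<le> b i" by simp
    ultimately show ?thesis by (simp add: C_def)
  qed
  have M0: "0 \<le> M" unfolding M_def by (intro sum_nonneg d0[rule_format])
  have M: "\<forall>Y\<in>Fields. \<forall>u\<in>?B. norm (Y u) \<le> M"
  proof (intro ballI)
    fix Y u assume "Y \<in> Fields" and u: "u \<in> ?B"
    then obtain i where i: "i < m" "Y = Xc i \<or> Y = - Xc i" by (auto simp: Fields_def)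
    have "d i \<le> (\<Sum>i<m. d i)" by (rule member_le_sum) (use d0 i in auto)
    moreover have "norm (Xc i u) \<le> d i"
      by (rule bspec[OF conjunct2[OF bspec[OF d]] u]) (use i(1) in simp)
    moreover have "norm (Y u) = norm (Xc i u)" using i(2) by (elim disjE) simp_all
    ultimately show "norm (Y u) \<le> M" by (simp add: M_def)
  qed
  define \<tau> where "\<tau> = sqrt (\<epsilon> / (2 * C))"
  have e2C: "0 < \<epsilon> / (2 * C)" by (intro divide_pos_pos mult_pos_pos \<epsilon> C) simp
  have "\<tau>\<^sup>2 = \<epsilon> / (2 * C)" unfolding \<tau>_def by (rule real_sqrt_pow2[OF less_imp_le[OF e2C]])
  then have "\<tau>\<^sup>2 * C = \<epsilon> / (2 * C) * C" by (rule arg_cong)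
  also have "\<dots> = \<epsilon> / 2" using C by simp
  finally have \<tau>: "0 < \<tau>" "\<tau>\<^sup>2 * C < \<epsilon>" using e2C \<epsilon> unfolding \<tau>_def by simp_all
  from local_reachability[OF open_Om Fields_smooth Fields_minus r M0 M span_brackets \<tau>(1)]
  obtain \<delta> where \<delta>: "0 < \<delta>" "\<forall>y\<in>ball u0 \<delta>. \<forall>z\<in>ball u0 \<delta>. \<exists>T<\<tau>. traj_reach M ?B Fields T y z"
    by (elim exE conjE)
  define W where "W = fst c \<inter> snd c -` ball u0 \<delta>"
  have "open W" unfolding W_def
    by (rule continuous_open_preimage[OF chart_continuous[OF c(1)] chart_open(1)[OF c(1)]]) simp
  moreover have "x0 \<in> W" using c \<delta>(1) by (simp add: W_def)
  moreover have "V y z < ennreal \<epsilon>" if yz: "y \<in> W" "z \<in> W" for y z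
  proof -
    have yc: "chart_inv c (snd c y) = y" "chart_inv c (snd c z) = z" using yz c(1) by (auto simp: W_def)
    have "snd c y \<in> ball u0 \<delta>" "snd c z \<in> ball u0 \<delta>" using yz by (auto simp: W_def)
    then obtain T where T: "T < \<tau>" "traj_reach M ?B Fields T (snd c y) (snd c z)" using \<delta>(2) by blast
    then obtain x where x: "0 \<le> T" "trajectory M ?B Fields T x" "x 0 = snd c y" "x T = snd c z"
      unfolding traj_reach_def by blast
    show ?thesis
    proof (cases "T = 0")
      case True
      then have "snd c y = snd c z" using x(3,4) by simp
      then have "y = z" using yc by (rule box_equals[OF arg_cong[of _ _ "chart_inv c"]])
      then show ?thesis using V_refl \<epsilon> by simp
    next
      case False
      then have T0: "0 < T" using x by simp
      obtain N where lip: "M-lipschitz_on {0..T} x" and xB: "x ` {0..T} \<subseteq> ?B" and N: "countable N"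
        "\<forall>t\<in>{0<..<T} - N. \<exists>Y\<in>Fields. (x has_vector_derivative Y (x t)) (at t)"
        using x(2) unfolding trajectory_def by blast
      let ?\<gamma> = "\<lambda>t. chart_inv c (x t)"
      have xO: "x ` {0..T} \<subseteq> Om" using xB r(2) by blast
      have der: "\<exists>v\<in>\<Delta> (?\<gamma> t). (x has_vector_derivative v c) (at t) \<and> g (?\<gamma> t) v v \<le> C" if t: "t \<in> {0<..<T} - N" for t
      proof -
        obtain Y where Y: "Y \<in> Fields" "(x has_vector_derivative Y (x t)) (at t)" using N(2) t by blast
        have xt: "x t \<in> ?B" using xB t by (auto simp: image_subset_iff)
        obtain v i where v: "v \<in> \<Delta> (?\<gamma> t)" "v c = Y (x t)" "i < m" "g (?\<gamma> t) v v = G i i (x t)"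
          using Fields_horizontal[OF Y(1), of "x t"] xt r(2) by blast
        have "G i i (x t) \<le> C" by (rule GC[OF v(3) xt])
        then show ?thesis using Y(2) v by (intro bexI[OF _ v(1)]) simp
      qed
      have der': "\<exists>v\<in>\<Delta> (?\<gamma> t). (x has_vector_derivative v c) (at t)" if "t \<in> {0<..<T} - N" for t
        using der[OF that] by blast
      have h: "hpath 0 T ?\<gamma>" by (rule chart_curve(1)[OF lip xO N(1) der'])
      have sp: "speed_sq ?\<gamma> t \<le> C" if t: "t \<in> {0<..<T} - N" for t
      proof -
        obtain v where v: "v \<in> \<Delta> (?\<gamma> t)" "(x has_vector_derivative v c) (at t)" "g (?\<gamma> t) v v \<le> C" using der[OF t] by blast
        have "has_velocity ?\<gamma> v t"
          by (rule chart_curve(2)[OF lip xO N(1) der' _ v(1,2)]) (use t in simp_all)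
        then show ?thesis using vel_eq v(3) C by (simp add: speed_sq_def)
      qed
      have "V (?\<gamma> 0) (?\<gamma> T) \<le> ennreal ((T - 0)\<^sup>2 * C)"
        by (rule V_le_speed_bound[OF h T0 N(1) sp]) (use C in simp_all)
      also have "\<dots> < ennreal \<epsilon>"
      proof -
        have "T\<^sup>2 * C \<le> \<tau>\<^sup>2 * C" using T T0 C by (intro mult_right_mono power_mono) auto
        then show ?thesis using \<tau>(2) \<epsilon> by (simp add: ennreal_lessI)
      qed
      finally show ?thesis using x(3,4) yc by simp
    qed
  qed
  ultimately show ?thesis by blast
qed

end

section \<open>Finiteness and continuity of the value function\<close>

context sub_riemannian
begin

lemma V_small:
  assumes "0 < \<epsilon>"
  shows "\<exists>W. open W \<and> x \<in> W \<and> (\<forall>y\<in>W. \<forall>z\<in>W. V y z < ennreal \<epsilon>)"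
proof -
  obtain c where "c \<in> A" "x \<in> fst c" using chart_exists by blast
  then obtain U m X where "framed_chart A \<Delta> g c U m X x" using framed_chart_exists by blast
  then show ?thesis using assms by (rule framed_chart.V_small_near)
qed

lemma V_finite_step:
  assumes V: "V x y < \<infinity>" "V y z < ennreal 1"
  shows "V x z < \<infinity>"
proof -
  define r where "r = enn2real (V x y)"
  have r: "V x y = ennreal r" "0 \<le> r" using V(1) by (simp_all add: r_def)
  have "r < (r + 1)\<^sup>2" using zero_le_power2[of r] r(2) unfolding power2_sum power_one mult_1_right by linarith
  then have "V x y < ennreal ((r + 1)\<^sup>2)" unfolding r(1) by (rule ennreal_lessI[rotated]) (use r(2) in simp)
  moreover have "V y z < ennreal (1\<^sup>2)" using V(2) by simp
  ultimately have "V x z \<le> ennreal ((r + 1 + 1)\<^sup>2)" by (rule V_triangle) (use r(2) in auto)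
  also have "\<dots> < \<infinity>" by simp
  finally show ?thesis .
qed

text \<open>By \<open>V_small\<close> any two points of a small neighbourhood are joined, in both
  orders, at a cost below 1. Hence finiteness of the value and its failure are both open conditions,
  and connectedness excludes the latter.\<close>

lemma V_finite:
  assumes conn: "connected (UNIV :: 'a set)"
  shows "V x y < \<infinity>"
proof -
  let ?S = "{y. V x y < \<infinity>}"
  have W: "\<exists>W. open W \<and> y \<in> W \<and> (\<forall>y\<in>W. \<forall>z\<in>W. V y z < ennreal 1)" for y by (rule V_small) simp
  have "open ?S"
  proof (subst open_subopen, intro ballI)
    fix y assume y: "y \<in> ?S"
    obtain W where W: "open W" "y \<in> W" "\<forall>y\<in>W. \<forall>z\<in>W. V y z < ennreal 1" using W[of y] by (elim exE conjE)
    have "W \<subseteq> ?S"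
    proof
      fix z assume "z \<in> W"
      then have "V y z < ennreal 1" using W(2,3) by blast
      then show "z \<in> ?S" using V_finite_step[of x y z] y by simp
    qed
    then show "\<exists>T. open T \<and> y \<in> T \<and> T \<subseteq> ?S" using W(1,2) by blast
  qed
  moreover have "open (- ?S)"
  proof (subst open_subopen, intro ballI)
    fix y assume y: "y \<in> - ?S"
    obtain W where W: "open W" "y \<in> W" "\<forall>y\<in>W. \<forall>z\<in>W. V y z < ennreal 1" using W[of y] by (elim exE conjE)
    have "W \<subseteq> - ?S"
    proof
      fix z assume "z \<in> W"
      then have "V z y < ennreal 1" using W(2,3) by blast
      then show "z \<in> - ?S" using V_finite_step[of x z y] y by auto
    qed
    then show "\<exists>T. open T \<and> y \<in> T \<and> T \<subseteq> - ?S" using W(1,2) by blast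
  qed
  moreover have "x \<in> ?S" by (simp add: V_refl)
  ultimately have "- ?S = {}" using connectedD[OF conn, of ?S "- ?S"] by blast
  then show ?thesis by blast
qed

definition D :: "'a \<Rightarrow> 'a \<Rightarrow> real" where "D x y = sqrt (enn2real (V x y))"

lemma D_nonneg: "0 \<le> D x y"
  by (simp add: D_def)

lemma D_squared: "(D x y)\<^sup>2 = enn2real (V x y)"
  by (simp add: D_def)

lemma V_eq_D: "V x y < \<infinity> \<Longrightarrow> V x y = ennreal ((D x y)\<^sup>2)"
  by (simp add: D_squared)

text \<open>\<open>V_triangle\<close> asks for strict bounds, which forces a slack \<open>e\<close>
  in the first leg; it is removed by letting \<open>e\<close> tend to 0.\<close>

lemma D_triangle:
  assumes fin: "V x y < \<infinity>" and q: "V y z < ennreal (q\<^sup>2)" "0 < q"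
  shows "D x z \<le> D x y + q"
proof (rule field_le_epsilon)
  fix e :: real assume e: "0 < e"
  have d: "0 \<le> D x y" by (rule D_nonneg)
  have "(D x y)\<^sup>2 < (D x y + e)\<^sup>2" using e d by (intro power_strict_mono) auto
  then have "V x y < ennreal ((D x y + e)\<^sup>2)"
    unfolding V_eq_D[OF fin] by (subst ennreal_less_iff) auto
  then have "V x z \<le> ennreal ((D x y + e + q)\<^sup>2)" by (rule V_triangle[OF _ q(1) _ q(2)]) (use e d in simp)
  then have "enn2real (V x z) \<le> (D x y + e + q)\<^sup>2" by (rule enn2real_leI[rotated]) simp
  then have "D x z \<le> sqrt ((D x y + e + q)\<^sup>2)" unfolding D_def[of x z] by (rule real_sqrt_le_mono)
  also have "\<dots> = D x y + e + q" using d e q(2) by simp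
  finally show "D x z \<le> D x y + q + e" by simp
qed

lemma D_continuous:
  assumes fin: "\<forall>y. V x y < \<infinity>"
  shows "continuous_on UNIV (D x)"
proof -
  have "(D x \<longlongrightarrow> D x y) (at y)" for y
    unfolding tendsto_iff
  proof (intro allI impI)
    fix e :: real assume e: "0 < e"
    obtain W where W: "open W" "y \<in> W" "\<forall>y\<in>W. \<forall>z\<in>W. V y z < ennreal ((e / 2)\<^sup>2)"
      using V_small[of "(e / 2)\<^sup>2" y] e by auto
    have "dist (D x z) (D x y) < e" if z: "z \<in> W" for z
    proof -
      \<comment> \<open>\<open>V_small\<close> bounds \<open>V y z\<close> and \<open>V z y\<close>
        alike, which gives the estimate in both directions.\<close>
      have "D x z \<le> D x y + e / 2" by (rule D_triangle) (use fin W(2,3) z e in auto)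
      moreover have "D x y \<le> D x z + e / 2" by (rule D_triangle) (use fin W(2,3) z e in auto)
      ultimately show ?thesis using e by (simp add: dist_real_def)
    qed
    then show "\<forall>\<^sub>F z in at y. dist (D x z) (D x y) < e"
      unfolding eventually_at_topological using W(1,2) by blast
  qed
  then show ?thesis by (simp add: continuous_on_def)
qed

end

section \<open>The Hamiltonian and the two viscosity inequalities\<close>

section \<open>The Hamiltonian\<close>

context framed_chart
begin

lemma Delta_coordinates_subspace: "subspace ((\<lambda>v. v c) ` \<Delta> x0)"
  by (rule linear_subspace_image[OF linear_eval subspace_Delta])

lemma g_zero: "g x 0 0 = 0"
  by (rule inner_product_on_0_left[OF inner_product_g subspace_Delta subspace_0[OF subspace_Delta]])

text \<open>Beyond coordinate norm \<open>2 * K / \<mu>\<close> the quadratic term outweighs the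
  linear one, so the function is at most 0 there, which is its value at the zero vector; inside the
  ball compactness gives a maximum.\<close>

lemma hamiltonian_maximiser:
  assumes L: "linear (L :: 'e \<Rightarrow> real)"
  shows "\<exists>v\<in>\<Delta> x0. \<forall>w\<in>\<Delta> x0. L (w c) - 1/2 * g x0 w w \<le> L (v c) - 1/2 * g x0 v v"
proof -
  obtain R \<mu> and F :: "'e \<times> 'e \<Rightarrow> real" where R: "0 < R" "0 < \<mu>" "continuous_on (cball u0 R \<times> UNIV) F"
    and gF0: "\<forall>x\<in>fst c. snd c x \<in> cball u0 R \<longrightarrow> (\<forall>v\<in>\<Delta> x. g x v v = F (snd c x, v c) \<and> \<mu> * (norm (v c))\<^sup>2 \<le> g x v v)"
    using local_model by (elim exE conjE)
  have u0R: "u0 \<in> cball u0 R" using R(1) by simp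
  have gF: "\<forall>v\<in>\<Delta> x0. g x0 v v = F (u0, v c) \<and> \<mu> * (norm (v c))\<^sup>2 \<le> g x0 v v"
    using gF0 c(2) u0R by blast
  let ?E = "(\<lambda>v. v c) ` \<Delta> x0"
  define q where "q w = L w - 1/2 * F (u0, w)" for w
  have qv: "q (v c) = L (v c) - 1/2 * g x0 v v" if "v \<in> \<Delta> x0" for v using gF that by (simp add: q_def)
  have z: "0 \<in> \<Delta> x0" by (rule subspace_0[OF subspace_Delta])
  have q0: "q (0 c) = 0" using qv[OF z] linear_0[OF L] g_zero by simp
  obtain K where K: "0 < K" "\<forall>w. norm (L w) \<le> K * norm w"
    using linear_bounded_pos[OF L] by (auto simp: mult.commute)
  have contq: "continuous_on UNIV q"
    unfolding q_def
    by (intro continuous_intros linear_continuous_on[OF linear_conv_bounded_linear[THEN iffD1, OF L]]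
        continuous_on_compose2[OF R(3)]) (use u0R in auto)
  let ?C = "?E \<inter> cball 0 (2 * K / \<mu>)"
  have "compact ?C" by (intro closed_Int_compact closed_subspace Delta_coordinates_subspace) simp
  moreover have zC: "0 c \<in> ?C" using z K(1) R(2) by (auto intro: image_eqI[of _ _ 0])
  ultimately obtain w where w: "w \<in> ?C" "\<forall>w'\<in>?C. q w' \<le> q w"
    using continuous_attains_sup[OF _ _ continuous_on_subset[OF contq subset_UNIV], of ?C] by blast
  then obtain v where v: "v \<in> \<Delta> x0" "w = v c" by blast
  have "q (v' c) \<le> q w" if v': "v' \<in> \<Delta> x0" for v'
  proof (cases "norm (v' c) \<le> 2 * K / \<mu>")
    case True
    then have "v' c \<in> ?C" using v' by simp
    then show ?thesis using w(2) by blast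
  next
    case False
    then have "2 * K \<le> \<mu> * norm (v' c)" using R(2) by (simp add: field_simps)
    then have "2 * K * norm (v' c) \<le> \<mu> * norm (v' c) * norm (v' c)" by (rule mult_right_mono) simp
    also have "\<dots> = \<mu> * (norm (v' c))\<^sup>2" by (simp add: power2_eq_square)
    also have "\<dots> \<le> g x0 v' v'" by (rule conjunct2[OF bspec[OF gF v']])
    finally have "K * norm (v' c) \<le> 1/2 * g x0 v' v'" by simp
    moreover have "L (v' c) \<le> K * norm (v' c)" using K(2)[rule_format, of "v' c"] by simp
    ultimately have "q (v' c) \<le> 0" using qv[OF v'] by simp
    also have "\<dots> \<le> q w" using bspec[OF w(2) zC] unfolding q0 .
    finally show ?thesis .
  qed
  then show ?thesis using v qv by (intro bexI[of _ v]) auto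
qed

lemma hamiltonian_max:
  assumes L: "linear (L :: 'e \<Rightarrow> real)" and p: "\<forall>v\<in>\<Delta> x0. p v = L (v c)"
  shows "\<exists>v\<in>\<Delta> x0. hamiltonian \<Delta> g x0 p = L (v c) - 1/2 * g x0 v v"
    and "v \<in> \<Delta> x0 \<Longrightarrow> L (v c) - 1/2 * g x0 v v \<le> hamiltonian \<Delta> g x0 p"
proof -
  obtain w where w: "w \<in> \<Delta> x0" "\<forall>v\<in>\<Delta> x0. L (v c) - 1/2 * g x0 v v \<le> L (w c) - 1/2 * g x0 w w"
    using hamiltonian_maximiser[OF L] by (elim bexE)
  have H: "hamiltonian \<Delta> g x0 p = L (w c) - 1/2 * g x0 w w"
    unfolding hamiltonian_def
  proof (rule Greatest_equality)
    show "\<exists>v\<in>\<Delta> x0. L (w c) - 1/2 * g x0 w w = p v - 1/2 * g x0 v v" using w(1) p by (intro bexI[of _ w]) simp_all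
    fix h assume "\<exists>v\<in>\<Delta> x0. h = p v - 1/2 * g x0 v v"
    then obtain v where "v \<in> \<Delta> x0" "h = p v - 1/2 * g x0 v v" by (elim bexE)
    then show "h \<le> L (w c) - 1/2 * g x0 w w" using w(2) p by simp
  qed
  then show "\<exists>v\<in>\<Delta> x0. hamiltonian \<Delta> g x0 p = L (v c) - 1/2 * g x0 v v" using w(1) by (intro bexI[of _ w])
  show "v \<in> \<Delta> x0 \<Longrightarrow> L (v c) - 1/2 * g x0 v v \<le> hamiltonian \<Delta> g x0 p" unfolding H using w(2) by simp
qed

section \<open>The subsolution property\<close>

text \<open>Constant coefficients in the frame extend \<open>v\<close> to a horizontal field near
  \<open>x0\<close>. Following its negative from \<open>x0\<close> and then reversing time yields,
  for each \<open>t\<close>, a horizontal path of duration \<open>t\<close> that ends at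
  \<open>x0\<close> and whose squared speed exceeds \<open>g x0 v v\<close> only slightly.\<close>

lemma short_incoming_curve:
  assumes v: "v \<in> \<Delta> x0" and \<epsilon>: "0 < \<epsilon>"
  shows "\<exists>T>0. \<exists>x. x 0 = u0 \<and> (x has_vector_derivative - v c) (at 0 within {0..T}) \<and>
    (\<forall>t\<in>{0<..T}. x t \<in> Om \<and> V (chart_inv c (x t)) x0 < ennreal ((t * sqrt (g x0 v v + \<epsilon>))\<^sup>2))"
proof -
  obtain a where a: "v = (\<Sum>i<m. a i *\<^sub>R X i x0)" using Delta_rep[OF x0 v] by (elim exE)
  define Y where "Y u = - (\<Sum>i<m. a i *\<^sub>R Xc i u)" for u
  define Q where "Q u = (\<Sum>i<m. \<Sum>j<m. a i * a j * G i j u)" for u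
  have Ys: "smooth_on Om Y"
    unfolding Y_def[abs_def]
    by (intro smooth_on_minus smooth_on_sum smooth_on_scaleR smooth_on_const X_smooth open_Om) simp
  have Y0: "Y u0 = - v c" by (simp only: Y_def a sum_X_coord[OF c(2)])
  have Qc: "continuous_on Om Q" unfolding Q_def[abs_def] by (intro continuous_intros G_continuous) auto
  have gQ: "g (chart_inv c u) (\<Sum>i<m. a i *\<^sub>R X i (chart_inv c u)) (\<Sum>i<m. a i *\<^sub>R X i (chart_inv c u)) = Q u"
    if u: "u \<in> Om" for u
    using g_sum_X[of "chart_inv c u" a] Om_inv[OF u] by (simp add: Q_def)
  have Q0: "Q u0 = g x0 v v" using gQ[OF u0_mem] c by (simp add: a)
  obtain r where r: "0 < r" "cball u0 r \<subseteq> Om" using open_Om u0_mem open_contains_cball by blast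
  have "isCont Q u0" using Qc open_Om u0_mem continuous_on_eq_continuous_at by blast
  then have "\<exists>d>0. \<forall>u. dist u u0 < d \<longrightarrow> dist (Q u) (Q u0) < \<epsilon> / 2"
    unfolding continuous_at_eps_delta by (rule allE[of _ "\<epsilon> / 2"]) (use \<epsilon> in simp)
  then obtain d where d: "0 < d" "\<forall>u. dist u u0 < d \<longrightarrow> dist (Q u) (Q u0) < \<epsilon> / 2" by (elim exE conjE)
  define R where "R = min r (d / 2)"
  have R: "0 < R" "cball u0 R \<subseteq> Om" "R < d" using r d(1) by (auto simp: R_def)
  \<comment> \<open>A value strictly between \<open>g x0 v v\<close> and
    \<open>g x0 v v + \<epsilon>\<close>: continuity keeps the squared speed at most
    \<open>C\<close>, and the gap makes the final inequality strict.\<close>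
  define C where "C = g x0 v v + \<epsilon> / 2"
  have C: "0 < C" "C < g x0 v v + \<epsilon>" using g_nonneg[OF v] \<epsilon> by (simp_all add: C_def)
  have QC: "Q u \<le> C" if "u \<in> cball u0 R" for u
  proof -
    have "dist u u0 < d" using that R(3) by (simp add: dist_commute)
    then have "dist (Q u) (Q u0) < \<epsilon> / 2" by (rule d(2)[rule_format])
    then show ?thesis unfolding C_def Q0[symmetric] dist_real_def by linarith
  qed
  obtain L where L: "L-lipschitz_on (cball u0 R) Y" using smooth_on_lipschitz_cball[OF Ys R(2)] by (elim exE)
  have L0: "0 \<le> L" using L by (rule lipschitz_on_nonneg)
  have "bounded (Y ` cball u0 R)"
    using smooth_on_continuous_on[OF smooth_on_subset[OF Ys R(2)]]
    by (intro compact_imp_bounded compact_continuous_image) auto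
  then obtain M where M: "0 < M" "\<forall>y\<in>Y ` cball u0 R. norm y \<le> M" unfolding bounded_pos by (elim exE conjE)
  have MY: "norm (Y z) \<le> M" if "z \<in> cball u0 R" for z using M(2) that by blast
  define T where "T = min (R / M) (1 / (2 * (L + 1)))"
  have T: "0 < T" using R(1) M(1) L0 by (simp add: T_def)
  have "T \<le> R / M" by (simp add: T_def)
  then have MT: "M * T \<le> R" using M(1) by (simp add: field_simps)
  have "T \<le> 1 / (2 * (L + 1))" by (simp add: T_def)
  then have "(L + 1) * T \<le> 1/2" using L0 by (simp add: field_simps)
  then have LT: "L * T \<le> 1/2" using T by (simp add: algebra_simps)
  obtain x where x: "x 0 = u0"
    "\<forall>t\<in>{0..T}. x t \<in> cball u0 R \<and> (x has_vector_derivative Y (x t)) (at t within {0..T})"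
    using integral_curve_exists[OF L MY _ _ MT LT] R(1) T by (auto simp del: mem_cball)
  have xB: "x t \<in> cball u0 R" if "t \<in> {0..T}" for t using x(2) that by blast
  have xO: "x t \<in> Om" if "t \<in> {0..T}" for t using xB[OF that] R(2) by blast
  have xlip: "M-lipschitz_on {0..T} x"
  proof (rule bounded_derivative_imp_lipschitz)
    fix t assume t: "t \<in> {0..T}"
    show "(x has_derivative (\<lambda>h. h *\<^sub>R Y (x t))) (at t within {0..T})"
      using x(2) t unfolding has_vector_derivative_def by blast
    show "onorm (\<lambda>h. h *\<^sub>R Y (x t)) \<le> M"
    proof (rule onorm_le)
      fix h :: real
      have "\<bar>h\<bar> * norm (Y (x t)) \<le> \<bar>h\<bar> * M" by (rule mult_left_mono[OF MY[OF xB[OF t]]]) simp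
      then show "norm (h *\<^sub>R Y (x t)) \<le> M * norm h" by (simp add: mult.commute)
    qed
  qed (use M(1) in auto)
  have "V (chart_inv c (x t)) x0 < ennreal ((t * sqrt (g x0 v v + \<epsilon>))\<^sup>2)" if t: "t \<in> {0<..T}" for t
  proof -
    define z where "z s = x (t - s)" for s
    let ?\<gamma> = "\<lambda>s. chart_inv c (z s)"
    let ?v = "\<lambda>s. \<Sum>i<m. a i *\<^sub>R X i (?\<gamma> s)"
    have ts: "t - s \<in> {0..T}" if "s \<in> {0..t}" for s using that t by auto
    have zO: "z ` {0..t} \<subseteq> Om" using xO ts by (auto simp: z_def)
    have zv: "\<exists>v\<in>\<Delta> (?\<gamma> s). (z has_vector_derivative v c) (at s) \<and> g (?\<gamma> s) v v \<le> C"
      if s: "s \<in> {0<..<t}" for s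
    proof -
      have s': "t - s \<in> {0<..<T}" using s t by auto
      then have tsT: "t - s \<in> {0..T}" by auto
      have zs: "z s \<in> Om" unfolding z_def by (rule xO[OF tsT])
      have "(x has_vector_derivative Y (x (t - s))) (at (t - s))"
        using x(2)[rule_format, OF tsT, THEN conjunct2] at_within_Icc_at[of 0 "t - s" T] s' by simp
      moreover have "((\<lambda>s. t - s) has_vector_derivative - 1) (at s)" by (auto intro!: derivative_eq_intros)
      ultimately have "(z has_vector_derivative - 1 *\<^sub>R Y (z s)) (at s)"
        using vector_diff_chain_at[of "\<lambda>s. t - s" "- 1" s x "Y (z s)"] by (simp add: z_def[abs_def] o_def)
      moreover have "- 1 *\<^sub>R Y (z s) = ?v s c"
        using sum_X_coord[of "?\<gamma> s" a] Om_inv[OF zs] by (simp add: Y_def)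
      ultimately have "(z has_vector_derivative ?v s c) (at s)" by simp
      moreover have "?v s \<in> \<Delta> (?\<gamma> s)" by (rule sum_X_Delta) (use Om_inv[OF zs] in simp)
      moreover have "g (?\<gamma> s) (?v s) (?v s) \<le> C"
        unfolding gQ[OF zs] unfolding z_def by (rule QC[OF xB[OF tsT]])
      ultimately show ?thesis by (intro bexI[of _ "?v s"]) simp_all
    qed
    have zv': "\<exists>v\<in>\<Delta> (?\<gamma> s). (z has_vector_derivative v c) (at s)" if "s \<in> {0<..<t} - {}" for s
    proof -
      have "s \<in> {0<..<t}" using that by simp
      from zv[OF this] show ?thesis by blast
    qed
    have zlip: "M-lipschitz_on {0..t} z"
    proof (rule lipschitz_onI)
      fix s s' assume "s \<in> {0..t}" "s' \<in> {0..t}"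
      then show "dist (z s) (z s') \<le> M * dist s s'"
        using lipschitz_onD[OF xlip ts ts, of s s'] by (simp add: z_def dist_real_def abs_minus_commute)
    qed (use M(1) in simp)
    have t0: "0 < t" using t by simp
    have h: "hpath 0 t ?\<gamma>" by (rule chart_curve(1)[OF zlip zO countable_empty zv'])
    have sp: "speed_sq ?\<gamma> s \<le> C" if s: "s \<in> {0<..<t} - {}" for s
    proof -
      have s': "s \<in> {0<..<t}" using s by simp
      from zv[OF s'] obtain v where v: "v \<in> \<Delta> (?\<gamma> s)" "(z has_vector_derivative v c) (at s)" "g (?\<gamma> s) v v \<le> C"
        by (elim bexE conjE)
      have "has_velocity ?\<gamma> v s"
        by (rule chart_curve(2)[OF zlip zO countable_empty zv' s' v(1,2)])
      then show ?thesis using vel_eq v(3) C(1) by (simp add: speed_sq_def)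
    qed
    have "V (?\<gamma> 0) (?\<gamma> t) \<le> ennreal ((t - 0)\<^sup>2 * C)"
      by (rule V_le_speed_bound[OF h t0 countable_empty sp]) (use C(1) in simp_all)
    also have "?\<gamma> 0 = chart_inv c (x t)" by (simp add: z_def)
    also have "?\<gamma> t = x0" using x(1) c by (simp add: z_def)
    also have "ennreal ((t - 0)\<^sup>2 * C) < ennreal ((t * sqrt (g x0 v v + \<epsilon>))\<^sup>2)"
    proof (rule ennreal_lessI)
      have e: "(t * sqrt (g x0 v v + \<epsilon>))\<^sup>2 = t\<^sup>2 * (g x0 v v + \<epsilon>)"
        using g_nonneg[OF v] \<epsilon> by (simp add: power_mult_distrib)
      show "(t - 0)\<^sup>2 * C < (t * sqrt (g x0 v v + \<epsilon>))\<^sup>2" unfolding e using C(2) t0 by simp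
      show "0 < (t * sqrt (g x0 v v + \<epsilon>))\<^sup>2" unfolding e using g_nonneg[OF v] \<epsilon> t0 by simp
    qed
    finally show ?thesis .
  qed
  moreover have "(x has_vector_derivative - v c) (at 0 within {0..T})" using x T Y0 by force
  ultimately show ?thesis using T x(1) xO by (intro exI[of _ T] exI[of _ x] conjI ballI) auto
qed

lemma derivative_above_value:
  fixes \<phi> :: "'e \<Rightarrow> real"
  assumes fin: "\<forall>y. V xb y < \<infinity>" and \<phi>: "(\<phi> has_derivative L) (at u0)" and S: "open S" "u0 \<in> S"
    and above: "\<forall>u\<in>Om \<inter> S. (D xb (chart_inv c u))\<^sup>2 \<le> \<phi> u" and eq: "\<phi> u0 = (D xb x0)\<^sup>2"
    and v: "v \<in> \<Delta> x0"
  shows "L (v c) \<le> (D xb x0)\<^sup>2 + g x0 v v"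
proof (rule field_le_epsilon)
  fix \<epsilon> :: real assume \<epsilon>: "0 < \<epsilon>"
  obtain T x where T: "0 < T" and x0': "x 0 = u0" and xd: "(x has_vector_derivative - v c) (at 0 within {0..T})"
    and xV: "\<forall>t\<in>{0<..T}. x t \<in> Om \<and> V (chart_inv c (x t)) x0 < ennreal ((t * sqrt (g x0 v v + \<epsilon>))\<^sup>2)"
    using short_incoming_curve[OF v \<epsilon>] by (elim exE conjE)
  define k where "k = sqrt (g x0 v v + \<epsilon>)"
  have k: "0 < k" "k\<^sup>2 = g x0 v v + \<epsilon>" using g_nonneg[OF v] \<epsilon> by (simp_all add: k_def)
  let ?d = "D xb x0"
  have L: "linear L" using \<phi> by (rule has_derivative_linear)
  have T0: "at 0 within {0..T} = at_right 0" using T by (rule at_within_Icc_at_right)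
  have "((\<lambda>t. \<phi> (x t)) has_derivative (\<lambda>h. L (h *\<^sub>R - v c))) (at 0 within {0..T})"
    using has_derivative_compose[OF xd[unfolded has_vector_derivative_def], of \<phi> L] \<phi> x0' by simp
  moreover have "(\<lambda>h. L (h *\<^sub>R - v c)) = times (- L (v c))"
    using linear_cmul[OF L] linear_neg[OF L] by (auto simp: fun_eq_iff)
  ultimately have "((\<lambda>t. \<phi> (x t)) has_real_derivative - L (v c)) (at_right 0)"
    unfolding has_field_derivative_def T0 by simp
  then have lim: "((\<lambda>t. (\<phi> (x t) - \<phi> u0) / t) \<longlongrightarrow> - L (v c)) (at_right 0)"
    unfolding has_field_derivative_iff x0' by simp
  have "(x \<longlongrightarrow> u0) (at_right 0)"
    using has_vector_derivative_continuous[OF xd] unfolding continuous_within x0' T0 .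
  then have evS: "\<forall>\<^sub>F t in at_right 0. x t \<in> S" using S topological_tendstoD by blast
  have evT: "\<forall>\<^sub>F t in at_right 0. t \<in> {0<..<T}" using T by (rule eventually_at_right_real)
  have "\<forall>\<^sub>F t in at_right 0. - (2 * ?d * k) \<le> (\<phi> (x t) - \<phi> u0) / t"
    using evS evT
  proof eventually_elim
    case (elim t)
    let ?e = "D xb (chart_inv c (x t))"
    have t: "t \<in> {0<..T}" "0 < t" using elim(2) by auto
    have xt: "x t \<in> Om" "V (chart_inv c (x t)) x0 < ennreal ((t * k)\<^sup>2)" using bspec[OF xV t(1)] unfolding k_def by simp_all
    have "?d \<le> ?e + t * k" by (rule D_triangle[OF fin[rule_format] xt(2)]) (use t(2) k(1) in simp)
    then have de: "?d - t * k \<le> ?e" by simp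
    \<comment> \<open>Squaring \<open>?d - t * k \<le> ?e\<close> is legitimate only if the left
      side is nonnegative; otherwise the left side of the claim is at most 0.\<close>
    have "?d\<^sup>2 - 2 * ?d * (t * k) \<le> ?e\<^sup>2"
    proof (cases "t * k \<le> ?d")
      case True
      then have "(?d - t * k)\<^sup>2 \<le> ?e\<^sup>2" using de by (intro power_mono) auto
      then show ?thesis using zero_le_power2[of "t * k"] unfolding power2_diff by linarith
    next
      case False
      then have "?d * ?d \<le> ?d * (t * k)" using D_nonneg by (intro mult_left_mono) auto
      moreover have "0 \<le> ?d * (t * k)" using t(2) k(1) D_nonneg by simp
      ultimately show ?thesis using zero_le_power2[of ?e] unfolding power2_eq_square mult.assoc[of 2] by linarith
    qed
    also have "\<dots> \<le> \<phi> (x t)" using above elim(1) xt(1) by blast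
    finally have "- (2 * ?d * k) * t \<le> \<phi> (x t) - \<phi> u0" unfolding eq by (simp add: algebra_simps)
    then show ?case using t(2) by (simp add: pos_le_divide_eq)
  qed
  then have "- (2 * ?d * k) \<le> - L (v c)" by (rule tendsto_lowerbound[OF lim]) simp
  moreover have "2 * ?d * k \<le> ?d\<^sup>2 + k\<^sup>2" using zero_le_power2[of "?d - k"] unfolding power2_diff by linarith
  ultimately show "L (v c) \<le> ?d\<^sup>2 + g x0 v v + \<epsilon>" using k(2) by linarith
qed

end

section \<open>Energy of horizontal paths in a chart\<close>

context sub_riemannian
begin

text \<open>Passes from the Lebesgue integral of the energy to the gauge integral, in which the
  fundamental theorem is available.\<close>

lemma energy_has_integral:
  assumes h: "hpath a b \<gamma>" and ab: "a \<le> b" and e: "energy a b \<gamma> = ennreal e" "0 \<le> e"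
  shows "(speed_sq \<gamma> has_integral e) {a..b}"
proof -
  let ?f = "\<lambda>t. indicator {a..b} t * speed_sq \<gamma> t"
  have m: "?f \<in> borel_measurable lebesgue" by (rule speed_sq_measurable[OF h ab])
  have nn: "AE t in lebesgue. 0 \<le> ?f t" using speed_sq_nonneg by simp
  have I: "(\<integral>\<^sup>+t. ennreal (?f t) \<partial>lebesgue) = ennreal e" using e(1) unfolding energy_def .
  have "integrable lebesgue ?f" by (rule integrableI_nn_integral_finite[OF m nn I])
  then have "(?f has_integral (integral\<^sup>L lebesgue ?f)) UNIV" by (rule has_integral_integral_lebesgue)
  moreover have "integral\<^sup>L lebesgue ?f = e" unfolding integral_eq_nn_integral[OF m nn] I using e(2) by simp
  moreover have "?f = (\<lambda>t. if t \<in> {a..b} then speed_sq \<gamma> t else 0)" by (auto simp: fun_eq_iff)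
  ultimately show ?thesis by (simp only: has_integral_restrict_UNIV)
qed

text \<open>Duration times energy replaces squared length without any change of parametrisation. By
  Cauchy-Schwarz the roots of this product for the two pieces sum to at most the root for the whole
  path, so cutting off \<rho> leaves at most \<open>P - \<rho>\<close>.\<close>

lemma energy_split_at_product:
  assumes h: "hpath 0 1 \<gamma>" and P: "0 < P" "energy 0 1 \<gamma> < ennreal (P\<^sup>2)"
    and \<rho>: "0 < \<rho>" "ennreal (\<rho>\<^sup>2) < energy 0 1 \<gamma>"
  shows "\<exists>s A1 A2. 0 < s \<and> s < 1 \<and> 0 \<le> A1 \<and> 0 < A2 \<and> energy 0 s \<gamma> = ennreal A1 \<and> energy s 1 \<gamma> = ennreal A2 \<and>
    (1 - s) * A2 = \<rho>\<^sup>2 \<and> s * A1 \<le> (P - \<rho>)\<^sup>2 \<and> \<rho> \<le> P"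
proof -
  define E where "E = enn2real (energy 0 1 \<gamma>)"
  have fin: "energy 0 1 \<gamma> < \<infinity>" using P(2) by (rule less_trans) simp
  have E: "energy 0 1 \<gamma> = ennreal E" "0 \<le> E" using fin by (simp_all add: E_def)
  have EP: "E < P\<^sup>2" using P(2) unfolding E(1) by (simp add: ennreal_less_iff E(2))
  have \<rho>E: "\<rho>\<^sup>2 < E" using \<rho>(2) unfolding E(1) by (subst (asm) ennreal_less_iff) auto
  have I: "(speed_sq \<gamma> has_integral E) {0..1}" by (rule energy_has_integral[OF h _ E]) simp
  have sub: "\<exists>A\<ge>0. energy p q \<gamma> = ennreal A \<and> integral {p..q} (speed_sq \<gamma>) = A" if pq: "0 \<le> p" "p \<le> q" "q \<le> 1" for p q
  proof -
    have "energy p q \<gamma> \<le> energy 0 1 \<gamma>" by (rule energy_mono) (use pq in auto)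
    then have "energy p q \<gamma> < \<infinity>" using fin by (rule le_less_trans)
    then have e: "energy p q \<gamma> = ennreal (enn2real (energy p q \<gamma>))" by simp
    have "(speed_sq \<gamma> has_integral (enn2real (energy p q \<gamma>))) {p..q}"
      by (rule energy_has_integral[OF hpath_subinterval[OF h pq(1,3)] pq(2) e]) simp
    then show ?thesis using e by (intro exI[of _ "enn2real (energy p q \<gamma>)"]) (simp add: integral_unique)
  qed
  \<comment> \<open>Duration times energy of the piece after \<open>s\<close>: it varies
    continuously from \<open>E\<close> at 0 to 0 at 1, so the intermediate value theorem yields the
    cutting time.\<close>
  define f where "f s = (1 - s) * (E - integral {0..s} (speed_sq \<gamma>))" for s
  have "continuous_on {0..1} (\<lambda>s. integral {0..s} (speed_sq \<gamma>))"
    by (rule indefinite_integral_continuous_1) (use I in blast)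
  then have "continuous_on {0..1} f" unfolding f_def[abs_def] by (intro continuous_intros)
  moreover have "f 1 \<le> \<rho>\<^sup>2" "\<rho>\<^sup>2 \<le> f 0" using \<rho>E by (simp_all add: f_def)
  ultimately obtain s where s: "0 \<le> s" "s \<le> 1" "f s = \<rho>\<^sup>2" using IVT2'[of f 1 "\<rho>\<^sup>2" 0] by auto
  have \<rho>2: "0 < \<rho>\<^sup>2" using \<rho>(1) by simp
  have s1: "s \<noteq> 1" "s \<noteq> 0" using s(3) \<rho>2 \<rho>E by (auto simp: f_def)
  obtain A1 where A1: "0 \<le> A1" "energy 0 s \<gamma> = ennreal A1" "integral {0..s} (speed_sq \<gamma>) = A1"
    using sub[of 0 s] s by auto
  obtain A2 where A2: "0 \<le> A2" "energy s 1 \<gamma> = ennreal A2" using sub[of s 1] s by auto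
  have "ennreal E = ennreal A1 + ennreal A2" using energy_split[OF h s(1,2)] unfolding E(1) A1(2) A2(2) .
  then have EA: "E = A1 + A2" using E(2) A1(1) A2(1) by (simp flip: ennreal_plus)
  have prod: "(1 - s) * A2 = \<rho>\<^sup>2" using s(3) A1(3) by (simp add: f_def EA)
  have A2pos: "0 < A2" using prod \<rho>2 A2(1) by (cases "A2 = 0") auto
  define a where "a = sqrt (s * A1)"
  have a: "0 \<le> a" "a\<^sup>2 = s * A1" using s(1) A1(1) by (simp_all add: a_def)
  \<comment> \<open>The inequality between the arithmetic and geometric mean of the mixed products
    \<open>X\<close> and \<open>Y\<close> is Cauchy-Schwarz for the pairs of durations and
    energies.\<close>
  define X where "X = (1 - s) * A1"
  define Y where "Y = s * A2"
  have XY: "0 \<le> X" "0 \<le> Y" using s A1(1) A2(1) by (simp_all add: X_def Y_def)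
  have "(2 * (a * \<rho>))\<^sup>2 = 4 * (X * Y)"
    unfolding X_def Y_def power_mult_distrib a(2) prod[symmetric] by simp
  also have "\<dots> \<le> (X + Y)\<^sup>2" using zero_le_power2[of "X - Y"] by (simp add: power2_eq_square algebra_simps)
  finally have "2 * (a * \<rho>) \<le> X + Y" by (rule power2_le_imp_le) (use XY in simp)
  then have "(a + \<rho>)\<^sup>2 \<le> E"
    unfolding power2_sum a(2) prod[symmetric] EA X_def Y_def by (simp add: algebra_simps)
  then have "(a + \<rho>)\<^sup>2 \<le> P\<^sup>2" using EP by simp
  then have aP: "a + \<rho> \<le> P" by (rule power2_le_imp_le) (use P(1) in simp)
  have "a\<^sup>2 \<le> (P - \<rho>)\<^sup>2" using a(1) aP by (intro power_mono) auto
  moreover have "\<rho> \<le> P" using a(1) aP by simp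
  ultimately show ?thesis
    using s s1 A1(1,2) A2 A2pos prod a(2) by (intro exI[of _ s] exI[of _ A1] exI[of _ A2]) auto
qed

text \<open>The derivative bound is integrated along the path. Nonnegative \<alpha> and \<beta>
  cover the non-horizontal times, where the derivative is replaced by 0.\<close>

lemma C1_increment_le:
  fixes f :: "'e \<Rightarrow> real"
  assumes h: "hpath a b \<gamma>" and ab: "a \<le> b" and e: "energy a b \<gamma> = ennreal e" "0 \<le> e"
    and c: "c \<in> A" and \<gamma>c: "\<gamma> ` {a..b} \<subseteq> fst c"
    and f: "Ck_on 1 S f" and S: "open S" "\<forall>t\<in>{a..b}. snd c (\<gamma> t) \<in> S" and \<alpha>: "0 \<le> \<alpha>" "0 \<le> \<beta>"
    and le: "\<forall>t\<in>{a..b}. \<forall>v\<in>\<Delta> (\<gamma> t). frechet_derivative f (at (snd c (\<gamma> t))) (v c) \<le> \<alpha> + \<beta> * g (\<gamma> t) v v"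
  shows "f (snd c (\<gamma> b)) - f (snd c (\<gamma> a)) \<le> \<alpha> * (b - a) + \<beta> * e"
proof -
  let ?N = "{t \<in> {a<..<b}. \<not> hor \<gamma> t} \<union> {a, b}"
  have N: "negligible ?N" by (intro negligible_Un hpathD(2)[OF h]) auto
  have ac: "absolutely_continuous_on_interval a b (\<lambda>t. snd c (\<gamma> t))"
    using h c ab \<gamma>c unfolding hpath_def o_def by blast
  have cont: "continuous_on {a..b} (\<lambda>t. snd c (\<gamma> t))"
    by (rule continuous_on_compose2[OF chart_continuous[OF c] hpathD(1)[OF h] \<gamma>c])
  have "absolutely_continuous_on_interval a b (\<lambda>t. f (snd c (\<gamma> t)))"
    by (rule absolutely_continuous_compose_C1[OF f S(1) ac cont]) (use S(2) in blast)
  let ?f' = "\<lambda>t. if hor \<gamma> t then frechet_derivative f (at (snd c (\<gamma> t))) (vel \<gamma> t c) else 0"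
  have "(?f' has_integral (f (snd c (\<gamma> b)) - f (snd c (\<gamma> a)))) {a..b}"
  proof (rule absolutely_continuous_has_integral_derivative[OF _ ab N])
    show "absolutely_continuous_on_interval a b (\<lambda>t. f (snd c (\<gamma> t)))" by fact
    fix t assume t: "t \<in> {a..b} - ?N"
    then have t': "t \<in> {a<..<b}" "hor \<gamma> t" "t \<in> {a..b}" by auto
    have tc: "\<gamma> t \<in> fst c" using \<gamma>c t'(3) by blast
    have 1: "((\<lambda>t. snd c (\<gamma> t)) has_vector_derivative vel \<gamma> t c) (at t)"
      using horD(2)[OF t'(2)] c tc unfolding has_velocity_def o_def by blast
    have "f differentiable (at (snd c (\<gamma> t)))" using f S(2) t'(3) unfolding One_nat_def Ck_on.simps by blast
    then have 2: "(f has_derivative frechet_derivative f (at (snd c (\<gamma> t)))) (at (snd c (\<gamma> t)))"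
      unfolding frechet_derivative_works .
    note lin = has_derivative_linear[OF 2]
    have "((\<lambda>t. f (snd c (\<gamma> t))) has_vector_derivative frechet_derivative f (at (snd c (\<gamma> t))) (vel \<gamma> t c)) (at t)"
      using has_derivative_compose[OF 1[unfolded has_vector_derivative_def] 2] linear_cmul[OF lin]
      unfolding has_vector_derivative_def by simp
    then show "((\<lambda>t. f (snd c (\<gamma> t))) has_vector_derivative ?f' t) (at t within {a..b})"
      using t'(2) by (simp add: has_vector_derivative_at_within)
  qed
  moreover have "((\<lambda>t. \<alpha> + \<beta> * speed_sq \<gamma> t) has_integral (\<alpha> * (b - a) + \<beta> * e)) {a..b}"
    using has_integral_add[OF has_integral_const_real[of \<alpha> a b] has_integral_mult_right[OF energy_has_integral[OF h ab e], of \<beta>]] ab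
    by (simp add: mult.commute)
  moreover have "?f' t \<le> \<alpha> + \<beta> * speed_sq \<gamma> t" if t: "t \<in> {a..b}" for t
  proof (cases "hor \<gamma> t")
    case True
    then show ?thesis using bspec[OF bspec[OF le t] horD(1)[OF True]] by (simp add: speed_sq_def)
  next
    case False
    then show ?thesis using \<alpha> speed_sq_nonneg by simp
  qed
  ultimately show ?thesis by (rule has_integral_le)
qed

end

section \<open>Paths with little energy stay near their end point\<close>

text \<open>From \<open>0 \<le> (1 - \<sigma> * y)\<^sup>2\<close>. It converts bounds linear in the
  velocity into duration and energy, with the weight \<sigma> left free.\<close>

lemma sqrt_le_weighted:
  fixes y z \<sigma> :: real
  assumes "0 < \<sigma>" "y\<^sup>2 \<le> z"
  shows "y \<le> (1 / \<sigma> + \<sigma> * z) / 2"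
proof -
  have "0 \<le> (1 - \<sigma> * y)\<^sup>2" by simp
  also have "\<dots> = 1 + \<sigma> * (\<sigma> * y\<^sup>2) - 2 * \<sigma> * y" by (simp add: power2_eq_square algebra_simps)
  also have "\<dots> \<le> 1 + \<sigma> * (\<sigma> * z) - 2 * \<sigma> * y" using assms by (simp add: mult_left_mono)
  finally have "y * (2 * \<sigma>) \<le> 1 + \<sigma> * (\<sigma> * z)" by (simp add: mult.commute)
  then have "y \<le> (1 + \<sigma> * (\<sigma> * z)) / (2 * \<sigma>)" using assms(1) by (simp add: pos_le_divide_eq)
  also have "\<dots> = (1 / \<sigma> + \<sigma> * z) / 2" using assms(1) by (simp add: field_simps)
  finally show ?thesis .
qed

context framed_chart
begin

text \<open>The displacement is tested against the linear function in its own direction, whose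
  derivative on a velocity is at most the norm of that velocity; \<open>sqrt_le_weighted\<close>
  trades this norm for energy.\<close>

lemma displacement_le:
  assumes h: "hpath a b \<gamma>" and ab: "a \<le> b" and e: "energy a b \<gamma> = ennreal e" "0 \<le> e"
    and \<gamma>c: "\<gamma> ` {a..b} \<subseteq> fst c" and \<sigma>: "0 < \<sigma>" and \<mu>: "0 < \<mu>"
    and g\<mu>: "\<forall>t\<in>{a..b}. \<forall>v\<in>\<Delta> (\<gamma> t). \<mu> * (norm (v c))\<^sup>2 \<le> g (\<gamma> t) v v"
  shows "norm (snd c (\<gamma> b) - snd c (\<gamma> a)) \<le> ((b - a) / \<sigma> + \<sigma> * e / \<mu>) / 2"
proof -
  define w where "w = sgn (snd c (\<gamma> b) - snd c (\<gamma> a))"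
  have w: "norm w \<le> 1" by (simp add: w_def norm_sgn)
  have d: "((\<lambda>u. w \<bullet> u) has_derivative (\<lambda>u. w \<bullet> u)) (at u)" for u by (auto intro!: derivative_eq_intros)
  then have fd: "frechet_derivative (\<lambda>u. w \<bullet> u) (at u) = (\<lambda>u. w \<bullet> u)" for u by (rule frechet_derivative_at[symmetric])
  have C1: "Ck_on 1 UNIV (\<lambda>u. w \<bullet> u)"
    using d by (auto simp: fd differentiable_def intro!: continuous_intros)
  have "w \<bullet> snd c (\<gamma> b) - w \<bullet> snd c (\<gamma> a) \<le> (1 / (2 * \<sigma>)) * (b - a) + (\<sigma> / (2 * \<mu>)) * e"
  proof (rule C1_increment_le[OF h ab e c(1) \<gamma>c C1 open_UNIV], intro ballI)
    show "\<forall>t\<in>{a..b}. \<forall>v\<in>\<Delta> (\<gamma> t). frechet_derivative (\<lambda>u. w \<bullet> u) (at (snd c (\<gamma> t))) (v c)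
        \<le> 1 / (2 * \<sigma>) + \<sigma> / (2 * \<mu>) * g (\<gamma> t) v v"
    proof (intro ballI)
      fix t v assume tv: "t \<in> {a..b}" "v \<in> \<Delta> (\<gamma> t)"
      have "w \<bullet> v c \<le> norm w * norm (v c)" by (rule norm_cauchy_schwarz)
      also have "\<dots> \<le> 1 * norm (v c)" using w by (intro mult_right_mono) auto
      also have "1 * norm (v c) \<le> (1 / \<sigma> + \<sigma> * (g (\<gamma> t) v v / \<mu>)) / 2"
      proof -
        have "(norm (v c))\<^sup>2 \<le> g (\<gamma> t) v v / \<mu>"
          using bspec[OF bspec[OF g\<mu> tv(1)] tv(2)] \<mu> by (simp add: pos_le_divide_eq mult.commute)
        from sqrt_le_weighted[OF \<sigma> this] show ?thesis by simp
      qed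
      also have "\<dots> = 1 / (2 * \<sigma>) + \<sigma> / (2 * \<mu>) * g (\<gamma> t) v v" by (simp add: add_divide_distrib)
      finally show "frechet_derivative (\<lambda>u. w \<bullet> u) (at (snd c (\<gamma> t))) (v c) \<le> 1 / (2 * \<sigma>) + \<sigma> / (2 * \<mu>) * g (\<gamma> t) v v"
        unfolding fd .
    qed
  qed (use \<sigma> \<mu> in auto)
  moreover have "w \<bullet> snd c (\<gamma> b) - w \<bullet> snd c (\<gamma> a) = norm (snd c (\<gamma> b) - snd c (\<gamma> a))"
  proof -
    let ?z = "snd c (\<gamma> b) - snd c (\<gamma> a)"
    have "w \<bullet> ?z = norm ?z"
      by (cases "?z = 0") (auto simp: w_def sgn_div_norm power2_norm_eq_inner[symmetric] power2_eq_square)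
    then show ?thesis by (simp add: inner_diff_right)
  qed
  moreover have "(1 / (2 * \<sigma>)) * (b - a) + (\<sigma> / (2 * \<mu>)) * e = ((b - a) / \<sigma> + \<sigma> * e / \<mu>) / 2"
    using \<sigma> \<mu> by (simp add: field_simps)
  ultimately show ?thesis by simp
qed

text \<open>Coercivity is known only inside the chart ball, so the path is followed back from its
  end to the last time \<tau> outside \<open>B\<close>. After \<tau> the displacement estimate is
  valid and gives a radius smaller than that of \<open>B\<close>; by closedness the point at \<tau>
  obeys it too and lies in \<open>B\<close>, a contradiction.\<close>

lemma path_stays_near:
  assumes h: "hpath a b \<gamma>" and ab: "a \<le> b" and e: "energy a b \<gamma> = ennreal e" "0 \<le> e"
    and end_pt: "\<gamma> b = x0" and \<sigma>: "0 < \<sigma>" and \<mu>: "0 < \<mu>"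
    and g\<mu>: "\<forall>x\<in>fst c. snd c x \<in> cball u0 R \<longrightarrow> (\<forall>v\<in>\<Delta> x. \<mu> * (norm (v c))\<^sup>2 \<le> g x v v)"
    and R: "cball u0 R \<subseteq> Om" and r: "r \<le> R" "((b - a) / \<sigma> + \<sigma> * e / \<mu>) / 2 < r"
    and t: "t \<in> {a..b}"
  shows "\<gamma> t \<in> fst c \<and> snd c (\<gamma> t) \<in> cball u0 r"
proof -
  define r' where "r' = ((b - a) / \<sigma> + \<sigma> * e / \<mu>) / 2"
  have r': "0 \<le> r'" "r' < r" using ab \<sigma> \<mu> e(2) r(2) by (simp_all add: r'_def)
  define B where "B = fst c \<inter> snd c -` ball u0 r"
  \<comment> \<open>Compact, hence closed since the manifold is Hausdorff; the gap between
    \<open>r'\<close> and \<open>r\<close> places it inside the open set \<open>B\<close>.\<close>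
  define K where "K = chart_inv c ` cball u0 r'"
  have oB: "open B" unfolding B_def
    by (rule continuous_open_preimage[OF chart_continuous[OF c(1)] chart_open(1)[OF c(1)]]) simp
  have r'Om: "cball u0 r' \<subseteq> Om" using R r' r(1) by (meson order.strict_implies_order order_trans subset_cball)
  have "compact K" unfolding K_def
    by (rule compact_continuous_image[OF continuous_on_subset[OF chart_inv_continuous[OF c(1)]]])
      (use r'Om Om_sub in auto)
  then have cK: "closed K" by (rule compact_imp_closed)
  have KB: "K \<subseteq> B"
  proof
    fix x assume "x \<in> K"
    then obtain u where u: "u \<in> cball u0 r'" "x = chart_inv c u" unfolding K_def by blast
    have "u \<in> Om" using u(1) r'Om by blast
    then show "x \<in> B" using Om_inv[of u] u r'(2) by (auto simp: B_def)
  qed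
  have cont: "continuous_on {a..b} \<gamma>" by (rule hpathD(1)[OF h])
  have "\<forall>t\<in>{a..b}. \<gamma> t \<in> B"
  proof (rule ccontr)
    let ?Z = "{a..b} \<inter> \<gamma> -` (- B)"
    assume "\<not> (\<forall>t\<in>{a..b}. \<gamma> t \<in> B)"
    then have ne: "?Z \<noteq> {}" by blast
    have "closed ?Z" by (rule continuous_closed_preimage[OF cont]) (use oB in auto)
    then have "compact ?Z" by (intro compact_Int_closed[of "{a..b}" "?Z", simplified Int_assoc[symmetric] Int_absorb]) simp_all
    then obtain \<tau> where \<tau>: "\<tau> \<in> ?Z" "\<forall>t\<in>?Z. t \<le> \<tau>" using compact_attains_sup[OF _ ne] by blast
    have x0B: "x0 \<in> B" using c r' by (simp add: B_def)
    have "\<tau> \<noteq> b" using \<tau>(1) end_pt x0B by auto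
    then have \<tau>b: "\<tau> < b" "a \<le> \<tau>" using \<tau>(1) by auto
    have inB: "\<gamma> t \<in> B" if t: "t \<in> {\<tau><..b}" for t
    proof (rule ccontr)
      assume "\<gamma> t \<notin> B"
      then have "t \<in> ?Z" using t \<tau>b(2) by simp
      then have "t \<le> \<tau>" by (rule bspec[OF \<tau>(2)])
      then show False using t by simp
    qed
    have inK: "\<gamma> t \<in> K" if t: "t \<in> {\<tau><..b}" for t
    proof -
      have tab: "a \<le> t" "t \<le> b" using t \<tau>b by auto
      have tb: "s \<in> {\<tau><..b}" if "s \<in> {t..b}" for s using that t by auto
      have sub: "\<gamma> ` {t..b} \<subseteq> fst c" using inB tb by (auto simp: B_def)
      have g\<mu>': "\<forall>s\<in>{t..b}. \<forall>v\<in>\<Delta> (\<gamma> s). \<mu> * (norm (v c))\<^sup>2 \<le> g (\<gamma> s) v v"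
      proof
        fix s assume "s \<in> {t..b}"
        then have "\<gamma> s \<in> B" by (intro inB tb)
        then show "\<forall>v\<in>\<Delta> (\<gamma> s). \<mu> * (norm (v c))\<^sup>2 \<le> g (\<gamma> s) v v" using g\<mu> r(1) by (simp add: B_def)
      qed
      define e' where "e' = enn2real (energy t b \<gamma>)"
      have le: "energy t b \<gamma> \<le> ennreal e" using energy_mono[OF tab(1) order_refl, of b \<gamma>] unfolding e(1) .
      then have e': "energy t b \<gamma> = ennreal e'" "0 \<le> e'" "e' \<le> e"
        using e(2) by (auto simp: e'_def enn2real_leI le_less_trans[OF le])
      have "norm (snd c (\<gamma> b) - snd c (\<gamma> t)) \<le> ((b - t) / \<sigma> + \<sigma> * e' / \<mu>) / 2"
        by (rule displacement_le[OF hpath_subinterval[OF h tab(1) order_refl] tab(2) e'(1,2) sub \<sigma> \<mu> g\<mu>'])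
      also have "\<dots> \<le> r'" unfolding r'_def
        using tab(1) e'(3) \<sigma> \<mu> by (intro divide_right_mono add_mono mult_left_mono) auto
      finally have "snd c (\<gamma> t) \<in> cball u0 r'" by (simp add: end_pt dist_norm)
      moreover have "\<gamma> t \<in> fst c" using inB[OF t] by (simp add: B_def)
      ultimately show ?thesis unfolding K_def using c(1) by (intro image_eqI[of _ _ "snd c (\<gamma> t)"]) simp_all
    qed
    have "closed ({\<tau>..b} \<inter> \<gamma> -` K)"
      by (rule continuous_closed_preimage[OF continuous_on_subset[OF cont]]) (use \<tau>b cK in auto)
    then have "closure {\<tau><..b} \<subseteq> {\<tau>..b} \<inter> \<gamma> -` K"
      by (rule closure_minimal[rotated]) (use inK in auto)
    moreover have "\<tau> \<in> closure {\<tau><..b}" using \<tau>b(1) by simp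
    ultimately have "\<gamma> \<tau> \<in> K" by blast
    then show False using KB \<tau>(1) by blast
  qed
  then have "\<gamma> t \<in> B" using t by blast
  then show ?thesis by (simp add: B_def)
qed

end

section \<open>The supersolution property\<close>

context framed_chart
begin

text \<open>Inserting \<open>\<sigma> *\<^sub>R v\<close> into the hypothesis gives the bound with
  weight \<sigma> at \<open>x0\<close>. Moving to a nearby point costs terms proportional to
  \<open>norm (v c)\<close> and to its square; \<open>sqrt_le_weighted\<close> and coercivity absorb
  both into \<eta>.\<close>

lemma derivative_bound_near:
  fixes f :: "'e \<Rightarrow> real"
  assumes f: "Ck_on 1 S f" and S: "open S" "u0 \<in> S" and \<eta>: "0 < \<eta>"
    and le: "\<forall>v\<in>\<Delta> x0. frechet_derivative f (at u0) (v c) \<le> h + g x0 v v"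
  shows "\<exists>\<delta>>0. cball u0 \<delta> \<subseteq> S \<and> (\<forall>x\<in>fst c. snd c x \<in> cball u0 \<delta> \<longrightarrow> (\<forall>v\<in>\<Delta> x. \<forall>\<sigma>>0.
    frechet_derivative f (at (snd c x)) (v c) \<le> (h + \<eta>) / \<sigma> + (1 + \<eta>) * \<sigma> * g x v v))"
proof -
  obtain R \<mu> and F :: "'e \<times> 'e \<Rightarrow> real" where R: "0 < R" and \<mu>: "0 < \<mu>"
    and gF: "\<forall>x\<in>fst c. snd c x \<in> cball u0 R \<longrightarrow> (\<forall>v\<in>\<Delta> x. g x v v = F (snd c x, v c) \<and> \<mu> * (norm (v c))\<^sup>2 \<le> g x v v)"
    and model: "\<forall>\<eta>>0. \<exists>\<delta>>0. \<forall>x\<in>fst c. snd c x \<in> cball u0 \<delta> \<longrightarrow>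
      (\<forall>v\<in>\<Delta> x. \<exists>v0\<in>\<Delta> x0. norm (v c - v0 c) \<le> \<eta> * norm (v c) \<and> g x0 v0 v0 \<le> g x v v + \<eta> * (norm (v c))\<^sup>2)"
    using local_model by (elim exE conjE)
  define L where "L u = frechet_derivative f (at u)" for u
  have lin: "linear (L u)" if "u \<in> S" for u
  proof -
    have "f differentiable (at u)" using f that unfolding One_nat_def Ck_on.simps by blast
    then show ?thesis unfolding L_def by (rule linear_frechet_derivative)
  qed
  note lin0 = lin[OF S(2)]
  have scaled: "L u0 (v c) \<le> h / \<sigma> + \<sigma> * g x0 v v" if v: "v \<in> \<Delta> x0" and \<sigma>: "0 < \<sigma>" for v \<sigma>
  proof -
    have "L u0 ((\<sigma> *\<^sub>R v) c) \<le> h + g x0 (\<sigma> *\<^sub>R v) (\<sigma> *\<^sub>R v)"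
      unfolding L_def by (rule bspec[OF le subspace_scale[OF subspace_Delta v]])
    moreover have "(\<sigma> *\<^sub>R v) c = \<sigma> *\<^sub>R v c" by (simp add: scaleR_fun_def)
    ultimately have "L u0 (v c) * \<sigma> \<le> h + \<sigma>\<^sup>2 * g x0 v v"
      by (simp add: g_scale[OF v] linear_cmul[OF lin0] mult.commute)
    then have "L u0 (v c) \<le> (h + \<sigma>\<^sup>2 * g x0 v v) / \<sigma>" using \<sigma> by (simp add: pos_le_divide_eq)
    also have "\<dots> = h / \<sigma> + \<sigma> * g x0 v v" using \<sigma> by (simp add: field_simps power2_eq_square)
    finally show ?thesis .
  qed
  define s where "s u = (\<Sum>b\<in>Basis. \<bar>L u b - L u0 b\<bar>)" for u
  have "continuous_on S (\<lambda>u. L u b)" for b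
    using f unfolding L_def One_nat_def Ck_on.simps by blast
  then have conts: "continuous_on S s" unfolding s_def[abs_def] by (intro continuous_intros)
  have s0: "s u0 = 0" by (simp add: s_def)
  have diff: "L u w - L u0 w \<le> s u * norm w" if u: "u \<in> S" for u w
  proof -
    have rep: "L u w = (\<Sum>b\<in>Basis. (w \<bullet> b) * L u b)" if "u \<in> S" for u
    proof -
      have "L u w = L u (\<Sum>b\<in>Basis. (w \<bullet> b) *\<^sub>R b)" by (simp only: euclidean_representation)
      also have "\<dots> = (\<Sum>b\<in>Basis. (w \<bullet> b) * L u b)"
        by (simp add: linear_sum[OF lin[OF that]] linear_cmul[OF lin[OF that]])
      finally show ?thesis .
    qed
    have "L u w - L u0 w = (\<Sum>b\<in>Basis. (w \<bullet> b) * (L u b - L u0 b))"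
      unfolding rep[OF u] rep[OF S(2)] by (simp add: sum_subtractf right_diff_distrib)
    also have "\<dots> \<le> (\<Sum>b\<in>Basis. norm w * \<bar>L u b - L u0 b\<bar>)"
    proof (rule sum_mono)
      fix b :: 'e assume "b \<in> Basis"
      then have "\<bar>w \<bullet> b\<bar> \<le> norm w" by (rule Basis_le_norm)
      then have "\<bar>w \<bullet> b\<bar> * \<bar>L u b - L u0 b\<bar> \<le> norm w * \<bar>L u b - L u0 b\<bar>" by (rule mult_right_mono) simp
      then show "(w \<bullet> b) * (L u b - L u0 b) \<le> norm w * \<bar>L u b - L u0 b\<bar>"
        unfolding abs_mult[symmetric] by (rule order_trans[OF abs_ge_self])
    qed
    also have "\<dots> = s u * norm w" unfolding s_def by (simp add: sum_distrib_left[symmetric] mult.commute)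
    finally show ?thesis .
  qed
  obtain K where K: "0 < K" "\<forall>w. norm (L u0 w) \<le> K * norm w"
    using linear_bounded_pos[OF lin0] by (auto simp: mult.commute)
  \<comment> \<open>The errors add up to \<open>(K + 1) * \<eta>1\<close> in front of
    \<open>1 / \<sigma>\<close> and \<open>(K + 2) * \<eta>1\<close> in front of \<open>p\<close>;
    they must not exceed \<eta> and \<open>\<eta> * \<mu>\<close>.\<close>
  define \<eta>1 where "\<eta>1 = min (\<eta> / (K + 1)) (\<eta> * \<mu> / (K + 2))"
  have \<eta>1: "0 < \<eta>1" using \<eta> \<mu> K(1) by (simp add: \<eta>1_def)
  have "\<eta>1 \<le> \<eta> / (K + 1)" by (simp add: \<eta>1_def)
  then have a1: "(K + 1) * \<eta>1 \<le> \<eta>" using K(1) by (simp add: pos_le_divide_eq mult.commute)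
  have "\<eta>1 \<le> \<eta> * \<mu> / (K + 2)" by (simp add: \<eta>1_def)
  then have a2: "(K + 2) * \<eta>1 \<le> \<eta> * \<mu>" using K(1) by (simp add: pos_le_divide_eq mult.commute)
  obtain \<delta>1 where \<delta>1: "0 < \<delta>1" "\<forall>x\<in>fst c. snd c x \<in> cball u0 \<delta>1 \<longrightarrow>
      (\<forall>v\<in>\<Delta> x. \<exists>v0\<in>\<Delta> x0. norm (v c - v0 c) \<le> \<eta>1 * norm (v c) \<and> g x0 v0 v0 \<le> g x v v + \<eta>1 * (norm (v c))\<^sup>2)"
    using model[rule_format, OF \<eta>1] by (elim exE conjE)
  obtain \<delta>2 where \<delta>2: "0 < \<delta>2" "cball u0 \<delta>2 \<subseteq> S" using S open_contains_cball by blast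
  have "isCont s u0" using conts S continuous_on_eq_continuous_at by blast
  then have "\<exists>d>0. \<forall>u. dist u u0 < d \<longrightarrow> dist (s u) (s u0) < \<eta>1"
    unfolding continuous_at_eps_delta by (rule allE[of _ "\<eta>1"]) (use \<eta>1 in simp)
  then obtain \<delta>3 where \<delta>3: "0 < \<delta>3" "\<forall>u. dist u u0 < \<delta>3 \<longrightarrow> dist (s u) (s u0) < \<eta>1" by (elim exE conjE)
  define \<delta> where "\<delta> = min (min \<delta>1 R) (min \<delta>2 (\<delta>3 / 2))"
  have \<delta>: "0 < \<delta>" "\<delta> \<le> \<delta>1" "\<delta> \<le> R" "\<delta> \<le> \<delta>2" "\<delta> < \<delta>3" using R \<delta>1(1) \<delta>2(1) \<delta>3(1) by (auto simp: \<delta>_def)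
  have "L (snd c x) (v c) \<le> (h + \<eta>) / \<sigma> + (1 + \<eta>) * \<sigma> * g x v v"
    if x: "x \<in> fst c" "snd c x \<in> cball u0 \<delta>" and v: "v \<in> \<Delta> x" and \<sigma>: "0 < \<sigma>" for x v \<sigma>
  proof -
    have xb: "snd c x \<in> cball u0 \<delta>1" "snd c x \<in> cball u0 R" "snd c x \<in> cball u0 \<delta>2" "dist (snd c x) u0 < \<delta>3"
      using x(2) \<delta> by (auto simp: dist_commute)
    have xS: "snd c x \<in> S" using xb(3) \<delta>2(2) by blast
    obtain v0 where v0: "v0 \<in> \<Delta> x0" "norm (v c - v0 c) \<le> \<eta>1 * norm (v c)" "g x0 v0 v0 \<le> g x v v + \<eta>1 * (norm (v c))\<^sup>2"
      using \<delta>1(2) x(1) xb(1) v by blast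
    let ?n = "norm (v c)" and ?G = "g x v v"
    have n: "\<mu> * ?n\<^sup>2 \<le> ?G" using gF x(1) xb(2) v by blast
    then have n': "?n\<^sup>2 \<le> ?G / \<mu>" using \<mu> by (simp add: pos_le_divide_eq mult.commute)
    define p where "p = \<sigma> * (?G / \<mu>)"
    have p: "\<sigma> * ?n\<^sup>2 \<le> p" unfolding p_def using n' \<sigma> by (intro mult_left_mono) auto
    have "0 \<le> \<sigma> * ?n\<^sup>2" using \<sigma> by simp
    then have p0: "0 \<le> p" using p by (rule order_trans)
    have i0: "0 < 1 / \<sigma>" using \<sigma> by simp
    have "?n \<le> (1 / \<sigma> + p) / 2" unfolding p_def by (rule sqrt_le_weighted[OF \<sigma> n'])
    also have "\<dots> \<le> 1 / \<sigma> + p"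
    proof -
      have "x / 2 \<le> x" if "0 \<le> x" for x :: real using that by simp
      then show ?thesis using p0 i0 by (simp only: add_nonneg_nonneg less_imp_le)
    qed
    finally have n2: "?n \<le> 1 / \<sigma> + p" .
    have pG: "\<mu> * p = \<sigma> * ?G" using \<mu> by (simp add: p_def)
    have "dist (s (snd c x)) (s u0) < \<eta>1" by (rule \<delta>3(2)[rule_format, OF xb(4)])
    then have "s (snd c x) \<le> \<eta>1" unfolding s0 by simp
    then have "s (snd c x) * ?n \<le> \<eta>1 * ?n" by (rule mult_right_mono) simp
    then have e1: "L (snd c x) (v c) \<le> L u0 (v c) + \<eta>1 * ?n" using diff[OF xS, of "v c"] by simp
    have "L u0 (v c) = L u0 (v0 c) + L u0 (v c - v0 c)" using linear_diff[OF lin0, of "v c" "v0 c"] by simp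
    moreover have "L u0 (v c - v0 c) \<le> K * norm (v c - v0 c)" using K(2)[rule_format, of "v c - v0 c"] by simp
    moreover have "K * norm (v c - v0 c) \<le> K * (\<eta>1 * ?n)" using v0(2) K(1) by (intro mult_left_mono) auto
    moreover have "\<sigma> * g x0 v0 v0 \<le> \<sigma> * (?G + \<eta>1 * ?n\<^sup>2)" using v0(3) \<sigma> by (intro mult_left_mono) auto
    ultimately have e2: "L u0 (v c) \<le> h / \<sigma> + \<sigma> * ?G + \<eta>1 * (\<sigma> * ?n\<^sup>2) + K * \<eta>1 * ?n"
      using scaled[OF v0(1) \<sigma>] by (simp add: algebra_simps)
    have e3: "\<eta>1 * (\<sigma> * ?n\<^sup>2) \<le> \<eta>1 * p" using p \<eta>1 by (intro mult_left_mono) auto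
    have e4: "(K + 1) * \<eta>1 * ?n \<le> (K + 1) * \<eta>1 * (1 / \<sigma> + p)" using n2 K(1) \<eta>1 by (intro mult_left_mono) auto
    have e5: "(K + 1) * \<eta>1 * (1 / \<sigma>) \<le> \<eta> * (1 / \<sigma>)" using a1 \<sigma> by (intro mult_right_mono) auto
    have e6: "(K + 2) * \<eta>1 * p \<le> \<eta> * \<mu> * p" using a2 p0 by (intro mult_right_mono) auto
    have "L (snd c x) (v c) \<le> h / \<sigma> + \<sigma> * ?G + \<eta>1 * p + (K + 1) * \<eta>1 * (1 / \<sigma> + p)"
      using e1 e2 e3 e4 by (simp add: algebra_simps)
    also have "\<dots> = h / \<sigma> + \<sigma> * ?G + (K + 1) * \<eta>1 * (1 / \<sigma>) + (K + 2) * \<eta>1 * p" by (simp add: algebra_simps)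
    also have "\<dots> \<le> h / \<sigma> + \<sigma> * ?G + \<eta> * (1 / \<sigma>) + \<eta> * \<mu> * p" using e5 e6 by simp
    also have "\<dots> = (h + \<eta>) / \<sigma> + (1 + \<eta>) * \<sigma> * ?G"
      unfolding mult.assoc[of \<eta> \<mu> p] pG by (simp add: add_divide_distrib algebra_simps)
    finally show ?thesis .
  qed
  then show ?thesis using \<delta>(1,4) \<delta>2(2) unfolding L_def
    by (intro exI[of _ \<delta>] conjI ballI impI allI) auto
qed

lemma derivative_below_value:
  fixes f :: "'e \<Rightarrow> real"
  assumes fin: "\<forall>y. V xb y < \<infinity>" and f: "Ck_on 1 S f" and S: "open S" "u0 \<in> S"
    and below: "\<forall>u\<in>Om \<inter> S. f u \<le> (D xb (chart_inv c u))\<^sup>2" and eq: "f u0 = (D xb x0)\<^sup>2"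
    and h: "0 \<le> h" and le: "\<forall>v\<in>\<Delta> x0. frechet_derivative f (at u0) (v c) \<le> h + g x0 v v"
  shows "(D xb x0)\<^sup>2 \<le> h"
proof (rule ccontr)
  let ?d = "D xb x0"
  assume "\<not> ?d\<^sup>2 \<le> h"
  then have hd: "h < ?d\<^sup>2" by simp
  have d: "0 < ?d"
  proof (rule ccontr)
    assume "\<not> 0 < ?d"
    then have "?d = 0" using D_nonneg[of xb x0] by simp
    then show False using hd h by simp
  qed
  \<comment> \<open>Small enough to keep \<kappa> below \<open>2 * ?d\<close>: for vanishing \<eta>
    this says \<open>h / ?d + ?d < 2 * ?d\<close>, which is \<open>h < ?d\<^sup>2\<close>.\<close>
  define \<eta> where "\<eta> = (?d\<^sup>2 - h) / (2 * (1 + ?d\<^sup>2))"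
  have d2: "0 < 1 + ?d\<^sup>2" using zero_le_power2[of ?d] by linarith
  have \<eta>: "0 < \<eta>" unfolding \<eta>_def using hd d2 by simp
  have \<eta>eq: "2 * (\<eta> * (1 + ?d\<^sup>2)) = ?d\<^sup>2 - h" unfolding \<eta>_def using d2 by (simp add: field_simps)
  define \<kappa> where "\<kappa> = (h + \<eta>) / ?d + (1 + \<eta>) * ?d"
  have "(h + \<eta>) / ?d * ?d = h + \<eta>" using d by simp
  then have "\<kappa> * ?d = h + \<eta> + (1 + \<eta>) * ?d\<^sup>2"
    unfolding \<kappa>_def distrib_right[of "(h + \<eta>) / ?d" _ ?d] power2_eq_square mult.assoc by (simp only:)
  also have "\<dots> = h + ?d\<^sup>2 + \<eta> * (1 + ?d\<^sup>2)" by (simp add: algebra_simps)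
  also have "\<dots> < 2 * ?d\<^sup>2" using \<eta>eq hd by linarith
  finally have "\<kappa> * ?d < (2 * ?d) * ?d" by (simp add: power2_eq_square)
  then have \<kappa>: "\<kappa> < 2 * ?d" by (rule mult_right_less_imp_less) (use d in simp)
  obtain R \<mu> and F :: "'e \<times> 'e \<Rightarrow> real" where R: "0 < R" "cball u0 R \<subseteq> Om" and \<mu>: "0 < \<mu>"
    and gF: "\<forall>x\<in>fst c. snd c x \<in> cball u0 R \<longrightarrow> (\<forall>v\<in>\<Delta> x. g x v v = F (snd c x, v c) \<and> \<mu> * (norm (v c))\<^sup>2 \<le> g x v v)"
    using local_model by (elim exE conjE)
  have g\<mu>: "\<forall>x\<in>fst c. snd c x \<in> cball u0 R \<longrightarrow> (\<forall>v\<in>\<Delta> x. \<mu> * (norm (v c))\<^sup>2 \<le> g x v v)" using gF by blast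
  obtain \<delta> where \<delta>: "0 < \<delta>" "cball u0 \<delta> \<subseteq> S"
    and bound: "\<forall>x\<in>fst c. snd c x \<in> cball u0 \<delta> \<longrightarrow> (\<forall>v\<in>\<Delta> x. \<forall>\<sigma>>0.
      frechet_derivative f (at (snd c x)) (v c) \<le> (h + \<eta>) / \<sigma> + (1 + \<eta>) * \<sigma> * g x v v)"
    using derivative_bound_near[OF f S \<eta> le] by (elim exE conjE)
  define r where "r = min \<delta> R"
  have r: "0 < r" "r \<le> R" "r \<le> \<delta>" using \<delta>(1) R(1) by (auto simp: r_def)
  \<comment> \<open>The first bound puts \<rho> below \<open>?d\<close>. The second leaves a
    positive gap \<theta> between the drop \<open>2 * ?d * \<rho> - \<rho>\<^sup>2\<close> of the
    squared distance and \<open>\<kappa> * \<rho>\<close>. The third keeps the last piece within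
    radius \<open>r\<close>.\<close>
  define \<rho> where "\<rho> = min (?d / 2) (min ((2 * ?d - \<kappa>) / 2) (r / (1 + 1 / \<mu>)))"
  have m1: "0 < 1 + 1 / \<mu>" using \<mu> by (simp add: add_pos_pos)
  have "\<rho> \<le> (2 * ?d - \<kappa>) / 2" unfolding \<rho>_def by (rule min.coboundedI2[OF min.cobounded1])
  moreover have "\<rho> \<le> ?d / 2" unfolding \<rho>_def by (rule min.cobounded1)
  moreover have "0 < \<rho>" using d \<kappa> r(1) m1 by (simp add: \<rho>_def)
  ultimately have \<rho>: "0 < \<rho>" "\<rho> < ?d" "\<rho> < 2 * ?d - \<kappa>" using d \<kappa> by simp_all
  have "\<rho> \<le> r / (1 + 1 / \<mu>)" by (simp add: \<rho>_def)
  then have \<rho>r: "\<rho> + \<rho> / \<mu> \<le> r" using m1 by (simp add: pos_le_divide_eq algebra_simps)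
  define \<theta> where "\<theta> = \<rho> * (2 * ?d - \<rho> - \<kappa>)"
  have \<theta>: "0 < \<theta>" unfolding \<theta>_def using \<rho> by simp
  \<comment> \<open>Being minimal only up to \<epsilon> raises the bound on the value at the cutting
    point by at most \<open>\<theta> / 2\<close>.\<close>
  define \<epsilon> where "\<epsilon> = min 1 (\<theta> / (2 * (2 * ?d + 1)))"
  have \<epsilon>: "0 < \<epsilon>" "\<epsilon> \<le> 1" using \<theta> d by (simp_all add: \<epsilon>_def)
  have "\<epsilon> \<le> \<theta> / (2 * (2 * ?d + 1))" by (simp add: \<epsilon>_def)
  then have \<epsilon>\<theta>: "\<epsilon> * (2 * ?d + 1) \<le> \<theta> / 2" using d by (simp add: pos_le_divide_eq algebra_simps)
  have V0: "V xb x0 = ennreal (?d\<^sup>2)" by (rule V_eq_D) (use fin in blast)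
  have "?d\<^sup>2 < (?d + \<epsilon>)\<^sup>2" using \<epsilon>(1) d by (intro power_strict_mono) auto
  then have "V xb x0 < ennreal ((?d + \<epsilon>)\<^sup>2)" unfolding V0 by (simp add: ennreal_less_iff)
  then obtain \<gamma> where \<gamma>: "hpath 0 1 \<gamma>" "\<gamma> 0 = xb" "\<gamma> 1 = x0" "energy 0 1 \<gamma> < ennreal ((?d + \<epsilon>)\<^sup>2)"
    using V_less_path by blast
  have "ennreal (\<rho>\<^sup>2) < ennreal (?d\<^sup>2)" using \<rho> by (simp add: ennreal_less_iff power_strict_mono)
  also have "\<dots> \<le> energy 0 1 \<gamma>" using V_le_energy[OF \<gamma>(1)] unfolding \<gamma>(2,3) V0 by simp
  finally have \<rho>E: "ennreal (\<rho>\<^sup>2) < energy 0 1 \<gamma>" .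
  have P: "0 < ?d + \<epsilon>" using d \<epsilon>(1) by simp
  obtain s A1 A2 where s: "0 < s" "s < 1" and A: "0 \<le> A1" "0 < A2"
    and E: "energy 0 s \<gamma> = ennreal A1" "energy s 1 \<gamma> = ennreal A2"
    and prod: "(1 - s) * A2 = \<rho>\<^sup>2" and sA1: "s * A1 \<le> (?d + \<epsilon> - \<rho>)\<^sup>2"
    using energy_split_at_product[OF \<gamma>(1) P \<gamma>(4) \<rho>(1) \<rho>E] by (elim exE conjE)
  have A2: "A2 = \<rho>\<^sup>2 / (1 - s)" using prod s(2) by (simp add: field_simps)
  have h1: "hpath s 1 \<gamma>" by (rule hpath_subinterval[OF \<gamma>(1)]) (use s in auto)
  \<comment> \<open>The reciprocal of the mean speed of the last piece, measured with length \<rho>: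
    its duration divided by \<sigma> and its energy times \<sigma> are both \<rho>.\<close>
  define \<sigma> where "\<sigma> = (1 - s) / \<rho>"
  have \<sigma>: "0 < \<sigma>" using s(2) \<rho>(1) by (simp add: \<sigma>_def)
  have \<sigma>1: "(1 - s) / \<sigma> = \<rho>" "\<sigma> * A2 = \<rho>"
    using s(2) \<rho>(1) by (simp_all add: \<sigma>_def A2 power2_eq_square)
  have small: "((1 - s) / \<sigma> + \<sigma> * A2 / \<mu>) / 2 < r" unfolding \<sigma>1 using \<rho>r r(1) by simp
  have near: "\<gamma> t \<in> fst c \<and> snd c (\<gamma> t) \<in> cball u0 r" if "t \<in> {s..1}" for t
    by (rule path_stays_near[OF h1 less_imp_le[OF s(2)] E(2) less_imp_le[OF A(2)] \<gamma>(3) \<sigma> \<mu> g\<mu> R(2) r(2) small that])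
  have near\<delta>: "snd c (\<gamma> t) \<in> cball u0 \<delta>" if "t \<in> {s..1}" for t using near[OF that] r(3) by simp
  \<comment> \<open>The weight that rescales the mean speed to \<open>?d\<close>: the two terms then
    contribute \<open>(h + \<eta>) / ?d * \<rho>\<close> and
    \<open>(1 + \<eta>) * ?d * \<rho>\<close>, together \<open>\<kappa> * \<rho>\<close>.\<close>
  define \<tau> where "\<tau> = \<sigma> * ?d"
  have \<tau>: "0 < \<tau>" using \<sigma> d by (simp add: \<tau>_def)
  have "f (snd c (\<gamma> 1)) - f (snd c (\<gamma> s)) \<le> (h + \<eta>) / \<tau> * (1 - s) + ((1 + \<eta>) * \<tau>) * A2"
  proof (rule C1_increment_le[OF h1 less_imp_le[OF s(2)] E(2) less_imp_le[OF A(2)] c(1) _ f S(1)])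
    show "\<gamma> ` {s..1} \<subseteq> fst c" using near by blast
    show "\<forall>t\<in>{s..1}. snd c (\<gamma> t) \<in> S" using near\<delta> \<delta>(2) by blast
    show "0 \<le> (h + \<eta>) / \<tau>" "0 \<le> (1 + \<eta>) * \<tau>" using h \<eta> \<tau> by simp_all
    show "\<forall>t\<in>{s..1}. \<forall>v\<in>\<Delta> (\<gamma> t). frechet_derivative f (at (snd c (\<gamma> t))) (v c)
        \<le> (h + \<eta>) / \<tau> + (1 + \<eta>) * \<tau> * g (\<gamma> t) v v"
    proof (intro ballI)
      fix t v assume tv: "t \<in> {s..1}" "v \<in> \<Delta> (\<gamma> t)"
      have tc: "\<gamma> t \<in> fst c" using near[OF tv(1)] by (rule conjunct1)
      show "frechet_derivative f (at (snd c (\<gamma> t))) (v c) \<le> (h + \<eta>) / \<tau> + (1 + \<eta>) * \<tau> * g (\<gamma> t) v v"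
        by (rule bound[rule_format, OF tc near\<delta>[OF tv(1)] tv(2) \<tau>])
    qed
  qed
  also have "\<dots> = \<kappa> * \<rho>"
  proof -
    have "(h + \<eta>) / \<tau> * (1 - s) = (h + \<eta>) / ?d * ((1 - s) / \<sigma>)" using \<sigma> d by (simp add: \<tau>_def)
    moreover have "((1 + \<eta>) * \<tau>) * A2 = (1 + \<eta>) * ?d * (\<sigma> * A2)" by (simp add: \<tau>_def)
    ultimately show ?thesis unfolding \<sigma>1 by (simp add: \<kappa>_def algebra_simps)
  qed
  finally have inc: "?d\<^sup>2 - f (snd c (\<gamma> s)) \<le> \<kappa> * \<rho>" unfolding \<gamma>(3) eq .
  have ss: "s \<in> {s..1}" using s by simp
  have xs: "\<gamma> s \<in> fst c" "snd c (\<gamma> s) \<in> Om \<inter> S"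
    using near[OF ss] near\<delta>[OF ss] \<delta>(2) R(2) r(2) by auto
  have "f (snd c (\<gamma> s)) \<le> (D xb (\<gamma> s))\<^sup>2" using bspec[OF below xs(2)] c(1) xs(1) by simp
  also have "\<dots> \<le> s * A1"
  proof -
    have hs: "hpath 0 s \<gamma>" by (rule hpath_subinterval[OF \<gamma>(1)]) (use s in auto)
    have "V xb (\<gamma> s) \<le> ennreal s * ennreal A1" using V_le_energy[OF hs s(1)] unfolding \<gamma>(2) E(1) by simp
    also have "\<dots> = ennreal (s * A1)" using s(1) A(1) by (simp add: ennreal_mult)
    finally show ?thesis unfolding D_squared by (rule enn2real_leI[rotated]) (use s(1) A(1) in simp)
  qed
  also note sA1
  also have "(?d + \<epsilon> - \<rho>)\<^sup>2 = (?d - \<rho>)\<^sup>2 + \<epsilon> * (2 * (?d - \<rho>) + \<epsilon>)" by (simp add: power2_eq_square algebra_simps)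
  also have "\<epsilon> * (2 * (?d - \<rho>) + \<epsilon>) \<le> \<epsilon> * (2 * ?d + 1)" using \<epsilon> \<rho>(1) by (intro mult_left_mono) auto
  also note \<epsilon>\<theta>
  finally have "f (snd c (\<gamma> s)) \<le> (?d - \<rho>)\<^sup>2 + \<theta> / 2" by simp
  then have "?d\<^sup>2 - (?d - \<rho>)\<^sup>2 - \<theta> / 2 \<le> \<kappa> * \<rho>" using inc by simp
  moreover have "?d\<^sup>2 - (?d - \<rho>)\<^sup>2 - \<kappa> * \<rho> = \<theta>" unfolding \<theta>_def by (simp add: power2_eq_square algebra_simps)
  ultimately show False using \<theta> by simp
qed

end

context sub_riemannian
begin

text \<open>The frame is set up in the very chart that \<open>SOME\<close> selects in
  \<open>differential\<close>, which avoids any change of chart for covectors.\<close>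

lemma differential_in_chart:
  fixes f :: "'a \<Rightarrow> real"
  shows "\<exists>c U m X. framed_chart A \<Delta> g c U m X x \<and>
    differential A f x = (\<lambda>v. frechet_derivative (f \<circ> chart_inv c) (at (snd c x)) (v c))"
proof -
  let ?c = "SOME c. c \<in> A \<and> x \<in> fst c"
  have "\<exists>c. c \<in> A \<and> x \<in> fst c" using chart_exists by blast
  then have c: "?c \<in> A \<and> x \<in> fst ?c" by (rule someI_ex)
  then obtain U m X where "framed_chart A \<Delta> g ?c U m X x" using framed_chart_exists[of ?c x] by blast
  moreover have "differential A f x = (\<lambda>v. frechet_derivative (f \<circ> chart_inv ?c) (at (snd ?c x)) (v ?c))"
    by (simp add: differential_def Let_def fun_eq_iff)
  ultimately show ?thesis by blast
qed

lemma C1_fun_in_chart: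
  assumes U: "open U" "C1_fun A U f" and c: "c \<in> A" "x \<in> fst c" "x \<in> U"
  shows "Ck_on 1 (snd c ` (U \<inter> fst c)) (f \<circ> chart_inv c)" "open (snd c ` (U \<inter> fst c))"
    "snd c x \<in> snd c ` (U \<inter> fst c)"
    "((f \<circ> chart_inv c) has_derivative frechet_derivative (f \<circ> chart_inv c) (at (snd c x))) (at (snd c x))"
proof -
  show f: "Ck_on 1 (snd c ` (U \<inter> fst c)) (f \<circ> chart_inv c)" using U(2) c(1) unfolding C1_fun_def by blast
  show "open (snd c ` (U \<inter> fst c))" by (rule chart_image_open[OF c(1) U(1)])
  show m: "snd c x \<in> snd c ` (U \<inter> fst c)" using c by blast
  have "(f \<circ> chart_inv c) differentiable (at (snd c x))" using f m unfolding One_nat_def Ck_on.simps by blast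
  then show "((f \<circ> chart_inv c) has_derivative frechet_derivative (f \<circ> chart_inv c) (at (snd c x))) (at (snd c x))"
    unfolding frechet_derivative_works .
qed

text \<open>The maximum in the Hamiltonian is attained at some \<open>v\<close>, and
  \<open>derivative_above_value\<close> is applied to this one vector.\<close>

lemma viscosity_sub:
  assumes fin: "\<forall>y. V xb y < \<infinity>" and U: "open U" "C1_fun A U \<phi>" "x \<in> U"
    and above: "\<forall>y\<in>U. (D xb y)\<^sup>2 \<le> \<phi> y" and eq: "\<phi> x = (D xb x)\<^sup>2"
  shows "hamiltonian \<Delta> g x ((1/2) *\<^sub>R differential A \<phi> x) \<le> (1/2) * (D xb x)\<^sup>2"
proof -
  obtain c U' m X where fc: "framed_chart A \<Delta> g c U' m X x"
    and diff: "differential A \<phi> x = (\<lambda>v. frechet_derivative (\<phi> \<circ> chart_inv c) (at (snd c x)) (v c))"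
    using differential_in_chart[of x \<phi>] by (elim exE conjE)
  interpret framed_chart A \<Delta> g c U' m X x by (rule fc)
  note f = C1_fun_in_chart[OF U(1,2) c U(3)]
  define L where "L = frechet_derivative (\<phi> \<circ> chart_inv c) (at (snd c x))"
  have L: "linear L" unfolding L_def by (rule has_derivative_linear[OF f(4)])
  have L': "linear (\<lambda>w. (1/2) * L w)" by (rule linearI) (simp_all add: linear_add[OF L] linear_cmul[OF L] algebra_simps)
  have p: "\<forall>v\<in>\<Delta> x. ((1/2) *\<^sub>R differential A \<phi> x) v = (1/2) * L (v c)"
    by (simp add: diff L_def scaleR_fun_def)
  obtain v where v: "v \<in> \<Delta> x"
    "hamiltonian \<Delta> g x ((1/2) *\<^sub>R differential A \<phi> x) = (1/2) * L (v c) - 1/2 * g x v v"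
    using hamiltonian_max(1)[OF L' p] by (elim bexE)
  have ab: "\<forall>u\<in>Om \<inter> snd c ` (U \<inter> fst c). (D xb (chart_inv c u))\<^sup>2 \<le> (\<phi> \<circ> chart_inv c) u"
    using above c(1) by auto
  have "L (v c) \<le> (D xb x)\<^sup>2 + g x v v"
    by (rule derivative_above_value[OF fin f(4)[folded L_def] f(2,3) ab _ v(1)]) (use eq c in simp)
  then show ?thesis unfolding v(2) by simp
qed

lemma viscosity_super:
  assumes fin: "\<forall>y. V xb y < \<infinity>" and U: "open U" "C1_fun A U \<psi>" "x \<in> U"
    and below: "\<forall>y\<in>U. \<psi> y \<le> (D xb y)\<^sup>2" and eq: "\<psi> x = (D xb x)\<^sup>2"
  shows "(1/2) * (D xb x)\<^sup>2 \<le> hamiltonian \<Delta> g x ((1/2) *\<^sub>R differential A \<psi> x)"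
proof -
  obtain c U' m X where fc: "framed_chart A \<Delta> g c U' m X x"
    and diff: "differential A \<psi> x = (\<lambda>v. frechet_derivative (\<psi> \<circ> chart_inv c) (at (snd c x)) (v c))"
    using differential_in_chart[of x \<psi>] by (elim exE conjE)
  interpret framed_chart A \<Delta> g c U' m X x by (rule fc)
  note f = C1_fun_in_chart[OF U(1,2) c U(3)]
  define L where "L = frechet_derivative (\<psi> \<circ> chart_inv c) (at (snd c x))"
  have L: "linear L" unfolding L_def by (rule has_derivative_linear[OF f(4)])
  have L': "linear (\<lambda>w. (1/2) * L w)" by (rule linearI) (simp_all add: linear_add[OF L] linear_cmul[OF L] algebra_simps)
  have p: "\<forall>v\<in>\<Delta> x. ((1/2) *\<^sub>R differential A \<psi> x) v = (1/2) * L (v c)"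
    by (simp add: diff L_def scaleR_fun_def)
  define H where "H = hamiltonian \<Delta> g x ((1/2) *\<^sub>R differential A \<psi> x)"
  have H: "(1/2) * L (v c) - 1/2 * g x v v \<le> H" if "v \<in> \<Delta> x" for v
    unfolding H_def by (rule hamiltonian_max(2)[OF L' p that])
  have z: "0 \<in> \<Delta> x" by (rule subspace_0[OF subspace_Delta])
  \<comment> \<open>The zero vector shows that \<open>2 * H\<close> is nonnegative; maximality then
    makes it a valid \<open>h\<close> in \<open>derivative_below_value\<close>.\<close>
  have H0: "0 \<le> 2 * H" using H[OF z] linear_0[OF L] g_zero by simp
  have le: "\<forall>v\<in>\<Delta> x. L (v c) \<le> 2 * H + g x v v"
  proof
    fix v assume "v \<in> \<Delta> x"
    from H[OF this] show "L (v c) \<le> 2 * H + g x v v" by simp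
  qed
  have be: "\<forall>u\<in>Om \<inter> snd c ` (U \<inter> fst c). (\<psi> \<circ> chart_inv c) u \<le> (D xb (chart_inv c u))\<^sup>2"
    using below c(1) by auto
  have "(D xb x)\<^sup>2 \<le> 2 * H"
    by (rule derivative_below_value[OF fin f(1,2,3) be _ H0 le[unfolded L_def]]) (use eq c in simp)
  then show ?thesis unfolding H_def by simp
qed

end

theorem proposition8:
  fixes A :: "('a::{t2_space,second_countable_topology}, 'e::euclidean_space) chart set"
    and \<Delta> :: "('a, 'e) distribution"
    and g :: "('a, 'e) metric_field"
    and xbar :: 'a
  defines "V \<equiv> \<lambda>x. enn2real (value_function A \<Delta> g xbar x)"
  assumes "smooth_atlas A"
    and "connected (UNIV :: 'a set)"
    and "smooth_distribution A \<Delta>"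
    and "smooth_metric_on A \<Delta> g"
    and "sr_complete A \<Delta> g"
    and "nonholonomic A \<Delta>"
  shows "(\<forall>x. value_function A \<Delta> g xbar x < \<infinity>) \<and>
    continuous_on UNIV V \<and>
    viscosity_solution A (\<lambda>x p s. - (1/2) * s + hamiltonian \<Delta> g x ((1/2) *\<^sub>R p)) (UNIV - {xbar}) V"
proof -
  interpret sub_riemannian A \<Delta> g
    by unfold_locales (rule assms(2), rule assms(5), rule assms(7))
  have fin: "\<forall>x. value_function A \<Delta> g xbar x < \<infinity>" using V_finite[OF assms(3)] by blast
  have VD: "V = (\<lambda>x. (D xbar x)\<^sup>2)" unfolding V_def D_squared ..
  have cont: "continuous_on UNIV V" unfolding VD by (intro continuous_intros D_continuous fin)
  have op: "open (UNIV - {xbar})" by (simp add: open_Diff)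
  have "viscosity_subsolution A (\<lambda>x p s. - (1/2) * s + hamiltonian \<Delta> g x ((1/2) *\<^sub>R p)) (UNIV - {xbar}) V"
    unfolding viscosity_subsolution_def
  proof (intro conjI allI impI ballI continuous_on_subset[OF cont])
    fix \<phi> x assume "C1_fun A (UNIV - {xbar}) \<phi> \<and> (\<forall>x\<in>UNIV - {xbar}. V x \<le> \<phi> x)"
      and x: "x \<in> UNIV - {xbar}" "\<phi> x = V x"
    then have \<phi>: "C1_fun A (UNIV - {xbar}) \<phi>" "\<forall>x\<in>UNIV - {xbar}. (D xbar x)\<^sup>2 \<le> \<phi> x" "\<phi> x = (D xbar x)\<^sup>2"
      unfolding VD by blast+
    show "- (1/2) * V x + hamiltonian \<Delta> g x ((1/2) *\<^sub>R differential A \<phi> x) \<le> 0"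
      using viscosity_sub[OF fin op \<phi>(1) x(1) \<phi>(2,3)] unfolding VD by simp
  qed simp
  moreover have "viscosity_supersolution A (\<lambda>x p s. - (1/2) * s + hamiltonian \<Delta> g x ((1/2) *\<^sub>R p)) (UNIV - {xbar}) V"
    unfolding viscosity_supersolution_def
  proof (intro conjI allI impI ballI continuous_on_subset[OF cont])
    fix \<psi> x assume "C1_fun A (UNIV - {xbar}) \<psi> \<and> (\<forall>x\<in>UNIV - {xbar}. \<psi> x \<le> V x)"
      and x: "x \<in> UNIV - {xbar}" "\<psi> x = V x"
    then have \<psi>: "C1_fun A (UNIV - {xbar}) \<psi>" "\<forall>x\<in>UNIV - {xbar}. \<psi> x \<le> (D xbar x)\<^sup>2" "\<psi> x = (D xbar x)\<^sup>2"
      unfolding VD by blast+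
    show "0 \<le> - (1/2) * V x + hamiltonian \<Delta> g x ((1/2) *\<^sub>R differential A \<psi> x)"
      using viscosity_super[OF fin op \<psi>(1) x(1) \<psi>(2,3)] unfolding VD by simp
  qed simp
  ultimately show ?thesis using fin cont unfolding viscosity_solution_def by blast
qed

end
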